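(* Let $N\in\mathbb{N}$, let $L=N\mathbb{Z}^2$ with quadratic form $Q\left(\binom{a}{b}\right)=\frac{ab}{N}$, so $L^*/L=(\mathbb{Z}/N\mathbb{Z})^2$, and let $\tilde\vartheta_h(\tau)$, $\vartheta_h(\tau)$ $(h\in L^*/L)$ be the functions on the upper half-plane defined in the context. Then the function $\tilde\vartheta(\tau):=\sum_{h\in L^*/L}\tilde\vartheta_h(\tau)\,\mathfrak{e}_h$ is a harmonic Maass form of weight $1$ with respect to $\rho_{-L}$, and it is mapped by $\xi=\xi_1$ to the Eisenstein series $\vartheta(\tau)=\sum_{h\in L^*/L}\vartheta_h(\tau)\mathfrak{e}_h$, i.e. $\xi\tilde\vartheta=\vartheta$. For $h=\binom{h_1}{h_2}\in\mathbb{Z}^2$ it has the Fourier expansion $$\tilde\vartheta_h(\tau)=\sum_{n\in\mathbb{Q}_{\ge0}}\tilde c_h(n)q^n+c_h(0)\log v-\sum_{n\in\mathbb{Q}_{>0}}c_h(n)\,\Gamma(0,4\pi vn)\,q^{-n},\qquad q=e^{2\pi i\tau},\ \tau=u+iv,$$ where $c_h(n)\in\mathbb{Q}$ are given by $$c_h(0)=\begin{cases}\frac12-\langle\frac{h_1}{N}\rangle & N\nmid h_1,\ N\mid h_2,\\ \frac12-\langle\frac{h_2}{N}\rangle & N\mid h_1,\ N\nmid h_2,\\ 0&\text{otherwise,}\end{cases}\qquad c_h(n)=\sum_{X=\binom{x_1}{x_2}\in L+h,\ Q(X)=n}\operatorname{sgn}(x_1)\quad(n>0),$$ and $$\tilde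 c_h(0)=\begin{cases}c_h(0)\left(\log(\pi N)-\frac{\Gamma'(1/2)}{\Gamma(1/2)}\right)-\log\Gamma\left(\langle\frac{h_1}{N}\rangle\right)+\log\Gamma\left(\langle-\frac{h_1}{N}\rangle\right),& N\mid h_2,\\ c_h(0)\left(\log(\pi N)-\frac{\Gamma'(1/2)}{\Gamma(1/2)}\right)-\log\Gamma\left(\langle\frac{h_2}{N}\rangle\right)+\log\Gamma\left(\langle-\frac{h_2}{N}\rangle\right),& N\mid h_1,\\ 0,&\text{otherwise,}\end{cases}$$ $$\tilde c_h(n)=\sum_{X=\binom{x_1}{x_2}\in L+h,\ -Q(X)=n}\operatorname{sgn}(x_1)\log\left|\frac{x_1}{x_2}\right|,\qquad n>0.$$
   Context: Notation: $\mathbf{e}(a)=e^{2\pi i a}$; $\mathcal{H}=\{\tau=u+iv: v>0\}$; $\operatorname{sgn}(0)=0$; $\langle x\rangle\in(0,1]$ is defined by $x-\langle x\rangle\in\mathbb{Z}$; $\Gamma(s,x)=\int_x^\infty t^{s-1}e^{-t}dt$; $\operatorname{erfc}(x)=1-\frac{2}{\sqrt\pi}\int_0^xe^{-r^2}dr$; $\mathds{1}$ denotes a characteristic function. Operators: $\xi_k(f)=2iv^k\,\overline{\frac{\partial f}{\partial\bar\tau}}$, $\xi=\xi_1$, $\Delta_k=-\xi_{2-k}\circ\xi_k$. On vector-valued functions $\xi$ acts componentwise: $\xi(\sum_h f_h\mathfrak{e}_h)=\sum_h\xi(f_h)\mathfrak{e}_h$. Lattice: $L=N\mathbb{Z}^2$,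 $Q(\binom ab)=\frac{ab}{N}$, $B$ the associated bilinear form, $B(\binom ab,\binom{a'}{b'})=\frac{ab'+a'b}{N}$, dual lattice $L^*=\mathbb{Z}^2$. $\mathbb{C}[L^*/L]$ has canonical basis $\{\mathfrak{e}_h\}$. The Weil representation $\rho_{-L}$ of $\mathrm{SL}_2(\mathbb{Z})$ on $\mathbb{C}[L^*/L]$ (for the lattice $L$ with form $-Q$) is determined on $T=\begin{pmatrix}1&1\\0&1\end{pmatrix}$, $S=\begin{pmatrix}0&-1\\1&0\end{pmatrix}$ by $\rho_{-L}(T)\mathfrak{e}_h=\mathbf{e}(-Q(h))\mathfrak{e}_h$, $\rho_{-L}(S)\mathfrak{e}_h=\frac1N\sum_{\delta\in L^*/L}\mathbf{e}(B(\delta,h))\mathfrak{e}_\delta$. A harmonic Maass form of weight $k$ with respect to a representation $\rho$ of $\mathrm{SL}_2(\mathbb{Z})$ is a real-analytic function $f$ on $\mathcal{H}$ with values in the space of $\rho$ such that $f(\gamma\tau)=(c\tau+d)^k\rho(\gamma)f(\tau)$ for all $\gamma=\begin{pmatrix}a&b\\c&d\end{pmatrix}\in\mathrm{SL}_2(\mathbb{Z})$ and $\Delta_kf=0$. For $t>0$ put $W_t=\sqrt{N/2}\binom{t}{1/t}$, $Z_t=\sqrt{N/2}\binom{t}{-1/t}$ and $\iota_t(X)=(B(X,W_t),B(X,Z_t))\in\mathbb{R}^2$ for $X\in\mathbb{R}^2$. For $(x,y)\in\mathbb{R}^2$ define $$\varphi_\tau(x,y)=\sqrt{2v}\,x\,\mathbf{e}\left(\tfrac{x^2}{2}\tau-\tfrac{y^2}{2}\bar\tau\right),\qquad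 \tilde\varphi_\tau(x,y)=\operatorname{sgn}(x)\,\mathbf{e}\left(\tfrac{y^2-x^2}{2}\tau\right)\left(\mathds{1}_{y^2>x^2}-\operatorname{erfc}(\sqrt{2\pi v}|x|)\right).$$ The Eisenstein series $\vartheta$: let $\Theta_h(\tau,t)=\sum_{X\in L+h}\varphi_\tau(\iota_t(X))$ and $\vartheta_h(\tau,s)=\int_0^1\Theta_h(\tau,t)t^s\frac{dt}{t}+\int_1^\infty\Theta_h(\tau,t)t^{-s}\frac{dt}{t}$, which converges for $\Re s\gg0$ and is analytically continued in $s$; $\vartheta_h(\tau)$ is the constant term of its Laurent expansion at $s=0$. The function $\tilde\vartheta$: let $\tilde\Theta_h(\tau,t)=c_h(0)+\sum_{X\in L+h}\tilde\varphi_\tau(\iota_t(X))$, with $c_h(0)$ as in the claim, and $\tilde\vartheta_h(\tau;s)=\int_1^\infty\tilde\Theta_h(\tau,t)t^{-s}\frac{dt}{t}+\int_0^1\tilde\Theta_h(\tau,t)t^{s}\frac{dt}{t}$, which converges for $\Re(s)>0$ and is analytically continued in $s$ to $\mathbb{C}$; $\tilde\vartheta_h(\tau)$ is the constant term of $\tilde\vartheta_h(\tau;s)$ at $s=0$. *)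

theory Defs
  imports "HOL-Complex_Analysis.Complex_Analysis"
begin

definition ee :: "complex \<Rightarrow> complex" where
  "ee a = exp (2 * of_real pi * \<i> * a)"

definition uhp :: "complex set" where
  "uhp = {\<tau>. Im \<tau> > 0}"

text \<open>\<open>\<langle>x\<rangle> \<in> (0,1]\<close>, so that \<open>\<langle>0\<rangle> = 1\<close>.\<close>

definition ang :: "real \<Rightarrow> real" where
  "ang x = (THE y. 0 < y \<and> y \<le> 1 \<and> x - y \<in> \<int>)"

definition upper_Gamma :: "real \<Rightarrow> real \<Rightarrow> real" where
  "upper_Gamma s x = (LINT t:{x<..}|lborel. t powr (s - 1) * exp (- t))"

definition erfc :: "real \<Rightarrow> real" where
  "erfc x = 1 - 2 / sqrt pi * (LBINT r=0..x. exp (- (r ^ 2)))"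

definition dbar :: "(complex \<Rightarrow> complex) \<Rightarrow> complex \<Rightarrow> complex" where
  "dbar f \<tau> =
     (vector_derivative (\<lambda>x::real. f (\<tau> + of_real x)) (at 0)
      + \<i> * vector_derivative (\<lambda>y::real. f (\<tau> + \<i> * of_real y)) (at 0)) / 2"

definition xi :: "int \<Rightarrow> (complex \<Rightarrow> complex) \<Rightarrow> complex \<Rightarrow> complex" where
  "xi k f \<tau> = 2 * \<i> * of_real (Im \<tau> powi k) * cnj (dbar f \<tau>)"

definition Delta :: "int \<Rightarrow> (complex \<Rightarrow> complex) \<Rightarrow> complex \<Rightarrow> complex" where
  "Delta k f \<tau> = - xi (2 - k) (xi k f) \<tau>"

text \<open>Vector-valued functions are written in components, \<open>f \<tau> h\<close> being the
  coefficient at \<open>h\<close>.\<close>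

definition xi_vec :: "int \<Rightarrow> (complex \<Rightarrow> 'i \<Rightarrow> complex) \<Rightarrow> complex \<Rightarrow> 'i \<Rightarrow> complex" where
  "xi_vec k f \<tau> = (\<lambda>h. xi k (\<lambda>\<tau>'. f \<tau>' h) \<tau>)"

definition real_analytic_on :: "(complex \<Rightarrow> complex) \<Rightarrow> complex set \<Rightarrow> bool" where
  "real_analytic_on f U \<longleftrightarrow>
     (\<forall>z\<in>U. \<exists>r>0. \<exists>a :: nat \<times> nat \<Rightarrow> complex. \<forall>x y. \<bar>x\<bar> < r \<longrightarrow> \<bar>y\<bar> < r \<longrightarrow>
        ((\<lambda>(m, n). a (m, n) * of_real x ^ m * of_real y ^ n) has_sum f (z + Complex x y)) UNIV)"

definition SL2Z :: "(int ^ 2 ^ 2) set" where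
  "SL2Z = {A. det A = 1}"

definition T_mat :: "int ^ 2 ^ 2" where
  "T_mat = vector [vector [1, 1], vector [0, 1]]"

definition S_mat :: "int ^ 2 ^ 2" where
  "S_mat = vector [vector [0, -1], vector [1, 0]]"

definition mobius :: "int ^ 2 ^ 2 \<Rightarrow> complex \<Rightarrow> complex" where
  "mobius A \<tau> = (of_int (A $ 1 $ 1) * \<tau> + of_int (A $ 1 $ 2)) /
                (of_int (A $ 2 $ 1) * \<tau> + of_int (A $ 2 $ 2))"

definition sl2z_rep ::
  "('i \<Rightarrow> complex) set \<Rightarrow> (int ^ 2 ^ 2 \<Rightarrow> ('i \<Rightarrow> complex) \<Rightarrow> 'i \<Rightarrow> complex) \<Rightarrow> bool" where
  "sl2z_rep V \<rho> \<longleftrightarrow>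
     (\<forall>A\<in>SL2Z. \<forall>f\<in>V. \<rho> A f \<in> V) \<and>
     (\<forall>A\<in>SL2Z. \<forall>f\<in>V. \<forall>g\<in>V. \<rho> A (\<lambda>h. f h + g h) = (\<lambda>h. \<rho> A f h + \<rho> A g h)) \<and>
     (\<forall>A\<in>SL2Z. \<forall>f\<in>V. \<forall>c. \<rho> A (\<lambda>h. c * f h) = (\<lambda>h. c * \<rho> A f h)) \<and>
     (\<forall>f\<in>V. \<rho> (mat 1) f = f) \<and>
     (\<forall>A\<in>SL2Z. \<forall>B\<in>SL2Z. \<forall>f\<in>V. \<rho> (A ** B) f = \<rho> A (\<rho> B f))"

text \<open>No growth condition at the cusp is imposed.\<close>

definition harmonic_maass_form ::
  "int \<Rightarrow> ('i \<Rightarrow> complex) set \<Rightarrow> (int ^ 2 ^ 2 \<Rightarrow> ('i \<Rightarrow> complex) \<Rightarrow> 'i \<Rightarrow> complex)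
     \<Rightarrow> (complex \<Rightarrow> 'i \<Rightarrow> complex) \<Rightarrow> bool" where
  "harmonic_maass_form k V \<rho> f \<longleftrightarrow>
     sl2z_rep V \<rho> \<and>
     (\<forall>\<tau>\<in>uhp. f \<tau> \<in> V) \<and>
     (\<forall>h. real_analytic_on (\<lambda>\<tau>. f \<tau> h) uhp) \<and>
     (\<forall>A\<in>SL2Z. \<forall>\<tau>\<in>uhp. f (mobius A \<tau>) =
        (\<lambda>h. (of_int (A $ 2 $ 1) * \<tau> + of_int (A $ 2 $ 2)) powi k * \<rho> A (f \<tau>) h)) \<and>
     (\<forall>h. \<forall>\<tau>\<in>uhp. Delta k (\<lambda>\<tau>'. f \<tau>' h) \<tau> = 0)"

text \<open>The dual lattice \<open>\<int>\<^sup>2\<close> is the type \<^typ>\<open>int \<times> int\<close>, embedded into the real plane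
  by \<open>rvec\<close>.\<close>

definition rvec :: "int \<times> int \<Rightarrow> real \<times> real" where
  "rvec X = (real_of_int (fst X), real_of_int (snd X))"

definition lat :: "nat \<Rightarrow> (int \<times> int) set" where
  "lat N = {(int N * a, int N * b) | a b. True}"

definition lat_coset :: "nat \<Rightarrow> int \<times> int \<Rightarrow> (int \<times> int) set" where
  "lat_coset N h = (\<lambda>X. X + h) ` lat N"

definition QF :: "nat \<Rightarrow> real \<times> real \<Rightarrow> real" where
  "QF N X = fst X * snd X / real N"

definition BF :: "nat \<Rightarrow> real \<times> real \<Rightarrow> real \<times> real \<Rightarrow> real" where
  "BF N X Y = (fst X * snd Y + fst Y * snd X) / real N"

definition disc_reps :: "nat \<Rightarrow> (int \<times> int) set" where
  "disc_reps N = {0..<int N} \<times> {0..<int N}"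

text \<open>\<open>\<complex>[L\<^sup>*/L]\<close> is the space of functions on \<open>\<int>\<^sup>2\<close> that are periodic
  with respect to the lattice; its canonical basis vector at \<open>h\<close> is the characteristic
  function of the class of \<open>h\<close>.\<close>

definition group_algebra :: "nat \<Rightarrow> (int \<times> int \<Rightarrow> complex) set" where
  "group_algebra N = {f. \<forall>h. \<forall>X\<in>lat N. f (h + X) = f h}"

definition e_vec :: "nat \<Rightarrow> int \<times> int \<Rightarrow> int \<times> int \<Rightarrow> complex" where
  "e_vec N h = indicator (lat_coset N h)"

definition is_weil_rep ::
  "nat \<Rightarrow> (int ^ 2 ^ 2 \<Rightarrow> (int \<times> int \<Rightarrow> complex) \<Rightarrow> int \<times> int \<Rightarrow> complex) \<Rightarrow> bool" where
  "is_weil_rep N \<rho> \<longleftrightarrow>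
     sl2z_rep (group_algebra N) \<rho> \<and>
     (\<forall>h. \<rho> T_mat (e_vec N h) = (\<lambda>g. ee (of_real (- QF N (rvec h))) * e_vec N h g)) \<and>
     (\<forall>h. \<rho> S_mat (e_vec N h) =
        (\<lambda>g. 1 / of_nat N *
             (\<Sum>\<delta>\<in>disc_reps N. ee (of_real (BF N (rvec \<delta>) (rvec h))) * e_vec N \<delta> g)))"

text \<open>\<open>\<rho>\<^bsub>-L\<^esub>\<close>. As \<open>S\<close> and \<open>T\<close> generate \<open>SL\<^sub>2(\<int>)\<close>, the choice affects neither
  the values at elements of \<open>SL\<^sub>2(\<int>)\<close> on the group algebra nor anything below.\<close>

definition weil_rep ::
  "nat \<Rightarrow> int ^ 2 ^ 2 \<Rightarrow> (int \<times> int \<Rightarrow> complex) \<Rightarrow> int \<times> int \<Rightarrow> complex" where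
  "weil_rep N = (SOME \<rho>. is_weil_rep N \<rho>)"

definition Wvec :: "nat \<Rightarrow> real \<Rightarrow> real \<times> real" where
  "Wvec N t = sqrt (real N / 2) *\<^sub>R (t, 1 / t)"

definition Zvec :: "nat \<Rightarrow> real \<Rightarrow> real \<times> real" where
  "Zvec N t = sqrt (real N / 2) *\<^sub>R (t, - (1 / t))"

definition iota :: "nat \<Rightarrow> real \<Rightarrow> real \<times> real \<Rightarrow> real \<times> real" where
  "iota N t X = (BF N X (Wvec N t), BF N X (Zvec N t))"

definition phi :: "complex \<Rightarrow> real \<times> real \<Rightarrow> complex" where
  "phi \<tau> = (\<lambda>(x, y). of_real (sqrt (2 * Im \<tau>) * x) *
      ee (of_real (x ^ 2 / 2) * \<tau> - of_real (y ^ 2 / 2) * cnj \<tau>))"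

definition tphi :: "complex \<Rightarrow> real \<times> real \<Rightarrow> complex" where
  "tphi \<tau> = (\<lambda>(x, y). of_real (sgn x) * ee (of_real ((y ^ 2 - x ^ 2) / 2) * \<tau>) *
      of_real (of_bool (y ^ 2 > x ^ 2) - erfc (sqrt (2 * pi * Im \<tau>) * \<bar>x\<bar>)))"

definition split_integral :: "(real \<Rightarrow> complex) \<Rightarrow> complex \<Rightarrow> complex" where
  "split_integral \<Theta> s =
     (LINT t:{0<..1}|lborel. \<Theta> t * of_real t powr s / of_real t) +
     (LINT t:{1..}|lborel. \<Theta> t * of_real t powr (- s) / of_real t)"

text \<open>The constant term of the Laurent expansion at \<open>0\<close> of the meromorphic continuation
  of a function given for sufficiently large real part.\<close>

definition continued_constant_term :: "(complex \<Rightarrow> complex) \<Rightarrow> complex" where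
  "continued_constant_term f =
     (THE c. \<exists>F \<sigma>. F meromorphic_on UNIV \<and> (\<forall>s. Re s > \<sigma> \<longrightarrow> F s = f s) \<and>
                   c = fls_nth (laurent_expansion F 0) 0)"

definition Theta :: "nat \<Rightarrow> int \<times> int \<Rightarrow> complex \<Rightarrow> real \<Rightarrow> complex" where
  "Theta N h \<tau> t = (\<Sum>\<^sub>\<infinity>X\<in>lat_coset N h. phi \<tau> (iota N t (rvec X)))"

definition vartheta :: "nat \<Rightarrow> int \<times> int \<Rightarrow> complex \<Rightarrow> complex" where
  "vartheta N h \<tau> = continued_constant_term (split_integral (Theta N h \<tau>))"

definition vartheta_vec :: "nat \<Rightarrow> complex \<Rightarrow> int \<times> int \<Rightarrow> complex" where
  "vartheta_vec N \<tau> = (\<lambda>g. \<Sum>h\<in>disc_reps N. vartheta N h \<tau> * e_vec N h g)"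

text \<open>The coefficients \<open>c\<^sub>h(n)\<close>, to be used for \<open>n \<ge> 0\<close>; the index set of the sum is
  finite whenever \<open>n \<noteq> 0\<close>.\<close>

definition c_coeff :: "nat \<Rightarrow> int \<times> int \<Rightarrow> real \<Rightarrow> real" where
  "c_coeff N = (\<lambda>(h1, h2) n.
     if n = 0 then
       (if \<not> int N dvd h1 \<and> int N dvd h2 then 1 / 2 - ang (of_int h1 / of_nat N)
        else if int N dvd h1 \<and> \<not> int N dvd h2 then 1 / 2 - ang (of_int h2 / of_nat N)
        else 0)
     else (\<Sum>X\<in>{X \<in> lat_coset N (h1, h2). QF N (rvec X) = n}. sgn (of_int (fst X))))"

definition tTheta :: "nat \<Rightarrow> int \<times> int \<Rightarrow> complex \<Rightarrow> real \<Rightarrow> complex" where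
  "tTheta N h \<tau> t =
     of_real (c_coeff N h 0) + (\<Sum>\<^sub>\<infinity>X\<in>lat_coset N h. tphi \<tau> (iota N t (rvec X)))"

definition tvartheta :: "nat \<Rightarrow> int \<times> int \<Rightarrow> complex \<Rightarrow> complex" where
  "tvartheta N h \<tau> = continued_constant_term (split_integral (tTheta N h \<tau>))"

definition tvartheta_vec :: "nat \<Rightarrow> complex \<Rightarrow> int \<times> int \<Rightarrow> complex" where
  "tvartheta_vec N \<tau> = (\<lambda>g. \<Sum>h\<in>disc_reps N. tvartheta N h \<tau> * e_vec N h g)"

text \<open>The coefficients of the holomorphic part, to be used for \<open>n \<ge> 0\<close>. For \<open>n = 0\<close> the
  first two cases agree (both give \<open>0\<close>) where they overlap.\<close>

definition tc_coeff :: "nat \<Rightarrow> int \<times> int \<Rightarrow> real \<Rightarrow> real" where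
  "tc_coeff N = (\<lambda>(h1, h2) n.
     if n = 0 then
       (if int N dvd h2 then
          c_coeff N (h1, h2) 0 * (ln (pi * of_nat N) - deriv Gamma (1 / 2) / Gamma (1 / 2))
          - ln (Gamma (ang (of_int h1 / of_nat N))) + ln (Gamma (ang (- of_int h1 / of_nat N)))
        else if int N dvd h1 then
          c_coeff N (h1, h2) 0 * (ln (pi * of_nat N) - deriv Gamma (1 / 2) / Gamma (1 / 2))
          - ln (Gamma (ang (of_int h2 / of_nat N))) + ln (Gamma (ang (- of_int h2 / of_nat N)))
        else 0)
     else (\<Sum>X\<in>{X \<in> lat_coset N (h1, h2). - QF N (rvec X) = n}.
             sgn (of_int (fst X)) * ln \<bar>of_int (fst X) / of_int (snd X)\<bar>))"

text \<open>\<open>q\<^sup>n\<close> for \<open>q = ee \<tau>\<close> and real \<open>n\<close>; not \<open>powr\<close>, which would take the principal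
  branch.\<close>

definition qpow :: "complex \<Rightarrow> real \<Rightarrow> complex" where
  "qpow \<tau> n = ee (of_real n * \<tau>)"

end

theory Submission
  imports Defs "HOL-Probability.Probability" "HOL-Real_Asymp.Real_Asymp"
begin

text \<open>Put \<open>t = e\<^sup>w\<close>. Termwise, the kernel of \<open>tvartheta\<close> is a primitive in \<open>w\<close> of a kernel \<open>\<psi>\<close>, since \<open>1 - erfc\<close> is odd, and the
kernel of \<open>\<vartheta>\<close> is \<open>\<psi>/2\<close> after the reflection \<open>x\<^sub>1 \<mapsto> - x\<^sub>1\<close>. Poisson summation in one coordinate shows that the lattice
sum \<open>\<Psi>\<close> of \<open>\<psi>\<close> decays superexponentially at both ends and transforms under \<open>S\<close>. One integration by parts identifies
the constant term at \<open>s = 0\<close> with \<open>- \<integral> w \<Psi>(e\<^sup>w) dw\<close>, so modularity is inherited from \<open>\<Psi>\<close>. Integrating term by term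
gives the Fourier expansion: \<open>Q < 0\<close> contributes \<open>log |x\<^sub>1/x\<^sub>2|\<close>, \<open>Q > 0\<close> contributes \<open>\<Gamma>(0,4\<pi>vQ)\<close>, and the isotropic
vectors contribute \<open>log \<Gamma>(a) - log \<Gamma>(1 - a)\<close>. Real analyticity, \<open>\<xi>\<close> and \<open>\<Delta>\<close> are then computed termwise.\<close>

text \<open>Integration by parts on both half-lines turns the transform of the tilde series into
  G(s)/s with G entire, so its constant term is G'(0), and differentiating exp(-s|w|) is what
  produces the weight w. The other series is itself entire, and its value at 0 is the same kind of
  integral with weight 1. Hence every integral is computed once, for a weight p + q w. Poisson
  summation in one coordinate replaces the exponent by |n tau + k|^2. The only pair where this
  vanishes, (0, 0), carries the factor 0, which gives the decay as t tends to infinity; exchanging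
  the coordinates gives the decay at 0. The pairs (k, n) are permuted by SL2(Z), which gives the
  behaviour under S. The isotropic vectors are the obstacle: up to sign each contributes the same
  amount to the integral, so sum and integral cannot be exchanged absolutely. Pairing m + a with m +
  1 - a and comparing with a telescoping sum gives a corrected partial sum with an integrable
  remainder. There w is shifted by ln(pi N v)/2, and this shift is the origin of both log v and
  log(pi N).\<close>

abbreviation x1 :: "int \<times> int \<Rightarrow> 'a::ring_1" where "x1 X \<equiv> of_int (fst X)"
abbreviation x2 :: "int \<times> int \<Rightarrow> 'a::ring_1" where "x2 X \<equiv> of_int (snd X)"

lemmas integrable_dominated = Bochner_Integration.integrable_bound
lemmas lebesgue_integral_cong = Bochner_Integration.integral_cong

abbreviation entry :: "int ^ 2 ^ 2 => 2 => 2 => int" where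
 "entry A i j \<equiv> vec_nth (vec_nth A i) j"

section \<open>Finite Fourier sums and the Weil representation\<close>

lemma sum_periodic_shift:
 fixes g :: "int => 'a::comm_monoid_add"
 assumes N: "N > 0" and per: "\<And>k. g (k + N) = g k"
 shows "(\<Sum>k\<in>{0..<N}. g (k + c)) = (\<Sum>k\<in>{0..<N}. g k)"
proof -
 have per1: "g (k + int n * N) = g k" for k n
  by (induction n) (use per in \<open>auto simp: algebra_simps\<close>, metis add.assoc add.commute)
 have per2: "g (k + z * N) = g k" for k z
 proof (cases "z >= 0")
  case True then show ?thesis using per1[of k "nat z"] by simp
 next
  case False then show ?thesis using per1[of "k + z * N" "nat (-z)"] by simp
 qed
 have md: "g (k mod N) = g k" for k
  using per2[of "k mod N" "k div N"] by simp
 show ?thesis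
  by (rule sum.reindex_bij_witness[of _ "%k. (k - c) mod N" "%k. (k + c) mod N"])
    (use N md in \<open>auto simp: mod_simps\<close>)
qed

lemma sum_periodic_uminus:
 fixes g :: "int => 'a::comm_monoid_add"
 assumes N: "N > 0" and per: "\<And>k. g (k + N) = g k"
 shows "(\<Sum>k\<in>{0..<N}. g (- k)) = (\<Sum>k\<in>{0..<N}. g k)"
proof -
 \<comment> \<open>The reflection k -> N - 1 - k preserves the window {0..<N}, so the shift by 1 - N
   is the one that turns g(k + (1 - N)) into g(- k).\<close>
 have "(\<Sum>k\<in>{0..<N}. g k) = (\<Sum>k\<in>{0..<N}. g (k + (1 - N)))"
  by (rule sum_periodic_shift[symmetric]) (use assms in auto)
 also have "... = (\<Sum>k\<in>{0..<N}. g (- k))"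
  by (rule sum.reindex_bij_witness[of _ "%k. N - 1 - k" "%k. N - 1 - k"]) (auto simp: algebra_simps)
 finally show ?thesis by simp
qed

lemma ee_add: "ee (a + b) = ee a * ee b"
 by (simp add: ee_def exp_add distrib_left)

lemma ee_diff: "ee (a - b) = ee a / ee b"
 by (simp add: ee_def exp_diff right_diff_distrib)

lemma ee_0 [simp]: "ee 0 = 1"
 by (simp add: ee_def)

lemma ee_nonzero [simp]: "ee a ~= 0"
 by (simp add: ee_def)

lemma ee_of_int [simp]: "ee (of_int n) = 1"
 unfolding ee_def by (rule exp_eq_1[THEN iffD2]) (auto intro!: exI[of _ n])

lemma ee_eqI: "a - b = of_int n ==> ee a = ee b"
 using ee_of_int[of n] by (metis ee_diff ee_nonzero eq_divide_imp mult.left_neutral nonzero_eq_divide_eq)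

lemma ee_power: "ee a ^ n = ee (of_nat n * a)"
 by (induction n) (auto simp: ee_add algebra_simps)

lemma ee_eq_1_iff: "ee (of_int m / of_nat N) = 1 \<longleftrightarrow> int N dvd m" if "N > 0"
proof
 assume "ee (of_int m / of_nat N) = 1"
 moreover have "2 * of_real pi * \<i> * (of_int m / of_nat N) = \<i> * of_real (2 * pi * (of_int m / of_nat N))"
  by simp
 ultimately have "exp (\<i> * of_real (2 * pi * (of_int m / of_nat N))) = 1" unfolding ee_def by metis
 then obtain n where n: "2 * pi * (of_int m / of_nat N) = of_int (2 * n) * pi"
  unfolding exp_eq_1 Im_i_times Re_complex_of_real by blast
 then have "real_of_int m = real_of_int (n * int N)" using that by (simp add: field_simps)
 then have "m = n * int N" by linarith
 then show "int N dvd m" by simp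
next
 assume "int N dvd m"
 then obtain k where "m = int N * k" by auto
 then show "ee (of_int m / of_nat N) = 1" using that by simp
qed

lemma sum_ee_orthogonal:
 assumes "N > 0"
 shows "(\<Sum>k\<in>{0..<int N}. ee (of_int (k * m) / of_nat N)) = (if int N dvd m then of_nat N else 0)"
proof -
 have "(\<Sum>k\<in>{0..<int N}. ee (of_int (k * m) / of_nat N)) = (\<Sum>k\<in>{0..<N}. ee (of_int m / of_nat N) ^ k)"
  by (rule sum.reindex_bij_witness[of _ int nat]) (auto simp: ee_power)
 also have "... = (if int N dvd m then of_nat N else 0)"
 proof (cases "int N dvd m")
  case True then show ?thesis using ee_eq_1_iff[OF assms, of m] by simp
 next
  case False
  have "ee (of_int m / of_nat N) ^ N = 1" using assms by (simp add: ee_power)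
  moreover have "ee (of_int m / of_nat N) ~= 1" using False ee_eq_1_iff[OF assms, of m] by simp
  ultimately show ?thesis using False by (simp add: geometric_sum atLeast0LessThan)
 qed
 finally show ?thesis .
qed

lemma in_lat_coset_iff: "g \<in> lat_coset N h \<longleftrightarrow> int N dvd fst g - fst h \<and> int N dvd snd g - snd h"
proof
 assume "g \<in> lat_coset N h"
 then show "int N dvd fst g - fst h \<and> int N dvd snd g - snd h"
  by (auto simp: lat_coset_def lat_def)
next
 assume "int N dvd fst g - fst h \<and> int N dvd snd g - snd h"
 then obtain a b where "fst g - fst h = int N * a" "snd g - snd h = int N * b" by (auto elim!: dvdE)
 then have "g = (int N * a, int N * b) + h" by (auto simp: prod_eq_iff)
 then show "g \<in> lat_coset N h" unfolding lat_coset_def lat_def by blast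
qed

lemma group_algebra_iff:
 "f \<in> group_algebra N \<longleftrightarrow> (\<forall>a b. f (a + int N, b) = f (a, b) \<and> f (a, b + int N) = f (a, b))"
proof
 assume f: "f \<in> group_algebra N"
 have "(int N, 0) \<in> lat N" "(0, int N) \<in> lat N"
  unfolding lat_def by (auto intro: exI[of _ 1] exI[of _ 0])
 then show "\<forall>a b. f (a + int N, b) = f (a, b) \<and> f (a, b + int N) = f (a, b)"
  using f unfolding group_algebra_def by (metis (mono_tags, lifting) add.right_neutral add_Pair mem_Collect_eq)
next
 assume per: "\<forall>a b. f (a + int N, b) = f (a, b) \<and> f (a, b + int N) = f (a, b)"
 have per1: "f (a + int N * int n, b) = f (a, b)" for a b n
 proof (induction n)
  case (Suc n)
  have "f (a + int N * int (Suc n), b) = f ((a + int N * int n) + int N, b)" by (simp add: algebra_simps)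
  with Suc per show ?case by simp
 qed simp
 have per2: "f (a, b + int N * int n) = f (a, b)" for a b n
 proof (induction n)
  case (Suc n)
  have "f (a, b + int N * int (Suc n)) = f (a, (b + int N * int n) + int N)" by (simp add: algebra_simps)
  with Suc per show ?case by simp
 qed simp
 have per1': "f (a + int N * z, b) = f (a, b)" for a b z
  using per1[of a "nat z" b] per1[of "a + int N * z" "nat (- z)" b] by (cases "z >= 0") auto
 have per2': "f (a, b + int N * z) = f (a, b)" for a b z
  using per2[of a b "nat z"] per2[of a "b + int N * z" "nat (- z)"] by (cases "z >= 0") auto
 show "f \<in> group_algebra N"
  unfolding group_algebra_def lat_def using per1' per2' by auto
qed

lemma group_algebra_cong:
 assumes "f \<in> group_algebra N" "g \<in> lat_coset N h"
 shows "f g = f h"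
 using assms unfolding group_algebra_def lat_coset_def by (fastforce simp: add.commute)

lemma e_vec_in_group_algebra: "e_vec N h \<in> group_algebra N"
proof -
 have "int N dvd a + int N - x \<longleftrightarrow> int N dvd a - x" for a x
  using dvd_add_triv_right_iff[of "int N" "a - x"] by (simp add: algebra_simps)
 then show ?thesis
  unfolding group_algebra_iff e_vec_def indicator_def in_lat_coset_iff by simp
qed

lemma sum_e_vec:
 assumes N: "N > 0" and c: "c \<in> group_algebra N"
 shows "(\<Sum>h\<in>disc_reps N. c h * e_vec N h g) = c g"
proof -
 define h0 where "h0 = (fst g mod int N, snd g mod int N)"
 have h0: "h0 \<in> disc_reps N" "g \<in> lat_coset N h0"
  using N by (auto simp: h0_def disc_reps_def in_lat_coset_iff minus_mod_eq_mult_div)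
 have iff: "g \<in> lat_coset N h \<longleftrightarrow> h = h0" if "h \<in> disc_reps N" for h
 proof -
  have "int N dvd x - y \<longleftrightarrow> y = x mod int N" if "0 <= y" "y < int N" for x y
   using that by (metis mod_eq_dvd_iff mod_pos_pos_trivial)
  then show ?thesis using that by (cases h) (auto simp: h0_def disc_reps_def in_lat_coset_iff)
 qed
 have "(\<Sum>h\<in>disc_reps N. c h * e_vec N h g) = (\<Sum>h\<in>disc_reps N. if h = h0 then c h else 0)"
  by (rule sum.cong) (auto simp: e_vec_def indicator_def iff)
 also have "... = c h0" using h0 by (simp add: disc_reps_def)
 also have "... = c g" using group_algebra_cong[OF c h0(2)] by simp
 finally show ?thesis .
qed

text \<open>Fourier transform in the second coordinate only. In this mixed model the Weil
  representation of a hyperbolic plane becomes a linear substitution in the pair (a, k), so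
  multiplicativity can be read off instead of being derived from relations between S and T.\<close>

definition partial_dft :: "nat => (int \<times> int => complex) => int => int => complex" where
 "partial_dft N f a k = (\<Sum>b\<in>{0..<int N}. f (a, b) * ee (of_int (b * k) / of_nat N))"

text \<open>The substitution (a, k) -> (a A11 - k A21, k A22 - a A12), conjugated by
  \<open>partial_dft\<close>. It is the witness that makes the choice operator in
  \<open>weil_rep\<close> meaningful.\<close>

definition explicit_weil :: "nat => int ^ 2 ^ 2 => (int \<times> int => complex) => int \<times> int => complex" where
 "explicit_weil N A f = (%(a, b). 1 / of_nat N * (\<Sum>k\<in>{0..<int N}.
   partial_dft N f (a * entry A 1 1 - k * entry A 2 1) (k * entry A 2 2 - a * entry A 1 2) * ee (- of_int (b * k) / of_nat N)))"

lemma ee_shift: "N > 0 ==> m - n = int N * l ==> ee (of_int m / of_nat N) = ee (of_int n / of_nat N)"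
proof (rule ee_eqI[of _ _ l])
 assume "N > 0" "m - n = int N * l"
 then have "(of_int (m - n) :: complex) = of_nat N * of_int l" by simp
 then show "of_int m / of_nat N - of_int n / of_nat N = (of_int l :: complex)"
  using \<open>N > 0\<close> by (simp add: field_simps)
qed

lemma partial_dft_periodic:
 assumes "N > 0" "f \<in> group_algebra N"
 shows "partial_dft N f (a + int N * z) k = partial_dft N f a k"
    "partial_dft N f a (k + int N * z) = partial_dft N f a k"
proof -
 have "f (a + int N * z, b) = f (a, b)" for b
  by (rule group_algebra_cong[OF assms(2)]) (auto simp: in_lat_coset_iff)
 then show "partial_dft N f (a + int N * z) k = partial_dft N f a k" unfolding partial_dft_def by simp
 have "ee (of_int (b * (k + int N * z)) / of_nat N) = ee (of_int (b * k) / of_nat N)" for b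
  by (rule ee_shift[OF assms(1), of _ _ "b * z"]) (simp add: algebra_simps)
 then show "partial_dft N f a (k + int N * z) = partial_dft N f a k" unfolding partial_dft_def by simp
qed

lemma partial_dft_inverse:
 assumes N: "N > 0" and f: "f \<in> group_algebra N"
 shows "1 / of_nat N * (\<Sum>k\<in>{0..<int N}. partial_dft N f a k * ee (- of_int (b * k) / of_nat N)) = f (a, b)"
proof -
 have "(\<Sum>k\<in>{0..<int N}. partial_dft N f a k * ee (- of_int (b * k) / of_nat N)) =
  (\<Sum>k\<in>{0..<int N}. \<Sum>c\<in>{0..<int N}. f (a, c) * ee (of_int (k * (c - b)) / of_nat N))"
  unfolding partial_dft_def sum_distrib_right
  by (intro sum.cong refl) (simp add: mult.assoc ee_add[symmetric] algebra_simps diff_divide_distrib)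
 also have "... = (\<Sum>c\<in>{0..<int N}. f (a, c) * (\<Sum>k\<in>{0..<int N}. ee (of_int (k * (c - b)) / of_nat N)))"
  by (subst sum.swap) (simp add: sum_distrib_left)
 also have "... = (\<Sum>c\<in>{0..<int N}. if c = b mod int N then of_nat N * f (a, c) else 0)"
 proof (intro sum.cong refl)
  fix c assume "c \<in> {0..<int N}"
  then have "int N dvd c - b \<longleftrightarrow> c = b mod int N"
   by (metis atLeastLessThan_iff mod_eq_dvd_iff mod_pos_pos_trivial)
  then show "f (a, c) * (\<Sum>k\<in>{0..<int N}. ee (of_int (k * (c - b)) / of_nat N)) =
   (if c = b mod int N then of_nat N * f (a, c) else 0)"
   unfolding sum_ee_orthogonal[OF N] by simp
 qed
 also have "... = of_nat N * f (a, b mod int N)"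
  using N by simp
 also have "f (a, b mod int N) = f (a, b)"
  by (rule group_algebra_cong[OF f]) (auto simp: in_lat_coset_iff mod_eq_dvd_iff[symmetric])
 finally show ?thesis using N by simp
qed

text \<open>Orthogonality of characters cancels the inverse transform inside
  \<open>explicit_weil\<close>, leaving the bare substitution.\<close>

lemma partial_dft_explicit_weil:
 assumes N: "N > 0" and f: "f \<in> group_algebra N"
 shows "partial_dft N (explicit_weil N A f) a k =
  partial_dft N f (a * entry A 1 1 - k * entry A 2 1) (k * entry A 2 2 - a * entry A 1 2)"
proof -
 have per2: "partial_dft N f (x + int N * z) (y + int N * w) = partial_dft N f x y" for x y z w
  using partial_dft_periodic[OF N f] by simp
 define G where "G k = partial_dft N f (a * entry A 1 1 - k * entry A 2 1) (k * entry A 2 2 - a * entry A 1 2)" for k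
 have Gper: "G (k + int N * z) = G k" for k z
 proof -
  have 1: "a * entry A 1 1 - (k + int N * z) * entry A 2 1 = (a * entry A 1 1 - k * entry A 2 1) + int N * (- z * entry A 2 1)"
   by (simp add: algebra_simps)
  have 2: "(k + int N * z) * entry A 2 2 - a * entry A 1 2 = (k * entry A 2 2 - a * entry A 1 2) + int N * (z * entry A 2 2)"
   by (simp add: algebra_simps)
  show ?thesis unfolding G_def by (subst 1, subst 2) (rule per2)
 qed
 have "partial_dft N (explicit_weil N A f) a k =
  1 / of_nat N * (\<Sum>b\<in>{0..<int N}. \<Sum>j\<in>{0..<int N}. G j * ee (of_int (b * (k - j)) / of_nat N))"
  unfolding partial_dft_def[of N "explicit_weil N A f" a k]
  unfolding explicit_weil_def G_def[symmetric] split_def fst_conv snd_conv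
   sum_distrib_left sum_distrib_right
  by (intro sum.cong refl) (simp add: mult.assoc ee_add[symmetric] algebra_simps diff_divide_distrib)
 also have "(\<Sum>b\<in>{0..<int N}. \<Sum>j\<in>{0..<int N}. G j * ee (of_int (b * (k - j)) / of_nat N)) =
   (\<Sum>j\<in>{0..<int N}. G j * (\<Sum>b\<in>{0..<int N}. ee (of_int (b * (k - j)) / of_nat N)))"
  by (subst sum.swap) (simp add: sum_distrib_left)
 also have "... = (\<Sum>j\<in>{0..<int N}. if j = k mod int N then of_nat N * G j else 0)"
 proof (intro sum.cong refl)
  fix c assume "c \<in> {0..<int N}"
  then have "int N dvd k - c \<longleftrightarrow> c = k mod int N"
   by (metis atLeastLessThan_iff mod_eq_dvd_iff mod_pos_pos_trivial)
  then show "G c * (\<Sum>b\<in>{0..<int N}. ee (of_int (b * (k - c)) / of_nat N)) =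
   (if c = k mod int N then of_nat N * G c else 0)"
   unfolding sum_ee_orthogonal[OF N] by simp
 qed
 also have "... = of_nat N * G (k mod int N)" using N by simp
 also have "G (k mod int N) = G k" using Gper[of "k mod int N" "k div int N"] by simp
 finally show ?thesis using N by (simp add: G_def)
qed

lemma explicit_weil_in_group_algebra:
 assumes N: "N > 0" and f: "f \<in> group_algebra N"
 shows "explicit_weil N A f \<in> group_algebra N"
proof -
 have per2: "partial_dft N f (x + int N * z) (y + int N * w) = partial_dft N f x y" for x y z w
  using partial_dft_periodic[OF N f] by simp
 have 1: "explicit_weil N A f (a + int N, b) = explicit_weil N A f (a, b)" for a b
 proof -
  have "partial_dft N f ((a + int N) * entry A 1 1 - k * entry A 2 1) (k * entry A 2 2 - (a + int N) * entry A 1 2) =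
   partial_dft N f (a * entry A 1 1 - k * entry A 2 1) (k * entry A 2 2 - a * entry A 1 2)" for k
  proof -
   have 1: "(a + int N) * entry A 1 1 - k * entry A 2 1 = (a * entry A 1 1 - k * entry A 2 1) + int N * entry A 1 1"
    by (simp add: algebra_simps)
   have 2: "k * entry A 2 2 - (a + int N) * entry A 1 2 = (k * entry A 2 2 - a * entry A 1 2) + int N * (- entry A 1 2)"
    by (simp add: algebra_simps)
   show ?thesis by (subst 1, subst 2) (rule per2)
  qed
  then show ?thesis unfolding explicit_weil_def by simp
 qed
 have 2: "explicit_weil N A f (a, b + int N) = explicit_weil N A f (a, b)" for a b
 proof -
  have "ee (- of_int ((b + int N) * k) / of_nat N) = ee (- of_int (b * k) / of_nat N)" for k
   using ee_shift[OF N, of "- (b + int N) * k" "- b * k" "- k"] by (simp add: algebra_simps)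
  then show ?thesis unfolding explicit_weil_def by simp
 qed
 show ?thesis unfolding group_algebra_iff using 1 2 by blast
qed

text \<open>On the transformed side both operators are linear substitutions in (a, k), and these
  compose like the matrices; the identity is then polynomial in the entries.\<close>

lemma explicit_weil_mult:
 assumes N: "N > 0" and f: "f \<in> group_algebra N"
 shows "explicit_weil N (A ** B) f = explicit_weil N A (explicit_weil N B f)"
 unfolding explicit_weil_def[of N A] explicit_weil_def[of N "A ** B"] partial_dft_explicit_weil[OF N f]
 by (intro ext) (simp add: split_def matrix_matrix_mult_def sum_2 algebra_simps)

lemma explicit_weil_1:
 assumes N: "N > 0" and f: "f \<in> group_algebra N"
 shows "explicit_weil N (mat 1) f = f"
 using partial_dft_inverse[OF N f] unfolding explicit_weil_def by (auto simp: mat_def)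

lemma sl2z_rep_explicit_weil:
 assumes N: "N > 0"
 shows "sl2z_rep (group_algebra N) (explicit_weil N)"
 unfolding sl2z_rep_def
proof (intro conjI ballI allI)
 fix A f g assume "f \<in> group_algebra N" "g \<in> group_algebra N"
 show "explicit_weil N A (%h. f h + g h) = (%h. explicit_weil N A f h + explicit_weil N A g h)"
  by (auto simp: explicit_weil_def partial_dft_def sum.distrib distrib_right distrib_left add_divide_distrib)
next
 fix A f and c :: complex
 show "explicit_weil N A (%h. c * f h) = (%h. c * explicit_weil N A f h)"
  by (auto simp: explicit_weil_def partial_dft_def sum_distrib_left sum_distrib_right mult_ac)
qed (use explicit_weil_in_group_algebra[OF N] explicit_weil_1[OF N] explicit_weil_mult[OF N] in auto)

lemma T_mat_entries [simp]: "entry T_mat 1 1 = 1" "entry T_mat 1 2 = 1" "entry T_mat 2 1 = 0" "entry T_mat 2 2 = 1"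
 by (simp_all add: T_mat_def)

lemma S_mat_entries [simp]: "entry S_mat 1 1 = 0" "entry S_mat 1 2 = -1" "entry S_mat 2 1 = 1" "entry S_mat 2 2 = 0"
 by (simp_all add: S_mat_def)

text \<open>For T the substitution is (a, k) -> (a, k - a). Shifting the summation variable back by
  a over the period leaves the phase ee(- a b / N).\<close>

lemma explicit_weil_T:
 assumes N: "N > 0" and f: "f \<in> group_algebra N"
 shows "explicit_weil N T_mat f (a, b) = ee (- of_int (a * b) / of_nat N) * f (a, b)"
proof -
 define G where "G k = partial_dft N f a k * ee (- of_int (b * k) / of_nat N)" for k
 have Gper: "G (k + int N) = G k" for k
 proof -
  have "ee (- of_int (b * (k + int N)) / of_nat N) = ee (- of_int (b * k) / of_nat N)" for k
   using ee_shift[OF N, of "- b * (k + int N)" "- b * k" "- b"] by (simp add: algebra_simps)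
  then show ?thesis unfolding G_def using partial_dft_periodic(2)[OF N f, of a k 1] by simp
 qed
 have "explicit_weil N T_mat f (a, b) = 1 / of_nat N * (\<Sum>k\<in>{0..<int N}. partial_dft N f a (k - a) * ee (- of_int (b * k) / of_nat N))"
  by (simp add: explicit_weil_def)
 also have "(\<Sum>k\<in>{0..<int N}. partial_dft N f a (k - a) * ee (- of_int (b * k) / of_nat N)) =
   ee (- of_int (a * b) / of_nat N) * (\<Sum>k\<in>{0..<int N}. G (k + (- a)))"
  unfolding G_def sum_distrib_left
  by (intro sum.cong refl) (simp add: mult_ac ee_add[symmetric] algebra_simps diff_divide_distrib add_divide_distrib)
 also have "(\<Sum>k\<in>{0..<int N}. G (k + (- a))) = (\<Sum>k\<in>{0..<int N}. G k)"
  by (rule sum_periodic_shift) (use N Gper in auto)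
 also have "1 / of_nat N * (ee (- of_int (a * b) / of_nat N) * (\<Sum>k\<in>{0..<int N}. G k)) =
  ee (- of_int (a * b) / of_nat N) * (1 / of_nat N * (\<Sum>k\<in>{0..<int N}. G k))" by (simp only: mult_ac)
 also have "1 / of_nat N * (\<Sum>k\<in>{0..<int N}. G k) = f (a, b)"
  unfolding G_def by (rule partial_dft_inverse[OF N f])
 finally show ?thesis .
qed

text \<open>For S the substitution is (a, k) -> (- k, a): the transform in the second coordinate and
  the inverse transform then run over different coordinates and together form a full finite Fourier
  transform.\<close>

lemma explicit_weil_S:
 assumes N: "N > 0" and f: "f \<in> group_algebra N"
 shows "explicit_weil N S_mat f (a, b) = 1 / of_nat N * (\<Sum>h\<in>disc_reps N. f h * ee (of_int (a * snd h + b * fst h) / of_nat N))"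
proof -
 define G where "G k = partial_dft N f k a * ee (of_int (b * k) / of_nat N)" for k
 have Gper: "G (k + int N) = G k" for k
 proof -
  have "ee (of_int (b * (k + int N)) / of_nat N) = ee (of_int (b * k) / of_nat N)" for k
   using ee_shift[OF N, of "b * (k + int N)" "b * k" "b"] by (simp add: algebra_simps)
  then show ?thesis unfolding G_def using partial_dft_periodic(1)[OF N f, of k 1] by simp
 qed
 have "explicit_weil N S_mat f (a, b) = 1 / of_nat N * (\<Sum>k\<in>{0..<int N}. G (- k))"
  by (simp add: explicit_weil_def G_def)
 also have "(\<Sum>k\<in>{0..<int N}. G (- k)) = (\<Sum>k\<in>{0..<int N}. G k)"
  by (rule sum_periodic_uminus) (use N Gper in auto)
 also have "... = (\<Sum>h\<in>disc_reps N. f h * ee (of_int (a * snd h + b * fst h) / of_nat N))"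
  unfolding disc_reps_def G_def partial_dft_def sum_distrib_right sum.cartesian_product split_def
  by (intro sum.cong refl) (auto simp: mult_ac ee_add[symmetric] algebra_simps add_divide_distrib)
 finally show ?thesis .
qed

lemma BF_rvec: "of_real (BF N (rvec g) (rvec h)) = (of_int (fst g * snd h + snd g * fst h) / of_nat N :: complex)"
 by (simp add: BF_def rvec_def mult.commute)

lemma QF_rvec: "of_real (QF N (rvec g)) = (of_int (fst g * snd g) / of_nat N :: complex)"
 by (simp add: QF_def rvec_def)

lemma ee_BF_in_group_algebra:
 assumes N: "N > 0"
 shows "(%g. ee (of_real (BF N (rvec g) (rvec h)))) \<in> group_algebra N"
 unfolding group_algebra_iff BF_rvec
proof (intro allI conjI)
 fix a b
 show "ee (of_int (fst (a + int N, b) * snd h + snd (a + int N, b) * fst h) / of_nat N) = ee (of_int (fst (a, b) * snd h + snd (a, b) * fst h) / of_nat N)"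
  by (rule ee_shift[OF N, of _ _ "snd h"]) (simp add: algebra_simps)
 show "ee (of_int (fst (a, b + int N) * snd h + snd (a, b + int N) * fst h) / of_nat N) = ee (of_int (fst (a, b) * snd h + snd (a, b) * fst h) / of_nat N)"
  by (rule ee_shift[OF N, of _ _ "fst h"]) (simp add: algebra_simps)
qed

lemma is_weil_rep_explicit_weil:
 assumes N: "N > 0"
 shows "is_weil_rep N (explicit_weil N)"
 unfolding is_weil_rep_def
proof (intro conjI allI ext)
 show "sl2z_rep (group_algebra N) (explicit_weil N)" by (rule sl2z_rep_explicit_weil[OF N])
next
 fix h g :: "int \<times> int"
 obtain a b where g: "g = (a, b)" by (cases g)
 have "ee (of_real (- QF N (rvec h))) * e_vec N h g = ee (- of_int (a * b) / of_nat N) * e_vec N h g"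
 proof (cases "g \<in> lat_coset N h")
  case True
  then obtain z w where "a - fst h = int N * z" "b - snd h = int N * w" by (auto simp: in_lat_coset_iff g elim!: dvdE)
  then have zw: "a = fst h + int N * z" "b = snd h + int N * w" by simp_all
  have "ee (of_int (- fst h * snd h) / of_nat N) = ee (of_int (- a * b) / of_nat N)"
   by (rule ee_shift[OF N, of _ _ "z * snd h + w * fst h + int N * z * w"]) (simp add: zw algebra_simps)
  then show ?thesis using QF_rvec[of N h] by simp
 qed (simp add: e_vec_def)
 then show "explicit_weil N T_mat (e_vec N h) g = ee (of_real (- QF N (rvec h))) * e_vec N h g"
  unfolding g explicit_weil_T[OF N e_vec_in_group_algebra] by auto
next
 fix h g :: "int \<times> int"
 obtain a b where g: "g = (a, b)" by (cases g)
 have sym: "e_vec N x y = e_vec N y x" for x y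
  unfolding e_vec_def indicator_def in_lat_coset_iff by (simp add: dvd_diff_commute)
 \<comment> \<open>Both sums over \<open>disc_reps\<close> expand a periodic function in the
   canonical basis, once evaluated at g and once at h; the symmetry of \<open>BF\<close> connects
   the two evaluations.\<close>
 have "(\<Sum>\<delta>\<in>disc_reps N. ee (of_real (BF N (rvec \<delta>) (rvec h))) * e_vec N \<delta> g) = ee (of_real (BF N (rvec g) (rvec h)))"
  by (rule sum_e_vec[OF N ee_BF_in_group_algebra[OF N]])
 also have "... = ee (of_real (BF N (rvec h) (rvec g)))" by (simp add: BF_def add.commute mult.commute)
 also have "... = (\<Sum>\<delta>\<in>disc_reps N. ee (of_real (BF N (rvec \<delta>) (rvec g))) * e_vec N \<delta> h)"
  by (rule sum_e_vec[OF N ee_BF_in_group_algebra[OF N], symmetric])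
 also have "... = (\<Sum>\<delta>\<in>disc_reps N. e_vec N h \<delta> * ee (of_int (a * snd \<delta> + b * fst \<delta>) / of_nat N))"
  by (intro sum.cong refl) (simp add: BF_rvec g sym[of h] mult.commute add.commute)
 finally show "explicit_weil N S_mat (e_vec N h) g = 1 / of_nat N * (\<Sum>\<delta>\<in>disc_reps N. ee (of_real (BF N (rvec \<delta>) (rvec h))) * e_vec N \<delta> g)"
  unfolding g explicit_weil_S[OF N e_vec_in_group_algebra] by simp
qed

lemma is_weil_rep_weil_rep: "N > 0 ==> is_weil_rep N (weil_rep N)"
 unfolding weil_rep_def using someI[of "is_weil_rep N", OF is_weil_rep_explicit_weil] by simp

lemma
 assumes "sl2z_rep V \<rho>" and A: "A \<in> SL2Z" and f: "f \<in> V"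
 shows sl2z_rep_closed: "\<rho> A f \<in> V"
  and sl2z_rep_add: "\<And>g. g \<in> V ==> \<rho> A (%h. f h + g h) = (%h. \<rho> A f h + \<rho> A g h)"
  and sl2z_rep_scale: "\<rho> A (%h. c * f h) = (%h. c * \<rho> A f h)"
  and sl2z_rep_one: "\<rho> (mat 1) f = f"
  and sl2z_rep_mult: "\<And>B. B \<in> SL2Z ==> \<rho> B (\<rho> A f) = \<rho> (B ** A) f"
proof -
 note D = assms(1)[unfolded sl2z_rep_def]
 note cl = D[THEN conjunct1] and ad = D[THEN conjunct2, THEN conjunct1]
  and sc = D[THEN conjunct2, THEN conjunct2, THEN conjunct1]
  and on = D[THEN conjunct2, THEN conjunct2, THEN conjunct2, THEN conjunct1]
  and mu = D[THEN conjunct2, THEN conjunct2, THEN conjunct2, THEN conjunct2]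
 show "\<rho> A f \<in> V" by (rule cl[rule_format, OF A f])
 show "\<rho> A (%h. f h + g h) = (%h. \<rho> A f h + \<rho> A g h)" if "g \<in> V" for g
  by (rule ad[rule_format, OF A f that])
 show "\<rho> A (%h. c * f h) = (%h. c * \<rho> A f h)" by (rule sc[rule_format, OF A f])
 show "\<rho> (mat 1) f = f" by (rule on[rule_format, OF f])
 show "\<rho> B (\<rho> A f) = \<rho> (B ** A) f" if "B \<in> SL2Z" for B
  by (rule mu[rule_format, OF that A f, symmetric])
qed

lemma sl2z_rep_group_algebra_sum:
 assumes \<rho>: "sl2z_rep (group_algebra N) \<rho>" and A: "A \<in> SL2Z" and I: "finite I"
  and F: "\<And>i. i \<in> I ==> F i \<in> group_algebra N"
 shows "\<rho> A (%g. \<Sum>i\<in>I. c i * F i g) = (%g. \<Sum>i\<in>I. c i * \<rho> A (F i) g)"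
 using I F
proof (induction I)
 case empty
 have "(%_. 0) \<in> group_algebra N" by (simp add: group_algebra_iff)
 from sl2z_rep_scale[OF \<rho> A this, of 0] have "\<rho> A (%_. 0) = (%_. 0)" by simp
 then show ?case by simp
next
 case (insert i I)
 have 1: "(%g. c i * F i g) \<in> group_algebra N" "(%g. \<Sum>i\<in>I. c i * F i g) \<in> group_algebra N"
  using insert.prems unfolding group_algebra_iff by auto
 have "\<rho> A (%h. (c i * F i h) + (\<Sum>i\<in>I. c i * F i h)) = (%h. \<rho> A (%g. c i * F i g) h + \<rho> A (%g. \<Sum>i\<in>I. c i * F i g) h)"
  by (rule sl2z_rep_add[OF \<rho> A 1(1) 1(2)])
 also have "\<rho> A (%g. c i * F i g) = (%h. c i * \<rho> A (F i) h)"
  by (rule sl2z_rep_scale[OF \<rho> A]) (use insert.prems in auto)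
 finally show ?case using insert by simp
qed

lemma T_S_in_SL2Z: "T_mat \<in> SL2Z" "S_mat \<in> SL2Z"
 by (simp_all add: SL2Z_def det_2)

text \<open>The defining properties prescribe rho only on the canonical basis. By linearity rho
  coincides at T with \<open>explicit_weil\<close>, whose action on an arbitrary f is known in
  closed form.\<close>

lemma weil_rep_T:
 assumes N: "N > 0" and \<rho>: "is_weil_rep N \<rho>" and f: "f \<in> group_algebra N"
 shows "\<rho> T_mat f (a, b) = ee (- of_int (a * b) / of_nat N) * f (a, b)"
proof -
 have feq: "f = (%g. \<Sum>h\<in>disc_reps N. f h * e_vec N h g)" using sum_e_vec[OF N f] by auto
 have fin: "finite (disc_reps N)" by (simp add: disc_reps_def)
 have *: "sl2z_rep (group_algebra N) \<sigma> ==> \<sigma> T_mat f = (%g. \<Sum>h\<in>disc_reps N. f h * \<sigma> T_mat (e_vec N h) g)" for \<sigma>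
  by (subst feq, rule sl2z_rep_group_algebra_sum[OF _ T_S_in_SL2Z(1) fin e_vec_in_group_algebra])
 have "\<rho> T_mat f = explicit_weil N T_mat f"
  using *[of \<rho>] *[of "explicit_weil N"] \<rho> is_weil_rep_explicit_weil[OF N] unfolding is_weil_rep_def by simp
 then show ?thesis using explicit_weil_T[OF N f] by simp
qed

lemma weil_rep_S:
 assumes N: "N > 0" and \<rho>: "is_weil_rep N \<rho>" and f: "f \<in> group_algebra N"
 shows "\<rho> S_mat f (a, b) = 1 / of_nat N * (\<Sum>h\<in>disc_reps N. f h * ee (of_int (a * snd h + b * fst h) / of_nat N))"
proof -
 have feq: "f = (%g. \<Sum>h\<in>disc_reps N. f h * e_vec N h g)" using sum_e_vec[OF N f] by auto
 have fin: "finite (disc_reps N)" by (simp add: disc_reps_def)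
 have *: "sl2z_rep (group_algebra N) \<sigma> ==> \<sigma> S_mat f = (%g. \<Sum>h\<in>disc_reps N. f h * \<sigma> S_mat (e_vec N h) g)" for \<sigma>
  by (subst feq, rule sl2z_rep_group_algebra_sum[OF _ T_S_in_SL2Z(2) fin e_vec_in_group_algebra])
 have "\<rho> S_mat f = explicit_weil N S_mat f"
  using *[of \<rho>] *[of "explicit_weil N"] \<rho> is_weil_rep_explicit_weil[OF N] unfolding is_weil_rep_def by simp
 then show ?thesis using explicit_weil_S[OF N f] by simp
qed

lemma mat2_eq_iff: "(A :: int ^ 2 ^ 2) = B \<longleftrightarrow> entry A 1 1 = entry B 1 1 \<and> entry A 1 2 = entry B 1 2 \<and> entry A 2 1 = entry B 2 1 \<and> entry A 2 2 = entry B 2 2"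
 by (auto simp: vec_eq_iff forall_2)

lemma mat2_mult_entry: "entry (A ** B) i j = entry A i 1 * entry B 1 j + entry A i 2 * entry B 2 j"
 by (simp add: matrix_matrix_mult_def sum_2)

lemma T_S_mult_entry:
 "entry (T_mat ** A) 1 j = entry A 1 j + entry A 2 j" "entry (T_mat ** A) 2 j = entry A 2 j"
 "entry (S_mat ** A) 1 j = - entry A 2 j" "entry (S_mat ** A) 2 j = entry A 1 j"
 by (simp_all add: mat2_mult_entry)

lemma SL2Z_mult: "A \<in> SL2Z ==> B \<in> SL2Z ==> A ** B \<in> SL2Z"
 by (simp add: SL2Z_def det_mul)

text \<open>Euclid's algorithm on the first column, by induction on |A21|. Only left multiplication
  by T and S is available as an induction step, so inverse powers of T have to be spelled as words
  in T and S.\<close>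

lemma SL2Z_induct [consumes 1, case_names one T S]:
 assumes A: "A \<in> SL2Z" and one: "Q (mat 1)"
  and T: "\<And>A. A \<in> SL2Z ==> Q A ==> Q (T_mat ** A)"
  and S: "\<And>A. A \<in> SL2Z ==> Q A ==> Q (S_mat ** A)"
 shows "Q A"
proof -
 define Tp :: "int => int ^ 2 ^ 2" where "Tp n = vector [vector [1, n], vector [0, 1]]" for n
 have Tp [simp]: "entry (Tp n) 1 1 = 1" "entry (Tp n) 1 2 = n" "entry (Tp n) 2 1 = 0" "entry (Tp n) 2 2 = 1" for n
  by (simp_all add: Tp_def)
 have Tinv: "Q (Tp (-1) ** A)" if "A \<in> SL2Z" "Q A" for A
 proof -
  \<comment> \<open>From (S T)^3 = -1 and S^2 = -1 one gets T^(-1) = S T S T S S S.\<close>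
  have eq: "Tp (-1) ** A = S_mat ** (T_mat ** (S_mat ** (T_mat ** (S_mat ** (S_mat ** (S_mat ** A))))))"
   by (simp add: mat2_eq_iff T_S_mult_entry) (simp add: mat2_mult_entry)
  show ?thesis unfolding eq using that by (intro S T SL2Z_mult T_S_in_SL2Z)
 qed
 have TpSL: "Tp n ** A \<in> SL2Z" if "A \<in> SL2Z" for A n
  using that by (auto simp: SL2Z_def det_2 mat2_mult_entry algebra_simps)
 have Tpow: "Q (Tp n ** A)" if "A \<in> SL2Z" "Q A" for A n
 proof (induction n rule: int_induct[where k = 0])
  case base
  have "Tp 0 ** A = A" by (simp add: mat2_eq_iff mat2_mult_entry)
  then show ?case using that by simp
 next
  case (step1 i)
  have "Tp (i + 1) ** A = T_mat ** (Tp i ** A)" by (simp add: mat2_eq_iff mat2_mult_entry algebra_simps)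
  then show ?case using T[OF TpSL[OF that(1)] step1(2)] by simp
 next
  case (step2 i)
  have "Tp (i - 1) ** A = Tp (-1) ** (Tp i ** A)" by (simp add: mat2_eq_iff mat2_mult_entry algebra_simps)
  then show ?case using Tinv[OF TpSL[OF that(1)] step2(2)] by simp
 qed
 show ?thesis using A
 proof (induction "nat \<bar>entry A 2 1\<bar>" arbitrary: A rule: less_induct)
  case less
  define a b c d where "a = entry A 1 1" and "b = entry A 1 2" and "c = entry A 2 1" and "d = entry A 2 2"
  note defs = a_def b_def c_def d_def
  have det: "a * d - b * c = 1" using less.prems by (simp add: SL2Z_def det_2 defs)
  have oneSL: "mat 1 \<in> SL2Z" by (simp add: SL2Z_def)
  show ?case
  proof (cases "c = 0")
   case True
   with det have "a * d = 1" by simp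
   then have ad: "a = 1 \<and> d = 1 \<or> a = -1 \<and> d = -1" by (simp add: zmult_eq_1_iff)
   then show ?thesis
   proof
    assume "a = 1 \<and> d = 1"
    then have "A = Tp b ** mat 1" using True by (simp add: mat2_eq_iff mat2_mult_entry defs mat_def)
    then show ?thesis using Tpow[OF oneSL one] by simp
   next
    assume "a = -1 \<and> d = -1"
    \<comment> \<open>Minus the identity is S^2.\<close>
    then have "A = Tp (-b) ** (S_mat ** (S_mat ** mat 1))" using True by (simp add: mat2_eq_iff mat2_mult_entry defs mat_def)
    moreover have "Q (S_mat ** (S_mat ** mat 1))" "S_mat ** (S_mat ** mat 1) \<in> SL2Z"
     by (intro S SL2Z_mult one oneSL T_S_in_SL2Z)+
    ultimately show ?thesis using Tpow by simp
   qed
  next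
   case False
   \<comment> \<open>B is the solution of A = T^q S B with q = a div c. Its lower left entry is -(a
     mod c), which makes the measure drop.\<close>
   define B :: "int ^ 2 ^ 2" where "B = vector [vector [c, d], vector [- (a mod c), - (b - (a div c) * d)]]"
   have B [simp]: "entry B 1 1 = c" "entry B 1 2 = d" "entry B 2 1 = - (a mod c)" "entry B 2 2 = - (b - (a div c) * d)"
    by (simp_all add: B_def)
   have amod: "a mod c = a - (a div c) * c" by (simp add: minus_div_mult_eq_mod)
   have BSL: "B \<in> SL2Z" using det by (simp add: SL2Z_def det_2 amod algebra_simps)
   have "nat \<bar>entry B 2 1\<bar> < nat \<bar>entry A 2 1\<bar>" using abs_mod_less[OF False, of a] False by (simp add: c_def[symmetric])
   then have "Q B" using less.hyps BSL by blast
   then have "Q (S_mat ** B)" "S_mat ** B \<in> SL2Z" using BSL by (auto intro!: S SL2Z_mult T_S_in_SL2Z)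
   moreover have "A = Tp (a div c) ** (S_mat ** B)"
    by (simp add: mat2_eq_iff mat2_mult_entry amod algebra_simps) (simp add: defs)
   ultimately show ?thesis using Tpow by simp
  qed
 qed
qed

lemma mobius_in_uhp_denom:
 assumes A: "A \<in> SL2Z" and \<tau>: "\<tau> \<in> uhp"
 shows "of_int (entry A 2 1) * \<tau> + of_int (entry A 2 2) ~= 0"
proof
 assume 0: "of_int (entry A 2 1) * \<tau> + of_int (entry A 2 2) = 0"
 then have "Im (of_int (entry A 2 1) * \<tau> + of_int (entry A 2 2)) = 0" by simp
 then have c: "entry A 2 1 = 0" using \<tau> by (simp add: uhp_def)
 with 0 have "entry A 2 2 = 0" by simp
 with c A show False by (simp add: SL2Z_def det_2)
qed

lemma uminus_inverse_in_uhp: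
 assumes "\<tau> \<in> uhp" shows "- 1 / \<tau> \<in> uhp"
proof -
 have "Im (- 1 / \<tau>) = Im \<tau> / (cmod \<tau>)\<^sup>2" by (simp add: Im_divide cmod_power2)
 moreover have "cmod \<tau> > 0" "Im \<tau> > 0" using assms by (auto simp: uhp_def)
 ultimately show ?thesis by (simp add: uhp_def)
qed

text \<open>The law for a generator is applied at the moved point \<open>mobius A \<tau>\<close>,
  and linearity takes the automorphy factor of A out of the representation; the rest is the cocycle
  relation. That the moved point stays in the half-plane is carried through the same
  induction.\<close>

lemma modular_from_generators:
 assumes N: "N > 0" and \<rho>: "sl2z_rep (group_algebra N) \<rho>"
  and F: "\<And>\<tau>. \<tau> \<in> uhp ==> F \<tau> \<in> group_algebra N"
  and T: "\<And>\<tau>. \<tau> \<in> uhp ==> F (\<tau> + 1) = \<rho> T_mat (F \<tau>)"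
  and S: "\<And>\<tau>. \<tau> \<in> uhp ==> F (- 1 / \<tau>) = (%h. \<tau> * \<rho> S_mat (F \<tau>) h)"
  and A: "A \<in> SL2Z" and \<tau>: "\<tau> \<in> uhp"
 shows "F (mobius A \<tau>) = (%h. (of_int (entry A 2 1) * \<tau> + of_int (entry A 2 2)) * \<rho> A (F \<tau>) h)"
proof -
 have "mobius A \<tau> \<in> uhp \<and> F (mobius A \<tau>) = (%h. (of_int (entry A 2 1) * \<tau> + of_int (entry A 2 2)) * \<rho> A (F \<tau>) h)"
  using A
 proof (induction A rule: SL2Z_induct)
  case one
  have "\<rho> (mat 1) (F \<tau>) = F \<tau>" by (rule sl2z_rep_one[OF \<rho> T_S_in_SL2Z(1) F[OF \<tau>]])
  then show ?case using \<tau> by (simp add: mobius_def mat_def)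
 next
  case (T A)
  let ?j = "of_int (entry A 2 1) * \<tau> + of_int (entry A 2 2)"
  have j: "?j ~= 0" by (rule mobius_in_uhp_denom[OF T(1) \<tau>])
  have m: "mobius (T_mat ** A) \<tau> = mobius A \<tau> + 1"
   using j by (simp add: mobius_def mat2_mult_entry field_simps)
  have AF: "\<rho> A (F \<tau>) \<in> group_algebra N" by (rule sl2z_rep_closed[OF \<rho> T(1) F[OF \<tau>]])
  have "F (mobius A \<tau> + 1) = \<rho> T_mat (F (mobius A \<tau>))" using assms(4) T by blast
  also have "... = \<rho> T_mat (%h. ?j * \<rho> A (F \<tau>) h)" using T by simp
  also have "... = (%h. ?j * \<rho> T_mat (\<rho> A (F \<tau>)) h)"
   by (rule sl2z_rep_scale[OF \<rho> T_S_in_SL2Z(1) AF])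
  also have "\<rho> T_mat (\<rho> A (F \<tau>)) = \<rho> (T_mat ** A) (F \<tau>)"
   by (rule sl2z_rep_mult[OF \<rho> T(1) F[OF \<tau>] T_S_in_SL2Z(1)])
  finally show ?case using T unfolding m by (simp add: mat2_mult_entry uhp_def)
 next
  case (S A)
  let ?j = "of_int (entry A 2 1) * \<tau> + of_int (entry A 2 2)"
  have j: "?j ~= 0" by (rule mobius_in_uhp_denom[OF S(1) \<tau>])
  have up: "mobius A \<tau> \<in> uhp" using S by simp
  then have nz: "mobius A \<tau> ~= 0" by (auto simp: uhp_def)
  have mj: "mobius A \<tau> * ?j = of_int (entry A 1 1) * \<tau> + of_int (entry A 1 2)" using j by (simp add: mobius_def)
  with nz j have num: "of_int (entry A 1 1) * \<tau> + of_int (entry A 1 2) ~= (0::complex)" by (metis mult_eq_0_iff)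
  have m: "mobius (S_mat ** A) \<tau> = - 1 / mobius A \<tau>"
   using j num by (simp add: mobius_def mat2_mult_entry field_simps)
  have AF: "\<rho> A (F \<tau>) \<in> group_algebra N" by (rule sl2z_rep_closed[OF \<rho> S(1) F[OF \<tau>]])
  have "F (- 1 / mobius A \<tau>) = (%h. mobius A \<tau> * \<rho> S_mat (F (mobius A \<tau>)) h)" using assms(5) S by blast
  also have "\<rho> S_mat (F (mobius A \<tau>)) = \<rho> S_mat (%h. ?j * \<rho> A (F \<tau>) h)" using S by simp
  also have "... = (%h. ?j * \<rho> S_mat (\<rho> A (F \<tau>)) h)"
   by (rule sl2z_rep_scale[OF \<rho> T_S_in_SL2Z(2) AF])
  also have "\<rho> S_mat (\<rho> A (F \<tau>)) = \<rho> (S_mat ** A) (F \<tau>)"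
   by (rule sl2z_rep_mult[OF \<rho> S(1) F[OF \<tau>] T_S_in_SL2Z(2)])
  \<comment> \<open>The product of the two automorphy factors is the numerator of
    \<open>mobius A \<tau>\<close>, which is the denominator belonging to S A.\<close>
  also have "(%h. mobius A \<tau> * (?j * \<rho> (S_mat ** A) (F \<tau>) h)) =
    (%h. (of_int (entry A 1 1) * \<tau> + of_int (entry A 1 2)) * \<rho> (S_mat ** A) (F \<tau>) h)"
   by (simp add: mj[symmetric] mult.assoc)
  finally have 2: "F (- 1 / mobius A \<tau>) = ..." .
  have "- 1 / mobius A \<tau> \<in> uhp" by (rule uminus_inverse_in_uhp[OF up])
  then show ?case using 2 unfolding m by (simp add: mat2_mult_entry)
 qed
 then show ?thesis by simp
qed

section \<open>Constant terms at s = 0 and the substitution t = exp w\<close>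

text \<open>Two meromorphic continuations agree on a common half-plane, hence off a sparse set,
  hence near 0 apart from 0 itself, and the Laurent expansion depends on no more than that. This
  gives the definite description its value.\<close>

lemma continued_constant_term_eqI:
 assumes F: "F meromorphic_on UNIV" and eq: "\<And>s. Re s > \<sigma> ==> F s = f s"
 shows "continued_constant_term f = fls_nth (laurent_expansion F 0) 0"
 unfolding continued_constant_term_def
proof (rule the_equality)
 show "\<exists>Fa \<sigma>. Fa meromorphic_on UNIV \<and> (\<forall>s. Re s > \<sigma> --> Fa s = f s) \<and>
   fls_nth (laurent_expansion F 0) 0 = fls_nth (laurent_expansion Fa 0) 0"
  using F eq by blast
next
 fix c assume "\<exists>F \<sigma>. F meromorphic_on UNIV \<and> (\<forall>s. Re s > \<sigma> --> F s = f s) \<and>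
   c = fls_nth (laurent_expansion F 0) 0"
 then obtain G \<sigma>' where G: "G meromorphic_on UNIV" "\<And>s. Re s > \<sigma>' ==> G s = f s"
  "c = fls_nth (laurent_expansion G 0) 0" by blast
 have D: "(%s. F s - G s) meromorphic_on UNIV"
  using F G(1) by (rule meromorphic_on_diff)
 define z0 :: complex where "z0 = of_real (max \<sigma> \<sigma>' + 1)"
 have ev: "eventually (%s. Re s > max \<sigma> \<sigma>') (at z0)"
 proof -
  have "open {s. Re s > max \<sigma> \<sigma>'}" by (intro open_Collect_less continuous_intros)
  moreover have "z0 \<in> {s. Re s > max \<sigma> \<sigma>'}" by (auto simp: z0_def)
  ultimately show ?thesis
   by (metis (no_types, lifting) eventually_at_topological mem_Collect_eq)
 qed
 have z: "eventually (%s. F s - G s = 0) (at z0)"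
  using ev by eventually_elim (use eq G(2) in auto)
 have nz: "\<not> eventually (%s. F s - G s ~= 0) (cosparse UNIV)"
 proof
  assume "eventually (%s. F s - G s ~= 0) (cosparse UNIV)"
  then have "eventually (%s. F s - G s ~= 0) (at z0)"
   by (auto simp: eventually_cosparse_open_eq)
  with z have "eventually (%s. False) (at z0)" by eventually_elim auto
  then show False by simp
 qed
 have "eventually (%s. F s - G s = 0) (cosparse UNIV)"
  using meromorphic_imp_constant_or_avoid[OF D open_UNIV connected_UNIV, of 0] nz by blast
 then have "eventually (%s. F s = G s) (at 0)"
  by (auto simp: eventually_cosparse_open_eq)
 then have "laurent_expansion F 0 = laurent_expansion G 0"
  by (rule laurent_expansion_cong) simp
 with G(3) show "c = fls_nth (laurent_expansion F 0) 0" by simp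
qed

lemma fls_nth_laurent_expansion_entire:
 assumes "G holomorphic_on UNIV"
 shows "fls_nth (laurent_expansion G 0) 0 = G 0"
proof -
 have "G analytic_on {0}"
  using assms by (meson analytic_on_holomorphic open_UNIV subset_UNIV)
 then have "G has_fps_expansion fps_expansion G 0"
  by (rule analytic_at_imp_has_fps_expansion_0)
 then have "G has_laurent_expansion fps_to_fls (fps_expansion G 0)"
  by (rule has_laurent_expansion_fps)
 then have "laurent_expansion G 0 = fps_to_fls (fps_expansion G 0)"
  by (rule laurent_expansion_0_eqI)
 then show ?thesis by (simp add: fps_expansion_def)
qed

text \<open>Division by s shifts the Taylor coefficients by one place, so the coefficient at 0 is
  the first Taylor coefficient of G.\<close>

lemma fls_nth_laurent_expansion_entire_divide:
 assumes "G holomorphic_on UNIV"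
 shows "fls_nth (laurent_expansion (%s. G s / s) 0) 0 = deriv G 0"
proof -
 have "G analytic_on {0}"
  using assms by (meson analytic_on_holomorphic open_UNIV subset_UNIV)
 then have "G has_fps_expansion fps_expansion G 0"
  by (rule analytic_at_imp_has_fps_expansion_0)
 then have "G has_laurent_expansion fps_to_fls (fps_expansion G 0)"
  by (rule has_laurent_expansion_fps)
 then have "(%s. G s * inverse s) has_laurent_expansion fps_to_fls (fps_expansion G 0) * fls_X_inv"
  by (rule has_laurent_expansion_mult) (rule has_laurent_expansion_fls_X_inv)
 then have "laurent_expansion (%s. G s * inverse s) 0 = fps_to_fls (fps_expansion G 0) * fls_X_inv"
  by (rule laurent_expansion_0_eqI)
 then show ?thesis by (simp add: fps_expansion_def divide_inverse fls_X_inv_times_conv_shift)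
qed

text \<open>Expanding exp(-s|w|) in powers of s, the partial sums of the absolute values are
  dominated by exp(|s||w|), against which f is integrable by hypothesis. So G is an everywhere
  convergent power series, and its linear coefficient is the derivative at 0.\<close>

lemma exp_transform_entire:
 fixes f :: "real => complex"
 assumes meas: "f \<in> borel_measurable borel"
  and int: "\<And>K::real. integrable lborel (%w. norm (f w) * exp (K * abs w))"
 defines "G \<equiv> %s. LINT w|lborel. f w * exp (- s * of_real \<bar>w\<bar>)"
 shows "G holomorphic_on UNIV" "deriv G 0 = - (LINT w|lborel. of_real \<bar>w\<bar> * f w)"
proof -
 define a where "a k = (LINT w|lborel. f w * of_real ((- abs w) ^ k / fact k))" for k
 have nsum: "(\<Sum>k<n. (r * abs w) ^ k / fact k) <= exp (r * abs w)" if "r >= 0" for r w :: real and n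
 proof -
  have "(%k. (r * abs w) ^ k /\<^sub>R fact k) sums exp (r * abs w)" by (rule exp_converges)
  then have "(\<Sum>k<n. (r * abs w) ^ k /\<^sub>R fact k) <= exp (r * abs w)"
   using that sum_le_suminf[of "%k. (r * abs w) ^ k /\<^sub>R fact k" "{..<n}"]
   by (auto simp: sums_iff)
  then show ?thesis by (simp add: divide_inverse mult.commute)
 qed
 have sums: "(%k. a k * s ^ k) sums G s" for s
 proof -
  define F where "F k w = f w * of_real ((- abs w) ^ k / fact k) * s ^ k" for k w
  have nF: "norm (F k w) = norm (f w) * ((norm s * abs w) ^ k / fact k)" for k w
   by (simp add: F_def norm_mult norm_power norm_divide power_mult_distrib)
  have le: "(norm s * abs w) ^ k / fact k <= exp (norm s * abs w)" for k w
  proof -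
   have "(norm s * abs w) ^ k / fact k <= (\<Sum>j<Suc k. (norm s * abs w) ^ j / fact j)"
    by (simp add: sum_nonneg)
   also have "... <= exp (norm s * abs w)" by (rule nsum) simp
   finally show ?thesis .
  qed
  have measF: "F k \<in> borel_measurable lborel" for k
   using meas unfolding F_def by measurable
  have intF: "integrable lborel (F k)" for k
   by (rule integrable_dominated[OF int[of "norm s"] measF])
     (auto simp: nF simp del: times_divide_eq_right intro!: mult_left_mono le)
  have intnF: "integrable lborel (%w. norm (F k w))" for k
   using intF by (rule integrable_norm)
  have F_sums: "(%k. F k w) sums (f w * exp (- s * of_real \<bar>w\<bar>))" for w
  proof -
   have "(%k. (- s * of_real \<bar>w\<bar>) ^ k /\<^sub>R fact k) sums exp (- s * of_real \<bar>w\<bar>)" by (rule exp_converges)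
   then have "(%k. f w * ((- s * of_real \<bar>w\<bar>) ^ k /\<^sub>R fact k)) sums (f w * exp (- s * of_real \<bar>w\<bar>))"
    by (rule sums_mult)
   moreover have "f w * ((- s * of_real \<bar>w\<bar>) ^ k /\<^sub>R fact k) = F k w" for k
   proof -
    have "- s * of_real \<bar>w\<bar> = of_real (- abs w) * s" by simp
    then have "(- s * of_real \<bar>w\<bar>) ^ k = of_real ((- abs w) ^ k) * s ^ k"
     by (simp only: power_mult_distrib of_real_power)
    then show ?thesis unfolding F_def by (simp add: scaleR_conv_of_real divide_inverse)
   qed
   ultimately show ?thesis by simp
  qed
  have summ: "AE w in lborel. summable (%k. norm (F k w))"
  proof (rule AE_I2)
   fix w
   have "summable (%k. norm (f w) * ((norm s * abs w) ^ k /\<^sub>R fact k))"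
    by (intro summable_mult summable_exp_generic)
   then show "summable (%k. norm (F k w))" by (simp add: nF divide_inverse mult_ac)
  qed
  have summi: "summable (%k. LINT w|lborel. norm (F k w))"
  proof (rule summableI_nonneg_bounded)
   fix n
   have "(\<Sum>k<n. LINT w|lborel. norm (F k w)) = (LINT w|lborel. (\<Sum>k<n. norm (F k w)))"
    using intnF by (simp add: Bochner_Integration.integral_sum)
   also have "... <= (LINT w|lborel. norm (f w) * exp (norm s * abs w))"
    by (intro integral_mono int Bochner_Integration.integrable_sum intnF)
      (auto simp: nF simp del: times_divide_eq_right simp flip: sum_distrib_left intro!: mult_left_mono nsum)
   finally show "(\<Sum>k<n. LINT w|lborel. norm (F k w)) <= (LINT w|lborel. norm (f w) * exp (norm s * abs w))" .
  qed auto
  have "(%k. integral\<^sup>L lborel (F k)) sums (LINT w|lborel. (\<Sum>k. F k w))"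
   by (rule sums_integral[OF intF summ summi])
  moreover have "(\<Sum>k. F k w) = f w * exp (- s * of_real \<bar>w\<bar>)" for w
   using F_sums sums_unique by metis
  moreover have "integral\<^sup>L lborel (F k) = a k * s ^ k" for k
   unfolding F_def a_def by simp
  ultimately show ?thesis by (simp add: G_def)
 qed
 have Geq: "G = (%s. \<Sum>k. a k * s ^ k)"
  using sums sums_unique by fast
 have der: "(G has_field_derivative (\<Sum>k. diffs a k * s ^ k)) (at s)" for s
  unfolding Geq by (rule termdiffs_strong_converges_everywhere) (use sums sums_summable in blast)
 show "G holomorphic_on UNIV"
  using der by (auto simp: holomorphic_on_def field_differentiable_def)
 have "deriv G 0 = (\<Sum>k. diffs a k * 0 ^ k)"
  using der[of 0] by (rule DERIV_imp_deriv)
 also have "... = diffs a 0" by (simp add: powser_zero)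
 also have "... = a 1" by (simp add: diffs_def)
 also have "... = - (LINT w|lborel. of_real \<bar>w\<bar> * f w)"
  by (simp add: a_def mult.commute)
 finally show "deriv G 0 = - (LINT w|lborel. of_real \<bar>w\<bar> * f w)" .
qed

lemma set_integrable_lborel_imp_absolutely_integrable:
 fixes f :: "real => real"
 assumes "set_integrable lborel S f"
 shows "f absolutely_integrable_on S" 
 using assms unfolding set_integrable_def
 by (subst integrable_completion) (auto dest: borel_measurable_integrable)

text \<open>The change of variables takes place for the completed measure; measurability of f on the
  image set leads back to Borel integrals.\<close>

lemma set_integral_substitution_real:
 fixes f g :: "real => real"
 assumes S: "S \<in> sets borel"
  and der: "\<And>x. x \<in> S ==> (g has_field_derivative g' x) (at x within S)"
  and inj: "inj_on g S"
  and meas: "set_borel_measurable borel (g ` S) f"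
  and int: "set_integrable lborel S (%x. \<bar>g' x\<bar> * f (g x))"
 shows "set_integrable lborel (g ` S) f"
  "(LINT x:g ` S|lborel. f x) = (LINT x:S|lborel. \<bar>g' x\<bar> * f (g x))"
proof -
 have Sl: "S \<in> sets lebesgue" using S by simp
 have "f absolutely_integrable_on (g ` S) \<and> integral (g ` S) f = integral S (%x. \<bar>g' x\<bar> * f (g x))"
  using has_absolute_integral_change_of_variables_1'[OF Sl der inj] 
   set_integrable_lborel_imp_absolutely_integrable[OF int] by blast
 moreover from this show "set_integrable lborel (g ` S) f"
  using meas unfolding set_integrable_def set_borel_measurable_def 
  by (subst (asm) integrable_completion) auto
 ultimately show "(LINT x:g ` S|lborel. f x) = (LINT x:S|lborel. \<bar>g' x\<bar> * f (g x))"
  using int by (simp add: set_borel_integral_eq_integral)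
qed

lemma set_integral_substitution_complex:
 fixes f :: "real => complex" and g :: "real => real"
 assumes S: "S \<in> sets borel"
  and der: "\<And>x. x \<in> S ==> (g has_field_derivative g' x) (at x within S)"
  and inj: "inj_on g S"
  and meas: "set_borel_measurable borel (g ` S) f"
  and int: "set_integrable lborel S (%x. of_real \<bar>g' x\<bar> * f (g x))"
 shows "set_integrable lborel (g ` S) f"
  "(LINT x:g ` S|lborel. f x) = (LINT x:S|lborel. of_real \<bar>g' x\<bar> * f (g x))"
proof -
 have mR: "set_borel_measurable borel (g ` S) (%x. Re (f x))"
  and mI: "set_borel_measurable borel (g ` S) (%x. Im (f x))"
  using borel_measurable_Re[THEN measurable_compose_rev, OF meas[unfolded set_borel_measurable_def]]
   borel_measurable_Im[THEN measurable_compose_rev, OF meas[unfolded set_borel_measurable_def]]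
  unfolding set_borel_measurable_def by simp_all
 have iR: "set_integrable lborel S (%x. \<bar>g' x\<bar> * Re (f (g x)))"
  and iI: "set_integrable lborel S (%x. \<bar>g' x\<bar> * Im (f (g x)))"
  using int unfolding set_integrable_def
  by (auto dest: integrable_Re integrable_Im)
 note R = set_integral_substitution_real[OF S der inj mR iR]
 note I = set_integral_substitution_real[OF S der inj mI iI]
 show i: "set_integrable lborel (g ` S) f"
 proof -
  have "integrable lborel (%x. of_real (indicator (g ` S) x *\<^sub>R Re (f x)) + \<i> * of_real (indicator (g ` S) x *\<^sub>R Im (f x)))"
   using R(1) I(1) unfolding set_integrable_def
   by (intro Bochner_Integration.integrable_add integrable_mult_right integrable_of_real) auto
  also have "(%x. of_real (indicator (g ` S) x *\<^sub>R Re (f x)) + \<i> * of_real (indicator (g ` S) x *\<^sub>R Im (f x))) =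
    (%x. indicator (g ` S) x *\<^sub>R f x)" by (auto simp: complex_eq_iff)
  finally show ?thesis unfolding set_integrable_def .
 qed
 show "(LINT x:g ` S|lborel. f x) = (LINT x:S|lborel. of_real \<bar>g' x\<bar> * f (g x))"
 proof (rule complex_eqI)
  show "Re (LINT x:g ` S|lborel. f x) = Re (LINT x:S|lborel. of_real \<bar>g' x\<bar> * f (g x))"
   using R(2) i int unfolding set_lebesgue_integral_def set_integrable_def
   by (simp flip: integral_Re)
  show "Im (LINT x:g ` S|lborel. f x) = Im (LINT x:S|lborel. of_real \<bar>g' x\<bar> * f (g x))"
   using I(2) i int unfolding set_lebesgue_integral_def set_integrable_def
   by (simp flip: integral_Im)
 qed
qed

text \<open>With t = exp w one has dt/t = dw, and both t^s on (0, 1] and t^(-s) on [1, infinity)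
  become exp(-s|w|), so the two pieces join to one integral over the line.\<close>

lemma split_integral_eq_exp_transform:
 fixes f :: "real => complex"
 assumes cont: "continuous_on {0<..} f"
  and int: "integrable lborel (%w. f (exp w) * exp (- s * of_real \<bar>w\<bar>))"
 shows "split_integral f s = (LINT w|lborel. f (exp w) * exp (- s * of_real \<bar>w\<bar>))"
proof -
 let ?h = "%w. f (exp w) * exp (- s * of_real \<bar>w\<bar>)"
 have im: "exp ` {..0::real} = {0<..1}" "exp ` {0::real..} = {1..}"
 proof -
  show "exp ` {..0::real} = {0<..1}"
   apply (auto simp: image_iff)
   by (metis exp_le_cancel_iff exp_ln exp_zero atMost_iff)
  show "exp ` {0::real..} = {1..}"
   apply (auto simp: image_iff)
   by (metis exp_ln exp_le_cancel_iff exp_zero less_le_trans zero_less_one atLeast_iff)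
 qed
 have pw: "of_real (exp w) powr z = exp (z * of_real w)" for w :: real and z :: complex
  by (simp add: powr_def Ln_of_real)
 have 1: "(LINT t:{0<..1}|lborel. f t * of_real t powr s / of_real t) = (LINT w:{..0}|lborel. ?h w)"
 proof -
  have eq: "of_real \<bar>exp w\<bar> * (f (exp w) * of_real (exp w) powr s / of_real (exp w)) = ?h w"
   if "w \<in> {..0}" for w
   using that by (simp add: pw)
  have "set_integrable lborel {..0} ?h"
   by (rule set_integrable_subset[of _ UNIV]) (use int in \<open>auto simp: set_integrable_def\<close>)
  then have i: "set_integrable lborel {..0} (%w. of_real \<bar>exp w\<bar> * (f (exp w) * of_real (exp w) powr s / of_real (exp w)))"
   using eq by (subst set_integrable_cong[OF refl]) auto
  let ?F = "%t. f t * of_real t powr s / of_real t"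
  have "(LINT t:exp ` {..0}|lborel. f t * of_real t powr s / of_real t) =
    (LINT w:{..0}|lborel. of_real \<bar>exp w\<bar> * (f (exp w) * of_real (exp w) powr s / of_real (exp w)))"
  proof (rule set_integral_substitution_complex(2)[where g=exp and g'=exp and f="?F", OF _ _ _ _ i])
   show "set_borel_measurable borel (exp ` {..0}) (%t. f t * of_real t powr s / of_real t)"
    unfolding im(1)
    by (intro set_measurable_continuous_on continuous_intros continuous_on_subset[OF cont]) auto
  qed (auto intro!: derivative_eq_intros simp: inj_on_def)
  also have "... = (LINT w:{..0}|lborel. ?h w)"
   using eq by (intro set_lebesgue_integral_cong) auto
  finally show ?thesis unfolding im .
 qed
 have 2: "(LINT t:{1..}|lborel. f t * of_real t powr (-s) / of_real t) = (LINT w:{0..}|lborel. ?h w)"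
 proof -
  have eq: "of_real \<bar>exp w\<bar> * (f (exp w) * of_real (exp w) powr (-s) / of_real (exp w)) = ?h w"
   if "w \<in> {0..}" for w
   using that by (simp add: pw)
  have "set_integrable lborel {0..} ?h"
   by (rule set_integrable_subset[of _ UNIV]) (use int in \<open>auto simp: set_integrable_def\<close>)
  then have i: "set_integrable lborel {0..} (%w. of_real \<bar>exp w\<bar> * (f (exp w) * of_real (exp w) powr (-s) / of_real (exp w)))"
   using eq by (subst set_integrable_cong[OF refl]) auto
  let ?F = "%t. f t * of_real t powr (-s) / of_real t"
  have "(LINT t:exp ` {0..}|lborel. f t * of_real t powr (-s) / of_real t) =
    (LINT w:{0..}|lborel. of_real \<bar>exp w\<bar> * (f (exp w) * of_real (exp w) powr (-s) / of_real (exp w)))"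
  proof (rule set_integral_substitution_complex(2)[where g=exp and g'=exp and f="?F", OF _ _ _ _ i])
   show "set_borel_measurable borel (exp ` {0..}) (%t. f t * of_real t powr (-s) / of_real t)"
    unfolding im(2)
    by (intro set_measurable_continuous_on continuous_intros continuous_on_subset[OF cont]) auto
  qed (auto intro!: derivative_eq_intros simp: inj_on_def)
  also have "... = (LINT w:{0..}|lborel. ?h w)"
   using eq by (intro set_lebesgue_integral_cong) auto
  finally show ?thesis unfolding im .
 qed
 have si: "set_integrable lborel A ?h" if "A \<in> sets borel" for A
  by (rule set_integrable_subset[of _ UNIV]) (use int that in \<open>auto simp: set_integrable_def\<close>)
 \<comment> \<open>The half-lines overlap in the point 0 only, a null set.\<close>
 have "(LINT w:{..0} \<union> {0..}|lborel. ?h w) = (LINT w:{..0}|lborel. ?h w) + (LINT w:{0..}|lborel. ?h w)"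
 proof (rule set_integral_Un_AE)
  show "AE x in lborel. \<not> (x \<in> {..0::real} \<and> x \<in> {0..})"
   using AE_lborel_singleton[of "0::real"] by eventually_elim auto
 qed (use si in auto)
 moreover have "{..0::real} \<union> {0..} = UNIV" by auto
 ultimately show ?thesis unfolding split_integral_def 1 2
  by (simp add: set_lebesgue_integral_def)
qed

section \<open>Poisson summation\<close>

lemma has_field_derivative_ee: "(ee has_field_derivative 2 * of_real pi * \<i> * ee z) (at z within A)"
 unfolding ee_def by (auto intro!: derivative_eq_intros)

lemma norm_ee: "norm (ee z) = exp (- 2 * pi * Im z)"
 by (simp add: ee_def)

lemma holomorphic_on_ee [holomorphic_intros]:
 "f holomorphic_on A ==> (%z. ee (f z)) holomorphic_on A"
 unfolding ee_def by (intro holomorphic_intros)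

lemma continuous_on_ee [continuous_intros]:
 "continuous_on A f ==> continuous_on A (%z. ee (f z))"
 unfolding ee_def by (intro continuous_intros)

lemma borel_measurable_ee [measurable]: "ee \<in> borel_measurable borel"
 by (intro borel_measurable_continuous_onI continuous_intros)

lemma ee_eq_1_imp_Ints: "ee z = 1 ==> \<exists>n::int. z = of_int n"
proof -
 assume "ee z = 1"
 then have 1: "Re (2 * of_real pi * \<i> * z) = 0" and 2: "\<exists>n::int. Im (2 * of_real pi * \<i> * z) = of_int (2 * n) * pi"
  unfolding ee_def exp_eq_1 by auto
 from 1 have "Im z = 0" by simp
 moreover from 2 obtain n :: int where "2 * pi * Re z = of_int (2 * n) * pi" by auto
 then have "Re z = of_int n" by simp
 ultimately show ?thesis by (intro exI[of _ n]) (simp add: complex_eq_iff)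
qed

text \<open>One integration by parts: the character is 1 at both ends of the interval, so the
  boundary term is (E 1 - E 0) divided by a multiple of k, and the remaining integral carries the
  same denominator.\<close>

lemma riemann_lebesgue_holomorphic:
 fixes E :: "complex => complex"
 assumes E: "E holomorphic_on S" and S: "open S" "of_real ` {0..1} \<subseteq> S"
 defines "e \<equiv> %k::int. integral {0..1} (%x. E (of_real x) * ee (- of_int k * of_real x))"
 shows "\<exists>C. \<forall>k. k ~= 0 --> norm (e k) <= C / \<bar>of_int k\<bar>"
proof -
 define E' where "E' = deriv E"
 have E'h: "E' holomorphic_on S" unfolding E'_def using E S(1) by (rule holomorphic_deriv)
 have mem: "of_real x \<in> S" if "x \<in> {0..1}" for x :: real using S(2) that by auto
 have contE: "continuous_on {0..1} (%x. E (of_real x))"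
  by (rule continuous_on_compose2[OF holomorphic_on_imp_continuous_on[OF E]]) (use mem in \<open>auto intro: continuous_intros\<close>)
 have contE': "continuous_on {0..1} (%x. E' (of_real x))"
  by (rule continuous_on_compose2[OF holomorphic_on_imp_continuous_on[OF E'h]]) (use mem in \<open>auto intro: continuous_intros\<close>)
 have "compact ((%x. E' (of_real x)) ` {0..1})"
  by (intro compact_continuous_image contE') auto
 then obtain B where B: "\<And>x. x \<in> {0..1} ==> norm (E' (of_real x)) <= B"
  using compact_imp_bounded bounded_iff by (metis (no_types, lifting) image_eqI)
 define C where "C = (norm (E 1) + norm (E 0) + B) / (2 * pi)"
 have "norm (e k) <= C / \<bar>of_int k\<bar>" if k: "k ~= 0" for k
 proof -
  define c :: complex where "c = - 2 * of_real pi * \<i> * of_int k"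
  have c0: "c ~= 0" using k by (simp add: c_def)
  have nc: "norm c = 2 * pi * \<bar>of_int k\<bar>" by (simp add: c_def norm_mult)
  have ek: "ee (- of_int k * of_real x) = exp (c * of_real x)" for x by (simp add: ee_def c_def mult_ac)
  have der: "((%x. E (of_real x) * (ee (- of_int k * of_real x) / c)) has_vector_derivative
    (E' (of_real x) * (ee (- of_int k * of_real x) / c) + E (of_real x) * ee (- of_int k * of_real x))) (at x within {0..1})"
   if "x \<in> {0..1}" for x :: real
  proof -
   have "(E has_field_derivative E' (of_real x)) (at (of_real x))"
    unfolding E'_def using holomorphic_derivI[OF E S(1) mem[OF that]] .
   then have "((%z. E z * (exp (c * z) / c)) has_field_derivative
     (E' (of_real x) * (exp (c * of_real x) / c) + E (of_real x) * exp (c * of_real x))) (at (of_real x))"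
    by (auto intro!: derivative_eq_intros simp: c0 field_simps)
   then show ?thesis unfolding ek
    by (rule has_vector_derivative_real_field)
  qed
  have "((%x. E' (of_real x) * (ee (- of_int k * of_real x) / c) + E (of_real x) * ee (- of_int k * of_real x))
    has_integral (E (of_real 1) * (ee (- of_int k * of_real 1) / c) - E (of_real 0) * (ee (- of_int k * of_real 0) / c))) {0..1}"
   by (rule fundamental_theorem_of_calculus) (use der in auto)
  moreover have "ee (- of_int k * of_real 1) = 1" "ee (- of_int k * of_real 0) = 1"
   unfolding ee_def by (auto simp: exp_eq_1 intro!: exI[of _ "-k"])
  ultimately have hi: "((%x. E' (of_real x) * (ee (- of_int k * of_real x) / c) + E (of_real x) * ee (- of_int k * of_real x))
    has_integral ((E 1 - E 0) / c)) {0..1}" by (simp add: diff_divide_distrib)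
  have i1: "(%x. E' (of_real x) * (ee (- of_int k * of_real x) / c)) integrable_on {0..1}"
   and i2: "(%x. E (of_real x) * ee (- of_int k * of_real x)) integrable_on {0..1}"
   by (intro integrable_continuous_interval continuous_intros contE contE' c0; simp add: c0)+
  have eq: "e k = (E 1 - E 0) / c - integral {0..1} (%x. E' (of_real x) * (ee (- of_int k * of_real x) / c))"
   using integral_unique[OF hi] integral_add[OF i1 i2] by (simp add: e_def)
  have ib: "norm (integral {0..1} (%x. E' (of_real x) * (ee (- of_int k * of_real x) / c))) <= (B / norm c) * (1 - 0)"
  proof (rule integral_bound)
   show "continuous_on {0..1} (%x. E' (of_real x) * (ee (- of_int k * of_real x) / c))"
    by (intro continuous_intros contE') (simp add: c0)
   show "norm (E' (of_real x) * (ee (- of_int k * of_real x) / c)) <= B / norm c" if "x \<in> {0..1}" for x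
    using B[OF that] by (simp add: norm_mult norm_divide norm_ee divide_right_mono)
  qed auto
  have "norm (e k) <= norm ((E 1 - E 0) / c) + norm (integral {0..1} (%x. E' (of_real x) * (ee (- of_int k * of_real x) / c)))"
   unfolding eq by (rule norm_triangle_ineq4)
  also have "... <= norm ((E 1 - E 0) / c) + B / norm c" using ib by simp
  also have "... <= (norm (E 1) + norm (E 0) + B) / norm c"
   by (simp add: norm_divide add_divide_distrib[symmetric] divide_right_mono norm_triangle_ineq4)
  also have "... = C / \<bar>of_int k\<bar>" by (simp add: nc C_def)
  finally show ?thesis .
 qed
 then show ?thesis by blast
qed

lemma filterlim_int_symmetric_interval:
 "filterlim (%n. {- int n..int n}) (finite_subsets_at_top UNIV) sequentially"
proof (rule filterlim_finite_subsets_at_top[THEN iffD2], intro allI impI, elim conjE)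
 fix X :: "int set" assume X: "finite X"
 define B where "B = Max (insert 0 (abs ` X))"
 have B: "abs x <= B" if "x \<in> X" for x
  unfolding B_def using X that by (intro Max_ge) auto
 show "\<forall>\<^sub>F n in sequentially. finite {- int n..int n} \<and> X \<subseteq> {- int n..int n} \<and> {- int n..int n} \<subseteq> UNIV"
  using eventually_gt_at_top[of "nat B"]
 proof eventually_elim
  case (elim n)
  then have "abs x <= int n" if "x \<in> X" for x using B[OF that] by linarith
  then show ?case by (fastforce simp: abs_le_iff)
 qed
qed

lemma filterlim_int_half_open_interval:
 "filterlim (%n. {- int n..<int n}) (finite_subsets_at_top UNIV) sequentially"
proof (rule filterlim_finite_subsets_at_top[THEN iffD2], intro allI impI, elim conjE)
 fix X :: "int set" assume X: "finite X"
 define B where "B = Max (insert 0 (abs ` X))"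
 have B: "abs x <= B" if "x \<in> X" for x
  unfolding B_def using X that by (intro Max_ge) auto
 show "\<forall>\<^sub>F n in sequentially. finite {- int n..<int n} \<and> X \<subseteq> {- int n..<int n} \<and> {- int n..<int n} \<subseteq> UNIV"
  using eventually_gt_at_top[of "nat B"]
 proof eventually_elim
  case (elim n)
  then have "abs x < int n" if "x \<in> X" for x using B[OF that] by linarith
  then show ?case by (fastforce simp: abs_less_iff)
 qed
qed

text \<open>With F the periodisation of g, the function E = (F - F 0) / (ee - 1) is holomorphic near
  [0, 1]. Since F = F 0 + E (ee - 1), the Fourier coefficients of F are differences of consecutive
  coefficients of E, apart from F 0 at k = 0. The symmetric partial sums telescope, and the two end
  terms tend to 0 by the Riemann-Lebesgue estimate, so the Fourier series converges to F 0 at the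
  point 0.\<close>

theorem poisson_summation_holomorphic:
 fixes g :: "complex => complex" and b :: "int => real"
 assumes hol: "g holomorphic_on UNIV"
  and bound: "\<And>m z. norm z <= 2 ==> norm (g (of_int m + z)) <= b m"
  and b: "b summable_on UNIV"
  and int: "integrable lborel (%x. g (of_real x))"
 shows "(%M. \<Sum>k\<in>{- int M..int M}. LINT x|lborel. g (of_real x) * ee (- of_int k * of_real x))
      \<longlonglongrightarrow> (\<Sum>\<^sub>\<infinity>m. g (of_int m))"
proof -
 define F where "F z = (\<Sum>\<^sub>\<infinity>m. g (of_int m + z))" for z
 have ulim: "uniform_limit (cball 0 2) (%X z. \<Sum>m\<in>X. g (of_int m + z)) F (finite_subsets_at_top UNIV)"
  unfolding F_def by (rule Weierstrass_m_test_general[OF _ b]) (use bound in auto)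
 have gh: "(%z. g (of_int m + z)) holomorphic_on A" for m A
  by (rule holomorphic_on_compose_gen[OF _ hol, unfolded o_def]) (auto intro!: holomorphic_intros)
 have Fhol: "F holomorphic_on ball 0 2"
 proof (rule holomorphic_uniform_limit[OF _ ulim])
  show "\<forall>\<^sub>F X in finite_subsets_at_top UNIV. continuous_on (cball 0 2) (%z. \<Sum>m\<in>X. g (of_int m + z)) \<and>
    (%z. \<Sum>m\<in>X. g (of_int m + z)) holomorphic_on ball 0 2"
   by (intro always_eventually allI conjI holomorphic_on_imp_continuous_on holomorphic_on_sum gh)
 qed auto
 have F1: "F 1 = F 0"
 proof -
  have "F 1 = (\<Sum>\<^sub>\<infinity>m. g (of_int ((%m. m + 1) m)))" unfolding F_def by simp
  also have "... = (\<Sum>\<^sub>\<infinity>m\<in>range (%m::int. m + 1). g (of_int m))"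
   by (subst infsum_reindex) (auto simp: inj_def o_def)
  also have "range (%m::int. m + 1) = UNIV" by (auto simp: image_iff)
  finally show ?thesis unfolding F_def by simp
 qed
 \<comment> \<open>A disc that contains [0, 1], has 0 and 1 as its only integers, and lies in the
   ball of radius 2 on which F is known to be holomorphic.\<close>
 define S where "S = ball (1/2 :: complex) 1"
 have SB: "S \<subseteq> ball 0 2"
 proof
  fix z assume "z \<in> S"
  then have "norm (1/2 - z) < 1" by (simp add: S_def dist_norm)
  moreover have "norm z <= norm (1/2 - z) + norm (1/2 :: complex)"
   using norm_triangle_ineq4[of "1/2" "1/2 - z"] by simp
  ultimately show "z \<in> ball 0 2" by simp
 qed
 have S01: "of_real ` {0..1} \<subseteq> S"
 proof
  fix z assume "z \<in> complex_of_real ` {0..1}"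
  then obtain x where x: "z = of_real x" "x \<in> {0..1}" by auto
  have "norm (1/2 - z) = \<bar>1/2 - x\<bar>" unfolding x(1) norm_of_real[symmetric, where 'a=complex] by simp
  then show "z \<in> S" using x(2) by (simp add: S_def dist_norm abs_if)
 qed
 have Sint: "n = 0 \<or> n = 1" if "of_int n \<in> S" for n :: int
 proof -
  have "norm (1/2 - of_int n :: complex) = \<bar>1/2 - of_int n\<bar>"
   unfolding norm_of_real[symmetric, where 'a=complex] by simp
  then have "\<bar>1/2 - of_int n :: real\<bar> < 1" using that by (simp add: S_def dist_norm)
  then show ?thesis by linarith
 qed
 define K where "K = {0, 1 :: complex}"
 have KS: "K \<subseteq> S" using S01 by (force simp: K_def)
 \<comment> \<open>The singularities at 0 and 1 are removable because F takes the value F 0 at both;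
   the values filled in are the quotients of the derivatives.\<close>
 define E where "E z = (if z \<in> K then deriv F z / (2 * of_real pi * \<i>) else (F z - F 0) / (ee z - 1))" for z
 have eeK: "ee p = 1" "F p = F 0" if "p \<in> K" for p
  using that F1 unfolding K_def ee_def by (auto simp: exp_eq_1)
 have nz: "ee z ~= 1" if "z \<in> S" "z \<notin> K" for z
 proof
  assume "ee z = 1"
  then obtain n where n: "z = of_int n" using ee_eq_1_imp_Ints by blast
  with Sint that have "n = 0 \<or> n = 1" by blast
  with n that show False by (auto simp: K_def)
 qed
 have Ehol: "E holomorphic_on S"
 proof (rule no_isolated_singularity')
  show "open S" "finite K" by (auto simp: S_def K_def)
  have "(%z. (F z - F 0) / (ee z - 1)) holomorphic_on S - K"
   using nz by (intro holomorphic_intros holomorphic_on_subset[OF Fhol]) (use SB in auto)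
  then show "E holomorphic_on S - K"
   by (rule holomorphic_transform) (auto simp: E_def)
  fix p assume p: "p \<in> K"
  have "(F has_field_derivative deriv F p) (at p)"
   using Fhol p KS SB by (intro holomorphic_derivI[OF Fhol]) auto
  then have a: "((%z. (F z - F p) / (z - p)) \<longlongrightarrow> deriv F p) (at p)"
   by (simp add: has_field_derivative_iff)
  have "(ee has_field_derivative 2 * of_real pi * \<i> * ee p) (at p)"
   by (rule has_field_derivative_ee)
  then have b: "((%z. (ee z - ee p) / (z - p)) \<longlongrightarrow> 2 * of_real pi * \<i> * ee p) (at p)"
   by (simp add: has_field_derivative_iff)
  have "((%z. ((F z - F p) / (z - p)) / ((ee z - ee p) / (z - p))) \<longlongrightarrow> deriv F p / (2 * of_real pi * \<i> * ee p)) (at p)"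
   by (rule tendsto_divide[OF a b]) (simp add: ee_def)
  then have lim: "((%z. ((F z - F p) / (z - p)) / ((ee z - ee p) / (z - p))) \<longlongrightarrow> E p) (at p within S)"
   using p eeK by (auto simp: E_def intro: tendsto_within_subset)
  have ev: "eventually (%z. z \<in> S - (K - {p})) (at p)"
   by (rule eventually_at_in_open') (use p KS in \<open>auto simp: S_def K_def intro!: open_Diff finite_imp_closed\<close>)
  have "eventually (%z. ((F z - F p) / (z - p)) / ((ee z - ee p) / (z - p)) = E z) (at p)"
   using ev eventually_neq_at_within[of p]
  proof eventually_elim
   case (elim z)
   then show ?case using eeK[OF p] by (auto simp: E_def)
  qed
  then have "eventually (%z. ((F z - F p) / (z - p)) / ((ee z - ee p) / (z - p)) = E z) (at p within S)"
   by (auto simp: eventually_at_filter elim: eventually_mono)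
  then show "(E \<longlongrightarrow> E p) (at p within S)"
   using lim by (rule Lim_transform_eventually[rotated])
 qed
 have Feq: "F z = F 0 + E z * (ee z - 1)" if "z \<in> S" for z
  using nz[OF that] eeK by (cases "z \<in> K") (auto simp: E_def)
 define e where "e k = integral {0..1} (%x. E (of_real x) * ee (- of_int k * of_real x))" for k :: int
 define c where "c k = integral {0..1} (%x. F (of_real x) * ee (- of_int k * of_real x))" for k :: int
 have mem: "of_real x \<in> S" if "x \<in> {0..1}" for x :: real using S01 that by auto
 have contE: "continuous_on {0..1} (%x. E (of_real x))"
  by (rule continuous_on_compose2[OF holomorphic_on_imp_continuous_on[OF Ehol]]) (use mem in \<open>auto intro: continuous_intros\<close>)
 have intE: "(%x. E (of_real x) * ee (- of_int k * of_real x)) integrable_on {0..1}" for k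
  by (intro integrable_continuous_interval continuous_intros contE)
 have int_ee: "integral {0..1} (%x. ee (- of_int k * of_real x)) = (if k = 0 then 1 else 0)" for k
 proof (cases "k = 0")
  case True then show ?thesis by (simp add: ee_def)
 next
  case False
  define c :: complex where "c = - 2 * of_real pi * \<i> * of_int k"
  have c0: "c ~= 0" using False by (simp add: c_def)
  have ek: "ee (- of_int k * of_real x) = exp (c * of_real x)" for x by (simp add: ee_def c_def mult_ac)
  have "((%x. exp (c * of_real x) / c) has_vector_derivative exp (c * of_real x)) (at x within {0..1})" for x
   by (rule has_vector_derivative_real_field) (use c0 in \<open>auto intro!: derivative_eq_intros\<close>)
  then have "((%x. exp (c * of_real x)) has_integral (exp (c * of_real 1) / c - exp (c * of_real 0) / c)) {0..1}"
   by (intro fundamental_theorem_of_calculus) auto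
  moreover have "exp (c * of_real 1) = 1" unfolding c_def by (auto simp: exp_eq_1 intro!: exI[of _ "-k"])
  ultimately show ?thesis using False unfolding ek by (simp add: integral_unique)
 qed
 \<comment> \<open>Multiplication of E by ee(x) lowers the index of the coefficient by one.\<close>
 have c_eq: "c k = (if k = 0 then F 0 else 0) + e (k - 1) - e k" for k
 proof -
  have "c k = integral {0..1} (%x. F 0 * ee (- of_int k * of_real x) + (E (of_real x) * ee (- of_int (k - 1) * of_real x)
     - E (of_real x) * ee (- of_int k * of_real x)))"
   unfolding c_def
  proof (rule Henstock_Kurzweil_Integration.integral_cong)
   fix x :: real assume "x \<in> {0..1}"
   then have A: "F (of_real x) = F 0 + E (of_real x) * (ee (of_real x) - 1)" using Feq mem by blast
   have B: "ee (- of_int (k - 1) * of_real x) = ee (of_real x) * ee (- of_int k * of_real x)"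
    by (simp add: ee_def exp_add[symmetric] algebra_simps)
   show "F (of_real x) * ee (- of_int k * of_real x) = F 0 * ee (- of_int k * of_real x) +
    (E (of_real x) * ee (- of_int (k - 1) * of_real x) - E (of_real x) * ee (- of_int k * of_real x))"
    unfolding A B by (simp add: algebra_simps)
  qed
  also have "... = integral {0..1} (%x. F 0 * ee (- of_int k * of_real x)) + (e (k - 1) - e k)"
   unfolding e_def
   using Henstock_Kurzweil_Integration.integral_add[OF integrable_continuous_interval integrable_diff[OF intE[of "k - 1"] intE[of k]],
     of "%x. F 0 * ee (- of_int k * of_real x)"] Henstock_Kurzweil_Integration.integral_diff[OF intE[of "k - 1"] intE[of k]]
   by (simp add: continuous_intros)
  also have "integral {0..1} (%x. F 0 * ee (- of_int k * of_real x)) = (if k = 0 then F 0 else 0)"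
   using int_ee[of k] by simp
  finally show ?thesis by simp
 qed
 have sum_c: "(\<Sum>k\<in>{- int M..int M}. c k) = F 0 + e (- int M - 1) - e (int M)" for M
 proof (induction M)
  case 0 then show ?case by (simp add: c_eq)
 next
  case (Suc M)
  have "{- int (Suc M)..int (Suc M)} = insert (- int (Suc M)) (insert (int (Suc M)) {- int M..int M})" by auto
  then have step: "(\<Sum>k\<in>{- int (Suc M)..int (Suc M)}. c k) = c (- int (Suc M)) + (c (int (Suc M)) + (\<Sum>k\<in>{- int M..int M}. c k))"
   by simp
  have c1: "c (- int (Suc M)) = e (- int (Suc M) - 1) - e (- 1 - int M)"
   and c2: "c (int (Suc M)) = e (int M) - e (int (Suc M))"
   using c_eq[of "- int (Suc M)"] c_eq[of "int (Suc M)"] by (simp_all add: algebra_simps)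
  have eq: "e (- 1 - int M) = e (- int M - 1)" by (rule arg_cong[where f=e]) simp
  show ?case unfolding step Suc.IH c1 c2 eq by simp
 qed
 obtain C where C: "\<And>k. k ~= 0 ==> norm (e k) <= C / \<bar>of_int k\<bar>"
  using riemann_lebesgue_holomorphic[OF Ehol _ S01] unfolding e_def S_def by auto
 have C0: "(%M. C / real M) \<longlonglongrightarrow> 0" by (rule lim_const_over_n)
 have e1: "(%M. e (int M)) \<longlonglongrightarrow> 0"
 proof (rule Lim_null_comparison[OF _ C0])
  show "\<forall>\<^sub>F M in sequentially. norm (e (int M)) <= C / real M"
   using eventually_gt_at_top[of 0] by eventually_elim (use C[of "int _"] in force)
 qed
 have e2: "(%M. e (- int M - 1)) \<longlonglongrightarrow> 0"
 proof -
  have "(%M. e (- int M)) \<longlonglongrightarrow> 0"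
  proof (rule Lim_null_comparison[OF _ C0])
   show "\<forall>\<^sub>F M in sequentially. norm (e (- int M)) <= C / real M"
    using eventually_gt_at_top[of 0] by eventually_elim (use C[of "- int _"] in force)
  qed
  moreover have "e (- int (Suc M)) = e (- int M - 1)" for M by (rule arg_cong[where f=e]) simp
  ultimately show ?thesis using LIMSEQ_Suc[of "%M. e (- int M)" 0] by (simp only:)
 qed
 have lim: "(%M. \<Sum>k\<in>{- int M..int M}. c k) \<longlonglongrightarrow> F 0"
  unfolding sum_c using tendsto_diff[OF tendsto_add[OF tendsto_const[of "F 0"] e2] e1] by simp
 \<comment> \<open>Unfolding: the integral of the periodisation over [0, 1] is the integral of g
   over the whole line, taken as a limit over the intervals [-n, n]. Half-open integer windows
   {-n..<n} are used because the corresponding unit intervals tile exactly [-n, n].\<close>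
 have ck: "c k = (LINT x|lborel. g (of_real x) * ee (- of_int k * of_real x))" for k
 proof -
  define G where "G x = g (of_real x) * ee (- of_int k * of_real x)" for x :: real
  have contG: "continuous_on A G" for A
   unfolding G_def
   using continuous_on_compose2[OF holomorphic_on_imp_continuous_on[OF hol], of A of_real]
   by (auto intro!: continuous_intros)
  have intG: "integrable lborel G"
   by (rule integrable_dominated[OF int])
     (use contG in \<open>auto simp: G_def norm_mult norm_ee intro!: borel_measurable_continuous_onI\<close>)
  note fl = filterlim_int_half_open_interval
  have ul: "uniform_limit {0..1} (%n x. (\<Sum>m\<in>{- int n..<int n}. g (of_int m + of_real x)) * ee (- of_int k * of_real x))
    (%x. F (of_real x) * ee (- of_int k * of_real x)) sequentially"
  proof -
   have "uniform_limit (cball 0 2) (%n z. \<Sum>m\<in>{- int n..<int n}. g (of_int m + z)) F sequentially"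
    using ulim fl by (rule filterlim_compose)
   note ul2 = uniform_limitD[OF this]
   show ?thesis
   proof (rule uniform_limitI)
    fix \<epsilon> :: real assume "\<epsilon> > 0"
    from ul2[OF this] show "\<forall>\<^sub>F n in sequentially. \<forall>x\<in>{0..1}.
     dist ((\<Sum>m\<in>{- int n..<int n}. g (of_int m + of_real x)) * ee (- of_int k * of_real x))
      (F (of_real x) * ee (- of_int k * of_real x)) < \<epsilon>"
     by eventually_elim (auto simp: dist_norm left_diff_distrib[symmetric] norm_mult norm_ee)
   qed
  qed
  obtain I J where IJ: "\<And>n. ((%x. (\<Sum>m\<in>{- int n..<int n}. g (of_int m + of_real x)) * ee (- of_int k * of_real x)) has_integral I n) {0..1}"
   "((%x. F (of_real x) * ee (- of_int k * of_real x)) has_integral J) {0..1}" "I \<longlonglongrightarrow> J"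
  proof (rule uniform_limit_integral[OF ul])
   fix n
   show "continuous_on {0..1} (%x. (\<Sum>m\<in>{- int n..<int n}. g (of_int m + of_real x)) * ee (- of_int k * of_real x))"
    by (intro continuous_intros continuous_on_compose2[OF holomorphic_on_imp_continuous_on[OF hol]]) auto
  qed auto
  have "J = c k" using IJ(2) by (simp add: c_def integral_unique)
  \<comment> \<open>Integer translation does not change the character, so each summand of the
    periodisation is a translate of the same integrand G.\<close>
  have shift: "ee (- of_int k * of_real x) = ee (- of_int k * of_real (of_int m + x))" for x and m :: int
   unfolding ee_def exp_eq by (auto intro!: exI[of _ "k * m"] simp: algebra_simps)
  have In: "I n = integral {- real n..real n} G" for n
  proof -
   have piece: "((%x. g (of_int m + of_real x) * ee (- of_int k * of_real x)) has_integral (integral {of_int m..of_int m + 1} G)) {0..1}" for m :: int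
   proof -
    have "(G has_integral (integral {of_int m..of_int m + 1} G)) (cbox (of_int m) (of_int m + 1))"
     using integrable_integral[OF integrable_continuous_interval[OF contG]] by simp
    from has_integral_affinity[OF this, of 1 "of_int m"] 
    have "((%x. G (x + of_int m)) has_integral (integral {of_int m..of_int m + 1} G)) {0..1}"
     by (simp add: image_affinity_atLeastAtMost_diff algebra_simps)
    moreover have "G (x + of_int m) = g (of_int m + of_real x) * ee (- of_int k * of_real x)" for x
     unfolding G_def by (subst shift[of x m]) (simp add: add.commute)
    ultimately show ?thesis by (simp only:)
   qed
   have "((%x. (\<Sum>m\<in>{- int n..<int n}. g (of_int m + of_real x) * ee (- of_int k * of_real x)))
     has_integral (\<Sum>m\<in>{- int n..<int n}. integral {of_int m..of_int m + 1} G)) {0..1}"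
    by (intro has_integral_sum piece) auto
   then have "I n = (\<Sum>m\<in>{- int n..<int n}. integral {of_int m..of_int m + 1} G)"
    using IJ(1)[of n] by (simp add: sum_distrib_right has_integral_unique)
   also have "... = integral {- real n..real n} G"
   proof (induction n)
    case (Suc n)
    have st: "{- int (Suc n)..<int (Suc n)} = insert (- int n - 1) (insert (int n) {- int n..<int n})" by auto
    have i: "G integrable_on {a..b}" for a b by (rule integrable_continuous_interval[OF contG])
    have "integral {- real (Suc n)..real (Suc n)} G = integral {- real (Suc n)..- real n} G + integral {- real n..real (Suc n)} G"
     by (rule Henstock_Kurzweil_Integration.integral_combine[symmetric]) (use i in auto)
    also have "integral {- real n..real (Suc n)} G = integral {- real n..real n} G + integral {real n..real (Suc n)} G"
     by (rule Henstock_Kurzweil_Integration.integral_combine[symmetric]) (use i in auto)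
    finally have fin: "integral {- real (Suc n)..real (Suc n)} G = integral {- real (Suc n)..- real n} G +
      (integral {- real n..real n} G + integral {real n..real (Suc n)} G)" .
    have e1: "integral {of_int (- int n - 1)..of_int (- int n - 1) + 1} G = integral {- real (Suc n)..- real n} G"
     by (rule arg_cong[where f="%A. integral A G"]) simp
    have e2: "integral {of_int (int n)..of_int (int n) + 1} G = integral {real n..real (Suc n)} G"
     by (rule arg_cong[where f="%A. integral A G"]) simp
    have "(\<Sum>m\<in>{- int (Suc n)..<int (Suc n)}. integral {of_int m..of_int m + 1} G) =
     integral {of_int (- int n - 1)..of_int (- int n - 1) + 1} G + (integral {of_int (int n)..of_int (int n) + 1} G +
      (\<Sum>m\<in>{- int n..<int n}. integral {of_int m..of_int m + 1} G))"
     unfolding st by (subst sum.insert, simp, simp, subst sum.insert) auto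
    then show ?case unfolding fin e1 e2 Suc.IH by simp
   qed simp
   finally show ?thesis .
  qed
  have si: "set_integrable lborel A G" if "A \<in> sets borel" for A
   by (rule set_integrable_subset[of _ UNIV]) (use intG that in \<open>auto simp: set_integrable_def\<close>)
  have "(%n. LINT x|lborel. indicator {- real n..real n} x *\<^sub>R G x) \<longlonglongrightarrow> (LINT x|lborel. G x)"
  proof (rule integral_dominated_convergence[where w="%x. norm (G x)"])
   show "AE x in lborel. (%n. indicator {- real n..real n} x *\<^sub>R G x) \<longlonglongrightarrow> G x"
   proof (rule AE_I2)
    fix x :: real
    have "\<forall>\<^sub>F n in sequentially. indicator {- real n..real n} x *\<^sub>R G x = G x"
     using eventually_gt_at_top[of "nat \<lceil>\<bar>x\<bar>\<rceil>"]
    proof eventually_elim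
     case (elim n)
     then have "abs x <= real n" by linarith
     then show ?case by (auto simp: indicator_def)
    qed
    then show "(%n. indicator {- real n..real n} x *\<^sub>R G x) \<longlonglongrightarrow> G x"
     by (rule tendsto_eventually)
   qed
  qed (use intG in \<open>auto intro!: integrable_norm simp: indicator_def\<close>)
  moreover have "(LINT x|lborel. indicator {- real n..real n} x *\<^sub>R G x) = I n" for n
   using set_borel_integral_eq_integral(2)[OF si, of "{- real n..real n}"] In[of n]
   by (simp add: set_lebesgue_integral_def)
  ultimately have "I \<longlonglongrightarrow> (LINT x|lborel. G x)" by simp
  with IJ(3) have "J = (LINT x|lborel. G x)" using LIMSEQ_unique by blast
  with \<open>J = c k\<close> show ?thesis by (simp add: G_def)
 qed
 show ?thesis using lim unfolding ck by (simp add: F_def)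
qed

lemma summable_on_exp_abs_int:
 fixes d :: real
 assumes "d > 0"
 shows "(%m::int. exp (- d * \<bar>of_int m\<bar>)) summable_on UNIV"
proof -
 have geo: "(%n::nat. exp (- d * real n)) summable_on UNIV"
 proof (rule norm_summable_imp_summable_on)
  have "summable (%n. exp (- d) ^ n)" using assms by (intro summable_geometric) auto
  then show "summable (%n. norm (exp (- d * real n)))"
   by (simp add: exp_of_nat_mult[symmetric] mult.commute)
 qed
 have 1: "(%m::int. exp (- d * \<bar>of_int m\<bar>)) summable_on range int"
  by (subst summable_on_reindex) (use geo in \<open>auto simp: o_def inj_on_def\<close>)
 have 2: "(%m::int. exp (- d * \<bar>of_int m\<bar>)) summable_on range (%n. - int n)"
  by (subst summable_on_reindex) (use geo in \<open>auto simp: o_def inj_on_def\<close>)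
 have "range int \<union> range (%n. - int n) = UNIV"
  by (auto simp: image_iff) (metis int_cases2)
 then show ?thesis using summable_on_union[OF 1 2] by simp
qed

lemma integrable_power_gauss:
 fixes a :: real
 assumes "a > 0"
 shows "integrable lborel (%x. x ^ k * exp (- a * x^2))"
proof -
 define s where "s = sqrt (2 * a)"
 have s: "s > 0" "s\<^sup>2 = 2 * a" using assms by (auto simp: s_def)
 have "integrable lborel (%x. std_normal_density (0 + s * x) * (0 + s * x) ^ k)"
  by (rule lborel_integrable_real_affine[OF integrable_std_normal_moment]) (use s in auto)
 then have "integrable lborel (%x. (sqrt (2 * pi) / s ^ k) * (std_normal_density (0 + s * x) * (0 + s * x) ^ k))"
  by (rule integrable_mult_right)
 also have "(%x. (sqrt (2 * pi) / s ^ k) * (std_normal_density (0 + s * x) * (0 + s * x) ^ k)) = (%x. x ^ k * exp (- a * x^2))"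
  using s by (auto simp: std_normal_density_def power_mult_distrib field_simps)
 finally show ?thesis .
qed

text \<open>Scaling by s = sqrt(2 pi alpha) turns the Gaussian into the standard normal density,
  whose characteristic function is known.\<close>

lemma fourier_gauss:
 fixes \<alpha> \<eta> :: real
 assumes "\<alpha> > 0"
 shows "(LINT x|lborel. of_real (exp (- pi * \<alpha> * x^2)) * ee (- of_real (\<eta> * x))) = of_real (exp (- pi * \<eta>^2 / \<alpha>) / sqrt \<alpha>)"
proof -
 define s where "s = sqrt (2 * pi * \<alpha>)"
 have s: "s > 0" "s\<^sup>2 = 2 * pi * \<alpha>" using assms by (auto simp: s_def)
 define t where "t = - 2 * pi * \<eta> / s"
 have "complex_of_real (exp (- (t^2) / 2)) = char std_normal_distribution t"
  by (simp add: char_std_normal_distribution)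
 also have "... = (LINT x|lborel. std_normal_density x *\<^sub>R iexp (t * x))"
  unfolding char_def by (subst integral_density) auto
 also have "... = abs s *\<^sub>R (LINT x|lborel. std_normal_density (0 + s * x) *\<^sub>R iexp (t * (0 + s * x)))"
  by (rule lborel_integral_real_affine) (use s in auto)
 also have "(%x. std_normal_density (0 + s * x) *\<^sub>R iexp (t * (0 + s * x))) =
   (%x. of_real (1 / sqrt (2 * pi)) * (of_real (exp (- pi * \<alpha> * x^2)) * ee (- of_real (\<eta> * x))))"
 proof
  fix x
  have "(s * x)\<^sup>2 / 2 = pi * \<alpha> * x^2" using s by (simp add: power_mult_distrib)
  then have A: "std_normal_density (0 + s * x) = 1 / sqrt (2 * pi) * exp (- pi * \<alpha> * x^2)"
   by (simp add: std_normal_density_def)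
  have "t * (0 + s * x) = - 2 * pi * \<eta> * x" using s by (simp add: t_def)
  then have B: "iexp (t * (0 + s * x)) = ee (- of_real (\<eta> * x))"
   unfolding ee_def by (simp only:) (rule arg_cong[where f=exp], simp)
  show "std_normal_density (0 + s * x) *\<^sub>R iexp (t * (0 + s * x)) =
    of_real (1 / sqrt (2 * pi)) * (of_real (exp (- pi * \<alpha> * x^2)) * ee (- of_real (\<eta> * x)))"
   unfolding A B by (simp only: scaleR_conv_of_real of_real_mult mult.assoc)
 qed
 also have "abs s *\<^sub>R (LINT x|lborel. of_real (1 / sqrt (2 * pi)) * (of_real (exp (- pi * \<alpha> * x^2)) * ee (- of_real (\<eta> * x)))) =
   of_real (sqrt \<alpha>) * (LINT x|lborel. of_real (exp (- pi * \<alpha> * x^2)) * ee (- of_real (\<eta> * x)))"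
 proof -
  have "abs s * (1 / sqrt (2 * pi)) = sqrt \<alpha>" using s assms by (simp add: s_def real_sqrt_mult)
  then have "complex_of_real \<bar>s\<bar> * of_real (1 / sqrt (2 * pi)) = of_real (sqrt \<alpha>)" by (metis of_real_mult)
  then show ?thesis unfolding integral_mult_right_zero scaleR_conv_of_real
   by (subst mult.assoc[symmetric]) (simp only:)
 qed
 finally have "of_real (sqrt \<alpha>) * (LINT x|lborel. of_real (exp (- pi * \<alpha> * x^2)) * ee (- of_real (\<eta> * x))) = complex_of_real (exp (- (t^2) / 2))" by simp
 moreover have "- (t^2) / 2 = - pi * \<eta>^2 / \<alpha>"
 proof -
  have "t\<^sup>2 = (2 * pi * \<eta>)\<^sup>2 / (2 * pi * \<alpha>)" using s by (simp add: t_def power_divide)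
  also have "... = 2 * (pi * \<eta>^2 / \<alpha>)" using assms by (simp add: power2_eq_square)
  finally show ?thesis by simp
 qed
 moreover have "complex_of_real (sqrt \<alpha>) ~= 0" using assms by simp
 ultimately show ?thesis by (simp add: nonzero_eq_divide_eq mult.commute)
qed

lemma integrable_gauss_ee:
 fixes \<alpha> \<eta> :: real
 assumes "\<alpha> > 0"
 shows "integrable lborel (%x. of_real (x ^ k * exp (- pi * \<alpha> * x^2)) * ee (- of_real (\<eta> * x)))"
proof -
 have "integrable lborel (%x. x ^ k * exp (- (pi * \<alpha>) * x^2))"
  using assms by (intro integrable_power_gauss) auto
 then show ?thesis
  by (rule integrable_dominated) (auto simp: norm_mult norm_power norm_ee abs_mult power_abs)
qed

text \<open>The derivative of G is a combination of x G and G, and its integral over the line is 0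
  because G vanishes at both ends. This expresses the first moment through the transform of the
  Gaussian itself.\<close>

lemma fourier_gauss_linear:
 fixes \<alpha> \<eta> :: real and p q :: complex
 assumes "\<alpha> > 0"
 shows "(LINT x|lborel. (p + q * of_real x) * (of_real (exp (- pi * \<alpha> * x^2)) * ee (- of_real (\<eta> * x))))
   = (p - \<i> * q * of_real (\<eta> / \<alpha>)) * of_real (exp (- pi * \<eta>^2 / \<alpha>) / sqrt \<alpha>)"
proof -
 define G where "G x = of_real (exp (- pi * \<alpha> * x^2)) * ee (- of_real (\<eta> * x))" for x
 have i0: "integrable lborel G" using integrable_gauss_ee[OF assms, of 0 \<eta>] unfolding G_def by simp
 have i1: "integrable lborel (%x. of_real x * G x)" using integrable_gauss_ee[OF assms, of 1 \<eta>] unfolding G_def by (simp add: mult.assoc)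
 define c d where "c = complex_of_real (- 2 * pi * \<alpha>)" and "d = complex_of_real (- 2 * pi * \<eta>) * \<i>"
 have der: "(G has_vector_derivative (c * (of_real x * G x) + d * G x)) (at x)" for x
 proof -
  have G: "G = (%x. exp (- of_real (pi * \<alpha>) * (of_real x)\<^sup>2 - 2 * of_real pi * \<i> * of_real \<eta> * of_real x))"
   unfolding G_def ee_def exp_of_real[symmetric] exp_add[symmetric]
   by (intro ext arg_cong[where f=exp]) simp
  show ?thesis unfolding G c_def d_def
   by (rule has_vector_derivative_real_field) (auto intro!: derivative_eq_intros simp: algebra_simps)
 qed
 have cont: "continuous_on A (%x. c * (of_real x * G x) + d * G x)" for A
  unfolding G_def by (intro continuous_intros)
 have int: "integrable lborel (%x. c * (of_real x * G x) + d * G x)" using i0 i1 by simp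
 have lim: "(G \<longlongrightarrow> 0) at_top" "(G \<longlongrightarrow> 0) at_bot"
 proof -
  have n: "norm (G x) = exp (- pi * \<alpha> * x^2)" for x by (simp add: G_def norm_mult norm_ee)
  have "((%x. exp (- pi * \<alpha> * x^2)) \<longlongrightarrow> 0) at_top" "((%x. exp (- pi * \<alpha> * x^2)) \<longlongrightarrow> 0) at_bot"
   using assms by real_asymp+
  then show "(G \<longlongrightarrow> 0) at_top" "(G \<longlongrightarrow> 0) at_bot"
   unfolding n[symmetric] by (simp_all add: tendsto_norm_zero_iff)
 qed
 have "(LBINT x=-\<infinity>..\<infinity>. c * (of_real x * G x) + d * G x) = 0 - 0"
 proof (rule interval_integral_FTC_integrable)
  show "isCont (%x. c * (of_real x * G x) + d * G x) x" for x
   using cont[of UNIV] by (simp add: continuous_on_eq_continuous_at)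
  show "set_integrable lborel (einterval (- \<infinity>) \<infinity>) (%x. c * (of_real x * G x) + d * G x)"
   using int by (simp add: set_integrable_def einterval_def)
 qed (use der lim in \<open>auto simp: ereal_tendsto_simps\<close>)
 then have "(LINT x|lborel. c * (of_real x * G x) + d * G x) = 0"
  by (simp add: interval_lebesgue_integral_def set_lebesgue_integral_def einterval_def)
 then have "c * (LINT x|lborel. of_real x * G x) + d * (LINT x|lborel. G x) = 0"
  using i0 i1 by simp
 then have "(LINT x|lborel. of_real x * G x) = - (d / c) * (LINT x|lborel. G x)"
  using assms by (simp add: c_def field_simps eq_neg_iff_add_eq_0)
 moreover have "d / c = \<i> * of_real (\<eta> / \<alpha>)" using assms by (simp add: c_def d_def field_simps)
 moreover have "(LINT x|lborel. (p + q * of_real x) * G x) = p * (LINT x|lborel. G x) + q * (LINT x|lborel. of_real x * G x)"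
  using i0 i1 by (simp add: distrib_right mult.assoc)
 ultimately have "(LINT x|lborel. (p + q * of_real x) * G x) = (p - \<i> * q * of_real (\<eta> / \<alpha>)) * (LINT x|lborel. G x)"
  by (simp add: algebra_simps)
 then show ?thesis unfolding G_def fourier_gauss[OF assms] .
qed

text \<open>In a horizontal strip the imaginary part costs only a constant. The Gaussian is bounded
  by exp(-2|Re w|), of which one factor exp(-|Re w|) pays for the linear polynomial.\<close>

lemma gauss_strip_bound:
 fixes \<alpha> b C :: real and p q :: complex
 assumes "\<alpha> > 0" "C >= 0"
 shows "\<exists>K\<ge>0. \<forall>w. \<bar>Im w\<bar> <= C -->
   norm ((p + q * w) * (exp (- of_real (pi * \<alpha>) * w^2) * ee (- (of_real b * w)))) <= K * exp (- \<bar>Re w\<bar>)"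
proof (intro exI conjI allI impI)
 define K where "K = (norm p + norm q * (1 + C)) * (exp (1 / (pi * \<alpha>)) * exp (pi * \<alpha> * C\<^sup>2) * exp (2 * pi * abs b * C))"
 show "K >= 0" unfolding K_def using assms by simp
 fix w assume w: "\<bar>Im w\<bar> <= C"
 have "norm w <= \<bar>Re w\<bar> + C" using cmod_le[of w] w by linarith
 then have "norm (p + q * w) <= norm p + norm q * (\<bar>Re w\<bar> + C)"
  by (intro norm_triangle_le add_mono) (auto simp: norm_mult intro!: mult_left_mono)
 also have "... <= (norm p + norm q * (1 + C)) * exp \<bar>Re w\<bar>"
 proof -
  have e: "1 <= exp \<bar>Re w\<bar>" "\<bar>Re w\<bar> <= exp \<bar>Re w\<bar>" using exp_ge_add_one_self[of "\<bar>Re w\<bar>"] abs_ge_zero[of "Re w"] by linarith+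
  then have "\<bar>Re w\<bar> + C <= (1 + C) * exp \<bar>Re w\<bar>" using assms(2) mult_left_mono[OF e(1) assms(2)] by (simp add: algebra_simps)
  then have "norm q * (\<bar>Re w\<bar> + C) <= norm q * ((1 + C) * exp \<bar>Re w\<bar>)" by (rule mult_left_mono) simp
  moreover have "norm p <= norm p * exp \<bar>Re w\<bar>" using e(1) by (simp add: mult_le_cancel_left1)
  ultimately show ?thesis by (simp add: algebra_simps)
 qed
 finally have 1: "norm (p + q * w) <= (norm p + norm q * (1 + C)) * exp \<bar>Re w\<bar>" .
 have "norm (exp (- of_real (pi * \<alpha>) * w^2)) = exp (- (pi * \<alpha>) * ((Re w)\<^sup>2 - (Im w)\<^sup>2))"
  by (simp add: norm_exp_eq_Re power2_eq_square)
 also have "... <= exp (1 / (pi * \<alpha>) - 2 * \<bar>Re w\<bar> + pi * \<alpha> * C\<^sup>2)"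
 proof -
  \<comment> \<open>Completing the square at |Re w| = 1/(pi alpha) trades the quadratic exponent for
    -2|Re w| at the price of the constant 1/(pi alpha).\<close>
  have "0 <= pi * \<alpha> * (\<bar>Re w\<bar> - 1 / (pi * \<alpha>))\<^sup>2" using assms by simp
  also have "... = pi * \<alpha> * (Re w)\<^sup>2 - 2 * \<bar>Re w\<bar> + 1 / (pi * \<alpha>)"
   using assms by (simp add: power2_diff field_simps power2_eq_square)
  finally have "- (pi * \<alpha>) * (Re w)\<^sup>2 <= 1 / (pi * \<alpha>) - 2 * \<bar>Re w\<bar>" by simp
  moreover have "(Im w)\<^sup>2 <= C\<^sup>2" using w by (simp add: abs_le_square_iff[symmetric])
  then have "pi * \<alpha> * (Im w)\<^sup>2 <= pi * \<alpha> * C\<^sup>2" using assms by simp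
  moreover have "- (pi * \<alpha>) * ((Re w)\<^sup>2 - (Im w)\<^sup>2) = - (pi * \<alpha>) * (Re w)\<^sup>2 + pi * \<alpha> * (Im w)\<^sup>2"
   by (simp add: algebra_simps)
  ultimately show ?thesis unfolding exp_le_cancel_iff by linarith
 qed
 finally have 2: "norm (exp (- of_real (pi * \<alpha>) * w^2)) <= exp (1 / (pi * \<alpha>) - 2 * \<bar>Re w\<bar> + pi * \<alpha> * C\<^sup>2)" .
 have 3: "norm (ee (- (of_real b * w))) <= exp (2 * pi * abs b * C)"
 proof -
  have "b * Im w <= \<bar>b * Im w\<bar>" by simp
  also have "... <= abs b * C" unfolding abs_mult by (rule mult_left_mono[OF w]) simp
  finally have "pi * (b * Im w) <= pi * (abs b * C)" by simp
  then show ?thesis by (simp add: norm_ee mult_ac)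
 qed
 have "norm ((p + q * w) * (exp (- of_real (pi * \<alpha>) * w^2) * ee (- (of_real b * w)))) <=
  ((norm p + norm q * (1 + C)) * exp \<bar>Re w\<bar>) * (exp (1 / (pi * \<alpha>) - 2 * \<bar>Re w\<bar> + pi * \<alpha> * C\<^sup>2) * exp (2 * pi * abs b * C))"
  unfolding norm_mult by (intro mult_mono 1 2 3) (use assms in auto)
 also have "... = K * (exp \<bar>Re w\<bar> * exp (- 2 * \<bar>Re w\<bar>))"
 proof -
  have "1 / (pi * \<alpha>) - 2 * \<bar>Re w\<bar> + pi * \<alpha> * C\<^sup>2 = 1 / (pi * \<alpha>) + (- 2 * \<bar>Re w\<bar> + pi * \<alpha> * C\<^sup>2)" by simp
  then show ?thesis unfolding K_def by (simp only: exp_add mult_ac)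
 qed
 also have "exp \<bar>Re w\<bar> * exp (- 2 * \<bar>Re w\<bar>) = exp (- \<bar>Re w\<bar>)" by (simp add: exp_add[symmetric])
 finally show "norm ((p + q * w) * (exp (- of_real (pi * \<alpha>) * w^2) * ee (- (of_real b * w)))) <= K * exp (- \<bar>Re w\<bar>)" .
qed

text \<open>The shift h and the step N are absorbed into the entire function g(z) = fc(h + N z); on
  the Fourier side they become the phase ee(k h / N) and the frequency b + k/N. Absolute summability
  of both sides is stated as well, since sums over two coordinates are rearranged later.\<close>

theorem poisson_gauss:
 fixes \<alpha> b h N :: real and p q :: complex
 assumes \<alpha>: "\<alpha> > 0" and N: "N > 0"
 defines "f \<equiv> %x. (p + q * of_real x) * (of_real (exp (- pi * \<alpha> * x^2)) * ee (- of_real (b * x)))"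
  and "fh \<equiv> %\<eta>. (p - \<i> * q * of_real (\<eta> / \<alpha>)) * of_real (exp (- pi * \<eta>^2 / \<alpha>) / sqrt \<alpha>)"
 shows "(%m::int. norm (f (h + N * of_int m))) summable_on UNIV"
  and "(%k::int. norm (ee (of_real (of_int k * h / N)) * fh (b + of_int k / N))) summable_on UNIV"
  and "(\<Sum>\<^sub>\<infinity>m::int. f (h + N * of_int m)) = of_real (1 / N) * (\<Sum>\<^sub>\<infinity>k::int. ee (of_real (of_int k * h / N)) * fh (b + of_int k / N))"
proof -
 define fc where "fc w = (p + q * w) * (exp (- of_real (pi * \<alpha>) * w^2) * ee (- (of_real b * w)))" for w
 have fcr: "fc (of_real x) = f x" for x
  by (simp add: fc_def f_def exp_of_real[symmetric])
 define g where "g z = fc (of_real h + of_real N * z)" for z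
 \<comment> \<open>The disc of radius 2 demanded by \<open>poisson_summation_holomorphic\<close> is
   scaled by N, hence the strip of half-width 2 N.\<close>
 obtain K where K: "K >= 0" "\<And>w. \<bar>Im w\<bar> <= 2 * N ==> norm (fc w) <= K * exp (- \<bar>Re w\<bar>)"
  using gauss_strip_bound[OF \<alpha>, of "2 * N" p q b] N unfolding fc_def by auto
 define bd where "bd m = K * exp (abs h + 2 * N) * exp (- N * \<bar>of_int m\<bar>)" for m :: int
 have bound: "norm (g (of_int m + z)) <= bd m" if z: "norm z <= 2" for m z
 proof -
  define w where "w = of_real h + of_real N * (of_int m + z)"
  have Im: "Im w = N * Im z" and Re: "Re w = h + N * (of_int m + Re z)" by (simp_all add: w_def)
  have "\<bar>Im w\<bar> <= 2 * N" unfolding Im using abs_Im_le_cmod[of z] z N by (simp add: abs_mult)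
  then have 1: "norm (fc w) <= K * exp (- \<bar>Re w\<bar>)" by (rule K(2))
  have "\<bar>N * of_int m\<bar> <= \<bar>Re w\<bar> + abs h + \<bar>N * Re z\<bar>" unfolding Re by (simp add: algebra_simps)
  moreover have "\<bar>N * Re z\<bar> <= 2 * N" using abs_Re_le_cmod[of z] z N by (simp add: abs_mult)
  moreover have "\<bar>N * of_int m\<bar> = N * \<bar>of_int m\<bar>" using N by (simp add: abs_mult)
  ultimately have "- \<bar>Re w\<bar> <= (abs h + 2 * N) + (- N * \<bar>of_int m\<bar>)" by linarith
  then have "exp (- \<bar>Re w\<bar>) <= exp (abs h + 2 * N) * exp (- N * \<bar>of_int m\<bar>)" unfolding exp_add[symmetric] by simp
  then have "K * exp (- \<bar>Re w\<bar>) <= bd m" unfolding bd_def mult.assoc using K(1) by (rule mult_left_mono)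
  with 1 show ?thesis by (simp add: g_def w_def)
 qed
 have bdsum: "bd summable_on UNIV"
  unfolding bd_def by (intro summable_on_cmult_right summable_on_exp_abs_int N)
 have gm: "g (of_int m) = f (h + N * of_int m)" for m
  unfolding g_def fcr[symmetric] by simp
 show abs1: "(%m::int. norm (f (h + N * of_int m))) summable_on UNIV"
  by (rule summable_on_comparison_test[OF bdsum]) (use bound[of 0] gm in \<open>auto simp: bd_def K(1)\<close>)
 have hol: "g holomorphic_on UNIV"
  unfolding g_def fc_def by (intro holomorphic_intros)
 have fint: "integrable lborel f"
  using integrable_gauss_ee[OF \<alpha>, of 0 b] integrable_gauss_ee[OF \<alpha>, of 1 b]
  unfolding f_def by (simp add: distrib_right mult.assoc)
 have int: "integrable lborel (%x. g (of_real x))"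
 proof -
  have "integrable lborel (%x. f (h + N * x))"
   by (rule lborel_integrable_real_affine[OF fint]) (use N in auto)
  also have "(%x. f (h + N * x)) = (%x. g (of_real x))" unfolding g_def fcr[symmetric] by simp
  finally show ?thesis .
 qed
 have coeff: "(LINT x|lborel. g (of_real x) * ee (- of_int k * of_real x)) =
   of_real (1 / N) * (ee (of_real (of_int k * h / N)) * fh (b + of_int k / N))" for k
 proof -
  define G where "G y = f y * ee (- of_real (of_int k * (y - h) / N))" for y
  have "(LINT y|lborel. G y) = \<bar>N\<bar> *\<^sub>R (LINT x|lborel. G (h + N * x))"
   by (rule lborel_integral_real_affine) (use N in auto)
  also have "(%x. G (h + N * x)) = (%x. g (of_real x) * ee (- of_int k * of_real x))"
   unfolding G_def g_def fcr[symmetric] using N by auto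
  finally have 1: "(LINT x|lborel. g (of_real x) * ee (- of_int k * of_real x)) = of_real (1 / N) * (LINT y|lborel. G y)"
   using N by (simp add: scaleR_conv_of_real)
  have "G y = ee (of_real (of_int k * h / N)) * ((p + q * of_real y) * (of_real (exp (- pi * \<alpha> * y^2)) * ee (- of_real ((b + of_int k / N) * y))))" for y
  proof -
   have E: "ee (- of_real (of_int k * (y - h) / N)) * ee (- of_real (b * y)) = ee (of_real (of_int k * h / N)) * ee (- of_real ((b + of_int k / N) * y))"
    unfolding ee_add[symmetric] using N by (intro arg_cong[where f=ee]) (simp add: field_simps)
   have gen: "(P * (X * B)) * E = C * (P * (X * D))" if "E * B = C * D" for P X B E C D :: complex
   proof -
    have "(P * (X * B)) * E = P * X * (E * B)" by (simp only: mult_ac)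
    also have "... = P * X * (C * D)" by (simp only: that)
    also have "... = C * (P * (X * D))" by (simp only: mult_ac)
    finally show ?thesis .
   qed
   show ?thesis unfolding G_def f_def by (rule gen[OF E])
  qed
  then have "(LINT y|lborel. G y) = ee (of_real (of_int k * h / N)) * (LINT y|lborel. (p + q * of_real y) * (of_real (exp (- pi * \<alpha> * y^2)) * ee (- of_real ((b + of_int k / N) * y))))"
   by (simp only: integral_mult_right_zero)
  also have "(LINT y|lborel. (p + q * of_real y) * (of_real (exp (- pi * \<alpha> * y^2)) * ee (- of_real ((b + of_int k / N) * y)))) = fh (b + of_int k / N)"
   unfolding fh_def by (rule fourier_gauss_linear[OF \<alpha>])
  finally show ?thesis using 1 by simp
 qed
 show abs2: "(%k::int. norm (ee (of_real (of_int k * h / N)) * fh (b + of_int k / N))) summable_on UNIV"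
 proof -
  \<comment> \<open>The transform is again a linear factor times a Gaussian, with 1/alpha in place
    of alpha, so the same estimate applies; real frequencies allow a strip of width 0.\<close>
  obtain K' where K': "K' >= 0" "\<And>w. \<bar>Im w\<bar> <= 0 ==> norm ((p + (- \<i> * q / of_real \<alpha>) * w) * (exp (- of_real (pi * (1 / \<alpha>)) * w^2) * ee (- (of_real 0 * w)))) <= K' * exp (- \<bar>Re w\<bar>)"
   using gauss_strip_bound[of "1 / \<alpha>" 0 p "- \<i> * q / of_real \<alpha>" 0] \<alpha> by auto
  have fhb: "norm (fh \<eta>) <= K' / sqrt \<alpha> * exp (- abs \<eta>)" for \<eta>
  proof -
   have "norm ((p - \<i> * q * of_real (\<eta> / \<alpha>)) * of_real (exp (- pi * \<eta>^2 / \<alpha>))) <= K' * exp (- abs \<eta>)"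
    using K'(2)[of "of_real \<eta>"] by (simp add: ee_def exp_of_real[symmetric] mult_ac)
   moreover have "norm (fh \<eta>) = norm ((p - \<i> * q * of_real (\<eta> / \<alpha>)) * of_real (exp (- pi * \<eta>^2 / \<alpha>))) / sqrt \<alpha>"
    using \<alpha> by (simp add: fh_def norm_mult norm_divide)
   ultimately show ?thesis using \<alpha> by (simp add: divide_right_mono)
  qed
  have "(%k::int. K' / sqrt \<alpha> * exp \<bar>b\<bar> * exp (- (1 / N) * \<bar>of_int k\<bar>)) summable_on UNIV"
   by (intro summable_on_cmult_right summable_on_exp_abs_int) (use N in auto)
  then show ?thesis
  proof (rule summable_on_comparison_test)
   fix k :: int
   have "\<bar>of_int k / N\<bar> <= \<bar>b + of_int k / N\<bar> + abs b" by simp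
   then have "- \<bar>b + of_int k / N\<bar> <= abs b + (- (1 / N) * \<bar>of_int k\<bar>)" using N by (simp add: abs_divide)
   then have "exp (- \<bar>b + of_int k / N\<bar>) <= exp \<bar>b\<bar> * exp (- (1 / N) * \<bar>of_int k\<bar>)" unfolding exp_add[symmetric] by simp
   then have "K' / sqrt \<alpha> * exp (- \<bar>b + of_int k / N\<bar>) <= K' / sqrt \<alpha> * exp \<bar>b\<bar> * exp (- (1 / N) * \<bar>of_int k\<bar>)"
    unfolding mult.assoc using K'(1) \<alpha> by (intro mult_left_mono) auto
   then show "norm (ee (of_real (of_int k * h / N)) * fh (b + of_int k / N)) <= K' / sqrt \<alpha> * exp \<bar>b\<bar> * exp (- (1 / N) * \<bar>of_int k\<bar>)"
    using fhb[of "b + of_int k / N"] by (simp add: norm_mult norm_ee)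
  qed auto
 qed
 have "(%M. \<Sum>k\<in>{- int M..int M}. of_real (1 / N) * (ee (of_real (of_int k * h / N)) * fh (b + of_int k / N)))
      \<longlonglongrightarrow> (\<Sum>\<^sub>\<infinity>m. g (of_int m))"
  using poisson_summation_holomorphic[OF hol bound bdsum int] unfolding coeff .
 \<comment> \<open>For a summable family the symmetric windows may replace the filter of all finite
   sets, so the limit of the partial sums is the unordered sum.\<close>
 moreover have "(%M. \<Sum>k\<in>{- int M..int M}. of_real (1 / N) * (ee (of_real (of_int k * h / N)) * fh (b + of_int k / N)))
      \<longlonglongrightarrow> of_real (1 / N) * (\<Sum>\<^sub>\<infinity>k::int. ee (of_real (of_int k * h / N)) * fh (b + of_int k / N))"
 proof -
  have "((%k. of_real (1 / N) * (ee (of_real (of_int k * h / N)) * fh (b + of_int k / N))) has_sum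
    of_real (1 / N) * (\<Sum>\<^sub>\<infinity>k::int. ee (of_real (of_int k * h / N)) * fh (b + of_int k / N))) UNIV"
   by (rule has_sum_cmult_right[OF has_sum_infsum[OF abs_summable_summable[OF abs2]]])
  then show ?thesis unfolding has_sum_def
   by (rule filterlim_compose[OF _ filterlim_int_symmetric_interval])
 qed
 ultimately show "(\<Sum>\<^sub>\<infinity>m::int. f (h + N * of_int m)) = of_real (1 / N) * (\<Sum>\<^sub>\<infinity>k::int. ee (of_real (of_int k * h / N)) * fh (b + of_int k / N))"
  unfolding gm by (rule LIMSEQ_unique)
qed

section \<open>Power series in two real variables\<close>

text \<open>Besides the expansion itself this records a bound M for the majorant series at radius
  rho. Functions with a common radius and summable bounds can be added over an infinite index set,
  which is how lattice sums are shown to be real analytic.\<close>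

definition ps1 :: "(real => complex) => real => real => (nat => complex) => real => bool" where
 "ps1 B v \<rho> b M \<longleftrightarrow> summable (%k. norm (b k) * \<rho> ^ k) \<and> (\<Sum>k. norm (b k) * \<rho> ^ k) <= M \<and>
   (\<forall>y. abs y <= \<rho> --> (%k. b k * of_real y ^ k) sums B (v + y))"

text \<open>The closed square of side 2 rho is included, so that the same radius serves both for
  convergence and for the majorant.\<close>

definition ps2 :: "(complex => complex) => complex => real => (nat \<times> nat => complex) => real => bool" where
 "ps2 f z \<rho> a M \<longleftrightarrow> (%p. norm (a p) * \<rho> ^ (fst p + snd p)) summable_on UNIV \<and>
   (\<Sum>\<^sub>\<infinity>p. norm (a p) * \<rho> ^ (fst p + snd p)) <= M \<and>
   (\<forall>x y. abs x <= \<rho> --> \<bar>y\<bar> <= \<rho> -->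
    ((%p. a p * of_real x ^ fst p * of_real y ^ snd p) has_sum f (z + Complex x y)) UNIV)"

lemma ps1_exp:
 fixes \<kappa> :: complex
 assumes "\<rho> >= 0"
 shows "ps1 (%v. exp (\<kappa> * of_real v)) v \<rho> (%k. exp (\<kappa> * of_real v) * (\<kappa> ^ k / fact k)) (norm (exp (\<kappa> * of_real v)) * exp (norm \<kappa> * \<rho>))"
 unfolding ps1_def
proof (intro conjI allI impI)
 have eq: "norm (exp (\<kappa> * of_real v) * (\<kappa> ^ k / fact k)) * \<rho> ^ k = norm (exp (\<kappa> * of_real v)) * ((norm \<kappa> * \<rho>) ^ k /\<^sub>R fact k)" for k
  by (simp add: norm_mult norm_divide norm_power power_mult_distrib field_simps)
 have s: "(%k. norm (exp (\<kappa> * of_real v) * (\<kappa> ^ k / fact k)) * \<rho> ^ k) sums (norm (exp (\<kappa> * of_real v)) * exp (norm \<kappa> * \<rho>))"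
  unfolding eq by (rule sums_mult) (rule exp_converges)
 show "summable (%k. norm (exp (\<kappa> * of_real v) * (\<kappa> ^ k / fact k)) * \<rho> ^ k)" using s by (rule sums_summable)
 show "(\<Sum>k. norm (exp (\<kappa> * of_real v) * (\<kappa> ^ k / fact k)) * \<rho> ^ k) <= norm (exp (\<kappa> * of_real v)) * exp (norm \<kappa> * \<rho>)"
  using sums_unique[OF s] by simp
 fix y :: real
 have "(%k. exp (\<kappa> * of_real v) * ((\<kappa> * of_real y) ^ k /\<^sub>R fact k)) sums (exp (\<kappa> * of_real v) * exp (\<kappa> * of_real y))"
  by (rule sums_mult) (rule exp_converges)
 moreover have "exp (\<kappa> * of_real v) * ((\<kappa> * of_real y) ^ k /\<^sub>R fact k) = exp (\<kappa> * of_real v) * (\<kappa> ^ k / fact k) * of_real y ^ k" for k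
  by (simp add: power_mult_distrib scaleR_conv_of_real divide_inverse)
 moreover have "exp (\<kappa> * of_real v) * exp (\<kappa> * of_real y) = exp (\<kappa> * of_real (v + y))"
  by (simp add: exp_add distrib_left)
 ultimately show "(%k. exp (\<kappa> * of_real v) * (\<kappa> ^ k / fact k) * of_real y ^ k) sums exp (\<kappa> * of_real (v + y))" by simp
qed

lemma ps1_cmult:
 assumes "ps1 B v \<rho> b M"
 shows "ps1 (%v. c * B v) v \<rho> (%k. c * b k) (norm c * M)"
 unfolding ps1_def
proof (intro conjI allI impI)
 have s: "summable (%k. norm (b k) * \<rho> ^ k)" and le: "(\<Sum>k. norm (b k) * \<rho> ^ k) <= M"
  and b: "\<And>y. abs y <= \<rho> ==> (%k. b k * of_real y ^ k) sums B (v + y)"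
  using assms unfolding ps1_def by auto
 show "summable (%k. norm (c * b k) * \<rho> ^ k)"
  using summable_mult[OF s, of "norm c"] by (simp add: norm_mult mult.assoc)
 show "(\<Sum>k. norm (c * b k) * \<rho> ^ k) <= norm c * M"
  using suminf_mult[OF s, of "norm c"] mult_left_mono[OF le, of "norm c"] by (simp add: norm_mult mult.assoc)
 show "(%k. c * b k * of_real y ^ k) sums (c * B (v + y))" if "abs y <= \<rho>" for y
  using sums_mult[OF b[OF that], of c] by (simp add: mult.assoc)
qed

lemma ps1_mult:
 assumes "\<rho> >= 0" "ps1 B v \<rho> b M" "ps1 C v \<rho> c K"
 shows "ps1 (%v. B v * C v) v \<rho> (%k. \<Sum>i\<le>k. b i * c (k - i)) (M * K)"
 unfolding ps1_def
proof (intro conjI allI impI)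
 have sb: "summable (%k. norm (b k) * \<rho> ^ k)" and lb: "(\<Sum>k. norm (b k) * \<rho> ^ k) <= M"
  and b: "\<And>y. abs y <= \<rho> ==> (%k. b k * of_real y ^ k) sums B (v + y)"
  and sc: "summable (%k. norm (c k) * \<rho> ^ k)" and lc: "(\<Sum>k. norm (c k) * \<rho> ^ k) <= K"
  and c: "\<And>y. abs y <= \<rho> ==> (%k. c k * of_real y ^ k) sums C (v + y)"
  using assms unfolding ps1_def by auto
 have pw: "x ^ i * x ^ (k - i) = x ^ k" if "i <= k" for x :: "'a::comm_monoid_mult" and i k
  using that by (simp add: power_add[symmetric])
 have nb: "summable (%k. norm (norm (b k) * \<rho> ^ k))" "summable (%k. norm (norm (c k) * \<rho> ^ k))"
  using sb sc assms(1) by simp_all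
 have P: "(%k. \<Sum>i\<le>k. (norm (b i) * \<rho> ^ i) * (norm (c (k - i)) * \<rho> ^ (k - i))) sums
   ((\<Sum>k. norm (b k) * \<rho> ^ k) * (\<Sum>k. norm (c k) * \<rho> ^ k))"
  by (rule Cauchy_product_sums[OF nb])
 have Peq: "(\<Sum>i\<le>k. (norm (b i) * \<rho> ^ i) * (norm (c (k - i)) * \<rho> ^ (k - i))) = (\<Sum>i\<le>k. norm (b i * c (k - i))) * \<rho> ^ k" for k
  unfolding sum_distrib_right
 proof (intro sum.cong refl)
  fix i assume "i \<in> {..k}"
  then show "(norm (b i) * \<rho> ^ i) * (norm (c (k - i)) * \<rho> ^ (k - i)) = norm (b i * c (k - i)) * \<rho> ^ k"
   using pw[of i k \<rho>] by (simp add: norm_mult mult_ac)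
 qed
 have le: "norm (\<Sum>i\<le>k. b i * c (k - i)) * \<rho> ^ k <= (\<Sum>i\<le>k. (norm (b i) * \<rho> ^ i) * (norm (c (k - i)) * \<rho> ^ (k - i)))" for k
  unfolding Peq by (intro mult_right_mono norm_sum) (use assms in auto)
 show s: "summable (%k. norm (\<Sum>i\<le>k. b i * c (k - i)) * \<rho> ^ k)"
  by (rule summable_comparison_test'[OF sums_summable[OF P], of 0]) (use le assms in auto)
 have "(\<Sum>k. norm (\<Sum>i\<le>k. b i * c (k - i)) * \<rho> ^ k) <= (\<Sum>k. norm (b k) * \<rho> ^ k) * (\<Sum>k. norm (c k) * \<rho> ^ k)"
  unfolding sums_unique[OF P] by (rule suminf_le[OF le s sums_summable[OF P]])
 also have "... <= M * K"
  by (intro mult_mono lb lc suminf_nonneg sb sc order_trans[OF suminf_nonneg[OF sb] lb]) (use assms in auto)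
 finally show "(\<Sum>k. norm (\<Sum>i\<le>k. b i * c (k - i)) * \<rho> ^ k) <= M * K" .
 fix y :: real assume y: "abs y <= \<rho>"
 have sm: "summable (%k. norm (d k * of_real y ^ k))" if "summable (%k. norm (d k) * \<rho> ^ k)" for d :: "nat => complex"
  by (rule summable_comparison_test'[OF that, of 0]) (use y in \<open>auto simp: norm_mult norm_power intro!: mult_left_mono power_mono\<close>)
 have "(%k. \<Sum>i\<le>k. (b i * of_real y ^ i) * (c (k - i) * of_real y ^ (k - i))) sums
  ((\<Sum>k. b k * of_real y ^ k) * (\<Sum>k. c k * of_real y ^ k))"
  by (rule Cauchy_product_sums[OF sm[OF sb] sm[OF sc]])
 moreover have "(\<Sum>i\<le>k. (b i * of_real y ^ i) * (c (k - i) * of_real y ^ (k - i))) = (\<Sum>i\<le>k. b i * c (k - i)) * of_real y ^ k" for k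
  unfolding sum_distrib_right
 proof (intro sum.cong refl)
  fix i assume "i \<in> {..k}"
  then show "(b i * of_real y ^ i) * (c (k - i) * of_real y ^ (k - i)) = b i * c (k - i) * of_real y ^ k"
   using pw[of i k "complex_of_real y"] by (simp add: mult_ac)
 qed
 ultimately show "(%k. (\<Sum>i\<le>k. b i * c (k - i)) * of_real y ^ k) sums (B (v + y) * C (v + y))"
  using sums_unique[OF b[OF y]] sums_unique[OF c[OF y]] by simp
qed

lemma summable_on_times_nonneg:
 fixes f g :: "_ => real"
 assumes f: "f summable_on A" and g: "g summable_on B" and "\<And>x. x \<in> A ==> f x >= 0" "\<And>y. y \<in> B ==> g y >= 0"
 shows "(%p. f (fst p) * g (snd p)) summable_on A \<times> B"
proof (rule summable_on_SigmaI)
 show "((%y. f (fst (x, y)) * g (snd (x, y))) has_sum (f x * infsum g B)) B" for x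
  using has_sum_cmult_right[OF has_sum_infsum[OF g]] by simp
 show "(%x. f x * infsum g B) summable_on A" by (rule summable_on_cmult_left[OF f])
qed (use assms in auto)

lemma summable_on_product_swap:
 assumes "f summable_on A \<times> B"
 shows "(%p. f (snd p, fst p)) summable_on B \<times> A"
proof -
 have "f summable_on prod.swap ` (B \<times> A)" using assms by (simp add: product_swap)
 then have "(f \<circ> prod.swap) summable_on (B \<times> A)" by (subst (asm) summable_on_reindex) auto
 then show ?thesis by (simp add: o_def prod.swap_def)
qed

lemma has_sum_product_swap:
 assumes "(f has_sum S) (A \<times> B)"
 shows "((%p. f (snd p, fst p)) has_sum S) (B \<times> A)"
proof -
 have "(f has_sum S) (prod.swap ` (B \<times> A))" using assms by (simp add: product_swap)
 then have "((f \<circ> prod.swap) has_sum S) (B \<times> A)" by (subst (asm) has_sum_reindex) auto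
 then show ?thesis by (simp add: o_def prod.swap_def)
qed

lemma ps2_product:
 assumes \<rho>: "\<rho> >= 0" and A: "ps1 A (Re z) \<rho> a M" and B: "ps1 B (Im z) \<rho> b K"
 shows "ps2 (%\<tau>. A (Re \<tau>) * B (Im \<tau>)) z \<rho> (%p. a (fst p) * b (snd p)) (M * K)"
 unfolding ps2_def
proof (intro conjI allI impI)
 have sb: "summable (%k. norm (b k) * \<rho> ^ k)" and lb: "(\<Sum>k. norm (b k) * \<rho> ^ k) <= K"
  and b: "\<And>y. abs y <= \<rho> ==> (%k. b k * of_real y ^ k) sums B (Im z + y)"
  and sa: "summable (%k. norm (a k) * \<rho> ^ k)" and la: "(\<Sum>k. norm (a k) * \<rho> ^ k) <= M"
  and a: "\<And>y. abs y <= \<rho> ==> (%k. a k * of_real y ^ k) sums A (Re z + y)"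
  using A B unfolding ps1_def by auto
 have prod: "((%p. d (fst p) * e (snd p)) has_sum ((\<Sum>k. d k) * (\<Sum>k. e k))) UNIV"
  if d: "summable (%k. norm (d k))" and e: "summable (%k. norm (e k))" for d e :: "nat => 'x :: {real_normed_field, banach}"
 proof -
  have dd: "(%k. norm (d k)) summable_on UNIV" and ee: "(%k. norm (e k)) summable_on UNIV"
   using d e norm_summable_imp_summable_on[of "%k. norm (d k)"] norm_summable_imp_summable_on[of "%k. norm (e k)"] by auto
  have "(%p. norm (d (fst p)) * norm (e (snd p))) summable_on UNIV \<times> UNIV"
   using summable_on_times_nonneg[OF dd ee] by simp
  then have "(%p. norm (case p of (m,n) => d m * e n)) summable_on UNIV \<times> UNIV"
   by (simp add: norm_mult split_def)
  then have s: "(%(m,n). d m * e n) summable_on UNIV \<times> UNIV" by (rule abs_summable_summable)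
  have "(\<Sum>\<^sub>\<infinity>(m,n)\<in>UNIV \<times> UNIV. d m * e n) = (\<Sum>\<^sub>\<infinity>m. \<Sum>\<^sub>\<infinity>n. d m * e n)"
   by (rule infsum_Sigma'_banach[OF s, symmetric])
  also have "... = (\<Sum>\<^sub>\<infinity>m. d m) * (\<Sum>\<^sub>\<infinity>n. e n)"
   by (simp add: infsum_cmult_right' infsum_cmult_left')
  also have "(\<Sum>\<^sub>\<infinity>m. d m) = (\<Sum>k. d k)"
   using norm_summable_imp_has_sum[OF d] d summable_norm_cancel summable_sums infsumI by blast
  also have "(\<Sum>\<^sub>\<infinity>m. e m) = (\<Sum>k. e k)"
   using norm_summable_imp_has_sum[OF e] e summable_norm_cancel summable_sums infsumI by blast
  finally have "(\<Sum>\<^sub>\<infinity>(m,n)\<in>UNIV \<times> UNIV. d m * e n) = (\<Sum>k. d k) * (\<Sum>k. e k)" .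
  then show ?thesis using has_sum_infsum[OF s] by (simp add: split_def)
 qed
 have n: "norm (a (fst p) * b (snd p)) * \<rho> ^ (fst p + snd p) = (norm (a (fst p)) * \<rho> ^ fst p) * (norm (b (snd p)) * \<rho> ^ snd p)" for p
  by (simp add: norm_mult power_add mult_ac)
 have hs: "((%p. norm (a (fst p) * b (snd p)) * \<rho> ^ (fst p + snd p)) has_sum ((\<Sum>k. norm (a k) * \<rho> ^ k) * (\<Sum>k. norm (b k) * \<rho> ^ k))) UNIV"
  unfolding n by (rule prod) (use sa sb \<rho> in auto)
 show "(%p. norm (a (fst p) * b (snd p)) * \<rho> ^ (fst p + snd p)) summable_on UNIV" using hs by (rule has_sum_imp_summable)
 have "(\<Sum>\<^sub>\<infinity>p. norm (a (fst p) * b (snd p)) * \<rho> ^ (fst p + snd p)) = (\<Sum>k. norm (a k) * \<rho> ^ k) * (\<Sum>k. norm (b k) * \<rho> ^ k)"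
  using hs by (rule infsumI)
 also have "... <= M * K"
  by (intro mult_mono la lb suminf_nonneg sa sb order_trans[OF suminf_nonneg[OF sa] la]) (use \<rho> in auto)
 finally show "(\<Sum>\<^sub>\<infinity>p. norm (a (fst p) * b (snd p)) * \<rho> ^ (fst p + snd p)) <= M * K" .
 fix x y :: real assume xy: "abs x <= \<rho>" "abs y <= \<rho>"
 have sm: "summable (%k. norm (d k * of_real y ^ k))" if "summable (%k. norm (d k) * \<rho> ^ k)" "abs y <= \<rho>" for d :: "nat => complex" and y
  by (rule summable_comparison_test'[OF that(1), of 0]) (use that(2) in \<open>auto simp: norm_mult norm_power intro!: mult_left_mono power_mono\<close>)
 have "((%p. (a (fst p) * of_real x ^ fst p) * (b (snd p) * of_real y ^ snd p)) has_sum
   ((\<Sum>k. a k * of_real x ^ k) * (\<Sum>k. b k * of_real y ^ k))) UNIV"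
  by (rule prod[OF sm[OF sa xy(1)] sm[OF sb xy(2)]])
 then show "((%p. a (fst p) * b (snd p) * of_real x ^ fst p * of_real y ^ snd p) has_sum
   (A (Re (z + Complex x y)) * B (Im (z + Complex x y)))) UNIV"
  using sums_unique[OF a[OF xy(1)]] sums_unique[OF b[OF xy(2)]] by (simp add: mult_ac)
qed

text \<open>The bounds M i make the coefficient family absolutely summable over all pairs (i, p);
  the sums over i and over p may then be exchanged, first for the coefficients and then for the
  values at each point of the square.\<close>

lemma
 fixes f :: "'i => complex => complex"
 assumes \<rho>: "\<rho> > 0" and f: "\<And>i. i \<in> I ==> ps2 (f i) z \<rho> (a i) (M i)" and M: "M summable_on I"
 shows ps2_infsum: "ps2 (%\<tau>. \<Sum>\<^sub>\<infinity>i\<in>I. f i \<tau>) z \<rho> (%p. \<Sum>\<^sub>\<infinity>i\<in>I. a i p) (\<Sum>\<^sub>\<infinity>i\<in>I. M i)"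
  and ps2_summable_coeff: "\<And>p. (%i. a i p) summable_on I"
  and ps2_summable: "(%i. f i z) summable_on I"
proof -
 define w where "w p = \<rho> ^ (fst p + snd p)" for p :: "nat \<times> nat"
 have w0: "w p > 0" for p using \<rho> by (simp add: w_def)
 have s1: "(%p. norm (a i p) * w p) summable_on UNIV" and l1: "(\<Sum>\<^sub>\<infinity>p. norm (a i p) * w p) <= M i"
  and r1: "\<And>x y. abs x <= \<rho> ==> \<bar>y\<bar> <= \<rho> ==>
    ((%p. a i p * of_real x ^ fst p * of_real y ^ snd p) has_sum f i (z + Complex x y)) UNIV" if "i \<in> I" for i
  using f[OF that] unfolding ps2_def w_def by auto
 define N where "N i = (\<Sum>\<^sub>\<infinity>p. norm (a i p) * w p)" for i
 have Nsum: "N summable_on I"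
  by (rule summable_on_comparison_test[OF M]) (use l1 w0 in \<open>auto simp: N_def less_imp_le intro!: infsum_nonneg\<close>)
 \<comment> \<open>Absolute summability over the product I x UNIV, from which every exchange of
   summations below is drawn.\<close>
 have S: "(%q. norm (a (fst q) (snd q)) * w (snd q)) summable_on I \<times> UNIV"
 proof (rule summable_on_SigmaI[OF _ Nsum])
  show "((%y. norm (a (fst (i, y)) (snd (i, y))) * w (snd (i, y))) has_sum N i) UNIV" if "i \<in> I" for i
   using has_sum_infsum[OF s1[OF that]] by (simp add: N_def)
 qed (use w0 in \<open>auto simp: less_imp_le\<close>)
 have S2: "(%q. norm (a (snd q) (fst q)) * w (fst q)) summable_on UNIV \<times> I"
  using summable_on_product_swap[OF S] by simp
 have fib: "(%i. norm (a i p) * w p) summable_on I" for p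
  using summable_on_SigmaD1[of "%p i. norm (a i p) * w p" UNIV "%_. I" p] S2 by (simp add: split_def)
 have fib': "(%i. norm (a i p)) summable_on I" for p
 proof -
  have "(%i. norm (a i p) * w p * (1 / w p)) summable_on I" by (rule summable_on_cmult_left[OF fib])
  then show ?thesis using w0[of p] by (simp add: less_imp_neq[symmetric])
 qed
 show sa: "(%i. a i p) summable_on I" for p by (rule abs_summable_summable[OF fib'])
 have le: "norm (\<Sum>\<^sub>\<infinity>i\<in>I. a i p) * w p <= (\<Sum>\<^sub>\<infinity>i\<in>I. norm (a i p) * w p)" for p
 proof -
  have "norm (\<Sum>\<^sub>\<infinity>i\<in>I. a i p) <= (\<Sum>\<^sub>\<infinity>i\<in>I. norm (a i p))" by (rule norm_infsum_bound[OF fib'])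
  then have "norm (\<Sum>\<^sub>\<infinity>i\<in>I. a i p) * w p <= (\<Sum>\<^sub>\<infinity>i\<in>I. norm (a i p)) * w p" using w0[of p] by simp
  also have "... = (\<Sum>\<^sub>\<infinity>i\<in>I. norm (a i p) * w p)" by (rule infsum_cmult_left'[symmetric])
  finally show ?thesis .
 qed
 have tot: "((%p. \<Sum>\<^sub>\<infinity>i\<in>I. norm (a i p) * w p) has_sum (\<Sum>\<^sub>\<infinity>i\<in>I. N i)) UNIV"
 proof -
  have "((%q. norm (a (fst q) (snd q)) * w (snd q)) has_sum (infsum (%q. norm (a (fst q) (snd q)) * w (snd q)) (I \<times> UNIV))) (I \<times> UNIV)"
   by (rule has_sum_infsum[OF S])
  moreover from has_sum_SigmaD[OF this, of N] s1
  have "(N has_sum (infsum (%q. norm (a (fst q) (snd q)) * w (snd q)) (I \<times> UNIV))) I"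
   by (simp add: N_def has_sum_infsum)
  then have "infsum (%q. norm (a (fst q) (snd q)) * w (snd q)) (I \<times> UNIV) = (\<Sum>\<^sub>\<infinity>i\<in>I. N i)" by (simp add: infsumI)
  ultimately have "((%q. norm (a (snd q) (fst q)) * w (fst q)) has_sum (\<Sum>\<^sub>\<infinity>i\<in>I. N i)) (UNIV \<times> I)"
   using has_sum_product_swap by fastforce
  from has_sum_SigmaD[OF this, of "%p. \<Sum>\<^sub>\<infinity>i\<in>I. norm (a i p) * w p"] fib
  show ?thesis by (simp add: has_sum_infsum)
 qed
 have sumc: "(%p. norm (\<Sum>\<^sub>\<infinity>i\<in>I. a i p) * w p) summable_on UNIV"
  by (rule summable_on_comparison_test[OF has_sum_imp_summable[OF tot]]) (use le w0 in \<open>auto simp: less_imp_le\<close>)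
 have bnd: "(\<Sum>\<^sub>\<infinity>p. norm (\<Sum>\<^sub>\<infinity>i\<in>I. a i p) * w p) <= (\<Sum>\<^sub>\<infinity>i\<in>I. M i)"
 proof -
  have "(\<Sum>\<^sub>\<infinity>p. norm (\<Sum>\<^sub>\<infinity>i\<in>I. a i p) * w p) <= (\<Sum>\<^sub>\<infinity>i\<in>I. N i)"
   unfolding infsumI[OF tot, symmetric] by (rule infsum_mono[OF sumc has_sum_imp_summable[OF tot] le])
  also have "... <= (\<Sum>\<^sub>\<infinity>i\<in>I. M i)" by (rule infsum_mono[OF Nsum M]) (use l1 in \<open>auto simp: N_def\<close>)
  finally show ?thesis .
 qed
 have rep: "((%i. f i (z + Complex x y)) has_sum (\<Sum>\<^sub>\<infinity>i\<in>I. f i (z + Complex x y))) I \<and>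
   ((%p. (\<Sum>\<^sub>\<infinity>i\<in>I. a i p) * of_real x ^ fst p * of_real y ^ snd p) has_sum (\<Sum>\<^sub>\<infinity>i\<in>I. f i (z + Complex x y))) UNIV"
  if xy: "abs x <= \<rho>" "abs y <= \<rho>" for x y
 proof -
  define F where "F q = a (fst q) (snd q) * of_real x ^ fst (snd q) * of_real y ^ snd (snd q)" for q
  have "norm (F q) <= norm (a (fst q) (snd q)) * w (snd q)" for q
  proof -
   have "abs x ^ fst (snd q) * abs y ^ snd (snd q) <= \<rho> ^ fst (snd q) * \<rho> ^ snd (snd q)"
    by (intro mult_mono power_mono xy) (use \<rho> in auto)
   then show ?thesis unfolding F_def w_def power_add norm_mult mult.assoc
    by (intro mult_left_mono) (auto simp: norm_power)
  qed
  then have "(%q. norm (F q)) summable_on I \<times> UNIV"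
   by (intro summable_on_comparison_test[OF S]) auto
  then have Fs: "F summable_on I \<times> UNIV" by (rule abs_summable_summable)
  have h1: "((%i. f i (z + Complex x y)) has_sum infsum F (I \<times> UNIV)) I"
   by (rule has_sum_SigmaD[OF has_sum_infsum[OF Fs]]) (use r1[OF _ xy] in \<open>simp add: F_def\<close>)
  have "((%q. F (snd q, fst q)) has_sum infsum F (I \<times> UNIV)) (UNIV \<times> I)"
   by (rule has_sum_product_swap[OF has_sum_infsum[OF Fs]])
  then have h2: "((%p. (\<Sum>\<^sub>\<infinity>i\<in>I. a i p) * of_real x ^ fst p * of_real y ^ snd p) has_sum infsum F (I \<times> UNIV)) UNIV"
  proof (rule has_sum_SigmaD)
   fix p :: "nat \<times> nat"
   show "((%i. F (snd (p, i), fst (p, i))) has_sum (\<Sum>\<^sub>\<infinity>i\<in>I. a i p) * of_real x ^ fst p * of_real y ^ snd p) I"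
    unfolding F_def fst_conv snd_conv by (intro has_sum_cmult_left has_sum_infsum sa)
  qed
  show ?thesis using h1 h2 by (simp add: infsumI[OF h1])
 qed
 show "ps2 (%\<tau>. \<Sum>\<^sub>\<infinity>i\<in>I. f i \<tau>) z \<rho> (%p. \<Sum>\<^sub>\<infinity>i\<in>I. a i p) (\<Sum>\<^sub>\<infinity>i\<in>I. M i)"
  unfolding ps2_def using sumc bnd rep by (simp add: w_def)
 have "Complex 0 0 = 0" by (simp add: complex_eq_iff)
 then show "(%i. f i z) summable_on I" using rep[of 0 0] \<rho> has_sum_imp_summable by fastforce
qed

lemma ps2_add:
 assumes \<rho>: "\<rho> > 0" and "ps2 f z \<rho> a M" "ps2 g z \<rho> b K"
 shows "ps2 (%\<tau>. f \<tau> + g \<tau>) z \<rho> (%p. a p + b p) (M + K)"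
proof -
 have "ps2 (%\<tau>. \<Sum>\<^sub>\<infinity>i\<in>{True, False}. (if i then f else g) \<tau>) z \<rho> (%p. \<Sum>\<^sub>\<infinity>i\<in>{True, False}. (if i then a else b) p) (\<Sum>\<^sub>\<infinity>i\<in>{True, False}. (if i then M else K))"
  by (rule ps2_infsum[OF \<rho>]) (use assms in auto)
 then show ?thesis by simp
qed

lemma real_analytic_onI:
 assumes "\<And>z. z \<in> U ==> \<exists>\<rho>>0. \<exists>a M. ps2 f z \<rho> a M"
 shows "real_analytic_on f U"
 unfolding real_analytic_on_def
proof
 fix z assume "z \<in> U"
 then obtain \<rho> a M where "\<rho> > 0" and p: "ps2 f z \<rho> a M" using assms by blast
 then show "\<exists>r>0. \<exists>a :: nat \<times> nat => complex. \<forall>x y. abs x < r --> \<bar>y\<bar> < r -->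
    ((%(m, n). a (m, n) * of_real x ^ m * of_real y ^ n) has_sum f (z + Complex x y)) UNIV"
  by (intro exI[of _ \<rho>] conjI exI[of _ a]) (auto simp: ps2_def split_def)
qed

lemma ps1_imp_vector_derivative:
 fixes g :: "real => complex"
 assumes \<rho>: "\<rho> > 0" and s: "\<And>x. abs x <= \<rho> ==> (%k. c k * of_real x ^ k) sums g x"
 shows "vector_derivative g (at 0) = c 1"
proof -
 have "((%x. \<Sum>k. c k * x ^ k) has_field_derivative (\<Sum>k. diffs c k * (of_real 0) ^ k)) (at (of_real 0))"
  by (rule termdiffs_strong[where K="of_real \<rho>"]) (use s[of \<rho>] \<rho> in \<open>auto simp: sums_summable\<close>)
 then have "((%x. \<Sum>k. c k * of_real x ^ k) has_vector_derivative (\<Sum>k. diffs c k * (of_real 0) ^ k)) (at 0)"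
  by (rule has_vector_derivative_real_field)
 moreover have "(\<Sum>k. diffs c k * (of_real 0) ^ k) = c 1"
  using powser_zero[of "diffs c"] by (simp add: diffs_def)
 ultimately have d: "((%x. \<Sum>k. c k * of_real x ^ k) has_vector_derivative c 1) (at 0)" by simp
 have "(g has_vector_derivative c 1) (at 0)"
 proof (rule has_vector_derivative_transform_within_open[OF d])
  show "open {-\<rho><..<\<rho>}" "0 \<in> {-\<rho><..<\<rho>}" using \<rho> by auto
  show "(\<Sum>k. c k * of_real x ^ k) = g x" if "x \<in> {-\<rho><..<\<rho>}" for x
   using sums_unique[OF s[of x]] that by auto
 qed
 then show ?thesis by (rule vector_derivative_at)
qed

text \<open>The two partial derivatives in \<open>dbar\<close> see the expansion only along the
  axes, so they are the two coefficients of total degree 1.\<close>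

lemma dbar_ps2:
 assumes \<rho>: "\<rho> > 0" and f: "ps2 f z \<rho> a M"
 shows "dbar f z = (a (1, 0) + \<i> * a (0, 1)) / 2"
proof -
 have r: "((%p. a p * of_real x ^ fst p * of_real y ^ snd p) has_sum f (z + Complex x y)) UNIV"
  if "abs x <= \<rho>" "abs y <= \<rho>" for x y using f that unfolding ps2_def by auto
 have X: "(%k. a (k, 0) * of_real x ^ k) sums f (z + of_real x)" if "abs x <= \<rho>" for x
 proof -
  have "((%p. a p * of_real x ^ fst p * of_real 0 ^ snd p) has_sum f (z + Complex x 0)) UNIV"
   by (rule r) (use that \<rho> in auto)
  \<comment> \<open>On the axis y = 0 the factor 0^n kills every term with n > 0, while 0^0 = 1
    keeps those with n = 0.\<close>
  moreover have "((%p. a p * of_real x ^ fst p * of_real 0 ^ snd p) has_sum v) UNIV \<longleftrightarrow>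
    ((%p. a p * of_real x ^ fst p * of_real 0 ^ snd p) has_sum v) (range (%k. (k, 0)))" for v
   by (rule has_sum_cong_neutral) (auto simp: image_iff power_0_left)
  moreover have "Complex x 0 = of_real x" by (simp add: complex_eq_iff)
  ultimately have "((%p. a p * of_real x ^ fst p * of_real 0 ^ snd p) has_sum f (z + of_real x)) (range (%k. (k, 0)))"
   by simp
  then have "((%k. a (k, 0) * of_real x ^ k) has_sum f (z + of_real x)) UNIV"
   by (subst (asm) has_sum_reindex) (auto simp: inj_def o_def)
  then show ?thesis by (rule has_sum_imp_sums)
 qed
 have Y: "(%k. a (0, k) * of_real y ^ k) sums f (z + \<i> * of_real y)" if "abs y <= \<rho>" for y
 proof -
  have "((%p. a p * of_real 0 ^ fst p * of_real y ^ snd p) has_sum f (z + Complex 0 y)) UNIV"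
   by (rule r) (use that \<rho> in auto)
  moreover have "((%p. a p * of_real 0 ^ fst p * of_real y ^ snd p) has_sum v) UNIV \<longleftrightarrow>
    ((%p. a p * of_real 0 ^ fst p * of_real y ^ snd p) has_sum v) (range (%k. (0, k)))" for v
   by (rule has_sum_cong_neutral) (auto simp: image_iff power_0_left)
  moreover have "Complex 0 y = \<i> * of_real y" by (simp add: complex_eq_iff)
  ultimately have "((%p. a p * of_real 0 ^ fst p * of_real y ^ snd p) has_sum f (z + \<i> * of_real y)) (range (%k. (0, k)))"
   by simp
  then have "((%k. a (0, k) * of_real y ^ k) has_sum f (z + \<i> * of_real y)) UNIV"
   by (subst (asm) has_sum_reindex) (auto simp: inj_def o_def)
  then show ?thesis by (rule has_sum_imp_sums)
 qed
 have "vector_derivative (%x. f (z + of_real x)) (at 0) = a (1, 0)"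
  by (rule ps1_imp_vector_derivative[OF \<rho> X])
 moreover have "vector_derivative (%y. f (z + \<i> * of_real y)) (at 0) = a (0, 1)"
  by (rule ps1_imp_vector_derivative[OF \<rho> Y])
 ultimately show ?thesis by (simp add: dbar_def)
qed

lemma dbar_infsum:
 fixes f :: "'i => complex => complex"
 assumes \<rho>: "\<rho> > 0" and f: "\<And>i. i \<in> I ==> ps2 (f i) z \<rho> (a i) (M i)" and M: "M summable_on I"
 shows "dbar (%\<tau>. \<Sum>\<^sub>\<infinity>i\<in>I. f i \<tau>) z = (\<Sum>\<^sub>\<infinity>i\<in>I. dbar (f i) z)"
proof -
 have s: "(%i. a i p) summable_on I" for p by (rule ps2_summable_coeff[OF assms])
 have "dbar (%\<tau>. \<Sum>\<^sub>\<infinity>i\<in>I. f i \<tau>) z = ((\<Sum>\<^sub>\<infinity>i\<in>I. a i (1, 0)) + \<i> * (\<Sum>\<^sub>\<infinity>i\<in>I. a i (0, 1))) / 2"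
  by (rule dbar_ps2[OF \<rho> ps2_infsum[OF assms]])
 also have "... = (\<Sum>\<^sub>\<infinity>i\<in>I. (a i (1, 0) + \<i> * a i (0, 1)) * (1 / 2))"
 proof (rule infsumI[symmetric])
  have "((%i. (a i (1, 0) + \<i> * a i (0, 1)) * (1 / 2)) has_sum
    (((\<Sum>\<^sub>\<infinity>i\<in>I. a i (1, 0)) + \<i> * (\<Sum>\<^sub>\<infinity>i\<in>I. a i (0, 1))) * (1 / 2))) I"
   by (intro has_sum_cmult_left has_sum_add has_sum_cmult_right has_sum_infsum s)
  then show "((%i. (a i (1, 0) + \<i> * a i (0, 1)) * (1 / 2)) has_sum
    (((\<Sum>\<^sub>\<infinity>i\<in>I. a i (1, 0)) + \<i> * (\<Sum>\<^sub>\<infinity>i\<in>I. a i (0, 1))) / 2)) I" by simp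
 qed
 also have "... = (\<Sum>\<^sub>\<infinity>i\<in>I. dbar (f i) z)"
  by (rule infsum_cong) (use dbar_ps2[OF \<rho> f] in auto)
 finally show ?thesis .
qed

section \<open>The Hurwitz-type integral\<close>

lemma integrable_exp_neg_abs:
 fixes c :: real
 assumes "c > 0"
 shows "integrable lborel (%w. exp (- c * abs w))"
proof -
 have "((%x. exp (- c * x)) has_integral exp (- c * 0) / c) {0..}"
  by (rule has_integral_exp_minus_to_infinity[OF assms])
 then have "(%x. exp (- c * x)) absolutely_integrable_on {0..}"
  by (intro nonnegative_absolutely_integrable_1) (auto simp: has_integral_integrable)
 then have 1: "integrable lborel (%x. indicator {0..} x *\<^sub>R exp (- c * x))"
  unfolding set_integrable_def by (subst (asm) integrable_completion) auto
 then have 2: "integrable lborel (%x. indicator {0..} (0 + (-1) * x) *\<^sub>R exp (- c * (0 + (-1) * x)))"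
  by (rule lborel_integrable_real_affine) auto
 have "integrable lborel (%x. indicator {0..} x *\<^sub>R exp (- c * x) + indicator {0..} (0 + (-1) * x) *\<^sub>R exp (- c * (0 + (-1) * x)))"
  using 1 2 by (rule Bochner_Integration.integrable_add)
 then show ?thesis
  by (rule integrable_dominated) (auto simp: indicator_def)
qed

lemma abs_le_exp_scaled:
 fixes w :: real
 assumes "d > 0"
 shows "abs w <= 1 / d * exp (d * abs w)"
proof -
 have "d * abs w <= exp (d * abs w)" using exp_ge_add_one_self[of "d * abs w"] by linarith
 then show ?thesis using assms by (simp add: field_simps)
qed

lemma exp_ge_two_times: "2 * y <= exp (y::real)"
proof (cases "y >= 0")
 case True
 then have "1 + y + y^2 / 2 <= exp y" by (rule exp_lower_Taylor_quadratic)
 moreover have "(y - 1)\<^sup>2 >= 0" by simp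
 then have "y\<^sup>2 - 2 * y + 1 >= 0" by (simp add: power2_diff)
 ultimately show ?thesis by linarith
next
 case False
 then show ?thesis using exp_gt_zero[of y] by linarith
qed

text \<open>For w >= 0 the double exponential wins because 4 w <= exp(2 w); for w < 0 the first
  factor already decays.\<close>

lemma exp_exp_bound:
 fixes x w :: real
 assumes "0 < x" "x <= 1"
 shows "exp (2 * x * w) * exp (- exp (2 * w)) <= exp (- (2 * x) * abs w)"
proof (cases "w >= 0")
 case True
 have "x * w <= w" using assms True by (simp add: mult_left_le_one_le)
 moreover have "2 * (2 * w) <= exp (2 * w)" by (rule exp_ge_two_times)
 moreover have "2 * x * w + (- exp (2 * w)) = 2 * (x * w) - exp (2 * w)" "- (2 * x) * abs w = - 2 * (x * w)"
  using True by simp_all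
 ultimately have "2 * x * w + (- exp (2 * w)) <= - (2 * x) * abs w" by linarith
 then show ?thesis by (simp add: exp_add[symmetric])
next
 case False
 have "exp (- exp (2 * w)) <= 1" by simp
 then have "exp (2 * x * w) * exp (- exp (2 * w)) <= exp (2 * x * w) * 1" by (intro mult_left_mono) auto
 then show ?thesis using False by simp
qed

text \<open>Euler's integral after t = exp(2 w). The factor 2 in the exponent is chosen so that x =
  1/2 gives twice \<open>gkern 1\<close>.\<close>

lemma Gamma_exp_integral:
 fixes x :: real
 assumes x: "0 < x" "x <= 1"
 shows "integrable lborel (%w. 2 * (exp (2 * x * w) * exp (- exp (2 * w))))"
  and "(LINT w|lborel. 2 * (exp (2 * x * w) * exp (- exp (2 * w)))) = Gamma x"
proof -
 let ?h = "%w. 2 * (exp (2 * x * w) * exp (- exp (2 * w)))"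
 let ?f = "%t::real. t powr (x - 1) / exp t"
 let ?g = "%w::real. exp (2 * w)"
 show i: "integrable lborel ?h"
 proof (rule integrable_dominated)
  show "integrable lborel (%w. 2 * exp (- (2 * x) * abs w))"
   using x by (intro integrable_mult_right integrable_exp_neg_abs) auto
  show "AE w in lborel. norm (?h w) <= norm (2 * exp (- (2 * x) * abs w))"
   using exp_exp_bound[OF x] by (intro AE_I2) simp
 qed auto
 have im: "range ?g = {0<..}"
 proof
  show "{0<..} \<subseteq> range ?g"
  proof
   fix t :: real assume "t \<in> {0<..}"
   then have "t = ?g (ln t / 2)" by simp
   then show "t \<in> range ?g" by blast
  qed
 qed auto
 have eq: "\<bar>2 * exp (2 * w)\<bar> * ?f (?g w) = ?h w" for w
  by (simp add: powr_def exp_minus divide_inverse) (simp add: exp_add[symmetric] algebra_simps)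
 have "(LINT t:range ?g|lborel. ?f t) = (LINT w:UNIV|lborel. \<bar>2 * exp (2 * w)\<bar> * ?f (?g w))"
 proof (rule set_integral_substitution_real(2))
  show "set_integrable lborel UNIV (%w. \<bar>2 * exp (2 * w)\<bar> * ?f (?g w))"
   unfolding eq using i by (simp add: set_integrable_def)
  show "set_borel_measurable borel (range ?g) ?f"
   unfolding im by (intro set_measurable_continuous_on continuous_intros) auto
 qed (auto intro!: derivative_eq_intros simp: inj_on_def)
 then have 1: "(LINT t:{0<..}|lborel. ?f t) = (LINT w|lborel. ?h w)"
  unfolding eq im by (simp add: set_lebesgue_integral_def)
 have si: "set_integrable lborel (range ?g) ?f"
 proof (rule set_integral_substitution_real(1))
  show "set_integrable lborel UNIV (%w. \<bar>2 * exp (2 * w)\<bar> * ?f (?g w))"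
   unfolding eq using i by (simp add: set_integrable_def)
  show "set_borel_measurable borel (range ?g) ?f"
   unfolding im by (intro set_measurable_continuous_on continuous_intros) auto
 qed (auto intro!: derivative_eq_intros simp: inj_on_def)
 have ind: "indicator {0<..} t *\<^sub>R ?f t = indicator {0..} t *\<^sub>R ?f t" for t
  by (auto simp: indicator_def)
 have si2: "set_integrable lborel {0..} ?f"
  using si unfolding im set_integrable_def ind .
 have "(LINT t:{0<..}|lborel. ?f t) = (LINT t:{0..}|lborel. ?f t)"
  unfolding set_lebesgue_integral_def ind ..
 also have "... = integral {0..} ?f" by (rule set_borel_integral_eq_integral(2)[OF si2])
 also have "... = Gamma x" using Gamma_integral_real[OF x(1)] by (rule integral_unique)
 finally show "(LINT w|lborel. ?h w) = Gamma x" using 1 by simp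
qed

text \<open>The kernel on an isotropic vector: up to the factor -2 / sqrt pi, a reflection and a
  shift of w, this is \<open>psi_term\<close> at a point of the first axis, with x the scaled
  coordinate.\<close>

definition gkern :: "real => real => real" where
 "gkern x w = x * exp w * exp (- ((x * exp w)\<^sup>2))"

lemma gkern_1: "gkern 1 w = exp w * exp (- exp (2 * w))"
 by (simp add: gkern_def exp_double)

lemma gkern_1_bound: "0 <= gkern 1 w" "gkern 1 w <= exp (- abs w)"
 using exp_exp_bound[of "1/2" w] by (simp_all add: gkern_1)

lemma gkern_shift: "x > 0 ==> gkern x (- ln x + w) = gkern 1 w"
proof -
 assume "x > 0"
 then have "x * exp (- ln x + w) = exp w" by (simp add: exp_diff)
 then show ?thesis by (simp add: gkern_def)
qed

lemma borel_measurable_gkern [measurable]: "gkern x \<in> borel_measurable borel"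
 unfolding gkern_def by measurable

lemma integrable_gkern_1:
 "integrable lborel (gkern 1)" "integrable lborel (%w. w * gkern 1 w)"
proof -
 show "integrable lborel (gkern 1)"
  by (rule integrable_dominated[OF integrable_exp_neg_abs[of 1]]) (use gkern_1_bound in auto)
 have b: "\<bar>w * gkern 1 w\<bar> <= 2 * exp (- (1/2) * abs w)" for w
 proof -
  have "\<bar>w * gkern 1 w\<bar> <= (1 / (1/2) * exp (1/2 * abs w)) * exp (- abs w)"
   unfolding abs_mult using gkern_1_bound[of w] by (intro mult_mono abs_le_exp_scaled) auto
  also have "... = 2 * exp (- (1/2) * abs w)" by (simp add: exp_add[symmetric])
  finally show ?thesis .
 qed
 have i: "integrable lborel (%w::real. 2 * exp (- (1/2) * abs w))"
  by (intro integrable_mult_right integrable_exp_neg_abs) auto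
 show "integrable lborel (%w. w * gkern 1 w)"
  by (rule integrable_dominated[OF i]) (use b in auto)
qed

lemma integral_gkern_1: "(LINT w|lborel. gkern 1 w) = sqrt pi / 2"
proof -
 have "Gamma (1/2) = (LINT w|lborel. 2 * gkern 1 w)"
  using Gamma_exp_integral(2)[of "1/2"] by (simp add: gkern_1)
 then show ?thesis by (simp add: Gamma_one_half_real)
qed

lemma abs_exp_minus_1_le: "\<bar>exp x - 1\<bar> <= abs x * exp \<bar>x::real\<bar>"
proof (cases "x >= 0")
 case True
 have "(1 - x) * exp x <= exp (- x) * exp x"
  using exp_ge_add_one_self[of "- x"] by (intro mult_right_mono) auto
 then have "exp x - x * exp x <= 1" by (simp add: exp_minus left_diff_distrib)
 then show ?thesis using True by simp
next
 case False
 have "1 - exp x <= - x" using exp_ge_add_one_self[of x] by linarith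
 also have "... <= abs x * exp \<bar>x\<bar>" using False by (simp add: mult_le_cancel_left1)
 finally show ?thesis using False by simp
qed

text \<open>Differentiation of the Gamma integral at 1/2: the difference quotient of exp(2 x w) in x
  tends to 2 w times the exponential, and dominated convergence passes to the limit.\<close>

lemma integral_times_gkern_1: "(LINT w|lborel. w * gkern 1 w) = deriv Gamma (1/2) / 4"
proof -
 \<comment> \<open>With h <= 1/8 the factor exp(2 h |w|) costs at most exp(|w|/4), and |w| itself
   another exp(|w|/4); the decay exp(-|w|) of \<open>gkern 1\<close> then leaves
   exp(-|w|/2).\<close>
 define h where "h n = 1 / (8 + real n)" for n
 have h: "0 < h n" "h n <= 1/8" for n by (simp_all add: h_def field_simps)
 have "(%n. 1 / (8 + real n)) \<longlonglongrightarrow> 0" by real_asymp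
 then have h0: "filterlim h (at 0) sequentially"
  unfolding filterlim_at h_def[symmetric] using h by (auto intro!: always_eventually simp: less_imp_neq[symmetric])
 have "(Gamma has_field_derivative Gamma (1/2) * Digamma (1/2)) (at (1/2 :: real))"
  by (rule has_field_derivative_Gamma) (auto elim!: nonpos_Ints_cases)
 then have d: "(Gamma has_field_derivative deriv Gamma (1/2)) (at (1/2 :: real))"
  using DERIV_imp_deriv by metis
 then have "((%h. (Gamma (1/2 + h) - Gamma (1/2)) / h) \<longlongrightarrow> deriv Gamma (1/2)) (at (0::real))"
  by (simp add: DERIV_def)
 then have 1: "(%n. (Gamma (1/2 + h n) - Gamma (1/2)) / h n) \<longlonglongrightarrow> deriv Gamma (1/2)"
  using h0 by (rule filterlim_compose)
 define F where "F n w = 2 * gkern 1 w * ((exp (2 * h n * w) - 1) / h n)" for n w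
 have Feq: "(Gamma (1/2 + h n) - Gamma (1/2)) / h n = (LINT w|lborel. F n w)" for n
 proof -
  have x: "0 < 1/2 + h n" "1/2 + h n <= 1" using h[of n] by auto
  have "Gamma (1/2 + h n) - Gamma (1/2) = (LINT w|lborel. 2 * (exp (2 * (1/2 + h n) * w) * exp (- exp (2 * w))) - 2 * (exp (2 * (1/2) * w) * exp (- exp (2 * w))))"
   using Gamma_exp_integral[OF x] Gamma_exp_integral[of "1/2"] by simp
  also have "... = (LINT w|lborel. h n * F n w)"
  proof (rule lebesgue_integral_cong[OF refl])
   fix w
   have "exp (2 * (1/2 + h n) * w) = exp w * exp (2 * h n * w)" by (simp add: exp_add[symmetric] algebra_simps)
   moreover have hF: "h n * F n w = 2 * gkern 1 w * (exp (2 * h n * w) - 1)" using h(1)[of n] by (simp add: F_def)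
   ultimately show "2 * (exp (2 * (1/2 + h n) * w) * exp (- exp (2 * w))) - 2 * (exp (2 * (1/2) * w) * exp (- exp (2 * w))) = h n * F n w"
    unfolding hF gkern_1 by (simp add: algebra_simps)
  qed
  also have "... = h n * (LINT w|lborel. F n w)" by simp
  finally show ?thesis using h(1)[of n] by (simp add: field_simps)
 qed
 have "(%n. LINT w|lborel. F n w) \<longlonglongrightarrow> (LINT w|lborel. 4 * (w * gkern 1 w))"
 proof (rule integral_dominated_convergence[where w="%w::real. 16 * exp (- (1/2) * abs w)"])
  show "AE w in lborel. (%n. F n w) \<longlonglongrightarrow> 4 * (w * gkern 1 w)"
  proof (rule AE_I2)
   fix w :: real
   have "((%x. exp (2 * x * w)) has_field_derivative (2 * w)) (at 0)"
    by (auto intro!: derivative_eq_intros)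
   then have "((%h. (exp (2 * h * w) - 1) / h) \<longlongrightarrow> 2 * w) (at 0)" by (simp add: DERIV_def)
   then have "(%n. (exp (2 * h n * w) - 1) / h n) \<longlonglongrightarrow> 2 * w"
    using h0 by (rule filterlim_compose)
   then have "(%n. F n w) \<longlonglongrightarrow> 2 * gkern 1 w * (2 * w)"
    unfolding F_def by (rule tendsto_mult_left)
   then show "(%n. F n w) \<longlonglongrightarrow> 4 * (w * gkern 1 w)" by (simp add: mult_ac)
  qed
  show "AE w in lborel. norm (F n w) <= 16 * exp (- (1/2) * abs w)" for n
  proof (rule AE_I2)
   fix w :: real
   have "\<bar>exp (2 * h n * w) - 1\<bar> <= \<bar>2 * h n * w\<bar> * exp \<bar>2 * h n * w\<bar>" by (rule abs_exp_minus_1_le)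
   then have "\<bar>(exp (2 * h n * w) - 1) / h n\<bar> <= (2 * abs w) * exp (2 * h n * abs w)"
    using h(1)[of n] by (simp add: abs_mult field_simps)
   also have "... <= (2 * (1 / (1/4) * exp (1/4 * abs w))) * exp (1/4 * abs w)"
   proof (intro mult_mono abs_le_exp_scaled)
    have "2 * h n * abs w <= (1/4) * abs w" using h(2)[of n] by (intro mult_right_mono) auto
    then show "exp (2 * h n * abs w) <= exp (1/4 * abs w)" by simp
   qed auto
   also have "... = 8 * exp (1/2 * abs w)" by (simp add: exp_add[symmetric])
   finally have b: "\<bar>(exp (2 * h n * w) - 1) / h n\<bar> <= 8 * exp (1/2 * abs w)" .
   have "norm (F n w) = 2 * gkern 1 w * \<bar>(exp (2 * h n * w) - 1) / h n\<bar>"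
    unfolding F_def real_norm_def abs_mult using gkern_1_bound(1)[of w] by simp
   also have "... <= (2 * exp (- abs w)) * (8 * exp (1/2 * abs w))"
    using gkern_1_bound[of w] by (intro mult_mono b) auto
   also have "... = 16 * exp (- (1/2) * abs w)" by (simp add: exp_add[symmetric])
   finally show "norm (F n w) <= 16 * exp (- (1/2) * abs w)" .
  qed
  show "integrable lborel (%w::real. 16 * exp (- (1/2) * abs w))"
   by (intro integrable_mult_right integrable_exp_neg_abs) auto
  show "F n \<in> borel_measurable lborel" for n unfolding F_def by measurable
 qed measurable
 then have "(LINT w|lborel. 4 * (w * gkern 1 w)) = deriv Gamma (1/2)"
  using 1 unfolding Feq by (rule LIMSEQ_unique)
 then show ?thesis by simp
qed

text \<open>\<open>gkern x\<close> is a translate of \<open>gkern 1\<close> by - ln x. The total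
  mass is therefore the same for every x > 0, and x enters the first moment only through ln x;
  summed over x this produces the logarithms of Gamma values.\<close>

lemma integral_gkern:
 fixes x p q :: real
 assumes x: "x > 0"
 shows "integrable lborel (%w. gkern x w * (p + q * w))"
  and "(LINT w|lborel. gkern x w * (p + q * w)) = sqrt pi / 2 * (p - q * ln x) + q * (deriv Gamma (1/2) / 4)"
proof -
 let ?f = "%w. gkern x w * (p + q * w)"
 have eq: "?f (- ln x + 1 * w) = (p - q * ln x) * gkern 1 w + q * (w * gkern 1 w)" for w
  using gkern_shift[OF x, of w] by (simp add: algebra_simps)
 have i: "integrable lborel (%w. (p - q * ln x) * gkern 1 w + q * (w * gkern 1 w))"
  using integrable_gkern_1 by simp
 show "integrable lborel ?f"
  using i unfolding eq[symmetric] by (subst (asm) lborel_integrable_real_affine_iff) auto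
 have "(LINT w|lborel. ?f w) = \<bar>1\<bar> *\<^sub>R (LINT w|lborel. ?f (- ln x + 1 * w))"
  by (rule lborel_integral_real_affine) simp
 also have "... = (p - q * ln x) * (LINT w|lborel. gkern 1 w) + q * (LINT w|lborel. w * gkern 1 w)"
  unfolding eq using integrable_gkern_1 by simp
 finally show "(LINT w|lborel. ?f w) = sqrt pi / 2 * (p - q * ln x) + q * (deriv Gamma (1/2) / 4)"
  by (simp add: integral_gkern_1 integral_times_gkern_1 mult.commute)
qed

lemma cube_le_exp: "y >= 0 ==> y ^ 3 <= 27 * exp (y::real)"
proof -
 assume "y >= 0"
 have "(y / 3) ^ 3 <= exp (y / 3) ^ 3"
  using exp_ge_add_one_self[of "y / 3"] \<open>y >= 0\<close> by (intro power_mono) linarith+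
 also have "exp (y / 3) ^ 3 = exp y" by (simp add: exp_of_nat_mult[symmetric])
 finally show ?thesis by (simp add: power_divide)
qed

text \<open>By the mean value theorem the antisymmetric difference is (2 a - 1) f'(xi2) and the unit
  difference is f'(xi1), so the combination is (1 - 2 a)(f'(xi1) - f'(xi2)). It is controlled by the
  second derivative on [m, m + 1], which decays fast enough to be summed over m and integrated over
  w.\<close>

lemma gkern_second_difference:
 fixes a w :: real and m :: nat
 assumes a: "0 < a" "a < 1"
 shows "\<bar>gkern (real m + a) w - gkern (real m + 1 - a) w + (1 - 2 * a) * (gkern (real m + 1) w - gkern (real m) w)\<bar>
   <= 114 * exp 1 * ((exp w)\<^sup>2 * exp (- real m * exp w))"
proof -
 define r where "r = exp w"
 have r: "r > 0" by (simp add: r_def)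
 define f where "f x = x * r * exp (- ((x * r)\<^sup>2))" for x
 define f' where "f' x = (r - 2 * r * (x * r)\<^sup>2) * exp (- ((x * r)\<^sup>2))" for x
 define f'' where "f'' x = r^2 * ((4 * (x * r) ^ 3 - 6 * (x * r)) * exp (- ((x * r)\<^sup>2)))" for x
 have d1: "(f has_field_derivative f' x) (at x)" for x
  unfolding f_def f'_def by (auto intro!: derivative_eq_intros simp: algebra_simps power2_eq_square)
 have d2: "(f' has_field_derivative f'' x) (at x)" for x
  unfolding f'_def f''_def by (auto intro!: derivative_eq_intros simp: algebra_simps power2_eq_square power3_eq_cube)
 \<comment> \<open>114 = 4 * 27 + 6: the cubic in the second derivative is estimated by
   \<open>cube_le_exp\<close> and the linear term by exp y. The factor exp 1 comes from y - y^2 <= 1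
   - y.\<close>
 define B where "B = 114 * exp 1 * (r^2 * exp (- real m * r))"
 have bd: "\<bar>f'' x\<bar> <= B" if x: "real m <= x" for x
 proof -
  define y where "y = x * r"
  have y: "y >= 0" using r x by (simp add: y_def)
  have "\<bar>4 * y ^ 3 - 6 * y\<bar> <= 4 * y ^ 3 + 6 * y" using y by (auto simp: abs_le_iff)
  also have "... <= 4 * (27 * exp y) + 6 * exp y"
   using cube_le_exp[OF y] exp_ge_add_one_self[of y] by linarith
  finally have 1: "\<bar>4 * y ^ 3 - 6 * y\<bar> <= 114 * exp y" by simp
  have "(y - 1)\<^sup>2 >= 0" by simp
  then have "y + - (y^2) <= 1 + - y" by (simp add: power2_diff)
  then have 2: "exp y * exp (- (y^2)) <= exp 1 * exp (- y)" unfolding exp_add[symmetric] by simp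
  have "real m * r <= y" unfolding y_def using x r by simp
  then have 3: "exp (- y) <= exp (- real m * r)" by simp
  have "\<bar>(4 * y ^ 3 - 6 * y) * exp (- (y^2))\<bar> <= 114 * exp y * exp (- (y^2))"
   unfolding abs_mult using 1 by simp
  also have "... <= 114 * (exp 1 * exp (- y))" using 2 by simp
  also have "... <= 114 * (exp 1 * exp (- real m * r))" using 3 by simp
  finally have "r\<^sup>2 * \<bar>(4 * y ^ 3 - 6 * y) * exp (- (y^2))\<bar> <= r^2 * (114 * (exp 1 * exp (- real m * r)))"
   by (rule mult_left_mono) simp
  then show ?thesis unfolding f''_def B_def y_def by (simp add: abs_mult mult_ac)
 qed
 have mvt: "\<exists>\<xi>. real m <= \<xi> \<and> \<xi> <= real m + 1 \<and> f u - f v = (u - v) * f' \<xi>"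
  if "real m <= v" "v <= u" "u <= real m + 1" for u v
 proof (cases "v = u")
  case False
  then have "v < u" using that by simp
  from MVT2[OF this d1] obtain \<xi> where "v < \<xi>" "\<xi> < u" "f u - f v = (u - v) * f' \<xi>" by blast
  then show ?thesis using that by (intro exI[of _ \<xi>]) auto
 qed (use that in \<open>auto intro!: exI[of _ "real m"]\<close>)
 have mvt2: "\<bar>f' u - f' v\<bar> <= B" if "real m <= u" "u <= real m + 1" "real m <= v" "v <= real m + 1" for u v
 proof -
  have *: "\<bar>f' u - f' v\<bar> <= B" if "real m <= v" "v < u" "u <= real m + 1" for u v
  proof -
   from MVT2[OF that(2) d2] obtain \<xi> where \<xi>: "v < \<xi>" "\<xi> < u" "f' u - f' v = (u - v) * f'' \<xi>" by blast
   have "\<bar>f' u - f' v\<bar> = (u - v) * \<bar>f'' \<xi>\<bar>" unfolding \<xi>(3) abs_mult using that by simp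
   also have "... <= 1 * B" using bd[of \<xi>] \<xi> that by (intro mult_mono) auto
   finally show ?thesis by simp
  qed
  have "B >= 0" unfolding B_def by simp
  then show ?thesis using *[of u v] *[of v u] that by (cases u v rule: linorder_cases) (auto simp: abs_minus_commute)
 qed
 obtain \<xi>1 where \<xi>1: "real m <= \<xi>1" "\<xi>1 <= real m + 1" "f (real m + 1) - f (real m) = f' \<xi>1"
  using mvt[of "real m" "real m + 1"] by auto
 obtain \<xi>2 where \<xi>2: "real m <= \<xi>2" "\<xi>2 <= real m + 1" "f (real m + a) - f (real m + 1 - a) = (2 * a - 1) * f' \<xi>2"
 proof (cases "a >= 1/2")
  case True
  from mvt[of "real m + 1 - a" "real m + a"] True a obtain \<xi> where "real m <= \<xi>" "\<xi> <= real m + 1"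
   "f (real m + a) - f (real m + 1 - a) = ((real m + a) - (real m + 1 - a)) * f' \<xi>" by auto
  moreover have "(real m + a) - (real m + 1 - a) = 2 * a - 1" by simp
  ultimately show ?thesis using that by metis
 next
  case False
  from mvt[of "real m + a" "real m + 1 - a"] False a obtain \<xi> where \<xi>: "real m <= \<xi>" "\<xi> <= real m + 1"
   "f (real m + 1 - a) - f (real m + a) = ((real m + 1 - a) - (real m + a)) * f' \<xi>" by auto
  have "f (real m + a) - f (real m + 1 - a) = (2 * a - 1) * f' \<xi>"
   using \<xi>(3) by (simp add: algebra_simps)
  then show ?thesis using that \<xi> by blast
 qed
 have "f (real m + a) - f (real m + 1 - a) + (1 - 2 * a) * (f (real m + 1) - f (real m)) = (1 - 2 * a) * (f' \<xi>1 - f' \<xi>2)"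
  unfolding \<xi>1 \<xi>2 by (simp add: algebra_simps)
 also have "abs ... <= 1 * B"
  unfolding abs_mult using mvt2[of \<xi>1 \<xi>2] \<xi>1 \<xi>2 a by (intro mult_mono) auto
 finally show ?thesis unfolding B_def f_def gkern_def r_def by simp
qed

lemma gkern_tendsto_0: "(%n. gkern (real n) w) \<longlonglongrightarrow> 0"
proof -
 have "((%x. x * r * exp (- ((x * r)\<^sup>2))) \<longlongrightarrow> 0) at_top" if "r > 0" for r :: real
  using that by real_asymp
 from filterlim_compose[OF this[of "exp w"] filterlim_real_sequentially] show ?thesis
  by (simp add: gkern_def)
qed

text \<open>The corrections (1 - 2 a)(gkern(m + 1) - gkern m) telescope, and gkern m tends to 0.
  Hence the limit differs from the corrected partial sum by the tail of the second differences,
  which a geometric series bounds.\<close>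

lemma gkern_tail_bound:
 fixes a w :: real and S :: real
 assumes a: "0 < a" "a < 1"
  and S: "(%M. \<Sum>m<M. gkern (real m + a) w - gkern (real m + 1 - a) w) \<longlonglongrightarrow> S"
 shows "\<bar>S - ((\<Sum>m<M. gkern (real m + a) w - gkern (real m + 1 - a) w) + (1 - 2 * a) * gkern (real M) w)\<bar>
   <= 114 * exp 1 * (((exp w)\<^sup>2 + exp w) * exp (- real M * exp w))"
proof -
 define T where "T M = (\<Sum>m<M. gkern (real m + a) w - gkern (real m + 1 - a) w)" for M :: nat
 define r where "r = exp w"
 have r: "r > 0" by (simp add: r_def)
 define B where "B = 114 * exp 1 * ((r^2 + r) * exp (- real M * r))"
 define D where "D m = gkern (real m + a) w - gkern (real m + 1 - a) w + (1 - 2 * a) * (gkern (real m + 1) w - gkern (real m) w)" for m :: nat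
 have Ds: "T (M + k) + (1 - 2 * a) * gkern (real (M + k)) w = T M + (1 - 2 * a) * gkern (real M) w + (\<Sum>j<k. D (M + j))" for k
 proof (induction k)
  case (Suc k)
  have "T (M + Suc k) = T (M + k) + (gkern (real (M + k) + a) w - gkern (real (M + k) + 1 - a) w)"
   by (simp add: T_def)
  moreover have "real (M + Suc k) = real (M + k) + 1" by simp
  ultimately show ?case using Suc.IH unfolding D_def sum.lessThan_Suc by (simp only:) (simp add: algebra_simps)
 qed simp
 \<comment> \<open>The bound 1 + 1/r for the geometric series follows from exp(-r)(1 + r) <= 1; the
   term 1/r turns r^2 into the summand r = exp w in the final bound.\<close>
 have geo: "(\<Sum>j<k. exp (- real j * r)) <= 1 + 1 / r" for k
 proof -
  have q: "exp (- r) < 1" using r by simp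
  have "(\<Sum>j<k. exp (- real j * r)) = (\<Sum>j<k. exp (- r) ^ j)" by (simp add: exp_of_nat_mult[symmetric])
  also have "... = (1 - exp (- r) ^ k) / (1 - exp (- r))" using q by (simp add: sum_gp_strict)
  also have "... <= 1 / (1 - exp (- r))" using q by (intro divide_right_mono) auto
  also have "... <= 1 + 1 / r"
  proof -
   have "exp (- r) * (1 + r) <= exp (- r) * exp r" by (intro mult_left_mono exp_ge_add_one_self) auto
   then have "exp (- r) * (1 + r) <= 1" by (simp add: exp_minus)
   then have "r <= (1 + r) * (1 - exp (- r))" by (simp add: algebra_simps)
   then show ?thesis using r q by (simp add: field_simps)
  qed
  finally show ?thesis .
 qed
 have Db: "\<bar>\<Sum>j<k. D (M + j)\<bar> <= B" for k
 proof -
  have "\<bar>\<Sum>j<k. D (M + j)\<bar> <= (\<Sum>j<k. \<bar>D (M + j)\<bar>)" by (rule sum_abs)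
  also have "... <= (\<Sum>j<k. 114 * exp 1 * (r^2 * exp (- real M * r)) * exp (- real j * r))"
  proof (rule sum_mono)
   fix j
   have "\<bar>D (M + j)\<bar> <= 114 * exp 1 * (r^2 * exp (- real (M + j) * r))"
    unfolding D_def r_def by (rule gkern_second_difference[OF a])
   also have "exp (- real (M + j) * r) = exp (- real M * r) * exp (- real j * r)"
    by (simp add: exp_add[symmetric] algebra_simps)
   finally show "\<bar>D (M + j)\<bar> <= 114 * exp 1 * (r^2 * exp (- real M * r)) * exp (- real j * r)" by (simp only: mult.assoc)
  qed
  also have "... = 114 * exp 1 * (r^2 * exp (- real M * r)) * (\<Sum>j<k. exp (- real j * r))" by (rule sum_distrib_left[symmetric])
  also have "... <= 114 * exp 1 * (r^2 * exp (- real M * r)) * (1 + 1 / r)" by (intro mult_left_mono geo) simp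
  also have "... = B" unfolding B_def using r by (simp add: field_simps power2_eq_square)
  finally show ?thesis .
 qed
 have "(%k. T (k + M) + (1 - 2 * a) * gkern (real (k + M)) w) \<longlonglongrightarrow> S + (1 - 2 * a) * 0"
  by (intro tendsto_intros LIMSEQ_ignore_initial_segment[OF S[folded T_def]] LIMSEQ_ignore_initial_segment[OF gkern_tendsto_0])
 then have "(%k. T (M + k) + (1 - 2 * a) * gkern (real (M + k)) w - (T M + (1 - 2 * a) * gkern (real M) w)) \<longlonglongrightarrow>
   S - (T M + (1 - 2 * a) * gkern (real M) w)"
  by (intro tendsto_intros) (simp add: add.commute)
 then have "(%k. \<Sum>j<k. D (M + j)) \<longlonglongrightarrow> S - (T M + (1 - 2 * a) * gkern (real M) w)"
  unfolding Ds by simp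
 then have "(%k. \<bar>\<Sum>j<k. D (M + j)\<bar>) \<longlonglongrightarrow> \<bar>S - (T M + (1 - 2 * a) * gkern (real M) w)\<bar>"
  by (rule tendsto_rabs)
 then have "\<bar>S - (T M + (1 - 2 * a) * gkern (real M) w)\<bar> <= B"
  by (rule LIMSEQ_le_const2) (use Db in auto)
 then show ?thesis unfolding T_def B_def r_def .
qed

text \<open>One integrable function of w that dominates the tail bound for all M >= 1. For w < 0 the
  factor exp w decays; for w >= 0 the double exponential does, by
  \<open>cube_le_exp\<close>.\<close>

lemma gkern_tail_majorant:
 fixes w :: real
 assumes "M >= 1"
 shows "((exp w)\<^sup>2 + exp w) * exp (- real M * exp w) <= 54 * exp (- abs w)"
proof (cases "w >= 0")
 case True
 have "exp w * 1 <= real M * exp w" using assms by simp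
 then have "exp (- real M * exp w) <= exp (- exp w)" by simp
 also have "... <= 27 * exp (- 3 * w)"
 proof -
  have "exp w ^ 3 <= 27 * exp (exp w)" by (rule cube_le_exp) simp
  then have "exp (3 * w) <= 27 * exp (exp w)" by (simp add: exp_of_nat_mult[symmetric])
  then show ?thesis by (simp add: exp_minus field_simps)
 qed
 finally have 1: "exp (- real M * exp w) <= 27 * exp (- 3 * w)" .
 have "exp w * 1 <= exp w * exp w" using True by (intro mult_left_mono) auto
 then have 2: "(exp w)\<^sup>2 + exp w <= 2 * exp (2 * w)" by (simp add: exp_double power2_eq_square)
 have "((exp w)\<^sup>2 + exp w) * exp (- real M * exp w) <= (2 * exp (2 * w)) * (27 * exp (- 3 * w))"
  by (intro mult_mono 1 2) auto
 also have "... = 54 * exp (- w)" by (simp add: exp_add[symmetric])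
 finally show ?thesis using True by simp
next
 case False
 have "(exp w)\<^sup>2 <= exp w" using False by (simp add: power2_eq_square mult_le_cancel_left1)
 then have "((exp w)\<^sup>2 + exp w) * exp (- real M * exp w) <= (2 * exp w) * 1"
  by (intro mult_mono) auto
 also have "... <= 54 * exp (- abs w)" using False by simp
 finally show ?thesis .
qed

text \<open>Euler's limit for ln Gamma contains the same sum of ln(m + z), the factor with m = 0
  included, hence Suc n terms. The sum of the ln k is common to a and 1 - a and cancels.\<close>

lemma sum_ln_shift:
 fixes a :: real
 assumes a: "0 < a" "a < 1" and n: "n > 0"
 shows "(\<Sum>m<Suc n. ln (real m + 1 - a) - ln (real m + a)) = ln_Gamma_series a n - ln_Gamma_series (1 - a) n + (1 - 2 * a) * ln (real n)"
proof -
 have *: "ln_Gamma_series z n = z * ln (real n) - (\<Sum>m<Suc n. ln (real m + z)) + (\<Sum>k=1..n. ln (real k))" if "z > 0" for z :: real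
 proof -
  have "(\<Sum>m<Suc n. ln (real m + z)) = ln z + (\<Sum>k=1..n. ln (real k + z))"
   by (subst sum.lessThan_Suc_shift) (simp add: sum.atLeast1_atMost_eq)
  also have "(\<Sum>k=1..n. ln (real k + z)) = (\<Sum>k=1..n. ln (z / real k + 1) + ln (real k))"
  proof (intro sum.cong refl)
   fix k assume "k \<in> {1..n}"
   then have k: "real k > 0" by simp
   then have "real k + z = (z / real k + 1) * real k" by (simp add: field_simps)
   moreover have "z / real k + 1 > 0" using k that by (simp add: add_pos_pos)
   ultimately show "ln (real k + z) = ln (z / real k + 1) + ln (real k)" using k by (simp add: ln_mult)
  qed
  finally show ?thesis by (simp add: ln_Gamma_series_def sum.distrib)
 qed
 have "(\<Sum>m<Suc n. ln (real m + 1 - a) - ln (real m + a)) = (\<Sum>m<Suc n. ln (real m + (1 - a))) - (\<Sum>m<Suc n. ln (real m + a))"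
  unfolding sum_subtractf[symmetric] by (simp add: add_diff_eq)
 also have "... = ln_Gamma_series a n - ln_Gamma_series (1 - a) n + (1 - 2 * a) * ln (real n)"
  using *[of a] *[of "1 - a"] a by (simp add: algebra_simps)
 finally show ?thesis .
qed

text \<open>The divergence \<open>(1 - 2 a) ln M\<close> of the integrated partial sums is cancelled by the correction
 \<open>(1 - 2 a) gkern M\<close>; what remains of them converges to \<open>ln \<Gamma>(a) - ln \<Gamma>(1 - a)\<close>.\<close>

theorem hurwitz_theta_integral:
 fixes a p q :: real and S :: "real => real"
 assumes a: "0 < a" "a < 1"
  and S: "\<And>w. (%M. \<Sum>m<M. gkern (real m + a) w - gkern (real m + 1 - a) w) \<longlonglongrightarrow> S w"
 shows "integrable lborel (%w. S w * (p + q * w))"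
  and "(LINT w|lborel. S w * (p + q * w)) = (1 - 2 * a) * (sqrt pi / 2 * p + q * (deriv Gamma (1/2) / 4))
    + sqrt pi / 2 * q * (ln (Gamma a) - ln (Gamma (1 - a)))"
proof -
 define T where "T M w = (\<Sum>m<M. gkern (real m + a) w - gkern (real m + 1 - a) w) + (1 - 2 * a) * gkern (real M) w" for M :: nat and w
 \<comment> \<open>The index Suc n keeps the number of terms at least 1, as
   \<open>gkern_tail_majorant\<close> requires.\<close>
 define H where "H n w = T (Suc n) w * (p + q * w)" for n w
 define A L where "A = sqrt pi / 2" and "L = deriv Gamma (1/2 :: real) / 4"
 define C where "C = 114 * exp 1 * (54 :: real)"
 have tail: "\<bar>S w - T M w\<bar> <= 114 * exp 1 * (((exp w)\<^sup>2 + exp w) * exp (- real M * exp w))" for M w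
  unfolding T_def by (rule gkern_tail_bound[OF a S])
 have tail2: "\<bar>S w - T (Suc n) w\<bar> <= C * exp (- abs w)" for n w
 proof -
  have "114 * exp 1 * (((exp w)\<^sup>2 + exp w) * exp (- real (Suc n) * exp w)) <= 114 * exp 1 * (54 * exp (- abs w))"
   by (intro mult_left_mono gkern_tail_majorant) auto
  then show ?thesis using tail[of w "Suc n"] unfolding C_def by (simp only: mult.assoc)
 qed
 have Tint: "integrable lborel (H n)" "(LINT w|lborel. H n w) =
   (\<Sum>m<Suc n. (A * (p - q * ln (real m + a)) + q * L) - (A * (p - q * ln (real m + 1 - a)) + q * L)) + (1 - 2 * a) * (A * (p - q * ln (real (Suc n))) + q * L)" for n
 proof -
  have Heq: "H n = (%w. (\<Sum>m<Suc n. gkern (real m + a) w * (p + q * w) - gkern (real m + 1 - a) w * (p + q * w)) + (1 - 2 * a) * (gkern (real (Suc n)) w * (p + q * w)))"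
   by (rule ext) (simp only: H_def T_def distrib_right sum_distrib_right left_diff_distrib mult.assoc)
  have i: "integrable lborel (%w. gkern (real m + a) w * (p + q * w))" "integrable lborel (%w. gkern (real m + 1 - a) w * (p + q * w))"
   "integrable lborel (%w. gkern (real (Suc n)) w * (p + q * w))" for m
   using a by (intro integral_gkern(1); simp add: add_pos_pos add_nonneg_pos)+
  have v: "(LINT w|lborel. gkern (real m + a) w * (p + q * w)) = A * (p - q * ln (real m + a)) + q * L"
    "(LINT w|lborel. gkern (real m + 1 - a) w * (p + q * w)) = A * (p - q * ln (real m + 1 - a)) + q * L"
    "(LINT w|lborel. gkern (real (Suc n)) w * (p + q * w)) = A * (p - q * ln (real (Suc n))) + q * L" for m
   unfolding A_def L_def using a by (intro integral_gkern(2); simp add: add_pos_pos add_nonneg_pos)+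
  show "integrable lborel (H n)" unfolding Heq
   by (intro Bochner_Integration.integrable_add Bochner_Integration.integrable_sum Bochner_Integration.integrable_diff integrable_mult_right i)
  show "(LINT w|lborel. H n w) =
   (\<Sum>m<Suc n. (A * (p - q * ln (real m + a)) + q * L) - (A * (p - q * ln (real m + 1 - a)) + q * L)) + (1 - 2 * a) * (A * (p - q * ln (real (Suc n))) + q * L)"
   unfolding Heq
   by (subst Bochner_Integration.integral_add, intro Bochner_Integration.integrable_sum Bochner_Integration.integrable_diff i, intro integrable_mult_right i,
     subst Bochner_Integration.integral_sum, intro Bochner_Integration.integrable_diff i,
     subst Bochner_Integration.integral_diff, rule i, rule i, simp only: v integral_mult_right_zero)
 qed
 have Smeas: "S \<in> borel_measurable lborel"
  by (rule borel_measurable_LIMSEQ_real[OF S]) measurable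
 have bint: "integrable lborel (%w. \<bar>p + q * w\<bar> * (C * exp (- abs w)))"
 proof (rule integrable_dominated)
  show "integrable lborel (%w. (abs p + 2 * abs q) * C * exp (- (1/2) * abs w))"
   by (intro integrable_mult_right integrable_exp_neg_abs) auto
  have "\<bar>p + q * w\<bar> * (C * exp (- abs w)) <= (abs p + 2 * abs q) * C * exp (- (1/2) * abs w)" for w
  proof -
   have "abs w <= 1 / (1/2) * exp (1/2 * abs w)" by (rule abs_le_exp_scaled) simp
   then have "abs q * abs w <= abs q * (2 * exp (1/2 * abs w))" by (intro mult_left_mono) auto
   moreover have "abs p * 1 <= abs p * exp (1/2 * abs w)" by (intro mult_left_mono) auto
   moreover have "\<bar>p + q * w\<bar> <= abs p + abs q * abs w" using abs_triangle_ineq[of p "q * w"] by (simp add: abs_mult)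
   ultimately have "\<bar>p + q * w\<bar> <= (abs p + 2 * abs q) * exp (1/2 * abs w)" by (simp add: algebra_simps)
   then have "\<bar>p + q * w\<bar> * (C * exp (- abs w)) <= (abs p + 2 * abs q) * exp (1/2 * abs w) * (C * exp (- abs w))"
    by (rule mult_right_mono) (simp add: C_def)
   also have "... = (abs p + 2 * abs q) * C * (exp (1/2 * abs w) * exp (- abs w))" by (simp only: mult_ac)
   also have "exp (1/2 * abs w) * exp (- abs w) = exp (- (1/2) * abs w)" by (simp add: exp_add[symmetric])
   finally show ?thesis .
  qed
  then show "AE w in lborel. norm (\<bar>p + q * w\<bar> * (C * exp (- abs w))) <= norm ((abs p + 2 * abs q) * C * exp (- (1/2) * abs w))"
   by (intro AE_I2) (simp add: C_def abs_mult)
 qed measurable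
 have Hdiff: "\<bar>S w * (p + q * w) - H n w\<bar> <= \<bar>p + q * w\<bar> * (C * exp (- abs w))" for n w
 proof -
  have "S w * (p + q * w) - H n w = (p + q * w) * (S w - T (Suc n) w)" by (simp add: H_def algebra_simps)
  then show ?thesis using mult_left_mono[OF tail2[of w n], of "\<bar>p + q * w\<bar>"] by (simp add: abs_mult)
 qed
 show Sint: "integrable lborel (%w. S w * (p + q * w))"
 proof (rule integrable_dominated)
  show "integrable lborel (%w. \<bar>H 0 w\<bar> + \<bar>p + q * w\<bar> * (C * exp (- abs w)))"
   by (intro Bochner_Integration.integrable_add integrable_abs Tint bint)
  show "AE w in lborel. norm (S w * (p + q * w)) <= norm (\<bar>H 0 w\<bar> + \<bar>p + q * w\<bar> * (C * exp (- abs w)))"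
  proof (rule AE_I2)
   fix w
   have "\<bar>S w * (p + q * w)\<bar> <= \<bar>H 0 w\<bar> + \<bar>S w * (p + q * w) - H 0 w\<bar>" by linarith
   then show "norm (S w * (p + q * w)) <= norm (\<bar>H 0 w\<bar> + \<bar>p + q * w\<bar> * (C * exp (- abs w)))"
    using Hdiff[of w 0] by simp
  qed
 qed (use Smeas in measurable)
 have "(%n. LINT w|lborel. H n w) \<longlonglongrightarrow> (LINT w|lborel. S w * (p + q * w))"
 proof (rule integral_dominated_convergence[where w="%w. \<bar>S w * (p + q * w)\<bar> + \<bar>p + q * w\<bar> * (C * exp (- abs w))"])
  show "integrable lborel (%w. \<bar>S w * (p + q * w)\<bar> + \<bar>p + q * w\<bar> * (C * exp (- abs w)))"
   by (intro Bochner_Integration.integrable_add integrable_abs Sint bint)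
  show "AE w in lborel. norm (H n w) <= \<bar>S w * (p + q * w)\<bar> + \<bar>p + q * w\<bar> * (C * exp (- abs w))" for n
  proof (rule AE_I2)
   fix w
   have "\<bar>H n w\<bar> <= \<bar>S w * (p + q * w)\<bar> + \<bar>S w * (p + q * w) - H n w\<bar>" by linarith
   then show "norm (H n w) <= \<bar>S w * (p + q * w)\<bar> + \<bar>p + q * w\<bar> * (C * exp (- abs w))"
    using Hdiff[of w n] by simp
  qed
  show "AE w in lborel. (%n. H n w) \<longlonglongrightarrow> S w * (p + q * w)"
  proof (rule AE_I2)
   fix w :: real
   have l: "((%x. 114 * exp 1 * ((r^2 + r) * exp (- x * r))) \<longlongrightarrow> 0) at_top" if "r > 0" for r :: real
    using that by real_asymp
   have "(%n. 114 * exp 1 * (((exp w)\<^sup>2 + exp w) * exp (- real n * exp w))) \<longlonglongrightarrow> 0"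
    using filterlim_compose[OF l[of "exp w"] filterlim_real_sequentially] by simp
   then have "(%n. S w - T n w) \<longlonglongrightarrow> 0"
    by (rule Lim_null_comparison[rotated]) (use tail in auto)
   then have "(%n. S w - (S w - T n w)) \<longlonglongrightarrow> S w - 0" by (intro tendsto_intros)
   then have "(%n. T (Suc n) w) \<longlonglongrightarrow> S w" using LIMSEQ_Suc by fastforce
   then show "(%n. H n w) \<longlonglongrightarrow> S w * (p + q * w)"
    unfolding H_def by (rule tendsto_mult_right)
  qed
  show "H n \<in> borel_measurable lborel" for n using Tint(1) by (rule borel_measurable_integrable)
  show "(%w. S w * (p + q * w)) \<in> borel_measurable lborel" using Sint by (rule borel_measurable_integrable)
 qed
 moreover have "(%n. LINT w|lborel. H n w) \<longlonglongrightarrow> (1 - 2 * a) * (A * p + q * L) + A * q * (ln (Gamma a) - ln (Gamma (1 - a)))"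
 proof -
  \<comment> \<open>The sum of logarithms produces ln n, the correction term ln(n + 1); their
    difference is kept explicitly and tends to 0.\<close>
  have ev: "(LINT w|lborel. H n w) = (1 - 2 * a) * (A * p + q * L) + A * q * (ln_Gamma_series a n - ln_Gamma_series (1 - a) n)
    + A * q * (1 - 2 * a) * (ln (real n) - ln (real (Suc n)))" if "n > 0" for n
  proof -
   have "(\<Sum>m<Suc n. (A * (p - q * ln (real m + a)) + q * L) - (A * (p - q * ln (real m + 1 - a)) + q * L)) =
    (\<Sum>m<Suc n. A * q * (ln (real m + 1 - a) - ln (real m + a)))"
    by (intro sum.cong refl) (simp add: algebra_simps)
   also have "... = A * q * (ln_Gamma_series a n - ln_Gamma_series (1 - a) n + (1 - 2 * a) * ln (real n))"
    unfolding sum_distrib_left[symmetric] sum_ln_shift[OF a that] ..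
   finally show ?thesis unfolding Tint(2) by (simp add: algebra_simps)
  qed
  have lg: "ln_Gamma_series z \<longlonglongrightarrow> ln (Gamma z)" if "z > 0" for z :: real
   using ln_Gamma_real_LIMSEQ[OF that] ln_Gamma_real_pos[OF that] by simp
  have ll: "(%n. ln (real n) - ln (real (Suc n))) \<longlonglongrightarrow> 0" by real_asymp
  have "(%n. (1 - 2 * a) * (A * p + q * L) + A * q * (ln_Gamma_series a n - ln_Gamma_series (1 - a) n)
    + A * q * (1 - 2 * a) * (ln (real n) - ln (real (Suc n)))) \<longlonglongrightarrow>
    (1 - 2 * a) * (A * p + q * L) + A * q * (ln (Gamma a) - ln (Gamma (1 - a))) + A * q * (1 - 2 * a) * 0"
   by (intro tendsto_add tendsto_mult tendsto_const tendsto_diff[OF lg lg] ll) (use a in auto)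
  moreover have "eventually (%n. (1 - 2 * a) * (A * p + q * L) + A * q * (ln_Gamma_series a n - ln_Gamma_series (1 - a) n)
    + A * q * (1 - 2 * a) * (ln (real n) - ln (real (Suc n))) = (LINT w|lborel. H n w)) sequentially"
   using eventually_gt_at_top[of 0] by eventually_elim (use ev in simp)
  ultimately show ?thesis using Lim_transform_eventually by fastforce
 qed
 ultimately have "(LINT w|lborel. S w * (p + q * w)) = (1 - 2 * a) * (A * p + q * L) + A * q * (ln (Gamma a) - ln (Gamma (1 - a)))"
  by (rule LIMSEQ_unique)
 then show "(LINT w|lborel. S w * (p + q * w)) = (1 - 2 * a) * (sqrt pi / 2 * p + q * (deriv Gamma (1/2) / 4))
    + sqrt pi / 2 * q * (ln (Gamma a) - ln (Gamma (1 - a)))"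
  unfolding A_def L_def .
qed

section \<open>The theta kernel\<close>

text \<open>The derivative of the kernel of \<open>tTheta\<close> in w = ln t. The phase, which
  involves Re tau alone, is separated from a real factor, so that absolute values are
  immediate.\<close>

definition psi_term :: "nat => complex => real => int \<times> int => complex" where
 "psi_term N \<tau> t X = of_real (2 * sqrt (Im \<tau> / real N) * (x2 X * t - x1 X / t) *
   exp (- pi * Im \<tau> / real N * ((x1 X)\<^sup>2 / t^2 + (x2 X)\<^sup>2 * t^2))) *
   ee (- of_real (of_int (fst X * snd X) * Re \<tau> / real N))"

definition Psi :: "nat => int \<times> int => complex => real => complex" where
 "Psi N h \<tau> t = (\<Sum>\<^sub>\<infinity>X\<in>lat_coset N h. psi_term N \<tau> t X)"

lemma norm_psi_term:
 assumes "Im \<tau> > 0"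
 shows "norm (psi_term N \<tau> t X) = 2 * sqrt (Im \<tau> / real N) * \<bar>x2 X * t - x1 X / t\<bar> *
   exp (- pi * Im \<tau> / real N * ((x1 X)\<^sup>2 / t^2 + (x2 X)\<^sup>2 * t^2))"
 using assms by (simp only: psi_term_def norm_mult norm_of_real norm_ee) (simp add: abs_mult)

lemma exp_neg_square_le:
 fixes c d x :: real
 assumes "c > 0"
 shows "exp (- c * x^2) <= exp (d^2 / (4 * c)) * exp (- d * abs x)"
proof -
 have "0 <= c * (abs x - d / (2 * c))\<^sup>2" using assms by simp
 also have "... = c * x^2 - d * abs x + d^2 / (4 * c)"
  using assms by (simp add: power2_diff field_simps power2_eq_square)
 finally have "- c * x^2 <= d^2 / (4 * c) + - d * abs x" by simp
 then show ?thesis unfolding exp_add[symmetric] by simp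
qed

lemma summable_exp_abs_pair:
 fixes d :: real
 assumes "d > 0"
 shows "(%X::int \<times> int. exp (- d * \<bar>x1 X\<bar>) * exp (- d * \<bar>x2 X\<bar>)) summable_on A"
proof -
 have "(%X::int \<times> int. exp (- d * \<bar>x1 X\<bar>) * exp (- d * \<bar>x2 X\<bar>)) summable_on UNIV \<times> UNIV"
  by (rule summable_on_times_nonneg) (use summable_on_exp_abs_int[OF assms] in auto)
 then show ?thesis by (rule summable_on_subset) auto
qed

text \<open>Uniformity for t in a compact range is what the Weierstrass test needs. It cannot extend
  to all t, because on the axes the decay in one coordinate is lost as t tends to 0 or
  infinity.\<close>

lemma psi_term_bound:
 assumes N: "N > 0" and v: "Im \<tau> > 0" and T: "T > 0"
 shows "\<exists>C\<ge>0. \<forall>t X. 1 / T <= t --> t <= T -->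
   norm (psi_term N \<tau> t X) <= C * (exp (- 1 * \<bar>x1 X\<bar>) * exp (- 1 * \<bar>x2 X\<bar>))"
proof -
 define c where "c = pi * Im \<tau> / (real N * T\<^sup>2)"
 have c: "c > 0" using assms by (simp add: c_def)
 \<comment> \<open>Each Gaussian is bounded through its square completed at slope 2; one unit of
   that exponential decay is spent on the linear factor.\<close>
 define C where "C = 2 * sqrt (Im \<tau> / real N) * T * (exp (2\<^sup>2 / (4 * c)) * exp (2\<^sup>2 / (4 * c)))"
 have C0: "C >= 0" using assms by (simp add: C_def)
 have "norm (psi_term N \<tau> t X) <= C * (exp (- 1 * \<bar>x1 X\<bar>) * exp (- 1 * \<bar>x2 X\<bar>))"
  if t: "1 / T <= t" "t <= T" for t and X :: "int \<times> int"
 proof -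
  define x y where "x = real_of_int (fst X)" and "y = real_of_int (snd X)"
  have t0: "t > 0" using t(1) T by (meson divide_pos_pos less_le_trans zero_less_one)
  have it: "1 / t <= T" using t T t0 by (simp add: field_simps)
  have "\<bar>y * t - x / t\<bar> <= abs y * t + abs x * (1 / t)" using abs_triangle_ineq4[of "y * t" "x / t"] t0 by (simp add: abs_mult)
  also have "... <= abs y * T + abs x * T" using t it by (intro add_mono mult_left_mono) auto
  also have "... <= T * (exp \<bar>x\<bar> * exp \<bar>y\<bar>)"
  proof -
   have "abs x + abs y <= exp (abs x + abs y)" using exp_ge_add_one_self[of "abs x + abs y"] by linarith
   then have "T * (abs x + abs y) <= T * exp (abs x + abs y)" using T by (intro mult_left_mono) auto
   then show ?thesis by (simp add: exp_add algebra_simps)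
  qed
  finally have 1: "\<bar>y * t - x / t\<bar> <= T * (exp \<bar>x\<bar> * exp \<bar>y\<bar>)" .
  have "1 / T\<^sup>2 <= 1 / t^2" using t t0 by (intro divide_left_mono power_mono) auto
  then have a: "x\<^sup>2 * (1 / T\<^sup>2) <= x^2 * (1 / t^2)" by (intro mult_left_mono) auto
  have "(1 / T)\<^sup>2 <= t^2" using t T by (intro power_mono) auto
  then have b: "y\<^sup>2 * (1 / T\<^sup>2) <= y^2 * t^2" by (intro mult_left_mono) (auto simp: power_divide)
  have "pi * Im \<tau> / real N * (x^2 * (1 / T\<^sup>2) + y^2 * (1 / T\<^sup>2)) <= pi * Im \<tau> / real N * (x^2 * (1 / t^2) + y^2 * t^2)"
   by (rule mult_left_mono[OF add_mono[OF a b]]) (use v N in auto)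
  moreover have "pi * Im \<tau> / real N * (x^2 * (1 / T\<^sup>2) + y^2 * (1 / T\<^sup>2)) = c * x^2 + c * y^2"
   using N T by (simp add: c_def field_simps)
  ultimately have "exp (- pi * Im \<tau> / real N * (x^2 / t^2 + y^2 * t^2)) <= exp (- c * x^2) * exp (- c * y^2)"
   unfolding exp_add[symmetric] by simp
  also have "... <= (exp (2\<^sup>2 / (4 * c)) * exp (- 2 * abs x)) * (exp (2\<^sup>2 / (4 * c)) * exp (- 2 * abs y))"
   by (intro mult_mono exp_neg_square_le c) auto
  finally have 2: "exp (- pi * Im \<tau> / real N * (x^2 / t^2 + y^2 * t^2)) <= ..." .
  have "norm (psi_term N \<tau> t X) = 2 * sqrt (Im \<tau> / real N) * \<bar>y * t - x / t\<bar> * exp (- pi * Im \<tau> / real N * (x^2 / t^2 + y^2 * t^2))"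
   unfolding norm_psi_term[OF v] x_def y_def ..
  also have "... <= 2 * sqrt (Im \<tau> / real N) * (T * (exp \<bar>x\<bar> * exp \<bar>y\<bar>)) * ((exp (2\<^sup>2 / (4 * c)) * exp (- 2 * abs x)) * (exp (2\<^sup>2 / (4 * c)) * exp (- 2 * abs y)))"
   using 1 2 v N by (intro mult_mono mult_left_mono) auto
  also have "... = C * ((exp \<bar>x\<bar> * exp (- 2 * abs x)) * (exp \<bar>y\<bar> * exp (- 2 * abs y)))"
   unfolding C_def by (simp only: mult_ac)
  also have "... = C * (exp (- 1 * abs x) * exp (- 1 * abs y))" by (simp add: exp_add[symmetric])
  finally show ?thesis unfolding x_def y_def .
 qed
 with C0 show ?thesis by blast
qed

lemma psi_term_abs_summable:
 assumes N: "N > 0" and v: "Im \<tau> > 0" and t: "t > 0"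
 shows "(%X. norm (psi_term N \<tau> t X)) summable_on A"
proof -
 define T where "T = max t (1 / t)"
 have T: "T > 0" "1 / T <= t" "t <= T" using t by (auto simp: T_def field_simps max_def)
 obtain C where C: "\<And>t X. 1 / T <= t ==> t <= T ==>
   norm (psi_term N \<tau> t X) <= C * (exp (- 1 * \<bar>x1 X\<bar>) * exp (- 1 * \<bar>x2 X\<bar>))"
  using psi_term_bound[OF N v T(1)] by blast
 have "(%X::int \<times> int. C * (exp (- 1 * \<bar>x1 X\<bar>) * exp (- 1 * \<bar>x2 X\<bar>))) summable_on A"
  by (intro summable_on_cmult_right summable_exp_abs_pair) auto
 then show ?thesis by (rule summable_on_comparison_test) (use C[OF T(2,3)] in auto)
qed

lemma psi_term_continuous: "continuous_on {0<..} (%t. psi_term N \<tau> t X)"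
 unfolding psi_term_def by (intro continuous_intros) auto

lemma Psi_uniform_limit:
 assumes N: "N > 0" and v: "Im \<tau> > 0" and T: "T > 0"
 shows "uniform_limit {1/T..T} (%F t. \<Sum>X\<in>F. psi_term N \<tau> t X) (Psi N h \<tau>) (finite_subsets_at_top (lat_coset N h))"
proof -
 obtain C where C: "\<And>t X. 1 / T <= t ==> t <= T ==>
   norm (psi_term N \<tau> t X) <= C * (exp (- 1 * \<bar>x1 X\<bar>) * exp (- 1 * \<bar>x2 X\<bar>))"
  using psi_term_bound[OF N v T] by blast
 have s: "(%X::int \<times> int. C * (exp (- 1 * \<bar>x1 X\<bar>) * exp (- 1 * \<bar>x2 X\<bar>))) summable_on lat_coset N h"
  by (intro summable_on_cmult_right summable_exp_abs_pair) auto
 show ?thesis unfolding Psi_def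
  by (rule Weierstrass_m_test_general[OF _ s]) (use C in auto)
qed

lemma Psi_continuous:
 assumes N: "N > 0" and v: "Im \<tau> > 0"
 shows "continuous_on {0<..} (Psi N h \<tau>)"
proof -
 have c: "continuous_on {1/T..T} (Psi N h \<tau>)" if T: "T > 0" for T
 proof (rule uniform_limit_theorem[OF _ Psi_uniform_limit[OF N v T]])
  show "\<forall>\<^sub>F F in finite_subsets_at_top (lat_coset N h). continuous_on {1/T..T} (%t. \<Sum>X\<in>F. psi_term N \<tau> t X)"
   using T by (intro always_eventually allI continuous_on_sum continuous_on_subset[OF psi_term_continuous]) (auto intro: less_le_trans[of 0 "1/T"])
 qed auto
 have "isCont (Psi N h \<tau>) t" if "t > 0" for t
 proof -
  define T where "T = max t (1 / t) + 1"
  have T: "T > 0" "1 / T < t" "t < T"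
  proof -
   show "T > 0" "t < T" using that by (auto simp: T_def)
   have "1 / t < T" by (simp add: T_def)
   then show "1 / T < t" using that \<open>T > 0\<close> by (simp add: field_simps)
  qed
  have "continuous_on {1/T<..<T} (Psi N h \<tau>)" by (rule continuous_on_subset[OF c[OF T(1)]]) auto
  then show ?thesis using T by (simp add: continuous_on_eq_continuous_at)
 qed
 then show ?thesis by (simp add: continuous_at_imp_continuous_on)
qed

text \<open>The term that Poisson summation in the first coordinate produces. The pair (k, n) stands
  for the point n tau + k of the lattice Z tau + Z, on which SL2(Z) acts.\<close>

definition dual_term :: "nat => complex => real => int \<times> int => complex" where
 "dual_term N \<tau> t = (%(k, n). (of_int n * cnj \<tau> + of_int k) *
   of_real (exp (- pi * t^2 / (real N * Im \<tau>) * (norm (of_int n * \<tau> + of_int k))\<^sup>2)))"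

text \<open>|n tau + k|^2 is positive definite in (k, n) since Im tau > 0; solving for k and n in
  terms of its real and imaginary parts gives an explicit constant.\<close>

lemma norm_lattice_ge:
 assumes v: "Im \<tau> > 0"
 shows "\<exists>\<epsilon>>0. \<forall>k n :: int. \<epsilon> * ((of_int k)\<^sup>2 + (of_int n)\<^sup>2) <= (norm (of_int n * \<tau> + of_int k))\<^sup>2"
proof -
 define u v' where "u = Re \<tau>" and "v' = Im \<tau>"
 have v': "v' > 0" using v by (simp add: v'_def)
 define C where "C = 2 + (2 * u^2 + 1) / v'\<^sup>2"
 have C: "C > 0" unfolding C_def by (intro add_pos_nonneg) auto
 have "1 / C * ((of_int k)\<^sup>2 + (of_int n)\<^sup>2) <= (norm (of_int n * \<tau> + of_int k))\<^sup>2" for k n :: int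
 proof -
  define a b where "a = of_int n * u + real_of_int k" and "b = of_int n * v'"
  have nn: "(norm (of_int n * \<tau> + of_int k))\<^sup>2 = a^2 + b^2"
   by (simp add: cmod_power2 a_def b_def u_def v'_def)
  have "(real_of_int k)\<^sup>2 = (a - of_int n * u)\<^sup>2" by (simp add: a_def)
  also have "... <= 2 * a^2 + 2 * (of_int n * u)\<^sup>2"
  proof -
   have "(a + of_int n * u)\<^sup>2 >= 0" by simp
   then show ?thesis by (simp add: power2_diff power2_sum)
  qed
  also have "(of_int n * u)\<^sup>2 = u^2 / v'\<^sup>2 * b^2" using v' by (simp add: b_def power_mult_distrib)
  finally have k: "(real_of_int k)\<^sup>2 <= 2 * a^2 + 2 * (u^2 / v'\<^sup>2 * b^2)" .
  have n: "(real_of_int n)\<^sup>2 = 1 / v'\<^sup>2 * b^2" using v' by (simp add: b_def power_mult_distrib)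
  have "(real_of_int k)\<^sup>2 + (real_of_int n)\<^sup>2 <= 2 * a^2 + (2 * u^2 + 1) / v'\<^sup>2 * b^2"
   using k unfolding n by (simp add: add_divide_distrib distrib_right)
  also have "... <= C * a^2 + C * b^2"
   unfolding C_def by (intro add_mono mult_right_mono) auto
  finally show ?thesis unfolding nn using C by (simp add: field_simps)
 qed
 then show ?thesis using C by (intro exI[of _ "1 / C"]) auto
qed

lemma dual_term_bound:
 assumes N: "N > 0" and v: "Im \<tau> > 0"
 shows "\<exists>c>0. \<exists>C\<ge>0. \<forall>t p. t > 0 --> norm (dual_term N \<tau> t p) <=
   C * (\<bar>of_int (fst p)\<bar> + \<bar>of_int (snd p)\<bar>) * exp (- c * t^2 * ((of_int (fst p))\<^sup>2 + (of_int (snd p))\<^sup>2))"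
proof -
 obtain \<epsilon> where e: "\<epsilon> > 0" "\<And>k n :: int. \<epsilon> * ((of_int k)\<^sup>2 + (of_int n)\<^sup>2) <= (norm (of_int n * \<tau> + of_int k))\<^sup>2"
  using norm_lattice_ge[OF v] by blast
 define c where "c = pi * \<epsilon> / (real N * Im \<tau>)"
 have c: "c > 0" using e N v by (simp add: c_def)
 have "norm (dual_term N \<tau> t p) <= (norm \<tau> + 1) * (\<bar>of_int (fst p)\<bar> + \<bar>of_int (snd p)\<bar>) * exp (- c * t^2 * ((of_int (fst p))\<^sup>2 + (of_int (snd p))\<^sup>2))"
  if "t > 0" for t p
 proof -
  obtain k n where p: "p = (k, n)" by (cases p)
  have "norm (of_int n * cnj \<tau> + of_int k) <= \<bar>of_int n\<bar> * norm \<tau> + \<bar>of_int k\<bar>"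
   using norm_triangle_ineq[of "of_int n * cnj \<tau>" "of_int k"] by (simp add: norm_mult)
  also have "... <= (norm \<tau> + 1) * (\<bar>of_int k\<bar> + \<bar>of_int n\<bar>)" by (simp add: algebra_simps)
  finally have 1: "norm (of_int n * cnj \<tau> + of_int k) <= (norm \<tau> + 1) * (\<bar>of_int k\<bar> + \<bar>of_int n\<bar>)" .
  have "pi * t^2 / (real N * Im \<tau>) * (\<epsilon> * ((of_int k)\<^sup>2 + (of_int n)\<^sup>2)) <= pi * t^2 / (real N * Im \<tau>) * (norm (of_int n * \<tau> + of_int k))\<^sup>2"
   using N v by (intro mult_left_mono e) auto
  moreover have "pi * t^2 / (real N * Im \<tau>) * (\<epsilon> * ((of_int k)\<^sup>2 + (of_int n)\<^sup>2)) = c * t^2 * ((of_int k)\<^sup>2 + (of_int n)\<^sup>2)"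
   by (simp add: c_def)
  ultimately have 2: "exp (- pi * t^2 / (real N * Im \<tau>) * (norm (of_int n * \<tau> + of_int k))\<^sup>2) <= exp (- c * t^2 * ((of_int k)\<^sup>2 + (of_int n)\<^sup>2))"
   by simp
  have "norm (dual_term N \<tau> t p) = norm (of_int n * cnj \<tau> + of_int k) * exp (- pi * t^2 / (real N * Im \<tau>) * (norm (of_int n * \<tau> + of_int k))\<^sup>2)"
   by (simp add: dual_term_def p norm_mult)
  also have "... <= ((norm \<tau> + 1) * (\<bar>of_int k\<bar> + \<bar>of_int n\<bar>)) * exp (- c * t^2 * ((of_int k)\<^sup>2 + (of_int n)\<^sup>2))"
   by (intro mult_mono 1 2) auto
  finally show ?thesis by (simp add: p)
 qed
 then show ?thesis using c by (intro exI[of _ c] conjI exI[of _ "norm \<tau> + 1"]) auto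
qed

lemma poly_gauss_pair_summable:
 fixes c :: real
 assumes c: "c > 0"
 shows "(%p::int \<times> int. (\<bar>of_int (fst p)\<bar> + \<bar>of_int (snd p)\<bar>) * exp (- c * ((of_int (fst p))\<^sup>2 + (of_int (snd p))\<^sup>2))) summable_on A"
proof -
 have "(%X::int \<times> int. (exp (2\<^sup>2 / (4 * c)) * exp (2\<^sup>2 / (4 * c))) * (exp (- 1 * \<bar>x1 X\<bar>) * exp (- 1 * \<bar>x2 X\<bar>))) summable_on A"
  by (intro summable_on_cmult_right summable_exp_abs_pair) auto
 then show ?thesis
 proof (rule summable_on_comparison_test)
  fix p :: "int \<times> int"
  define x y where "x = real_of_int (fst p)" and "y = real_of_int (snd p)"
  have 1: "abs x + abs y <= exp \<bar>x\<bar> * exp \<bar>y\<bar>"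
   using exp_ge_add_one_self[of "abs x + abs y"] unfolding exp_add[symmetric] by linarith
  have "exp (- c * (x^2 + y^2)) = exp (- c * x^2) * exp (- c * y^2)" by (simp add: exp_add[symmetric] algebra_simps)
  also have "... <= (exp (2\<^sup>2 / (4 * c)) * exp (- 2 * abs x)) * (exp (2\<^sup>2 / (4 * c)) * exp (- 2 * abs y))"
   by (intro mult_mono exp_neg_square_le c) auto
  finally have "(abs x + abs y) * exp (- c * (x^2 + y^2)) <= (exp \<bar>x\<bar> * exp \<bar>y\<bar>) * ((exp (2\<^sup>2 / (4 * c)) * exp (- 2 * abs x)) * (exp (2\<^sup>2 / (4 * c)) * exp (- 2 * abs y)))"
   using 1 by (intro mult_mono) auto
  also have "... = (exp (2\<^sup>2 / (4 * c)) * exp (2\<^sup>2 / (4 * c))) * ((exp \<bar>x\<bar> * exp (- 2 * abs x)) * (exp \<bar>y\<bar> * exp (- 2 * abs y)))"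
   by (simp only: mult_ac)
  also have "... = (exp (2\<^sup>2 / (4 * c)) * exp (2\<^sup>2 / (4 * c))) * (exp (- 1 * abs x) * exp (- 1 * abs y))" by (simp add: exp_add[symmetric])
  finally show "(\<bar>of_int (fst p)\<bar> + \<bar>of_int (snd p)\<bar>) * exp (- c * ((of_int (fst p))\<^sup>2 + (of_int (snd p))\<^sup>2)) <=
    (exp (2\<^sup>2 / (4 * c)) * exp (2\<^sup>2 / (4 * c))) * (exp (- 1 * \<bar>of_int (fst p)\<bar>) * exp (- 1 * \<bar>of_int (snd p)\<bar>))"
   unfolding x_def y_def .
 qed auto
qed

lemma dual_term_abs_summable:
 assumes N: "N > 0" and v: "Im \<tau> > 0" and t: "t > 0"
 shows "(%p. norm (dual_term N \<tau> t p)) summable_on A"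
proof -
 obtain c C where c: "c > 0" and b: "\<And>t p. t > 0 ==> norm (dual_term N \<tau> t p) <=
   C * (\<bar>of_int (fst p)\<bar> + \<bar>of_int (snd p)\<bar>) * exp (- c * t^2 * ((of_int (fst p))\<^sup>2 + (of_int (snd p))\<^sup>2))"
  using dual_term_bound[OF N v] by blast
 have "(%p::int \<times> int. C * ((\<bar>of_int (fst p)\<bar> + \<bar>of_int (snd p)\<bar>) * exp (- (c * t^2) * ((of_int (fst p))\<^sup>2 + (of_int (snd p))\<^sup>2)))) summable_on A"
  by (intro summable_on_cmult_right poly_gauss_pair_summable) (use c t in auto)
 then show ?thesis by (rule summable_on_comparison_test) (use b[OF t] in \<open>auto simp: mult.assoc\<close>)
qed

lemma lat_coset_eq_image: "lat_coset N h = (%(j, m). (fst h + int N * m, snd h + int N * j)) ` UNIV"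
proof (intro set_eqI iffI)
 fix X assume "X \<in> lat_coset N h"
 then obtain m j where "fst X - fst h = int N * m" "snd X - snd h = int N * j"
  by (auto simp: in_lat_coset_iff elim!: dvdE)
 then have "X = (%(j, m). (fst h + int N * m, snd h + int N * j)) (j, m)"
  unfolding prod_eq_iff by simp
 then show "X \<in> (%(j, m). (fst h + int N * m, snd h + int N * j)) ` UNIV" by blast
qed (auto simp: in_lat_coset_iff)

text \<open>For fixed second coordinate n the term is a linear polynomial times a Gaussian times a
  character in the first coordinate. After the transform the two Gaussian factors combine to exp(-pi
  t^2 |n tau + k|^2 / (N v)), and the linear factor becomes a multiple of the conjugate of n tau +
  k.\<close>

lemma Psi_dual:
 assumes N: "N > 0" and v: "Im \<tau> > 0" and t: "t > 0"
 shows "Psi N h \<tau> t = 2 * \<i> * of_real (t^2 / (real N * Im \<tau>)) *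
   (\<Sum>\<^sub>\<infinity>(n, k)\<in>{n. int N dvd n - snd h} \<times> UNIV. ee (of_int (k * fst h) / of_nat N) * dual_term N \<tau> t (k, n))"
proof -
 define u where "u = Re \<tau>"
 define v' where "v' = Im \<tau>"
 have v': "v' > 0" using v by (simp add: v'_def)
 define rN where "rN = real N"
 have rN: "rN > 0" using N by (simp add: rN_def)
 \<comment> \<open>alpha, b, p and q are the data for \<open>poisson_gauss\<close> in the variable
   x1; P collects the part that depends on the second coordinate only.\<close>
 define \<alpha> where "\<alpha> = v' / (rN * t^2)"
 have \<alpha>: "\<alpha> > 0" using v' rN t by (simp add: \<alpha>_def)
 define P where "P n = 2 * sqrt (v' / rN) * exp (- pi * v' / rN * ((of_int n)\<^sup>2 * t^2))" for n :: int
 define p q where "p n = complex_of_real (P n * (of_int n * t))" and "q n = complex_of_real (- P n / t)" for n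
 define b where "b n = of_int n * u / rN" for n :: int
 define G where "G n k = ee (of_int (k * fst h) / of_nat N) * dual_term N \<tau> t (k, n)" for n k
 define pre where "pre = 2 * \<i> * of_real (t^2 / (real N * Im \<tau>))"
 have inner: "(\<Sum>\<^sub>\<infinity>m. psi_term N \<tau> t (fst h + int N * m, n)) = pre * (\<Sum>\<^sub>\<infinity>k. G n k)" for n
 proof -
  have trm: "psi_term N \<tau> t (fst h + int N * m, n) =
   (p n + q n * of_real (of_int (fst h) + rN * of_int m)) * (of_real (exp (- pi * \<alpha> * (of_int (fst h) + rN * of_int m)\<^sup>2)) * ee (- of_real (b n * (of_int (fst h) + rN * of_int m))))" for m
  proof -
   define x where "x = of_int (fst h) + rN * of_int m"
   have x: "real_of_int (fst h + int N * m) = x" by (simp add: x_def rN_def)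
   have e: "exp (- pi * v' / rN * (x^2 / t^2 + (of_int n)\<^sup>2 * t^2)) = exp (- pi * v' / rN * ((of_int n)\<^sup>2 * t^2)) * exp (- pi * \<alpha> * x^2)"
    unfolding exp_add[symmetric] by (rule arg_cong[where f=exp]) (use rN t in \<open>simp add: \<alpha>_def field_simps\<close>)
   have pq: "p n + q n * of_real x = of_real (P n * (of_int n * t - x / t))"
    by (simp add: p_def q_def right_diff_distrib)
   have "psi_term N \<tau> t (fst h + int N * m, n) = of_real (2 * sqrt (v' / rN) * (of_int n * t - x / t) * exp (- pi * v' / rN * (x^2 / t^2 + (of_int n)\<^sup>2 * t^2))) * ee (- of_real (x * of_int n * u / rN))"
    unfolding psi_term_def fst_conv snd_conv of_int_mult x by (simp only: v'_def u_def rN_def)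
   also have "... = (p n + q n * of_real x) * (of_real (exp (- pi * \<alpha> * x^2)) * ee (- of_real (b n * x)))"
    unfolding pq e P_def b_def by (simp add: mult_ac)
   finally show ?thesis unfolding x_def .
  qed
  \<comment> \<open>The frequency is (n u + k)/N. Its Gaussian supplies (n u + k)^2, the fixed
    coordinate supplies (n v)^2, and together they form |n tau + k|^2.\<close>
  have fh: "(p n - \<i> * q n * of_real (\<eta> / \<alpha>)) * of_real (exp (- pi * \<eta>^2 / \<alpha>) / sqrt \<alpha>) = of_real rN * (pre * dual_term N \<tau> t (k, n))"
   if \<eta>: "\<eta> = b n + of_int k / rN" for \<eta> k
  proof -
   define s where "s = of_int n * u + of_int k"
   have \<eta>': "\<eta> = s / rN" by (simp add: \<eta> b_def s_def add_divide_distrib)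
   have ea: "\<eta> / \<alpha> = s * t^2 / v'" using rN t v' by (simp add: \<eta>' \<alpha>_def)
   have e2: "\<eta>\<^sup>2 / \<alpha> = s^2 * t^2 / (rN * v')" using rN t v' by (simp add: \<eta>' \<alpha>_def power_divide power2_eq_square)
   have sa: "1 / sqrt \<alpha> = t * sqrt (rN / v')" using t rN v' by (simp add: \<alpha>_def real_sqrt_divide real_sqrt_mult)
   have nrm: "(norm (of_int n * \<tau> + of_int k))\<^sup>2 = s^2 + (of_int n * v')\<^sup>2"
    by (simp add: cmod_power2 s_def u_def v'_def)
   have ex: "exp (- pi * v' / rN * ((of_int n)\<^sup>2 * t^2)) * exp (- pi * \<eta>^2 / \<alpha>) = exp (- pi * t^2 / (real N * Im \<tau>) * (norm (of_int n * \<tau> + of_int k))\<^sup>2)"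
   proof -
    have "- pi * \<eta>^2 / \<alpha> = - pi * (s^2 * t^2 / (rN * v'))" using e2 by (metis times_divide_eq_right)
    moreover have "- pi * v' / rN * ((of_int n)\<^sup>2 * t^2) + - pi * (s^2 * t^2 / (rN * v')) = - pi * t^2 / (rN * v') * (s^2 + (of_int n * v')\<^sup>2)"
     using rN v' by (simp add: field_simps power2_eq_square)
    ultimately show ?thesis unfolding exp_add[symmetric] nrm by (simp add: rN_def v'_def)
   qed
   have lin: "p n - \<i> * q n * of_real (\<eta> / \<alpha>) = of_real (P n * t / v') * \<i> * (of_int n * cnj \<tau> + of_int k)"
   proof -
    have c: "of_int n * cnj \<tau> + of_int k = of_real s - \<i> * of_real (of_int n * v')"
     by (simp add: complex_eq_iff s_def u_def v'_def)
    show ?thesis unfolding c ea p_def q_def using t v'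
     by (simp add: complex_eq_iff power2_eq_square)
   qed
   have sq: "sqrt (v' / rN) * sqrt (rN / v') = 1" using v' rN by (simp add: real_sqrt_mult[symmetric])
   have "(p n - \<i> * q n * of_real (\<eta> / \<alpha>)) * of_real (exp (- pi * \<eta>^2 / \<alpha>) / sqrt \<alpha>) =
    (of_real (P n * t / v') * \<i> * (of_int n * cnj \<tau> + of_int k)) * of_real (exp (- pi * \<eta>^2 / \<alpha>) * (t * sqrt (rN / v')))"
    unfolding lin sa[symmetric] by simp
   also have "... = of_real (P n * t / v' * (exp (- pi * \<eta>^2 / \<alpha>) * (t * sqrt (rN / v')))) * \<i> * (of_int n * cnj \<tau> + of_int k)"
    by (simp add: mult_ac)
   also have "P n * t / v' * (exp (- pi * \<eta>^2 / \<alpha>) * (t * sqrt (rN / v'))) =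
     2 * t^2 / v' * (sqrt (v' / rN) * sqrt (rN / v')) * (exp (- pi * v' / rN * ((of_int n)\<^sup>2 * t^2)) * exp (- pi * \<eta>^2 / \<alpha>))"
    unfolding P_def by (simp add: power2_eq_square)
   also have "... = 2 * t^2 / v' * exp (- pi * t^2 / (real N * Im \<tau>) * (norm (of_int n * \<tau> + of_int k))\<^sup>2)"
    unfolding sq ex by simp
   finally show ?thesis unfolding pre_def dual_term_def using rN by (simp add: rN_def v'_def)
  qed
  have "(\<Sum>\<^sub>\<infinity>m. psi_term N \<tau> t (fst h + int N * m, n)) =
    of_real (1 / rN) * (\<Sum>\<^sub>\<infinity>k::int. ee (of_real (of_int k * of_int (fst h) / rN)) * ((p n - \<i> * q n * of_real ((b n + of_int k / rN) / \<alpha>)) * of_real (exp (- pi * (b n + of_int k / rN)\<^sup>2 / \<alpha>) / sqrt \<alpha>)))"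
   unfolding trm by (rule poisson_gauss(3)[OF \<alpha> rN])
  also have "... = of_real (1 / rN) * (\<Sum>\<^sub>\<infinity>k. (of_real rN * pre) * G n k)"
   unfolding fh[OF refl] by (simp add: G_def rN_def mult_ac)
  also have "... = pre * (\<Sum>\<^sub>\<infinity>k. G n k)"
   using rN by (simp add: infsum_cmult_right')
  finally show ?thesis .
 qed
 have inj: "inj (%(j, m). (fst h + int N * m, snd h + int N * j))" using N by (auto simp: inj_def)
 have "(psi_term N \<tau> t) summable_on lat_coset N h"
  by (rule abs_summable_summable[OF psi_term_abs_summable[OF N v t]])
 then have s1: "(%(j, m). psi_term N \<tau> t (fst h + int N * m, snd h + int N * j)) summable_on UNIV \<times> UNIV"
  unfolding lat_coset_eq_image by (subst (asm) summable_on_reindex[OF inj]) (simp add: o_def split_def)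
 have "Psi N h \<tau> t = (\<Sum>\<^sub>\<infinity>(j, m)\<in>UNIV \<times> UNIV. psi_term N \<tau> t (fst h + int N * m, snd h + int N * j))"
  unfolding Psi_def lat_coset_eq_image by (subst infsum_reindex[OF inj]) (simp add: o_def split_def)
 also have "... = (\<Sum>\<^sub>\<infinity>j. \<Sum>\<^sub>\<infinity>m. psi_term N \<tau> t (fst h + int N * m, snd h + int N * j))"
  by (rule infsum_Sigma'_banach[OF s1, symmetric])
 also have "... = (\<Sum>\<^sub>\<infinity>j. pre * (\<Sum>\<^sub>\<infinity>k. G (snd h + int N * j) k))" unfolding inner ..
 also have "... = pre * (\<Sum>\<^sub>\<infinity>j. \<Sum>\<^sub>\<infinity>k. G (snd h + int N * j) k)" by (rule infsum_cmult_right')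
 also have "(\<Sum>\<^sub>\<infinity>j. \<Sum>\<^sub>\<infinity>k. G (snd h + int N * j) k) = (\<Sum>\<^sub>\<infinity>n\<in>{n. int N dvd n - snd h}. \<Sum>\<^sub>\<infinity>k. G n k)"
 proof -
  have "{n. int N dvd n - snd h} = range (%j. snd h + int N * j)"
   by (auto simp: image_iff elim!: dvdE) (metis add_diff_cancel_left' diff_add_cancel add.commute)
  moreover have "inj (%j. snd h + int N * j)" using N by (auto simp: inj_def)
  ultimately show ?thesis by (simp add: infsum_reindex o_def)
 qed
 also have "... = (\<Sum>\<^sub>\<infinity>(n, k)\<in>{n. int N dvd n - snd h} \<times> UNIV. G n k)"
 proof (rule infsum_Sigma'_banach)
  have "(%p. norm (dual_term N \<tau> t p)) summable_on UNIV \<times> {n. int N dvd n - snd h}"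
   by (rule dual_term_abs_summable[OF N v t])
  then have "(%p. norm (dual_term N \<tau> t (snd p, fst p))) summable_on {n. int N dvd n - snd h} \<times> UNIV"
   by (rule summable_on_product_swap)
  moreover have "norm (case p of (n, k) => G n k) = norm (dual_term N \<tau> t (snd p, fst p))" for p
   by (simp add: G_def norm_mult norm_ee split_def)
  ultimately have "(%p. norm (case p of (n, k) => G n k)) summable_on {n. int N dvd n - snd h} \<times> UNIV" by simp
  then show "(%(n, k). G n k) summable_on {n. int N dvd n - snd h} \<times> UNIV" by (rule abs_summable_summable)
 qed
 finally show ?thesis unfolding pre_def G_def .
qed

text \<open>From 2 w^2 <= exp(2|w|) the double exponential is below a Gaussian, hence below any
  exponential rate M.\<close>

lemma exp_abs_superexp_bound:
 fixes c w M :: real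
 assumes c: "c > 0"
 shows "exp (- c * exp (2 * abs w)) <= exp (M\<^sup>2 / (4 * (2 * c))) * exp (- M * abs w)"
proof -
 have "2 * w^2 <= exp (2 * abs w)"
  using exp_lower_Taylor_quadratic[of "2 * abs w"] by (simp add: power_mult_distrib)
 then have "c * (2 * w^2) <= c * exp (2 * abs w)" using c by (intro mult_left_mono) auto
 then have "exp (- c * exp (2 * abs w)) <= exp (- (2 * c) * w^2)" by simp
 also have "... <= exp (M\<^sup>2 / (4 * (2 * c))) * exp (- M * abs w)" by (rule exp_neg_square_le) (use c in auto)
 finally show ?thesis .
qed

text \<open>Inverting t exchanges the roles of the coordinates and changes the sign of the linear
  factor. It transports every estimate for large t to small t.\<close>

lemma psi_term_swap:
 assumes "t > 0"
 shows "psi_term N \<tau> (1 / t) X = - psi_term N \<tau> t (prod.swap X)"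
proof -
 have E1: "x2 X * (1 / t) - x1 X / (1 / t) = - (x1 X * t - x2 X / t)"
  by simp
 have E2: "(x1 X)\<^sup>2 / (1 / t)\<^sup>2 + (x2 X)\<^sup>2 * (1 / t)\<^sup>2 = (x2 X)\<^sup>2 / t^2 + (x1 X)\<^sup>2 * t^2"
  by (simp add: power_divide)
 show ?thesis
  unfolding psi_term_def fst_swap snd_swap E1 E2 mult.commute[of "snd X" "fst X"]
  by (simp only: mult_minus_left mult_minus_right of_real_minus)
qed

lemma lat_coset_swap: "prod.swap ` lat_coset N (prod.swap h) = lat_coset N h"
proof (intro set_eqI iffI)
 fix X assume "X \<in> lat_coset N h"
 then have "prod.swap X \<in> lat_coset N (prod.swap h)" by (simp add: in_lat_coset_iff)
 then show "X \<in> prod.swap ` lat_coset N (prod.swap h)" by (metis image_eqI swap_swap)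
qed (auto simp: in_lat_coset_iff)

lemma Psi_swap:
 assumes "t > 0"
 shows "Psi N h \<tau> (1 / t) = - Psi N (prod.swap h) \<tau> t"
proof -
 have "Psi N h \<tau> (1 / t) = (\<Sum>\<^sub>\<infinity>X\<in>prod.swap ` lat_coset N (prod.swap h). psi_term N \<tau> (1 / t) X)"
  unfolding Psi_def lat_coset_swap ..
 also have "... = (\<Sum>\<^sub>\<infinity>X\<in>lat_coset N (prod.swap h). psi_term N \<tau> (1 / t) (prod.swap X))"
  by (subst infsum_reindex) (auto simp: o_def)
 also have "... = - Psi N (prod.swap h) \<tau> t"
  unfolding psi_term_swap[OF assms] Psi_def by (simp add: infsum_uminus)
 finally show ?thesis .
qed

text \<open>In the dual sum the pair (0, 0) carries the linear factor 0, and every other pair has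
  k^2 + n^2 >= 1, so a common factor exp(-c t^2 / 2) can be extracted while a summable Gaussian
  remains.\<close>

lemma Psi_decay_at_top:
 assumes N: "N > 0" and v: "Im \<tau> > 0"
 shows "\<exists>c>0. \<exists>C\<ge>0. \<forall>t\<ge>1. norm (Psi N h \<tau> t) <= C * t^2 * exp (- c * t^2)"
proof -
 obtain c C where c: "c > 0" and C: "C >= 0" and b: "\<And>t p. t > 0 ==> norm (dual_term N \<tau> t p) <=
   C * (\<bar>of_int (fst p)\<bar> + \<bar>of_int (snd p)\<bar>) * exp (- c * t^2 * ((of_int (fst p))\<^sup>2 + (of_int (snd p))\<^sup>2))"
  using dual_term_bound[OF N v] by blast
 define A where "A = {n. int N dvd n - snd h} \<times> (UNIV :: int set)"
 define g where "g p = (\<bar>of_int (fst p)\<bar> + \<bar>of_int (snd p)\<bar>) * exp (- (c / 2) * ((of_int (fst p))\<^sup>2 + (of_int (snd p))\<^sup>2))" for p :: "int \<times> int"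
 have g: "g summable_on B" for B unfolding g_def by (rule poly_gauss_pair_summable) (use c in auto)
 have g0: "g p >= 0" for p by (simp add: g_def)
 define K where "K = (\<Sum>\<^sub>\<infinity>p\<in>A. g p)"
 have bd: "norm (dual_term N \<tau> t (k, n)) <= C * exp (- (c / 2) * t^2) * g (n, k)" if t: "t >= 1" for t k n
 proof (cases "k = 0 \<and> n = 0")
  case True
  then show ?thesis using C g0 by (simp add: dual_term_def)
 next
  case False
  define s where "s = (real_of_int k)\<^sup>2 + (real_of_int n)\<^sup>2"
  have s: "s >= 1"
  proof -
   have "k\<^sup>2 + n^2 > 0" using False by (simp add: sum_power2_gt_zero_iff)
   then have "real_of_int (k^2 + n^2) >= 1" by linarith
   then show ?thesis by (simp add: s_def)
  qed
  \<comment> \<open>Gives t^2 s >= t^2 + s - 1 >= (t^2 + s)/2, the splitting into a part in t and a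
    part in the lattice point.\<close>
  have "(t^2 - 1) * (s - 1) >= 0" "t\<^sup>2 >= 1" using s t by auto
  then have "t\<^sup>2 * s >= (1/2) * t^2 + (1/2) * s" using s by (simp add: algebra_simps)
  then have "c * (t^2 * s) >= c * ((1/2) * t^2 + (1/2) * s)" using c by (intro mult_left_mono) auto
  then have "exp (- c * t^2 * s) <= exp (- (c / 2) * t^2) * exp (- (c / 2) * s)"
   unfolding exp_add[symmetric] by (simp add: algebra_simps)
  then have "C * (\<bar>of_int k\<bar> + \<bar>of_int n\<bar>) * exp (- c * t^2 * s) <= C * (\<bar>of_int k\<bar> + \<bar>of_int n\<bar>) * (exp (- (c / 2) * t^2) * exp (- (c / 2) * s))"
   using C by (intro mult_left_mono) auto
  also have "... = C * exp (- (c / 2) * t^2) * g (n, k)"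
   unfolding g_def s_def fst_conv snd_conv by (simp only: mult_ac add_ac)
  finally show ?thesis using b[of t "(k, n)"] t unfolding s_def by simp
 qed
 have "norm (Psi N h \<tau> t) <= (2 / (real N * Im \<tau>) * C * K) * t^2 * exp (- (c / 2) * t^2)" if t: "t >= 1" for t
 proof -
  let ?G = "%p. ee (of_int (snd p * fst h) / of_nat N) * dual_term N \<tau> t (snd p, fst p)"
  have Gb: "norm (?G p) <= C * exp (- (c / 2) * t^2) * g p" for p
   using bd[OF t, of "snd p" "fst p"] by (simp add: norm_mult norm_ee)
  have sg: "(%p. C * exp (- (c / 2) * t^2) * g p) summable_on A" by (intro summable_on_cmult_right g)
  have ab: "(%p. norm (?G p)) summable_on A"
   by (rule summable_on_comparison_test[OF sg]) (use Gb in auto)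
  have "norm (\<Sum>\<^sub>\<infinity>p\<in>A. ?G p) <= (\<Sum>\<^sub>\<infinity>p\<in>A. norm (?G p))" by (rule norm_infsum_bound[OF ab])
  also have "... <= (\<Sum>\<^sub>\<infinity>p\<in>A. C * exp (- (c / 2) * t^2) * g p)" by (rule infsum_mono[OF ab sg Gb])
  also have "... = C * exp (- (c / 2) * t^2) * K" unfolding K_def by (rule infsum_cmult_right')
  finally have n: "norm (\<Sum>\<^sub>\<infinity>p\<in>A. ?G p) <= C * exp (- (c / 2) * t^2) * K" .
  have "Psi N h \<tau> t = 2 * \<i> * of_real (t^2 / (real N * Im \<tau>)) * (\<Sum>\<^sub>\<infinity>p\<in>A. ?G p)"
   using Psi_dual[OF N v, of t h] t unfolding A_def by (simp add: split_def)
  then have "norm (Psi N h \<tau> t) = 2 * (t^2 / (real N * Im \<tau>)) * norm (\<Sum>\<^sub>\<infinity>p\<in>A. ?G p)"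
   using v by (simp only: norm_mult norm_of_real) simp
  also have "... <= 2 * (t^2 / (real N * Im \<tau>)) * (C * exp (- (c / 2) * t^2) * K)"
   using v by (intro mult_left_mono n) auto
  finally show ?thesis by (simp add: mult_ac)
 qed
 moreover have "K >= 0" unfolding K_def by (rule infsum_nonneg) (use g0 in auto)
 ultimately show ?thesis using c C v by (intro exI[of _ "c / 2"] conjI exI[of _ "2 / (real N * Im \<tau>) * C * K"]) auto
qed

lemma Psi_exp_decay:
 assumes N: "N > 0" and v: "Im \<tau> > 0"
 shows "\<exists>c>0. \<exists>C\<ge>0. \<forall>w. norm (Psi N h \<tau> (exp w)) <= C * exp (2 * abs w) * exp (- c * exp (2 * abs w))"
proof -
 obtain c1 C1 where 1: "c1 > 0" "C1 >= 0" "\<And>t. t >= 1 ==> norm (Psi N h \<tau> t) <= C1 * t^2 * exp (- c1 * t^2)"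
  using Psi_decay_at_top[OF N v] by blast
 obtain c2 C2 where 2: "c2 > 0" "C2 >= 0" "\<And>t. t >= 1 ==> norm (Psi N (prod.swap h) \<tau> t) <= C2 * t^2 * exp (- c2 * t^2)"
  using Psi_decay_at_top[OF N v] by blast
 define c C where "c = min c1 c2" and "C = max C1 C2"
 have mono: "C' * (exp a)\<^sup>2 * exp (- c' * (exp a)\<^sup>2) <= C * exp (2 * a) * exp (- c * exp (2 * a))" if "C' <= C" "c <= c'" "C' >= 0" for C' c' a :: real
  unfolding exp_double using that by (intro mult_mono) auto
 have "norm (Psi N h \<tau> (exp w)) <= C * exp (2 * abs w) * exp (- c * exp (2 * abs w))" for w
 proof (cases "w >= 0")
  case True
  then have "norm (Psi N h \<tau> (exp w)) <= C1 * (exp w)\<^sup>2 * exp (- c1 * (exp w)\<^sup>2)" by (intro 1) auto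
  also have "... <= C * exp (2 * w) * exp (- c * exp (2 * w))" by (rule mono) (use 1 in \<open>auto simp: c_def C_def\<close>)
  finally show ?thesis using True by simp
 next
  case False
  have "1 / exp (- w) = exp w" by (simp add: exp_minus divide_inverse)
  then have "Psi N h \<tau> (exp w) = - Psi N (prod.swap h) \<tau> (exp (- w))"
   using Psi_swap[of "exp (- w)" N h \<tau>] by (simp only: exp_gt_zero simp_thms)
  then have "norm (Psi N h \<tau> (exp w)) <= C2 * (exp (- w))\<^sup>2 * exp (- c2 * (exp (- w))\<^sup>2)" using 2(3)[of "exp (- w)"] False by simp
  also have "... <= C * exp (2 * (- w)) * exp (- c * exp (2 * (- w)))" by (rule mono) (use 2 in \<open>auto simp: c_def C_def\<close>)
  finally show ?thesis using False by simp
 qed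
 moreover have "c > 0" "C >= 0" using 1 2 by (auto simp: c_def C_def)
 ultimately show ?thesis by blast
qed

lemma Psi_exp_measurable:
 assumes N: "N > 0" and v: "Im \<tau> > 0"
 shows "(%w. Psi N h \<tau> (exp w)) \<in> borel_measurable borel"
 by (intro borel_measurable_continuous_onI continuous_on_compose2[OF Psi_continuous[OF N v]] continuous_intros) auto

lemma Psi_exp_integrable:
 assumes N: "N > 0" and v: "Im \<tau> > 0"
 shows "integrable lborel (%w. norm (Psi N h \<tau> (exp w)) * exp (K * abs w))"
proof -
 obtain c C where c: "c > 0" "C >= 0" "\<And>w. norm (Psi N h \<tau> (exp w)) <= C * exp (2 * abs w) * exp (- c * exp (2 * abs w))"
  using Psi_exp_decay[OF N v] by blast
 \<comment> \<open>The rate must beat exp(2|w|) and exp(K|w|) and still leave exp(-|w|).\<close>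
 define M where "M = K + 3"
 define D where "D = C * exp (M\<^sup>2 / (4 * (2 * c)))"
 have "norm (Psi N h \<tau> (exp w)) * exp (K * abs w) <= D * exp (- 1 * abs w)" for w
 proof -
  have "norm (Psi N h \<tau> (exp w)) <= C * exp (2 * abs w) * (exp (M\<^sup>2 / (4 * (2 * c))) * exp (- M * abs w))"
   using mult_left_mono[OF exp_abs_superexp_bound[OF c(1), of w M], of "C * exp (2 * abs w)"] c(2) c(3)[of w] by simp
  then have "norm (Psi N h \<tau> (exp w)) * exp (K * abs w) <= (C * exp (2 * abs w) * (exp (M\<^sup>2 / (4 * (2 * c))) * exp (- M * abs w))) * exp (K * abs w)"
   by (rule mult_right_mono) simp
  also have "... = D * (exp (2 * abs w) * (exp (- M * abs w) * exp (K * abs w)))" unfolding D_def by (simp only: mult_ac)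
  also have "exp (2 * abs w) * (exp (- M * abs w) * exp (K * abs w)) = exp (- 1 * abs w)"
   unfolding exp_add[symmetric] M_def by (simp add: algebra_simps)
  finally show ?thesis .
 qed
 then have b: "norm (norm (Psi N h \<tau> (exp w)) * exp (K * abs w)) <= norm (D * exp (- 1 * abs w))" for w
  by (metis abs_ge_self abs_of_nonneg mult_nonneg_nonneg norm_ge_zero exp_ge_zero order_trans real_norm_def)
 have i: "integrable lborel (%w::real. D * exp (- 1 * abs w))"
  by (intro integrable_mult_right integrable_exp_neg_abs zero_less_one)
 have m: "(%w. norm (Psi N h \<tau> (exp w)) * exp (K * abs w)) \<in> borel_measurable lborel"
  using Psi_exp_measurable[OF N v] by measurable
 show ?thesis by (rule integrable_dominated[OF i m AE_I2[OF b]])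
qed

lemma Psi_exp_integrable_poly:
 assumes N: "N > 0" and v: "Im \<tau> > 0"
 shows "integrable lborel (%w. Psi N h \<tau> (exp w) * of_real (p + q * w))"
proof (rule integrable_dominated)
 show "integrable lborel (%w. (abs p + abs q) * (norm (Psi N h \<tau> (exp w)) * exp (1 * abs w)))"
  by (intro integrable_mult_right Psi_exp_integrable[OF N v])
 have "\<bar>p + q * w\<bar> <= (abs p + abs q) * exp (1 * abs w)" for w
 proof -
  have "\<bar>p + q * w\<bar> <= abs p * 1 + abs q * abs w" using abs_triangle_ineq[of p "q * w"] by (simp add: abs_mult)
  also have "... <= abs p * exp \<bar>w\<bar> + abs q * exp \<bar>w\<bar>"
  proof (intro add_mono mult_left_mono)
   show "1 <= exp \<bar>w\<bar>" "abs w <= exp \<bar>w\<bar>" using exp_ge_add_one_self[of "abs w"] abs_ge_zero[of w] by linarith+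
  qed auto
  finally show ?thesis by (simp add: algebra_simps)
 qed
 then have "norm (Psi N h \<tau> (exp w)) * \<bar>p + q * w\<bar> <= norm (Psi N h \<tau> (exp w)) * ((abs p + abs q) * exp (1 * abs w))" for w
  by (intro mult_left_mono) auto
 then show "AE w in lborel. norm (Psi N h \<tau> (exp w) * of_real (p + q * w)) <= norm ((abs p + abs q) * (norm (Psi N h \<tau> (exp w)) * exp (1 * abs w)))"
  by (intro AE_I2) (simp add: norm_mult abs_mult mult_ac del: of_real_add of_real_mult)
qed (use Psi_exp_measurable[OF N v] in measurable)

lemma Psi_T:
 assumes N: "N > 0"
 shows "Psi N h (\<tau> + 1) t = ee (- of_int (fst h * snd h) / of_nat N) * Psi N h \<tau> t"
proof -
 have "psi_term N (\<tau> + 1) t X = ee (- of_int (fst h * snd h) / of_nat N) * psi_term N \<tau> t X" if X: "X \<in> lat_coset N h" for X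
 proof -
  obtain z w where "fst X - fst h = int N * z" "snd X - snd h = int N * w" using X by (auto simp: in_lat_coset_iff elim!: dvdE)
  then have zw: "fst X = fst h + int N * z" "snd X = snd h + int N * w" by simp_all
  have e: "ee (of_int (- (fst X * snd X)) / of_nat N) = ee (of_int (- (fst h * snd h)) / of_nat N)"
   by (rule ee_shift[OF N, of _ _ "- (z * snd h + w * fst h + int N * z * w)"]) (simp add: zw algebra_simps)
  have "- complex_of_real (of_int (fst X * snd X) * Re (\<tau> + 1) / real N) = of_int (- (fst X * snd X)) / of_nat N + - of_real (of_int (fst X * snd X) * Re \<tau> / real N)"
   using N by (simp add: field_simps)
  then have "ee (- of_real (of_int (fst X * snd X) * Re (\<tau> + 1) / real N)) = ee (of_int (- (fst h * snd h)) / of_nat N) * ee (- of_real (of_int (fst X * snd X) * Re \<tau> / real N))"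
   by (simp only: ee_add e)
  then show ?thesis unfolding psi_term_def by simp
 qed
 then show ?thesis unfolding Psi_def by (simp add: infsum_cmult_right' cong: infsum_cong)
qed

text \<open>The congruence is moved from the index set into a factor. The dual sums of all classes
  then run over the same pairs and can be added termwise in \<open>Psi_S\<close>.\<close>

lemma Psi_dual_indicator:
 assumes N: "N > 0" and v: "Im \<tau> > 0" and t: "t > 0"
 shows "Psi N h \<tau> t = 2 * \<i> * of_real (t^2 / (real N * Im \<tau>)) *
   (\<Sum>\<^sub>\<infinity>p. of_bool (int N dvd snd p - snd h) * ee (of_int (fst p * fst h) / of_nat N) * dual_term N \<tau> t p)"
  and "(%p. of_bool (int N dvd snd p - snd h) * ee (of_int (fst p * fst h) / of_nat N) * dual_term N \<tau> t p) summable_on UNIV"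
proof -
 let ?A = "{n. int N dvd n - snd h} \<times> (UNIV :: int set)"
 have "(\<Sum>\<^sub>\<infinity>(n, k)\<in>?A. ee (of_int (k * fst h) / of_nat N) * dual_term N \<tau> t (k, n)) =
   (\<Sum>\<^sub>\<infinity>p\<in>prod.swap ` ?A. ee (of_int (fst p * fst h) / of_nat N) * dual_term N \<tau> t p)"
  by (subst infsum_reindex) (auto simp: o_def split_def prod.swap_def)
 also have "... = (\<Sum>\<^sub>\<infinity>p. of_bool (int N dvd snd p - snd h) * ee (of_int (fst p * fst h) / of_nat N) * dual_term N \<tau> t p)"
  by (rule infsum_cong_neutral) (auto simp: image_iff)
 finally show "Psi N h \<tau> t = 2 * \<i> * of_real (t^2 / (real N * Im \<tau>)) *
   (\<Sum>\<^sub>\<infinity>p. of_bool (int N dvd snd p - snd h) * ee (of_int (fst p * fst h) / of_nat N) * dual_term N \<tau> t p)"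
  using Psi_dual[OF N v t, of h] by simp
 have "(%p. norm (of_bool (int N dvd snd p - snd h) * ee (of_int (fst p * fst h) / of_nat N) * dual_term N \<tau> t p)) summable_on UNIV"
  by (rule summable_on_comparison_test[OF dual_term_abs_summable[OF N v t]]) (auto simp: norm_mult norm_ee)
 then show "(%p. of_bool (int N dvd snd p - snd h) * ee (of_int (fst p * fst h) / of_nat N) * dual_term N \<tau> t p) summable_on UNIV"
  by (rule abs_summable_summable)
qed

lemma infsum_sum_swap:
 fixes f :: "'i => 'a => complex"
 assumes "finite I" "\<And>i. i \<in> I ==> f i summable_on A"
 shows "(\<Sum>\<^sub>\<infinity>x\<in>A. \<Sum>i\<in>I. f i x) = (\<Sum>i\<in>I. \<Sum>\<^sub>\<infinity>x\<in>A. f i x)"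
proof -
 have "((%x. \<Sum>i\<in>I. f i x) has_sum (\<Sum>i\<in>I. \<Sum>\<^sub>\<infinity>x\<in>A. f i x)) A"
  using assms
 proof (induction I)
  case (insert i I)
  then have "((%x. f i x + (\<Sum>i\<in>I. f i x)) has_sum ((\<Sum>\<^sub>\<infinity>x\<in>A. f i x) + (\<Sum>i\<in>I. \<Sum>\<^sub>\<infinity>x\<in>A. f i x))) A"
   by (intro has_sum_add has_sum_infsum) auto
  then show ?case using insert by simp
 qed simp
 then show ?thesis by (rule infsumI)
qed

text \<open>n(-1/tau) + k = (k tau - n)/tau, and Im(-1/tau) = Im tau / |tau|^2, so the exponent is
  unchanged. The weight 1 comes from 1/Im together with 1/cnj tau, whose product scales by
  tau.\<close>

lemma dual_term_S:
 assumes v: "Im \<tau> > 0" and N: "N > 0"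
 shows "of_real (1 / Im (- 1 / \<tau>)) * dual_term N (- 1 / \<tau>) t (k, n) = \<tau> * (of_real (1 / Im \<tau>) * dual_term N \<tau> t (- n, k))"
proof -
 have nz: "\<tau> ~= 0" using v by auto
 then have n0: "norm \<tau> > 0" by simp
 have im: "Im (- 1 / \<tau>) = Im \<tau> / (norm \<tau>)\<^sup>2" by (simp add: Im_divide cmod_power2)
 have num: "of_int n * (- 1 / \<tau>) + of_int k = (of_int k * \<tau> + of_int (- n)) / \<tau>" using nz by (simp add: field_simps)
 have cn: "of_int n * cnj (- 1 / \<tau>) + of_int k = (of_int k * cnj \<tau> + of_int (- n)) / cnj \<tau>" using nz by (simp add: field_simps)
 have ex: "t\<^sup>2 / (real N * Im (- 1 / \<tau>)) * (norm (of_int n * (- 1 / \<tau>) + of_int k))\<^sup>2 = t^2 / (real N * Im \<tau>) * (norm (of_int k * \<tau> + of_int (- n)))\<^sup>2"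
  unfolding num im norm_divide power_divide using n0 v N by (simp add: field_simps)
 have ex': "- pi * t^2 / (real N * Im (- 1 / \<tau>)) * (norm (of_int n * (- 1 / \<tau>) + of_int k))\<^sup>2 = - pi * t^2 / (real N * Im \<tau>) * (norm (of_int k * \<tau> + of_int (- n)))\<^sup>2"
  using arg_cong[OF ex, of "%x. - pi * x"] by (simp only: times_divide_eq_right times_divide_eq_left mult.assoc)
 have "\<tau> * cnj \<tau> = of_real ((norm \<tau>)\<^sup>2)" by (rule complex_norm_square[symmetric])
 then have pre: "of_real (1 / Im (- 1 / \<tau>)) * (1 / cnj \<tau>) = \<tau> * of_real (1 / Im \<tau>)"
  using nz v unfolding im by (simp add: field_simps)
 have "of_real (1 / Im (- 1 / \<tau>)) * dual_term N (- 1 / \<tau>) t (k, n) =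
   (of_real (1 / Im (- 1 / \<tau>)) * (1 / cnj \<tau>)) * ((of_int k * cnj \<tau> + of_int (- n)) * of_real (exp (- pi * t^2 / (real N * Im \<tau>) * (norm (of_int k * \<tau> + of_int (- n)))\<^sup>2)))"
  unfolding dual_term_def prod.case cn ex' by simp
 also have "... = \<tau> * (of_real (1 / Im \<tau>) * dual_term N \<tau> t (- n, k))"
  unfolding pre dual_term_def prod.case by (simp only: mult.assoc)
 finally show ?thesis .
qed

text \<open>On the dual side S only permutes the pairs (k, n). The finite Fourier transform over the
  classes turns the phase into a congruence on k and the congruence on n into a phase, which is the
  pattern that the permutation produces.\<close>

lemma Psi_S:
 assumes N: "N > 0" and v: "Im \<tau> > 0" and t: "t > 0"
 shows "Psi N h (- 1 / \<tau>) t = \<tau> * (1 / of_nat N * (\<Sum>\<delta>\<in>disc_reps N. Psi N \<delta> \<tau> t * ee (of_int (fst h * snd \<delta> + snd h * fst \<delta>) / of_nat N)))"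
proof -
 have v': "Im (- 1 / \<tau>) > 0" using uminus_inverse_in_uhp[of \<tau>] v by (simp add: uhp_def)
 define D where "D p = dual_term N \<tau> t p" for p
 define c0 where "c0 = 2 * \<i> * of_real (t^2 / real N) * of_real (1 / Im \<tau>)"
 define B where "B \<delta> p = (of_bool (int N dvd snd p - snd \<delta>) * ee (of_int (fst p * fst \<delta>) / of_nat N) :: complex)" for \<delta> p :: "int \<times> int"
 have Psi_eq: "Psi N \<delta> \<tau> t = c0 * (\<Sum>\<^sub>\<infinity>p. B \<delta> p * D p)" for \<delta>
  using Psi_dual_indicator(1)[OF N v t, of \<delta>] unfolding B_def D_def c0_def by simp
 have Bs: "(%p. B \<delta> p * D p) summable_on UNIV" for \<delta>
  using Psi_dual_indicator(2)[OF N v t, of \<delta>] unfolding B_def D_def .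
 define E where "E p = (of_bool (int N dvd fst p + snd h) * ee (of_int (snd p * fst h) / of_nat N) :: complex)" for p :: "int \<times> int"
 have lhs: "Psi N h (- 1 / \<tau>) t = \<tau> * (c0 * (\<Sum>\<^sub>\<infinity>p. E p * D p))"
 proof -
  have "Psi N h (- 1 / \<tau>) t = 2 * \<i> * of_real (t^2 / real N) * (of_real (1 / Im (- 1 / \<tau>)) * (\<Sum>\<^sub>\<infinity>p. B h p * dual_term N (- 1 / \<tau>) t p))"
   using Psi_dual_indicator(1)[OF N v' t, of h] unfolding B_def by simp
  also have "of_real (1 / Im (- 1 / \<tau>)) * (\<Sum>\<^sub>\<infinity>p. B h p * dual_term N (- 1 / \<tau>) t p) =
   (\<Sum>\<^sub>\<infinity>p. B h p * (of_real (1 / Im (- 1 / \<tau>)) * dual_term N (- 1 / \<tau>) t p))"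
   unfolding infsum_cmult_right'[symmetric] by (rule infsum_cong) (simp only: mult_ac)
  also have "... = (\<Sum>\<^sub>\<infinity>p. B h p * (\<tau> * (of_real (1 / Im \<tau>) * D (- snd p, fst p))))"
   by (rule infsum_cong) (use dual_term_S[OF v N, of t] in \<open>auto simp only: D_def split_paired_all fst_conv snd_conv\<close>)
  also have "... = \<tau> * (of_real (1 / Im \<tau>) * (\<Sum>\<^sub>\<infinity>p. B h p * D (- snd p, fst p)))"
   unfolding infsum_cmult_right'[symmetric] by (rule infsum_cong) (simp only: mult_ac)
  also have "(\<Sum>\<^sub>\<infinity>p. B h p * D (- snd p, fst p)) = (\<Sum>\<^sub>\<infinity>p. E p * D p)"
  proof -
   \<comment> \<open>The substitution (k, n) -> (- n, k) is the action of S on the pairs.\<close>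
   have "bij_betw (%p :: int \<times> int. (- snd p, fst p)) UNIV UNIV"
    by (rule bij_betw_byWitness[where f'="%p. (snd p, - fst p)"]) auto
   from infsum_reindex_bij_betw[OF this, of "%p. E p * D p"]
   have "(\<Sum>\<^sub>\<infinity>p. E (- snd p, fst p) * D (- snd p, fst p)) = (\<Sum>\<^sub>\<infinity>p. E p * D p)" .
   moreover have "E (- snd p, fst p) = B h p" for p
    unfolding E_def B_def using dvd_diff_commute[of "int N" "snd p" "snd h"] by (simp add: add.commute)
   ultimately show ?thesis by simp
  qed
  finally show ?thesis unfolding c0_def by (simp only: mult_ac)
 qed
 \<comment> \<open>The sum factors over the two coordinates of delta: orthogonality of characters in
   the first, and a single surviving residue class in the second.\<close>
 have pt: "(\<Sum>\<delta>\<in>disc_reps N. B \<delta> p * ee (of_int (fst h * snd \<delta> + snd h * fst \<delta>) / of_nat N)) = of_nat N * E p" for p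
 proof -
  obtain k n where p: "p = (k, n)" by (cases p)
  have "(\<Sum>\<delta>\<in>disc_reps N. B \<delta> p * ee (of_int (fst h * snd \<delta> + snd h * fst \<delta>) / of_nat N)) =
   (\<Sum>d1\<in>{0..<int N}. \<Sum>d2\<in>{0..<int N}. ee (of_int (d1 * (k + snd h)) / of_nat N) * (of_bool (int N dvd n - d2) * ee (of_int (fst h * d2) / of_nat N)))"
   unfolding disc_reps_def sum.cartesian_product split_def
  proof (rule sum.cong[OF refl])
   fix \<delta> :: "int \<times> int"
   have "ee (of_int (k * fst \<delta>) / of_nat N) * ee (of_int (fst h * snd \<delta> + snd h * fst \<delta>) / of_nat N) = ee (of_int (fst \<delta> * (k + snd h)) / of_nat N) * ee (of_int (fst h * snd \<delta>) / of_nat N)"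
    unfolding ee_add[symmetric] by (rule arg_cong[where f=ee]) (simp add: add_divide_distrib[symmetric] algebra_simps)
   then show "B \<delta> p * ee (of_int (fst h * snd \<delta> + snd h * fst \<delta>) / of_nat N) =
     ee (of_int (fst \<delta> * (k + snd h)) / of_nat N) * (of_bool (int N dvd n - snd \<delta>) * ee (of_int (fst h * snd \<delta>) / of_nat N))"
    unfolding B_def p fst_conv snd_conv by (cases "int N dvd n - snd \<delta>") auto
  qed
  also have "... = (\<Sum>d1\<in>{0..<int N}. ee (of_int (d1 * (k + snd h)) / of_nat N)) * (\<Sum>d2\<in>{0..<int N}. of_bool (int N dvd n - d2) * ee (of_int (fst h * d2) / of_nat N))"
   by (rule sum_product[symmetric])
  also have "(\<Sum>d1\<in>{0..<int N}. ee (of_int (d1 * (k + snd h)) / of_nat N)) = (if int N dvd k + snd h then of_nat N else 0)"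
   by (rule sum_ee_orthogonal[OF N])
  also have "(\<Sum>d2\<in>{0..<int N}. of_bool (int N dvd n - d2) * ee (of_int (fst h * d2) / of_nat N)) = (\<Sum>d2\<in>{0..<int N}. if d2 = n mod int N then ee (of_int (fst h * n) / of_nat N) else 0)"
  proof (rule sum.cong[OF refl])
   fix d assume "d \<in> {0..<int N}"
   then have iff: "int N dvd n - d \<longleftrightarrow> d = n mod int N"
    by (metis atLeastLessThan_iff mod_eq_dvd_iff mod_pos_pos_trivial)
   have "ee (of_int (fst h * d) / of_nat N) = ee (of_int (fst h * n) / of_nat N)" if dv: "int N dvd n - d"
   proof -
    from dv obtain z where "n - d = int N * z" by (rule dvdE)
    then show ?thesis by (intro ee_shift[OF N, of _ _ "- fst h * z"]) (simp add: right_diff_distrib[symmetric] mult.left_commute algebra_simps)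
   qed
   then show "of_bool (int N dvd n - d) * ee (of_int (fst h * d) / of_nat N) = (if d = n mod int N then ee (of_int (fst h * n) / of_nat N) else 0)"
    using iff by auto
  qed
  also have "... = ee (of_int (fst h * n) / of_nat N)" using N by simp
  finally show ?thesis unfolding E_def p by (simp add: mult.commute)
 qed
 have "(\<Sum>\<delta>\<in>disc_reps N. Psi N \<delta> \<tau> t * ee (of_int (fst h * snd \<delta> + snd h * fst \<delta>) / of_nat N)) =
  c0 * (\<Sum>\<delta>\<in>disc_reps N. \<Sum>\<^sub>\<infinity>p. B \<delta> p * D p * ee (of_int (fst h * snd \<delta> + snd h * fst \<delta>) / of_nat N))"
  unfolding Psi_eq sum_distrib_left infsum_cmult_left' by (simp only: mult.assoc)
 also have "(\<Sum>\<delta>\<in>disc_reps N. \<Sum>\<^sub>\<infinity>p. B \<delta> p * D p * ee (of_int (fst h * snd \<delta> + snd h * fst \<delta>) / of_nat N)) =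
   (\<Sum>\<^sub>\<infinity>p. \<Sum>\<delta>\<in>disc_reps N. B \<delta> p * D p * ee (of_int (fst h * snd \<delta> + snd h * fst \<delta>) / of_nat N))"
  by (rule infsum_sum_swap[symmetric]) (auto simp: disc_reps_def intro!: summable_on_cmult_left Bs)
 also have "... = (\<Sum>\<^sub>\<infinity>p. of_nat N * (E p * D p))"
 proof (rule infsum_cong)
  fix p
  have "(\<Sum>\<delta>\<in>disc_reps N. B \<delta> p * D p * ee (of_int (fst h * snd \<delta> + snd h * fst \<delta>) / of_nat N)) =
   (\<Sum>\<delta>\<in>disc_reps N. B \<delta> p * ee (of_int (fst h * snd \<delta> + snd h * fst \<delta>) / of_nat N)) * D p"
   unfolding sum_distrib_right by (simp only: mult_ac)
  then show "(\<Sum>\<delta>\<in>disc_reps N. B \<delta> p * D p * ee (of_int (fst h * snd \<delta> + snd h * fst \<delta>) / of_nat N)) = of_nat N * (E p * D p)"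
   unfolding pt by (simp only: mult.assoc)
 qed
 also have "... = of_nat N * (\<Sum>\<^sub>\<infinity>p. E p * D p)" by (rule infsum_cmult_right')
 finally show ?thesis unfolding lhs using N by simp
qed

section \<open>The coordinates of \<open>iota\<close> and the two kernels expressed in them\<close>

text \<open>Along t = exp w the derivative of \<open>xi_coord\<close> in w is
  \<open>eta_coord\<close>; this relation makes the kernels primitives and derivatives of each
  other.\<close>

definition xi_coord :: "nat => real => int \<times> int => real" where
 "xi_coord N t X = (x1 X / t + x2 X * t) / sqrt (2 * real N)"

definition eta_coord :: "nat => real => int \<times> int => real" where
 "eta_coord N t X = (x2 X * t - x1 X / t) / sqrt (2 * real N)"

lemma iota_eq:
 assumes "N > 0" "t > 0"
 shows "iota N t (rvec X) = (xi_coord N t X, eta_coord N t X)"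
proof -
 have s: "sqrt (real N / 2) / real N = 1 / sqrt (2 * real N)"
 proof -
  have "sqrt (real N / 2) * sqrt (2 * real N) = real N"
   unfolding real_sqrt_mult[symmetric] using assms by (simp add: real_sqrt_mult)
  then show ?thesis using assms by (simp add: field_simps)
 qed
 have "BF N (rvec X) (Wvec N t) = sqrt (real N / 2) / real N * (x1 X / t + x2 X * t)"
  "BF N (rvec X) (Zvec N t) = sqrt (real N / 2) / real N * (x2 X * t - x1 X / t)"
  by (simp_all add: BF_def Wvec_def Zvec_def rvec_def algebra_simps diff_divide_distrib add_divide_distrib)
 then show ?thesis unfolding iota_def s xi_coord_def eta_coord_def by simp
qed

lemma coord_squares:
 assumes "N > 0" "t > 0"
 shows "(xi_coord N t X)\<^sup>2 - (eta_coord N t X)\<^sup>2 = 2 * (of_int (fst X * snd X) / real N)"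
  and "(xi_coord N t X)\<^sup>2 + (eta_coord N t X)\<^sup>2 = ((x1 X)\<^sup>2 / t^2 + (x2 X)\<^sup>2 * t^2) / real N"
proof -
 define A B where "A = x1 X / t" and "B = x2 X * t"
 have c: "(xi_coord N t X)\<^sup>2 = (A + B)\<^sup>2 / (2 * real N)" "(eta_coord N t X)\<^sup>2 = (B - A)\<^sup>2 / (2 * real N)"
  unfolding xi_coord_def eta_coord_def A_def B_def power_divide by simp_all
 have AB: "of_int (fst X * snd X) = A * B" using assms by (simp add: A_def B_def)
 have sq: "(x1 X)\<^sup>2 / t^2 = A\<^sup>2" "(x2 X)\<^sup>2 * t^2 = B\<^sup>2"
  by (simp_all add: A_def B_def power_divide power_mult_distrib)
 show "(xi_coord N t X)\<^sup>2 - (eta_coord N t X)\<^sup>2 = 2 * (of_int (fst X * snd X) / real N)"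
  unfolding c AB using assms by (simp add: field_simps power2_eq_square)
 show "(xi_coord N t X)\<^sup>2 + (eta_coord N t X)\<^sup>2 = ((x1 X)\<^sup>2 / t^2 + (x2 X)\<^sup>2 * t^2) / real N"
  unfolding c sq using assms by (simp add: field_simps power2_eq_square)
qed

lemma psi_term_coord:
 assumes N: "N > 0" and t: "t > 0" and v: "Im \<tau> > 0"
 shows "psi_term N \<tau> t X = of_real (2 * sqrt (2 * Im \<tau>) * eta_coord N t X * exp (- pi * Im \<tau> * ((xi_coord N t X)\<^sup>2 + (eta_coord N t X)\<^sup>2))) *
   ee (- of_real (of_int (fst X * snd X) * Re \<tau> / real N))"
proof -
 have s: "sqrt (Im \<tau> / real N) = sqrt (2 * Im \<tau>) / sqrt (2 * real N)"
  by (simp add: real_sqrt_divide[symmetric] real_sqrt_mult)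
 have e: "- pi * Im \<tau> / real N * ((x1 X)\<^sup>2 / t^2 + (x2 X)\<^sup>2 * t^2) = - pi * Im \<tau> * ((xi_coord N t X)\<^sup>2 + (eta_coord N t X)\<^sup>2)"
  unfolding coord_squares(2)[OF N t] by simp
 show ?thesis unfolding psi_term_def e s eta_coord_def by simp
qed

text \<open>Changing the sign of x1 exchanges the two coordinates and the sign of Q. The linear
  factor of \<open>phi\<close> is the first coordinate, that of \<open>psi_term\<close> the second,
  so the reflection matches them up to the normalisation 1/2.\<close>

lemma phi_eq_psi_term:
 assumes N: "N > 0" and t: "t > 0" and v: "Im \<tau> > 0"
 shows "phi \<tau> (iota N t (rvec X)) = 1 / 2 * psi_term N \<tau> t (- fst X, snd X)"
proof -
 define x y where "x = xi_coord N t X" and "y = eta_coord N t X"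
 have sw: "eta_coord N t (- fst X, snd X) = x" "xi_coord N t (- fst X, snd X) = y"
  by (simp_all add: x_def y_def xi_coord_def eta_coord_def)
 have d: "x\<^sup>2 - y\<^sup>2 = 2 * (of_int (fst X * snd X) / real N)" unfolding x_def y_def by (rule coord_squares(1)[OF N t])
 have "of_real (x^2 / 2) * \<tau> - of_real (y^2 / 2) * cnj \<tau> = of_real ((x^2 - y\<^sup>2) / 2 * Re \<tau>) + \<i> * of_real ((x^2 + y^2) / 2 * Im \<tau>)"
  by (simp add: complex_eq_iff algebra_simps diff_divide_distrib add_divide_distrib)
 moreover have "ee (\<i> * of_real ((x^2 + y^2) / 2 * Im \<tau>)) = of_real (exp (- pi * Im \<tau> * (x^2 + y^2)))"
  unfolding ee_def exp_of_real[symmetric] by (rule arg_cong[where f=exp]) (simp add: complex_eq_iff)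
 moreover have "(x^2 - y\<^sup>2) / 2 * Re \<tau> = of_int (fst X * snd X) * Re \<tau> / real N" unfolding d by simp
 ultimately have e: "ee (of_real (x^2 / 2) * \<tau> - of_real (y^2 / 2) * cnj \<tau>) = ee (of_real (of_int (fst X * snd X) * Re \<tau> / real N)) * of_real (exp (- pi * Im \<tau> * (x^2 + y^2)))"
  by (simp only: ee_add)
 have "phi \<tau> (iota N t (rvec X)) = of_real (sqrt (2 * Im \<tau>) * x) * (ee (of_real (of_int (fst X * snd X) * Re \<tau> / real N)) * of_real (exp (- pi * Im \<tau> * (x^2 + y^2))))"
  unfolding iota_eq[OF N t] phi_def prod.case x_def[symmetric] y_def[symmetric] e ..
 moreover have "psi_term N \<tau> t (- fst X, snd X) = of_real (2 * sqrt (2 * Im \<tau>) * x * exp (- pi * Im \<tau> * (y^2 + x^2))) * ee (of_real (of_int (fst X * snd X) * Re \<tau> / real N))"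
  unfolding psi_term_coord[OF N t v] sw by simp
 ultimately show ?thesis by (simp add: add.commute)
qed

lemma Theta_eq_Psi:
 assumes N: "N > 0" and t: "t > 0" and v: "Im \<tau> > 0"
 shows "Theta N h \<tau> t = 1 / 2 * Psi N (- fst h, snd h) \<tau> t"
proof -
 let ?r = "%X::int \<times> int. (- fst X, snd X)"
 have im: "?r ` lat_coset N h = lat_coset N (?r h)"
 proof (intro set_eqI iffI)
  fix X assume "X \<in> lat_coset N (?r h)"
  then have "?r X \<in> lat_coset N h"
   using dvd_minus_iff[of "int N" "fst X + fst h"] by (simp add: in_lat_coset_iff)
  moreover have "X = ?r (?r X)" by simp
  ultimately show "X \<in> ?r ` lat_coset N h" by blast
 next
  fix X assume "X \<in> ?r ` lat_coset N h"
  then obtain Y where Y: "Y \<in> lat_coset N h" "X = ?r Y" by blast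
  then show "X \<in> lat_coset N (?r h)"
   using dvd_minus_iff[of "int N" "fst Y - fst h"] by (simp add: in_lat_coset_iff)
 qed
 have "inj_on ?r A" for A by (auto simp: inj_on_def prod_eq_iff)
 then have "(\<Sum>\<^sub>\<infinity>X\<in>lat_coset N h. psi_term N \<tau> t (?r X)) = Psi N (?r h) \<tau> t"
  unfolding Psi_def im[symmetric] by (subst infsum_reindex) (auto simp: o_def)
 then show ?thesis unfolding Theta_def phi_eq_psi_term[OF N t v] infsum_cmult_right' by simp
qed

text \<open>Superexponential decay makes the transform converge and be entire for all s, so the
  constant term is just its value at 0.\<close>

lemma vartheta_eq_integral:
 assumes N: "N > 0" and v: "Im \<tau> > 0"
 shows "vartheta N h \<tau> = 1 / 2 * (LINT w|lborel. Psi N (- fst h, snd h) \<tau> (exp w))"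
proof -
 define f where "f w = 1 / 2 * Psi N (- fst h, snd h) \<tau> (exp w)" for w
 define G where "G s = (LINT w|lborel. f w * exp (- s * of_real \<bar>w\<bar>))" for s
 have f: "f w = Theta N h \<tau> (exp w)" for w unfolding f_def using Theta_eq_Psi[OF N _ v] by simp
 have meas: "f \<in> borel_measurable borel"
  unfolding f_def using Psi_exp_measurable[OF N v] by measurable
 have int: "integrable lborel (%w. norm (f w) * exp (K * abs w))" for K
  unfolding f_def norm_mult mult.assoc by (intro integrable_mult_right Psi_exp_integrable[OF N v])
 have hol: "G holomorphic_on UNIV" unfolding G_def by (rule exp_transform_entire(1)[OF meas int])
 have "G meromorphic_on UNIV"
  using hol by (intro analytic_on_imp_meromorphic_on) (simp add: analytic_on_open)
 moreover have "G s = split_integral (Theta N h \<tau>) s" for s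
 proof -
  have "split_integral (Theta N h \<tau>) s = (LINT w|lborel. Theta N h \<tau> (exp w) * exp (- s * of_real \<bar>w\<bar>))"
  proof (rule split_integral_eq_exp_transform)
   have "continuous_on {0<..} (%t. 1 / 2 * Psi N (- fst h, snd h) \<tau> t)"
    by (intro continuous_intros Psi_continuous[OF N v])
   then show "continuous_on {0<..} (Theta N h \<tau>)"
    by (rule continuous_on_eq) (use Theta_eq_Psi[OF N _ v] in simp)
   have "integrable lborel (%w. norm (f w) * exp (- Re s * abs w))" by (rule int)
   then have "integrable lborel (%w. f w * exp (- s * of_real \<bar>w\<bar>))"
    by (rule integrable_dominated) (use meas in \<open>auto simp: norm_mult\<close>)
   then show "integrable lborel (%w. Theta N h \<tau> (exp w) * exp (- s * of_real \<bar>w\<bar>))" unfolding f .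
  qed
  then show ?thesis unfolding G_def f by simp
 qed
 ultimately have "continued_constant_term (split_integral (Theta N h \<tau>)) = fls_nth (laurent_expansion G 0) 0"
  by (rule continued_constant_term_eqI)
 then show ?thesis unfolding vartheta_def fls_nth_laurent_expansion_entire[OF hol] by (simp add: G_def f_def)
qed

section \<open>The complementary error function\<close>

lemma DERIV_erfc: "(erfc has_real_derivative - 2 / sqrt pi * exp (- (x^2))) (at x)"
proof -
 let ?I = "{- abs x - 1..\<bar>x\<bar> + 1}"
 have "((%u. LBINT r=0..u. exp (- (r^2))) has_vector_derivative exp (- (x^2))) (at x within ?I)"
 proof -
  have "continuous_on ?I (%r. exp (- (r^2)))" by (intro continuous_intros)
  then have "((%u. LBINT r=ereal 0..ereal u. exp (- (r^2))) has_vector_derivative exp (- (x^2))) (at x within ?I)"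
   by (intro interval_integral_FTC2) (auto simp: abs_if)
  then show ?thesis by (simp add: zero_ereal_def)
 qed
 then have "((%u. LBINT r=0..u. exp (- (r^2))) has_real_derivative exp (- (x^2))) (at x within ?I)"
  by (simp add: has_real_derivative_iff_has_vector_derivative)
 moreover have "at x within ?I = at x"
  by (rule at_within_interior) (auto simp: abs_if)
 ultimately have "((%u. LBINT r=0..u. exp (- (r^2))) has_real_derivative exp (- (x^2))) (at x)" by simp
 then have "((%u. 1 - 2 / sqrt pi * (LBINT r=0..u. exp (- (r^2)))) has_real_derivative 0 - 2 / sqrt pi * exp (- (x^2))) (at x)"
  by (intro DERIV_diff DERIV_const DERIV_cmult)
 moreover have "erfc = (%u. 1 - 2 / sqrt pi * (LBINT r=0..u. exp (- (r^2))))"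
  by (rule ext) (simp add: erfc_def)
 ultimately show ?thesis by simp
qed

lemma erfc_0: "erfc 0 = 1"
 by (simp add: erfc_def zero_ereal_def[symmetric])

lemma erfc_minus: "erfc (- x) = 2 - erfc x"
proof -
 have d: "((%x. erfc x + erfc (- x)) has_real_derivative 0) (at x)" for x
 proof -
  have "((%x. erfc x + erfc (- x)) has_real_derivative (- 2 / sqrt pi * exp (- (x^2))) + (- 2 / sqrt pi * exp (- ((- x)\<^sup>2))) * (- 1)) (at x)"
   by (intro DERIV_add DERIV_erfc DERIV_chain2[OF DERIV_erfc]) (auto intro!: derivative_eq_intros)
  then show ?thesis by simp
 qed
 then have "\<forall>x. ((%x. erfc x + erfc (- x)) has_real_derivative 0) (at x)" by blast
 from DERIV_isconst_all[OF this, of x 0] show ?thesis by (simp add: erfc_0)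
qed

lemma erfc_tendsto_0: "(erfc \<longlongrightarrow> 0) at_top"
proof -
 let ?f = "%x::real. indicator {0..} x *\<^sub>R exp (- x\<^sup>2)"
 have i: "integrable lborel ?f" "(LINT x|lborel. ?f x) = sqrt pi / 2"
  using gaussian_moment_0 by (auto simp: has_bochner_integral_iff)
 have "((%y::real. LINT x|lborel. indicator {..y} x *\<^sub>R ?f x) \<longlongrightarrow> (LINT x|lborel. ?f x)) at_top"
  by (rule tendsto_integral_at_top) (use i in auto)
 moreover have "eventually (%y::real. (LINT x|lborel. indicator {..y} x *\<^sub>R ?f x) = (LBINT r=0..y. exp (- (r^2)))) at_top"
  using eventually_ge_at_top[of 0]
 proof eventually_elim
  case (elim y)
  have "(LBINT r=0..y. exp (- (r^2))) = (LBINT r:{0..y}. exp (- (r^2)))"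
   using interval_integral_Icc[of 0 y "%r. exp (- (r^2))"] elim by (simp add: zero_ereal_def)
  also have "... = (LINT x|lborel. indicator {..y} x *\<^sub>R ?f x)"
   unfolding set_lebesgue_integral_def by (rule lebesgue_integral_cong) (auto simp: indicator_def)
  finally show ?case by simp
 qed
 ultimately have "((%y::real. LBINT r=0..y. exp (- (r^2))) \<longlongrightarrow> sqrt pi / 2) at_top"
  unfolding i(2) by (rule Lim_transform_eventually)
 then have "((%y::real. 1 - 2 / sqrt pi * (LBINT r=0..y. exp (- (r^2)))) \<longlongrightarrow> 1 - 2 / sqrt pi * (sqrt pi / 2)) at_top"
  by (intro tendsto_intros)
 then show ?thesis by (simp add: erfc_def[abs_def])
qed

lemma erfc_antimono: "x <= y ==> erfc y <= erfc x"
 by (rule DERIV_nonpos_imp_nonincreasing) (auto intro!: exI[of _ "- 2 / sqrt pi * exp (- (_\<^sup>2))"] DERIV_erfc)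

lemma erfc_nonneg: "erfc x >= 0"
proof (rule tendsto_upperbound[OF erfc_tendsto_0])
 show "\<forall>\<^sub>F y in at_top. erfc y <= erfc x"
  using eventually_ge_at_top[of x] by eventually_elim (rule erfc_antimono)
qed auto

lemma erfc_le_1: "x >= 0 ==> erfc x <= 1"
 using erfc_antimono[of 0 x] by (simp add: erfc_0)

text \<open>The difference exp(-x^2) - erfc x vanishes at 0, increases up to x = 1/sqrt pi, then
  decreases to its limit 0; so it is nonnegative on both pieces.\<close>

lemma erfc_le_gauss:
 assumes "x >= 0"
 shows "erfc x <= exp (- (x^2))"
proof -
 define h where "h x = exp (- (x^2)) - erfc x" for x :: real
 have d: "(h has_real_derivative (2 / sqrt pi - 2 * x) * exp (- (x^2))) (at x)" for x
  unfolding h_def by (rule derivative_eq_intros DERIV_erfc refl)+ (simp add: algebra_simps)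
 have "h x >= 0"
 proof (cases "x <= 1 / sqrt pi")
  case True
  have "h 0 <= h x"
  proof (rule DERIV_nonneg_imp_nondecreasing[OF assms])
   fix y assume "0 <= y" "y <= x"
   with True have "2 / sqrt pi - 2 * y >= 0" by simp
   then show "\<exists>z. (h has_real_derivative z) (at y) \<and> 0 <= z" using d by (intro exI conjI, assumption?) auto
  qed
  then show ?thesis by (simp add: h_def erfc_0)
 next
  case False
  have "(h \<longlongrightarrow> 0 - 0) at_top"
   unfolding h_def by (intro tendsto_diff erfc_tendsto_0) real_asymp
  then have lim: "(h \<longlongrightarrow> 0) at_top" by simp
  show ?thesis
  proof (rule tendsto_upperbound[OF lim])
   show "\<forall>\<^sub>F y in at_top. h y <= h x"
    using eventually_ge_at_top[of x]
   proof eventually_elim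
    case (elim y)
    show ?case
    proof (rule DERIV_nonpos_imp_nonincreasing[OF elim])
     fix z assume "x <= z" "z <= y"
     with False have "2 / sqrt pi - 2 * z <= 0" by simp
     then have "(2 / sqrt pi - 2 * z) * exp (- (z^2)) <= 0" by (rule mult_nonpos_nonneg) simp
     then show "\<exists>w. (h has_real_derivative w) (at z) \<and> w <= 0" using d by blast
    qed
   qed
  qed auto
 qed
 then show ?thesis by (simp add: h_def)
qed

definition tphi_term :: "nat => complex => real => int \<times> int => complex" where
 "tphi_term N \<tau> t X = tphi \<tau> (iota N t (rvec X))"

lemma ee_of_real_times:
 "ee (of_real c * \<tau>) = ee (of_real (c * Re \<tau>)) * of_real (exp (- 2 * pi * c * Im \<tau>))"
proof -
 have "of_real c * \<tau> = of_real (c * Re \<tau>) + \<i> * of_real (c * Im \<tau>)" by (simp add: complex_eq_iff)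
 moreover have "ee (\<i> * of_real (c * Im \<tau>)) = of_real (exp (- 2 * pi * c * Im \<tau>))"
  unfolding ee_def exp_of_real[symmetric] by (rule arg_cong[where f=exp]) (simp add: complex_eq_iff)
 ultimately show ?thesis by (simp only: ee_add)
qed

definition qform :: "nat => int \<times> int => real" where
 "qform N X = of_int (fst X * snd X) / real N"

text \<open>With \<open>1 - erfc\<close> odd, the discontinuity of the sign is cancelled by the characteristic function:
 along the curve \<open>t\<close> the sign of the first coordinate is constant when \<open>Q(X) >= 0\<close>.\<close>

lemma tphi_term_eq:
 assumes N: "N > 0" and t: "t > 0" and v: "Im \<tau> > 0"
 shows "tphi_term N \<tau> t X = ee (- of_real (qform N X) * \<tau>) *
   of_real (1 - erfc (sqrt (2 * pi * Im \<tau>) * xi_coord N t X) - (if fst X * snd X < 0 then 0 else sgn (of_int (fst X + snd X))))"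
proof -
 define x y c where "x = xi_coord N t X" and "y = eta_coord N t X" and "c = sqrt (2 * pi * Im \<tau>)"
 have d: "(y^2 - x\<^sup>2) / 2 = - qform N X"
  using coord_squares(1)[OF N t, of X] unfolding x_def y_def qform_def by simp
 have neg: "y\<^sup>2 > x^2 \<longleftrightarrow> fst X * snd X < 0"
 proof -
  have "y\<^sup>2 > x^2 \<longleftrightarrow> qform N X < 0" using d by auto
  also have "... \<longleftrightarrow> real_of_int (fst X * snd X) < 0" using N by (simp add: qform_def divide_less_0_iff del: of_int_mult)
  finally show ?thesis by (simp only: of_int_less_0_iff)
 qed
 have key: "sgn x * (of_bool (y^2 > x^2) - erfc (c * abs x)) = 1 - erfc (c * x) - (if fst X * snd X < 0 then 0 else sgn (of_int (fst X + snd X)))"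
 proof (cases "fst X * snd X < 0")
  case True
  then show ?thesis using erfc_minus[of "c * x"] neg erfc_0 by (cases "x = 0"; cases "x > 0") (auto simp: sgn_if abs_if)
 next
  case False
  \<comment> \<open>When x1 x2 >= 0 the summands x1/t and x2 t cannot have opposite signs, so the
    sign of their sum is that of x1 + x2 for every t > 0.\<close>
  have sx: "sgn x = sgn (of_int (fst X + snd X))"
  proof -
   define a b where "a = fst X" and "b = snd X"
   have ab: "a * b >= 0" using False by (simp add: a_def b_def)
   have s: "sqrt (2 * real N) > 0" using N by simp
   consider "a > 0 \<and> b >= 0 \<or> a >= 0 \<and> b > 0" | "a < 0 \<and> b <= 0 \<or> a <= 0 \<and> b < 0" | "a = 0" "b = 0"
    using ab by (metis linorder_neqE_linordered_idom mult_less_0_iff not_less order_less_imp_le)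
   then have "sgn (of_int a / t + of_int b * t :: real) = sgn (of_int (a + b))"
   proof cases
    case 1
    then have "of_int a / t + of_int b * t > 0" using t by (auto intro: add_pos_nonneg add_nonneg_pos)
    moreover have "real_of_int (a + b) > 0" using 1 by auto
    ultimately show ?thesis by (simp only: sgn_pos)
   next
    case 2
    then have "of_int a / t + of_int b * t < 0"
    proof (elim disjE)
     assume "a < 0 \<and> b <= 0"
     then show ?thesis using t by (intro add_neg_nonpos divide_neg_pos mult_nonpos_nonneg) auto
    next
     assume "a <= 0 \<and> b < 0"
     then show ?thesis using t by (intro add_nonpos_neg divide_nonpos_pos mult_neg_pos) auto
    qed
    moreover have "real_of_int (a + b) < 0" using 2 by auto
    ultimately show ?thesis by (simp only: sgn_neg)
   qed auto
   then show ?thesis using s unfolding x_def xi_coord_def a_def b_def by (simp add: sgn_divide)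
  qed
  show ?thesis using False neg erfc_minus[of "c * x"] erfc_0 unfolding sx[symmetric]
   by (cases "x = 0"; cases "x > 0") (auto simp: sgn_if abs_if)
 qed
 have "tphi_term N \<tau> t X = ee (of_real (- qform N X) * \<tau>) * of_real (sgn x * (of_bool (y^2 > x^2) - erfc (c * abs x)))"
  unfolding tphi_term_def iota_eq[OF N t] tphi_def prod.case x_def[symmetric] y_def[symmetric] c_def[symmetric] d by simp
 then show ?thesis unfolding key unfolding x_def c_def by (metis of_real_minus)
qed

lemma xi_coord_DERIV:
 "((%w. xi_coord N (exp w) X) has_real_derivative eta_coord N (exp w) X) (at w)"
proof -
 have "xi_coord N (exp w) X = (x1 X * exp (- w) + x2 X * exp w) / sqrt (2 * real N)" for w
  by (simp add: xi_coord_def exp_minus divide_inverse)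
 moreover have "eta_coord N (exp w) X = (x1 X * (- exp (- w)) + x2 X * exp w) / sqrt (2 * real N)"
  by (simp add: eta_coord_def exp_minus divide_inverse)
 moreover have "((%w. (x1 X * exp (- w) + x2 X * exp w) / sqrt (2 * real N)) has_real_derivative
   (x1 X * (- exp (- w)) + x2 X * exp w) / sqrt (2 * real N)) (at w)"
  by (intro DERIV_cdivide) (auto intro!: derivative_eq_intros)
 ultimately show ?thesis by simp
qed

text \<open>From eta^2 = xi^2 - 2 Q one has xi^2 + eta^2 = 2 xi^2 - 2 Q, so the factor ee(-Q tau)
  splits off and the rest has the shape that the chain rule gives for erfc.\<close>

lemma psi_term_eq_deriv:
 assumes N: "N > 0" and t: "t > 0" and v: "Im \<tau> > 0"
 shows "psi_term N \<tau> t X = ee (- of_real (qform N X) * \<tau>) *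
   of_real (2 / sqrt pi * exp (- ((sqrt (2 * pi * Im \<tau>) * xi_coord N t X)\<^sup>2)) * (sqrt (2 * pi * Im \<tau>) * eta_coord N t X))"
proof -
 define x y where "x = xi_coord N t X" and "y = eta_coord N t X"
 have d: "x\<^sup>2 - y\<^sup>2 = 2 * qform N X" using coord_squares(1)[OF N t, of X] unfolding x_def y_def qform_def .
 have e: "exp (- pi * Im \<tau> * (x^2 + y^2)) = exp (- 2 * pi * (- qform N X) * Im \<tau>) * exp (- ((sqrt (2 * pi * Im \<tau>) * x)\<^sup>2))"
 proof -
  have y2: "y\<^sup>2 = x^2 - 2 * qform N X" using d by simp
  show ?thesis unfolding exp_add[symmetric] y2 using v by (simp add: power_mult_distrib algebra_simps)
 qed
 have s: "2 / sqrt pi * sqrt (2 * pi * Im \<tau>) = 2 * sqrt (2 * Im \<tau>)" by (simp add: real_sqrt_mult)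
 have q: "ee (- of_real (qform N X) * \<tau>) = ee (- of_real (of_int (fst X * snd X) * Re \<tau> / real N)) * of_real (exp (- 2 * pi * (- qform N X) * Im \<tau>))"
  using ee_of_real_times[of "- qform N X" \<tau>] by (simp add: qform_def)
 have "psi_term N \<tau> t X = of_real (2 * sqrt (2 * Im \<tau>) * y * exp (- pi * Im \<tau> * (x^2 + y^2))) * ee (- of_real (of_int (fst X * snd X) * Re \<tau> / real N))"
  unfolding psi_term_coord[OF N t v] x_def y_def ..
 also have "... = ee (- of_real (of_int (fst X * snd X) * Re \<tau> / real N)) * of_real (exp (- 2 * pi * (- qform N X) * Im \<tau>)) *
   of_real ((2 / sqrt pi * sqrt (2 * pi * Im \<tau>)) * exp (- ((sqrt (2 * pi * Im \<tau>) * x)\<^sup>2)) * y)"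
  unfolding e s by (simp only: of_real_mult mult_ac)
 finally show ?thesis unfolding q x_def y_def by (simp only: mult_ac)
qed

lemma tphi_term_has_vector_derivative:
 assumes N: "N > 0" and v: "Im \<tau> > 0"
 shows "((%w. tphi_term N \<tau> (exp w) X) has_vector_derivative psi_term N \<tau> (exp w) X) (at w within A)"
proof -
 define c where "c = sqrt (2 * pi * Im \<tau>)"
 define \<kappa> where "\<kappa> = (if fst X * snd X < 0 then 0 else sgn (real_of_int (fst X + snd X)))"
 have "((%w. 1 - erfc (c * xi_coord N (exp w) X) - \<kappa>) has_real_derivative
   0 - (- 2 / sqrt pi * exp (- ((c * xi_coord N (exp w) X)\<^sup>2))) * (c * eta_coord N (exp w) X) - 0) (at w)"
  by (intro DERIV_diff DERIV_const DERIV_chain2[OF DERIV_erfc] DERIV_cmult xi_coord_DERIV)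
 then have "((%w. 1 - erfc (c * xi_coord N (exp w) X) - \<kappa>) has_real_derivative
   2 / sqrt pi * exp (- ((c * xi_coord N (exp w) X)\<^sup>2)) * (c * eta_coord N (exp w) X)) (at w within A)"
  by (rule has_field_derivative_at_within[THEN DERIV_cong]) simp
 then have "((%w. ee (- of_real (qform N X) * \<tau>) * of_real (1 - erfc (c * xi_coord N (exp w) X) - \<kappa>)) has_vector_derivative
   ee (- of_real (qform N X) * \<tau>) * of_real (2 / sqrt pi * exp (- ((c * xi_coord N (exp w) X)\<^sup>2)) * (c * eta_coord N (exp w) X))) (at w within A)"
  by (intro has_vector_derivative_mult_right has_vector_derivative_of_real)
 then show ?thesis unfolding c_def \<kappa>_def tphi_term_eq[OF N exp_gt_zero v] psi_term_eq_deriv[OF N exp_gt_zero v] .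
qed

lemma int_prod_abs_ge:
 fixes a b :: int
 assumes "a ~= 0" "b ~= 0"
 shows "\<bar>real_of_int a\<bar> + \<bar>real_of_int b\<bar> <= 2 * \<bar>real_of_int (a * b)\<bar>"
proof -
 have "abs a >= 1" "abs b >= 1" using assms by auto
 then have 1: "\<bar>real_of_int a\<bar> >= 1" "\<bar>real_of_int b\<bar> >= 1" by (simp_all flip: of_int_abs)
 \<comment> \<open>This gives |ab| >= |a| + |b| - 1, and |a| + |b| >= 2 absorbs the 1.\<close>
 then have "(\<bar>real_of_int a\<bar> - 1) * (\<bar>real_of_int b\<bar> - 1) >= 0" by simp
 then have "\<bar>real_of_int a\<bar> * \<bar>real_of_int b\<bar> >= \<bar>real_of_int a\<bar> + \<bar>real_of_int b\<bar> - 1" by (simp add: algebra_simps)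
 then have "\<bar>real_of_int (a * b)\<bar> >= \<bar>real_of_int a\<bar> + \<bar>real_of_int b\<bar> - 1" by (simp add: abs_mult)
 then show ?thesis using 1 by linarith
qed

text \<open>For Q < 0 the factor ee(-Q tau) alone decays, because 2|x1 x2| dominates |x1| + |x2| for
  nonzero integers. For Q >= 0 the Gaussian bound for erfc compensates its growth and leaves exp(-pi
  v (xi^2 + eta^2)). The point t = 1 suffices, since the other values of t are reached by
  increments.\<close>

lemma tphi_term_abs_summable:
 assumes N: "N > 0" and v: "Im \<tau> > 0"
 shows "(%X. norm (tphi_term N \<tau> 1 X)) summable_on A"
proof -
 define c where "c = pi * Im \<tau> / real N"
 have c: "c > 0" using N v by (simp add: c_def)
 define g where "g X = exp (- c * \<bar>x1 X\<bar>) * exp (- c * \<bar>x2 X\<bar>)" for X :: "int \<times> int"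
 define K where "K = exp (c^2 / (4 * c)) * exp (c^2 / (4 * c))"
 have K: "K >= 1" unfolding K_def exp_add[symmetric] using c by simp
 have b: "norm (tphi_term N \<tau> 1 X) <= K * g X" for X
 proof -
  define x y where "x = xi_coord N 1 X" and "y = eta_coord N 1 X"
  have nq: "norm (ee (of_real ((y^2 - x\<^sup>2) / 2) * \<tau>)) = exp (2 * pi * Im \<tau> * ((x^2 - y\<^sup>2) / 2))"
   by (simp add: norm_ee algebra_simps)
  have d: "x\<^sup>2 - y\<^sup>2 = 2 * (of_int (fst X * snd X) / real N)" "x\<^sup>2 + y^2 = ((x1 X)\<^sup>2 + (x2 X)\<^sup>2) / real N"
   using coord_squares[OF N, of 1 X] unfolding x_def y_def by simp_all
  have nt: "norm (tphi_term N \<tau> 1 X) = \<bar>sgn x\<bar> * exp (2 * pi * Im \<tau> * ((x^2 - y\<^sup>2) / 2)) * \<bar>of_bool (y^2 > x^2) - erfc (sqrt (2 * pi * Im \<tau>) * abs x)\<bar>"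
   unfolding tphi_term_def iota_eq[OF N zero_less_one] tphi_def prod.case x_def[symmetric] y_def[symmetric] norm_mult nq norm_of_real ..
  have e: "0 <= erfc (sqrt (2 * pi * Im \<tau>) * abs x)" "erfc (sqrt (2 * pi * Im \<tau>) * abs x) <= 1"
   using erfc_nonneg erfc_le_1 v by auto
  have sg: "\<bar>sgn x\<bar> <= 1" by (simp add: sgn_if)
  show ?thesis
  proof (cases "fst X * snd X < 0")
   case True
   have "\<bar>of_bool (y^2 > x^2) - erfc (sqrt (2 * pi * Im \<tau>) * abs x)\<bar> <= 1" using e by (auto simp: of_bool_def)
   then have "norm (tphi_term N \<tau> 1 X) <= 1 * exp (2 * pi * Im \<tau> * ((x^2 - y\<^sup>2) / 2)) * 1"
    unfolding nt using sg by (intro mult_mono) auto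
   also have "... = exp (- (c * (2 * \<bar>real_of_int (fst X * snd X)\<bar>)))"
    unfolding d using True by (simp add: c_def abs_of_neg mult.commute mult.left_commute del: of_int_mult flip: of_int_less_0_iff)
   also have "... <= exp (- (c * (\<bar>real_of_int (fst X)\<bar> + \<bar>real_of_int (snd X)\<bar>)))"
   proof -
    have "\<bar>real_of_int (fst X)\<bar> + \<bar>real_of_int (snd X)\<bar> <= 2 * \<bar>real_of_int (fst X * snd X)\<bar>"
     by (rule int_prod_abs_ge) (use True in auto)
    then have "c * (\<bar>real_of_int (fst X)\<bar> + \<bar>real_of_int (snd X)\<bar>) <= c * (2 * \<bar>real_of_int (fst X * snd X)\<bar>)"
     using c by (intro mult_left_mono) auto
    then show ?thesis by simp
   qed
   also have "... = 1 * g X" unfolding g_def exp_add[symmetric] by (simp add: algebra_simps)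
   also have "... <= K * g X" using K by (intro mult_right_mono) (auto simp: g_def)
   finally show ?thesis .
  next
   case False
   then have "real_of_int (fst X * snd X) >= 0" by (simp only: of_int_0_le_iff not_less)
   then have "x\<^sup>2 - y\<^sup>2 >= 0" unfolding d using N by simp
   then have ob: "\<not> y\<^sup>2 > x^2" by simp
   have "erfc (sqrt (2 * pi * Im \<tau>) * abs x) <= exp (- ((sqrt (2 * pi * Im \<tau>) * abs x)\<^sup>2))"
    by (rule erfc_le_gauss) (use v in auto)
   then have "norm (tphi_term N \<tau> 1 X) <= 1 * exp (2 * pi * Im \<tau> * ((x^2 - y\<^sup>2) / 2)) * exp (- ((sqrt (2 * pi * Im \<tau>) * abs x)\<^sup>2))"
    unfolding nt using sg e ob by (intro mult_mono) auto
   also have "... = exp (- pi * Im \<tau> * (x^2 + y^2))"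
   proof -
    have k: "(sqrt (2 * pi * Im \<tau>) * abs x)\<^sup>2 = 2 * pi * Im \<tau> * x^2" using v by (simp add: power_mult_distrib)
    show ?thesis unfolding k mult_1 exp_add[symmetric] by (rule arg_cong[where f=exp]) (simp add: field_simps)
   qed
   also have "... = exp (- c * (x1 X)\<^sup>2) * exp (- c * (x2 X)\<^sup>2)"
    unfolding d exp_add[symmetric] by (rule arg_cong[where f=exp]) (use N in \<open>simp add: c_def field_simps\<close>)
   also have "... <= (exp (c^2 / (4 * c)) * exp (- c * \<bar>x1 X\<bar>)) * (exp (c^2 / (4 * c)) * exp (- c * \<bar>x2 X\<bar>))"
    by (intro mult_mono exp_neg_square_le c) auto
   also have "... = K * g X" unfolding K_def g_def by (simp only: mult_ac)
   finally show ?thesis .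
  qed
 qed
 have "(%X. K * g X) summable_on A" unfolding g_def by (intro summable_on_cmult_right summable_exp_abs_pair c)
 then show ?thesis by (rule summable_on_comparison_test) (use b in auto)
qed

section \<open>The constant term at zero\<close>

text \<open>Each term is a primitive of \<open>psi_term\<close>, whose sums converge uniformly on
  compact ranges of w, so the fundamental theorem passes through the sum. Summability at one t thus
  spreads to all t.\<close>

lemma tphi_term_increment:
 assumes N: "N > 0" and v: "Im \<tau> > 0" and ab: "a <= b"
 shows "((%X. tphi_term N \<tau> (exp b) X - tphi_term N \<tau> (exp a) X) has_sum
   integral {a..b} (%w. Psi N h \<tau> (exp w))) (lat_coset N h)"
proof -
 define T where "T = exp (max \<bar>a\<bar> \<bar>b\<bar>)"
 have T: "T > 0" by (simp add: T_def)
 have mem: "exp w \<in> {1 / T..T}" if "w \<in> {a..b}" for w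
 proof -
  have "w <= max \<bar>a\<bar> \<bar>b\<bar>" "- max \<bar>a\<bar> \<bar>b\<bar> <= w" using that by auto
  then show ?thesis unfolding T_def by (simp add: inverse_eq_divide[symmetric] exp_minus[symmetric])
 qed
 have ul: "uniform_limit (cbox a b) (%S w. \<Sum>X\<in>S. psi_term N \<tau> (exp w) X) (%w. Psi N h \<tau> (exp w)) (finite_subsets_at_top (lat_coset N h))"
  by (rule uniform_limit_compose'[OF Psi_uniform_limit[OF N v T]]) (use mem in auto)
 have hi: "((%w. \<Sum>X\<in>S. psi_term N \<tau> (exp w) X) has_integral (\<Sum>X\<in>S. tphi_term N \<tau> (exp b) X - tphi_term N \<tau> (exp a) X)) {a..b}"
  if "finite S" for S :: "(int \<times> int) set"
  by (intro has_integral_sum that fundamental_theorem_of_calculus ab tphi_term_has_vector_derivative N v)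
 have co: "continuous_on (cbox a b) (%w. \<Sum>X\<in>S. psi_term N \<tau> (exp w) X)" for S :: "(int \<times> int) set"
  unfolding psi_term_def by (intro continuous_intros) auto
 obtain I J where IJ: "\<And>S. ((%w. \<Sum>X\<in>S. psi_term N \<tau> (exp w) X) has_integral I S) (cbox a b)"
  "((%w. Psi N h \<tau> (exp w)) has_integral J) (cbox a b)" "(I \<longlongrightarrow> J) (finite_subsets_at_top (lat_coset N h))"
  by (rule uniform_limit_integral_cbox[OF ul co]) auto
 have "J = integral {a..b} (%w. Psi N h \<tau> (exp w))" using IJ(2) by (simp add: integral_unique)
 moreover have "eventually (%S. I S = (\<Sum>X\<in>S. tphi_term N \<tau> (exp b) X - tphi_term N \<tau> (exp a) X)) (finite_subsets_at_top (lat_coset N h))"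
 proof (rule eventually_finite_subsets_at_top_weakI)
  fix S :: "(int \<times> int) set" assume "finite S"
  from has_integral_unique[OF _ hi[OF this]] IJ(1)[of S]
  show "I S = (\<Sum>X\<in>S. tphi_term N \<tau> (exp b) X - tphi_term N \<tau> (exp a) X)" by simp
 qed
 ultimately show ?thesis unfolding has_sum_def
  using IJ(3) by (simp add: tendsto_cong)
qed

lemma tphi_term_summable_exp:
 assumes N: "N > 0" and v: "Im \<tau> > 0"
 shows "tphi_term N \<tau> (exp w) summable_on lat_coset N h"
proof -
 have s1: "tphi_term N \<tau> (exp 0) summable_on lat_coset N h"
  using abs_summable_summable[OF tphi_term_abs_summable[OF N v]] by simp
 show ?thesis
 proof (cases "w >= 0")
  case True
  have "(%X. (tphi_term N \<tau> (exp w) X - tphi_term N \<tau> (exp 0) X) + tphi_term N \<tau> (exp 0) X) summable_on lat_coset N h"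
   by (intro summable_on_add s1 has_sum_imp_summable[OF tphi_term_increment[OF N v True]])
  then show ?thesis by simp
 next
  case False
  then have "w <= 0" by simp
  have "(%X. tphi_term N \<tau> (exp 0) X + - 1 * (tphi_term N \<tau> (exp 0) X - tphi_term N \<tau> (exp w) X)) summable_on lat_coset N h"
   by (intro summable_on_add summable_on_cmult_right s1 has_sum_imp_summable[OF tphi_term_increment[OF N v \<open>w <= 0\<close>]])
  then show ?thesis by simp
 qed
qed

lemma tTheta_exp_diff:
 assumes N: "N > 0" and v: "Im \<tau> > 0" and ab: "a <= b"
 shows "tTheta N h \<tau> (exp b) - tTheta N h \<tau> (exp a) = integral {a..b} (%w. Psi N h \<tau> (exp w))"
 unfolding tTheta_def tphi_term_def[symmetric]
 using infsumI[OF tphi_term_increment[OF N v ab, of h]]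
  infsum_add[OF has_sum_imp_summable[OF tphi_term_increment[OF N v ab, of h]] tphi_term_summable_exp[OF N v, of a h]]
 by simp

lemma Psi_exp_continuous:
 assumes N: "N > 0" and v: "Im \<tau> > 0"
 shows "continuous_on A (%w. Psi N h \<tau> (exp w))"
proof -
 have "continuous_on UNIV (%w. Psi N h \<tau> (exp w))"
  by (rule continuous_on_compose2[OF Psi_continuous[OF N v]]) (auto intro: continuous_intros)
 then show ?thesis by (rule continuous_on_subset) auto
qed

lemma tTheta_exp_has_vector_derivative:
 assumes N: "N > 0" and v: "Im \<tau> > 0"
 shows "((%w. tTheta N h \<tau> (exp w)) has_vector_derivative Psi N h \<tau> (exp w)) (at w)"
proof -
 have "((%u. integral {w - 1..u} (%w. Psi N h \<tau> (exp w))) has_vector_derivative Psi N h \<tau> (exp w)) (at w within {w - 1..w + 1})"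
  by (rule integral_has_vector_derivative[OF Psi_exp_continuous[OF N v]]) auto
 then have "((%u. tTheta N h \<tau> (exp (w - 1)) + integral {w - 1..u} (%w. Psi N h \<tau> (exp w))) has_vector_derivative 0 + Psi N h \<tau> (exp w)) (at w within {w - 1..w + 1})"
  by (intro has_vector_derivative_add has_vector_derivative_const)
 moreover have "at w within {w - 1..w + 1} = at w" by (rule at_within_interior) auto
 ultimately have d: "((%u. tTheta N h \<tau> (exp (w - 1)) + integral {w - 1..u} (%w. Psi N h \<tau> (exp w))) has_vector_derivative Psi N h \<tau> (exp w)) (at w)"
  by simp
 show ?thesis
 proof (rule has_vector_derivative_transform_within_open[OF d, of "{w - 1<..<w + 1}"])
  fix u assume "u \<in> {w - 1<..<w + 1}"
  then have "w - 1 <= u" by simp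
  from tTheta_exp_diff[OF N v this, of h]
  show "tTheta N h \<tau> (exp (w - 1)) + integral {w - 1..u} (%w. Psi N h \<tau> (exp w)) = tTheta N h \<tau> (exp u)"
   by (simp add: algebra_simps)
 qed auto
qed

lemma Psi_exp_integrable_plain:
 assumes N: "N > 0" and v: "Im \<tau> > 0"
 shows "integrable lborel (%w. Psi N h \<tau> (exp w))"
 using Psi_exp_integrable_poly[OF N v, of h 1 0] by simp

text \<open>The total variation in w is at most the integral of the norm of Psi, which is
  finite.\<close>

lemma tTheta_exp_bounded:
 assumes N: "N > 0" and v: "Im \<tau> > 0"
 obtains M where "\<And>w. norm (tTheta N h \<tau> (exp w)) <= M"
proof -
 define J where "J = (LINT w|lborel. norm (Psi N h \<tau> (exp w)))"
 have d: "norm (tTheta N h \<tau> (exp b) - tTheta N h \<tau> (exp a)) <= J" if "a <= b" for a b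
 proof -
  have si: "set_integrable lborel {a..b} (%w. Psi N h \<tau> (exp w))"
   using integrable_mult_indicator[OF _ Psi_exp_integrable_plain[OF N v, of h], of "{a..b}"] unfolding set_integrable_def by simp
  have "integral {a..b} (%w. Psi N h \<tau> (exp w)) = (LINT w:{a..b}|lborel. Psi N h \<tau> (exp w))"
   using set_borel_integral_eq_integral(2)[OF si] by simp
  also have "norm ... <= (LINT w|lborel. norm (indicator {a..b} w *\<^sub>R Psi N h \<tau> (exp w)))"
   unfolding set_lebesgue_integral_def by (rule integral_norm_bound)
  also have "... <= J" unfolding J_def
   by (intro integral_mono integrable_norm si[unfolded set_integrable_def] Psi_exp_integrable_plain[OF N v]) (auto simp: indicator_def)
  finally show ?thesis using tTheta_exp_diff[OF N v that, of h] by simp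
 qed
 have "norm (tTheta N h \<tau> (exp w)) <= norm (tTheta N h \<tau> (exp 0)) + J" for w
 proof -
  have "norm (tTheta N h \<tau> (exp w) - tTheta N h \<tau> (exp 0)) <= J"
   using d[of 0 w] d[of w 0] by (cases "w >= 0") (auto simp: norm_minus_commute)
  then show ?thesis using norm_triangle_sub[of "tTheta N h \<tau> (exp w)" "tTheta N h \<tau> (exp 0)"] by simp
 qed
 then show thesis by (rule that)
qed

text \<open>The boundary term at infinity vanishes because U is bounded and Re s > 0; the one at 0
  is U 0.\<close>

lemma half_line_by_parts:
 fixes U f :: "real => complex"
 assumes U: "\<And>w. (U has_vector_derivative f w) (at w)" and cf: "continuous_on UNIV f"
  and M: "\<And>w. norm (U w) <= M" and int: "integrable lborel f" and s: "Re s > 0"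
 shows "set_integrable lborel {0<..} (%w. U w * exp (- s * of_real w))"
  and "s * (LINT w:{0<..}|lborel. U w * exp (- s * of_real w)) = U 0 + (LINT w:{0<..}|lborel. f w * exp (- s * of_real w))"
proof -
 define E where "E w = exp (- s * of_real w)" for w :: real
 have nE: "norm (E w) = exp (- Re s * w)" for w by (simp add: E_def)
 have dE: "(E has_vector_derivative - s * E w) (at w)" for w
  unfolding E_def by (rule has_vector_derivative_real_field[where f="%z. exp (- s * z)"]) (auto intro!: derivative_eq_intros)
 have cU: "continuous_on UNIV U" by (intro continuous_at_imp_continuous_on ballI has_vector_derivative_continuous[OF U])
 have cE: "continuous_on UNIV E" unfolding E_def by (intro continuous_intros)
 have bm: "(%w. U w * E w) \<in> borel_measurable borel" "(%w. f w * E w) \<in> borel_measurable borel"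
  by (intro borel_measurable_continuous_onI continuous_intros cU cE cf)+
 have M0: "M >= 0" using order_trans[OF norm_ge_zero M[of 0]] .
 have i1: "set_integrable lborel {0<..} (%w. U w * E w)" unfolding set_integrable_def
 proof (rule integrable_dominated[OF integrable_mult_right[OF integrable_exp_neg_abs[OF s], of M] _ AE_I2])
  show "(%w. indicator {0<..} w *\<^sub>R (U w * E w)) \<in> borel_measurable lborel" using bm by measurable
  show "norm (indicator {0<..} w *\<^sub>R (U w * E w)) <= norm (M * exp (- Re s * abs w))" for w
   using M[of w] M0 by (auto simp: indicator_def norm_mult nE intro!: mult_right_mono)
 qed
 have i2: "set_integrable lborel {0<..} (%w. f w * E w)" unfolding set_integrable_def
 proof (rule integrable_dominated[OF int _ AE_I2])
  show "(%w. indicator {0<..} w *\<^sub>R (f w * E w)) \<in> borel_measurable lborel" using bm by measurable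
  fix w
  have "norm (f w) * exp (- Re s * w) <= norm (f w) * 1" if "w > 0" using that s by (intro mult_left_mono) auto
  then show "norm (indicator {0<..} w *\<^sub>R (f w * E w)) <= norm (f w)" by (auto simp: indicator_def norm_mult nE)
 qed
 have i3: "set_integrable lborel {0<..} (%w. f w * E w - s * (U w * E w))"
  by (intro set_integral_diff(1) i2 set_integrable_mult_right i1)
 have ei: "einterval (ereal 0) \<infinity> = {0<..}" by (auto simp: einterval_def)
 have "(LBINT w=ereal 0..\<infinity>. f w * E w - s * (U w * E w)) = 0 - U 0 * E 0"
 proof (rule interval_integral_FTC_integrable)
  show "((%w. U w * E w) has_vector_derivative f w * E w - s * (U w * E w)) (at w)" for w
   using has_vector_derivative_mult[OF U dE, of w] by (simp add: algebra_simps)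
  have "continuous_on UNIV (%w. f w * E w - s * (U w * E w))" by (intro continuous_intros cU cE cf)
  then show "isCont (%w. f w * E w - s * (U w * E w)) w" for w by (simp add: continuous_on_eq_continuous_at)
  show "set_integrable lborel (einterval (ereal 0) \<infinity>) (%w. f w * E w - s * (U w * E w))" unfolding ei by (rule i3)
  have "continuous_on UNIV (%w. U w * E w)" by (intro continuous_intros cU cE)
  then have "isCont (%w. U w * E w) 0" by (simp add: continuous_on_eq_continuous_at)
  then have "((%w. U w * E w) \<longlongrightarrow> U 0 * E 0) (at_right 0)" by (simp add: isCont_def filterlim_at_split)
  then show "(((%w. U w * E w) \<circ> real_of_ereal) \<longlongrightarrow> U 0 * E 0) (at_right (ereal 0))" by (simp add: ereal_tendsto_simps)
  have "((%w. U w * E w) \<longlongrightarrow> 0) at_top"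
  proof (rule Lim_null_comparison)
   show "\<forall>\<^sub>F w in at_top. norm (U w * E w) <= M * exp (- Re s * w)"
    using M by (intro always_eventually allI) (auto simp: norm_mult nE intro!: mult_right_mono)
   show "((%w. M * exp (- Re s * w)) \<longlongrightarrow> 0) at_top" using s by real_asymp
  qed
  then show "(((%w. U w * E w) \<circ> real_of_ereal) \<longlongrightarrow> 0) (at_left \<infinity>)" by (simp add: ereal_tendsto_simps)
 qed simp
 then have "(LINT w:{0<..}|lborel. f w * E w - s * (U w * E w)) = - U 0"
  by (simp add: interval_lebesgue_integral_def ei E_def)
 moreover have "(LINT w:{0<..}|lborel. f w * E w - s * (U w * E w)) = (LINT w:{0<..}|lborel. f w * E w) - s * (LINT w:{0<..}|lborel. U w * E w)"
  by (subst set_integral_diff(2)[OF i2 set_integrable_mult_right[OF i1]]) simp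
 ultimately have "s * (LINT w:{0<..}|lborel. U w * E w) = U 0 + (LINT w:{0<..}|lborel. f w * E w)" by (simp add: algebra_simps)
 then show "s * (LINT w:{0<..}|lborel. U w * exp (- s * of_real w)) = U 0 + (LINT w:{0<..}|lborel. f w * exp (- s * of_real w))"
  unfolding E_def .
 show "set_integrable lborel {0<..} (%w. U w * exp (- s * of_real w))" using i1 unfolding E_def .
qed

lemma integral_split_reflect:
 fixes g :: "real => complex"
 assumes m: "g \<in> borel_measurable borel"
  and i1: "set_integrable lborel {0<..} g" and i2: "set_integrable lborel {0<..} (%w. g (- w))"
 shows "integrable lborel g"
  and "(LINT w|lborel. g w) = (LINT w:{0<..}|lborel. g w) + (LINT w:{0<..}|lborel. g (- w))"
proof -
 let ?h = "%w. indicator {0<..} (- w) *\<^sub>R g w"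
 have h1: "integrable lborel ?h"
  using lborel_integrable_real_affine[OF i2[unfolded set_integrable_def], of "-1" 0] by simp
 have h2: "(LINT w|lborel. ?h w) = (LINT w:{0<..}|lborel. g (- w))"
  using lborel_integral_real_affine[of "-1" ?h 0] by (simp add: set_lebesgue_integral_def)
 have ae: "AE w in lborel. indicator {0<..} w *\<^sub>R g w + ?h w = g w"
  using AE_lborel_singleton[of 0] by eventually_elim (auto simp: indicator_def)
 have s: "integrable lborel (%w. indicator {0<..} w *\<^sub>R g w + ?h w)"
  using i1 h1 unfolding set_integrable_def by (rule Bochner_Integration.integrable_add)
 show "integrable lborel g"
  by (rule integrable_cong_AE_imp[OF s]) (use m ae in \<open>auto elim: AE_mp\<close>)
 have "(LINT w|lborel. g w) = (LINT w|lborel. indicator {0<..} w *\<^sub>R g w + ?h w)"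
  by (rule integral_cong_AE) (use m ae s in \<open>auto elim: AE_mp\<close>)
 then show "(LINT w|lborel. g w) = (LINT w:{0<..}|lborel. g w) + (LINT w:{0<..}|lborel. g (- w))"
  using i1 h1 h2 unfolding set_integrable_def set_lebesgue_integral_def by simp
qed

text \<open>Each half-line contributes U 0. Reflecting the left one changes the sign of the
  derivative, which is recorded as sgn w.\<close>

lemma exp_transform_by_parts:
 fixes U f :: "real => complex"
 assumes U: "\<And>w. (U has_vector_derivative f w) (at w)" and cf: "continuous_on UNIV f"
  and M: "\<And>w. norm (U w) <= M" and int: "integrable lborel f" and s: "Re s > 0"
 shows "integrable lborel (%w. U w * exp (- s * of_real \<bar>w\<bar>))"
  and "s * (LINT w|lborel. U w * exp (- s * of_real \<bar>w\<bar>)) = 2 * U 0 + (LINT w|lborel. of_real (sgn w) * f w * exp (- s * of_real \<bar>w\<bar>))"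
proof -
 have cU: "continuous_on UNIV U" by (intro continuous_at_imp_continuous_on ballI has_vector_derivative_continuous[OF U])
 have Um: "((%w. U (- w)) has_vector_derivative - f (- w)) (at w)" for w
 proof -
  have "(uminus has_vector_derivative - 1) (at w)"
   unfolding has_real_derivative_iff_has_vector_derivative[symmetric] by (auto intro!: derivative_eq_intros)
  from vector_diff_chain_at[OF this, of U "f (- w)"] U[of "- w"] show ?thesis by (simp add: o_def)
 qed
 have cfm: "continuous_on UNIV (%w. - f (- w))" by (intro continuous_intros continuous_on_compose2[OF cf]) auto
 have intm: "integrable lborel (%w. - f (- w))" using lborel_integrable_real_affine[OF int, of "-1" 0] by simp
 note A = half_line_by_parts[OF U cf M int s] and B = half_line_by_parts[OF Um cfm M intm s]
 let ?g = "%w. U w * exp (- s * of_real \<bar>w\<bar>)" and ?k = "%w. of_real (sgn w) * f w * exp (- s * of_real \<bar>w\<bar>)"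
 have gm: "?g \<in> borel_measurable borel" by (intro borel_measurable_continuous_onI continuous_intros cU)
 have fm: "f \<in> borel_measurable borel" by (intro borel_measurable_continuous_onI cf)
 have em: "(%w. exp (- s * of_real \<bar>w\<bar>)) \<in> borel_measurable borel" by (intro borel_measurable_continuous_onI continuous_intros)
 have km: "?k \<in> borel_measurable borel" using fm em by measurable
 have eqs: "set_integrable lborel {0<..} ?g = set_integrable lborel {0<..} (%w. U w * exp (- s * of_real w))"
  "set_integrable lborel {0<..} (%w. ?g (- w)) = set_integrable lborel {0<..} (%w. U (- w) * exp (- s * of_real w))"
  by (intro set_integrable_cong refl; simp)+
 have g: "set_integrable lborel {0<..} ?g" "set_integrable lborel {0<..} (%w. ?g (- w))"
  unfolding eqs using A(1) B(1) by auto
 show "integrable lborel ?g" by (rule integral_split_reflect(1)[OF gm g])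
 have ik: "integrable lborel ?k"
 proof (rule integrable_dominated[OF int _ AE_I2])
  show "?k \<in> borel_measurable lborel" using km by simp
  fix w
  have "norm (?k w) = \<bar>sgn w\<bar> * norm (f w) * exp (- (Re s * abs w))" by (simp add: norm_mult)
  also have "... <= 1 * norm (f w) * 1" using s by (intro mult_mono) (auto simp: sgn_if)
  finally show "norm (?k w) <= norm (f w)" by simp
 qed
 have k: "set_integrable lborel {0<..} ?k" "set_integrable lborel {0<..} (%w. ?k (- w))"
  using integrable_mult_indicator[OF _ ik, of "{0<..}"] integrable_mult_indicator[OF _ lborel_integrable_real_affine[OF ik, of "-1" 0], of "{0<..}"]
  unfolding set_integrable_def by simp_all
 have e1: "(LINT w:{0<..}|lborel. ?g w) = (LINT w:{0<..}|lborel. U w * exp (- s * of_real w))"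
  by (rule set_lebesgue_integral_cong) auto
 have e2: "(LINT w:{0<..}|lborel. ?g (- w)) = (LINT w:{0<..}|lborel. U (- w) * exp (- s * of_real w))"
  by (rule set_lebesgue_integral_cong) auto
 have e3: "(LINT w:{0<..}|lborel. f w * exp (- s * of_real w)) = (LINT w:{0<..}|lborel. ?k w)"
  by (rule set_lebesgue_integral_cong) auto
 have e4: "(LINT w:{0<..}|lborel. - f (- w) * exp (- s * of_real w)) = (LINT w:{0<..}|lborel. ?k (- w))"
  by (rule set_lebesgue_integral_cong) auto
 show "s * (LINT w|lborel. ?g w) = 2 * U 0 + (LINT w|lborel. ?k w)"
  unfolding integral_split_reflect(2)[OF gm g] integral_split_reflect(2)[OF km k] distrib_left
   e1 e2 e3[symmetric] e4[symmetric] A(2) B(2)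
  by simp
qed

text \<open>The transform is G(s)/s with G(s) = 2 U(0) + G0(s) entire, so its constant term is
  G'(0). The boundary value 2 U(0) goes into the residue, and G0'(0) is minus the integral of |w|
  sgn w Psi = w Psi.\<close>

lemma tvartheta_eq_integral:
 assumes N: "N > 0" and v: "Im \<tau> > 0"
 shows "tvartheta N h \<tau> = - (LINT w|lborel. Psi N h \<tau> (exp w) * of_real w)"
proof -
 define U where "U w = tTheta N h \<tau> (exp w)" for w
 define f where "f w = of_real (sgn w) * Psi N h \<tau> (exp w)" for w
 define G0 where "G0 s = (LINT w|lborel. f w * exp (- s * of_real \<bar>w\<bar>))" for s
 define G where "G s = 2 * U 0 + G0 s" for s
 obtain M where M: "\<And>w. norm (U w) <= M" using tTheta_exp_bounded[OF N v, of h] unfolding U_def by metis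
 have meas: "f \<in> borel_measurable borel"
  unfolding f_def using Psi_exp_measurable[OF N v] by measurable
 have int: "integrable lborel (%w. norm (f w) * exp (K * abs w))" for K
 proof (rule integrable_dominated[OF Psi_exp_integrable[OF N v, of h K] _ AE_I2])
  show "(%w. norm (f w) * exp (K * abs w)) \<in> borel_measurable lborel" using meas by measurable
  show "norm (norm (f w) * exp (K * abs w)) <= norm (norm (Psi N h \<tau> (exp w)) * exp (K * abs w))" for w
   by (auto simp: f_def norm_mult sgn_if)
 qed
 have hol0: "G0 holomorphic_on UNIV" unfolding G0_def by (rule exp_transform_entire(1)[OF meas int])
 then have hol: "G holomorphic_on UNIV" unfolding G_def by (intro holomorphic_intros)
 have dG: "deriv G 0 = - (LINT w|lborel. Psi N h \<tau> (exp w) * of_real w)"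
 proof -
  have "G0 field_differentiable at 0" by (rule holomorphic_on_imp_differentiable_at[OF hol0]) auto
  then have "deriv G 0 = deriv (%s. 2 * U 0) 0 + deriv G0 0" unfolding G_def by (intro deriv_add) auto
  then have "deriv G 0 = deriv G0 0" by simp
  also have "... = - (LINT w|lborel. of_real \<bar>w\<bar> * f w)" unfolding G0_def by (rule exp_transform_entire(2)[OF meas int])
  also have "(LINT w|lborel. of_real \<bar>w\<bar> * f w) = (LINT w|lborel. Psi N h \<tau> (exp w) * of_real w)"
   by (rule lebesgue_integral_cong) (auto simp: f_def sgn_if)
  finally show ?thesis .
 qed
 have mer: "(%s. G s / s) meromorphic_on UNIV"
 proof (rule meromorphic_on_divide)
  show "G meromorphic_on UNIV" using hol by (intro analytic_on_imp_meromorphic_on) (simp add: analytic_on_open)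
  show "(%s. s) meromorphic_on UNIV" by (intro analytic_on_imp_meromorphic_on analytic_on_ident)
 qed
 have eq: "G s / s = split_integral (tTheta N h \<tau>) s" if s: "Re s > 0" for s
 proof -
  note P = exp_transform_by_parts[OF tTheta_exp_has_vector_derivative[OF N v, of h] Psi_exp_continuous[OF N v] M[unfolded U_def] Psi_exp_integrable_plain[OF N v] s]
  have "split_integral (tTheta N h \<tau>) s = (LINT w|lborel. tTheta N h \<tau> (exp w) * exp (- s * of_real \<bar>w\<bar>))"
  proof (rule split_integral_eq_exp_transform[OF _ P(1)])
   have "continuous_on UNIV (%w. tTheta N h \<tau> (exp w))"
    by (intro continuous_at_imp_continuous_on ballI has_vector_derivative_continuous[OF tTheta_exp_has_vector_derivative[OF N v]])
   then have "continuous_on {0<..} (%t. tTheta N h \<tau> (exp (ln t)))"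
    by (rule continuous_on_compose2) (auto intro!: continuous_intros)
   then show "continuous_on {0<..} (tTheta N h \<tau>)" by (rule continuous_on_eq) simp
  qed
  moreover have "G s = s * (LINT w|lborel. tTheta N h \<tau> (exp w) * exp (- s * of_real \<bar>w\<bar>))"
   unfolding P(2) G_def G0_def f_def U_def by simp
  moreover have "s ~= 0" using s by auto
  ultimately show ?thesis by simp
 qed
 have "continued_constant_term (split_integral (tTheta N h \<tau>)) = fls_nth (laurent_expansion (%s. G s / s) 0) 0"
  by (rule continued_constant_term_eqI[OF mer eq])
 then show ?thesis unfolding tvartheta_def fls_nth_laurent_expansion_entire_divide[OF hol] dG .
qed

section \<open>Integrals of the kernel\<close>

lemma integral_even_nonneg:
 fixes f :: "real => real"
 assumes m[measurable]: "f \<in> borel_measurable borel" and nn: "\<And>x. f x >= 0" and ev: "\<And>x. f (- x) = f x"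
  and A: "(\<integral>\<^sup>+x. ennreal (f x) * indicator {0..} x \<partial>lborel) = ennreal A" "A >= 0"
 shows "(LINT x|lborel. f x) = 2 * A"
proof -
 have "(\<integral>\<^sup>+x. ennreal (f x) * indicator {..<0} x \<partial>lborel) = (\<integral>\<^sup>+x. ennreal (f (0 + (-1) * x)) * indicator {..<0} (0 + (-1) * x) \<partial>lborel)"
  by (subst nn_integral_real_affine[where c="-1" and t=0]) auto
 also have "... = (\<integral>\<^sup>+x. ennreal (f x) * indicator {0..} x \<partial>lborel)"
 proof (rule nn_integral_cong_AE)
  show "AE x in lborel. ennreal (f (0 + (-1) * x)) * indicator {..<0} (0 + (-1) * x) = ennreal (f x) * indicator {0..} x"
   using AE_lborel_singleton[of 0] by eventually_elim (auto simp: ev indicator_def)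
 qed
 finally have neg: "(\<integral>\<^sup>+x. ennreal (f x) * indicator {..<0} x \<partial>lborel) = ennreal A" using A by simp
 have "(\<integral>\<^sup>+x. ennreal (f x) \<partial>lborel) = (\<integral>\<^sup>+x. ennreal (f x) * indicator {0..} x + ennreal (f x) * indicator {..<0} x \<partial>lborel)"
  by (rule nn_integral_cong) (auto simp: indicator_def)
 also have "... = ennreal A + ennreal A" by (subst nn_integral_add) (auto simp: A neg)
 also have "... = ennreal (2 * A)" using A(2) by (simp add: ennreal_plus[symmetric] del: ennreal_plus)
 finally have "(\<integral>\<^sup>+x. ennreal (f x) \<partial>lborel) = ennreal (2 * A)" .
 then show ?thesis using nn A(2) by (subst integral_eq_nn_integral) auto
qed

lemma integral_odd:
 fixes f :: "real => real"
 assumes "\<And>x. f (- x) = - f x"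
 shows "(LINT x|lborel. f x) = 0"
proof -
 have "(LINT x|lborel. f x) = (LINT x|lborel. f (- x))" using lborel_integral_real_affine[of "-1" f 0] by simp
 then show ?thesis by (simp add: assms)
qed

text \<open>The kernel on a vector with Q < 0, in the variable s that measures the distance of w
  from its centre; b is 4 pi v |Q|. It is the derivative of - erfc(sqrt b sinh s).\<close>

definition skern :: "real => real => real" where
 "skern b s = 2 / sqrt pi * (sqrt b * cosh s) * exp (- ((sqrt b * sinh s)\<^sup>2))"

text \<open>The same for Q > 0, where cosh and sinh change places: the derivative of - erfc(sqrt b
  cosh s), an odd function of s.\<close>

definition ckern :: "real => real => real" where
 "ckern b s = 2 / sqrt pi * (sqrt b * sinh s) * exp (- ((sqrt b * cosh s)\<^sup>2))"

lemma borel_measurable_kern [measurable]: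
 "skern b \<in> borel_measurable borel" "ckern b \<in> borel_measurable borel"
 unfolding skern_def[abs_def] ckern_def[abs_def] by (intro borel_measurable_continuous_onI continuous_intros)+

text \<open>The primitive - erfc(sqrt b sinh s) increases by 1 over the positive half-line; evenness
  doubles this and makes the first moment vanish.\<close>

lemma integral_skern:
 assumes b: "b > 0"
 shows "(LINT s|lborel. skern b s) = 2" "(LINT s|lborel. s * skern b s) = 0"
proof -
 have "(\<integral>\<^sup>+s. ennreal (skern b s) * indicator {0..} s \<partial>lborel) = ennreal (0 - (- erfc (sqrt b * sinh 0)))"
 proof (rule nn_integral_FTC_atLeast)
  show "((%s. - erfc (sqrt b * sinh s)) has_real_derivative skern b s) (at s)" for s
   unfolding skern_def by (rule derivative_eq_intros DERIV_chain2[OF DERIV_erfc] refl)+ simp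
  show "0 <= skern b s" for s unfolding skern_def using b by simp
  have "filterlim (%s. sqrt b * sinh s) at_top at_top"
   using b by (intro filterlim_tendsto_pos_mult_at_top[OF tendsto_const _ sinh_real_at_top]) auto
  from tendsto_minus[OF filterlim_compose[OF erfc_tendsto_0 this]]
  show "((%s. - erfc (sqrt b * sinh s)) \<longlongrightarrow> 0) at_top" by simp
 qed simp
 then have "(\<integral>\<^sup>+s. ennreal (skern b s) * indicator {0..} s \<partial>lborel) = ennreal 1" by (simp add: erfc_0)
 then have "(LINT s|lborel. skern b s) = 2 * 1"
  by (intro integral_even_nonneg borel_measurable_kern) (use b in \<open>auto simp: skern_def\<close>)
 then show "(LINT s|lborel. skern b s) = 2" by simp
 show "(LINT s|lborel. s * skern b s) = 0" by (rule integral_odd) (simp add: skern_def)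
qed

text \<open>The integrand exp(-u)/(2 u) is the one that the double integral for \<open>ckern\<close>
  ends in. The crude bound from 1/u <= 1/b serves for the majorants of the non-holomorphic
  terms.\<close>

lemma upper_Gamma_0_nn_integral:
 assumes b: "b > 0"
 shows "(\<integral>\<^sup>+u. ennreal (exp (- u) / (2 * u)) * indicator {b..} u \<partial>lborel) = ennreal (upper_Gamma 0 b / 2)"
  and "upper_Gamma 0 b >= 0" and "upper_Gamma 0 b <= exp (- b) / b"
proof -
 have le: "(\<integral>\<^sup>+u. ennreal (exp (- u) / (2 * u)) * indicator {b..} u \<partial>lborel) <= (\<integral>\<^sup>+u. ennreal (exp (- u) / (2 * b)) * indicator {b..} u \<partial>lborel)"
  using b by (intro nn_integral_mono) (auto simp: indicator_def intro!: ennreal_leI divide_left_mono)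
 also have "... = ennreal (0 - (- exp (- b) / (2 * b)))"
 proof (rule nn_integral_FTC_atLeast[where F="%u. - exp (- u) / (2 * b)"])
  show "((%u. - exp (- u) / (2 * b)) has_real_derivative exp (- u) / (2 * b)) (at u)" for u
   by (rule derivative_eq_intros refl | use b in simp)+
  have "((%u::real. exp (- u)) \<longlongrightarrow> 0) at_top" by real_asymp
  from tendsto_divide[OF tendsto_minus[OF this] tendsto_const, of "2 * b"] b
  show "((%u. - exp (- u) / (2 * b)) \<longlongrightarrow> 0) at_top" by simp
 qed (use b in auto)
 finally have up: "(\<integral>\<^sup>+u. ennreal (exp (- u) / (2 * u)) * indicator {b..} u \<partial>lborel) <= ennreal (exp (- b) / (2 * b))"
  by simp
 \<comment> \<open>\<open>enn2real\<close> sends infinity to 0, so finiteness has to precede the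
   identification with the Bochner integral.\<close>
 have fin: "(\<integral>\<^sup>+u. ennreal (exp (- u) / (2 * u)) * indicator {b..} u \<partial>lborel) < \<infinity>"
  by (rule le_less_trans[OF up]) simp
 have "upper_Gamma 0 b = (LINT u|lborel. indicator {b<..} u *\<^sub>R (u powr (0 - 1) * exp (- u)))"
  unfolding upper_Gamma_def set_lebesgue_integral_def ..
 also have "... = enn2real (\<integral>\<^sup>+u. ennreal (indicator {b<..} u *\<^sub>R (u powr (0 - 1) * exp (- u))) \<partial>lborel)"
  by (rule integral_eq_nn_integral) (auto simp: indicator_def)
 also have "(\<integral>\<^sup>+u. ennreal (indicator {b<..} u *\<^sub>R (u powr (0 - 1) * exp (- u))) \<partial>lborel) = (\<integral>\<^sup>+u. 2 * (ennreal (exp (- u) / (2 * u)) * indicator {b..} u) \<partial>lborel)"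
 proof (rule nn_integral_cong_AE)
  show "AE u in lborel. ennreal (indicator {b<..} u *\<^sub>R (u powr (0 - 1) * exp (- u))) = 2 * (ennreal (exp (- u) / (2 * u)) * indicator {b..} u)"
   using AE_lborel_singleton[of b]
  proof eventually_elim
   case (elim u)
   show ?case
   proof (cases "u > b")
    case True
    then have u: "u > 0" using b by simp
    have "ennreal (u powr - 1 * exp (- u)) = ennreal (2 * (exp (- u) / (2 * u)))"
     using u by (simp add: powr_minus_divide)
    also have "... = 2 * ennreal (exp (- u) / (2 * u))" using u by (subst ennreal_mult') auto
    finally show ?thesis using True by simp
   qed (use elim in \<open>auto simp: indicator_def\<close>)
  qed
 qed
 also have "... = 2 * (\<integral>\<^sup>+u. ennreal (exp (- u) / (2 * u)) * indicator {b..} u \<partial>lborel)"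
  by (rule nn_integral_cmult) simp
 finally have eq: "upper_Gamma 0 b = enn2real (2 * (\<integral>\<^sup>+u. ennreal (exp (- u) / (2 * u)) * indicator {b..} u \<partial>lborel))" .
 obtain r where r: "r >= 0" "(\<integral>\<^sup>+u. ennreal (exp (- u) / (2 * u)) * indicator {b..} u \<partial>lborel) = ennreal r"
  using fin by (cases "\<integral>\<^sup>+u. ennreal (exp (- u) / (2 * u)) * indicator {b..} u \<partial>lborel") auto
 have "2 * ennreal r = ennreal (2 * r)" using r by (simp add: ennreal_mult')
 then have g: "upper_Gamma 0 b = 2 * r" unfolding eq r(2) using r(1) by simp
 have "r <= exp (- b) / (2 * b)" using up b unfolding r(2) by (simp add: ennreal_le_iff)
 then show "upper_Gamma 0 b <= exp (- b) / b" unfolding g by (simp add: field_simps)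
 show "(\<integral>\<^sup>+u. ennreal (exp (- u) / (2 * u)) * indicator {b..} u \<partial>lborel) = ennreal (upper_Gamma 0 b / 2)"
  and "upper_Gamma 0 b >= 0" using r g by auto
qed

text \<open>Write s as the integral of 1 over [0, s] and exchange: the inner integral is erfc(sqrt b
  cosh r). Write this as an integral over u >= b of its derivative in u and exchange again: by
  cosh^2 = 1 + sinh^2 the integral over r is exact and leaves exp(-u)/(2 u). All integrands are
  nonnegative, so both exchanges are free.\<close>

lemma nn_integral_ckern:
 assumes b: "b > 0"
 shows "(\<integral>\<^sup>+s. ennreal (s * ckern b s) * indicator {0..} s \<partial>lborel) = ennreal (upper_Gamma 0 b / 2)"
proof -
 have cc: "sqrt b * cosh s >= 0" for s using b by simp
 have step1: "(\<integral>\<^sup>+s. ennreal (ckern b s) * indicator {r..} s \<partial>lborel) = ennreal (erfc (sqrt b * cosh r))" if r: "r >= 0" for r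
 proof -
  have "(\<integral>\<^sup>+s. ennreal (ckern b s) * indicator {r..} s \<partial>lborel) = ennreal (0 - (- erfc (sqrt b * cosh r)))"
  proof (rule nn_integral_FTC_atLeast[where F="%s. - erfc (sqrt b * cosh s)"])
   show "((%s. - erfc (sqrt b * cosh s)) has_real_derivative ckern b s) (at s)" for s
    unfolding ckern_def by (rule derivative_eq_intros DERIV_chain2[OF DERIV_erfc] refl)+ simp
   show "0 <= ckern b s" if "r <= s" for s unfolding ckern_def using b r that by simp
   have "filterlim (%s. sqrt b * cosh s) at_top at_top"
    using b by (intro filterlim_tendsto_pos_mult_at_top[OF tendsto_const _ cosh_real_at_top]) auto
   from tendsto_minus[OF filterlim_compose[OF erfc_tendsto_0 this]]
   show "((%s. - erfc (sqrt b * cosh s)) \<longlongrightarrow> 0) at_top" by simp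
  qed simp
  then show ?thesis by simp
 qed
 let ?k = "%u r. cosh r * exp (- ((sqrt u * cosh r)\<^sup>2)) / (sqrt pi * sqrt u) :: real"
 have step2: "ennreal (erfc (sqrt b * cosh r)) = (\<integral>\<^sup>+u. ennreal (?k u r) * indicator {b..} u \<partial>lborel)" for r
 proof -
  have "(\<integral>\<^sup>+u. ennreal (?k u r) * indicator {b..} u \<partial>lborel) = ennreal (0 - (- erfc (sqrt b * cosh r)))"
  proof (rule nn_integral_FTC_atLeast[where F="%u. - erfc (sqrt u * cosh r)"])
   fix u assume "b <= u"
   then have u: "u > 0" using b by simp
   show "((%u. - erfc (sqrt u * cosh r)) has_real_derivative ?k u r) (at u)"
    by (rule derivative_eq_intros DERIV_chain2[OF DERIV_erfc] DERIV_real_sqrt u refl)+ (use u in \<open>simp add: field_simps\<close>)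
   show "0 <= ?k u r" using u by simp
  next
   have "filterlim (%u. sqrt u * cosh r) at_top at_top"
    by (intro filterlim_at_top_mult_tendsto_pos[OF tendsto_const _ sqrt_at_top]) auto
   from tendsto_minus[OF filterlim_compose[OF erfc_tendsto_0 this]]
   show "((%u. - erfc (sqrt u * cosh r)) \<longlongrightarrow> 0) at_top" by simp
  qed simp
  then show ?thesis by simp
 qed
 \<comment> \<open>In the exponent u cosh^2 = u + u sinh^2, so the integrand is exp(-u)/(2 u) times
   the derivative of - erfc(sqrt u sinh r).\<close>
 have step3: "(\<integral>\<^sup>+r. ennreal (?k u r) * indicator {0..} r \<partial>lborel) = ennreal (exp (- u) / (2 * u))" if u: "u > 0" for u
 proof -
  have "(\<integral>\<^sup>+r. ennreal (?k u r) * indicator {0..} r \<partial>lborel) = ennreal (0 - (- (exp (- u) / (2 * u)) * erfc (sqrt u * sinh 0)))"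
  proof (rule nn_integral_FTC_atLeast[where F="%r. - (exp (- u) / (2 * u)) * erfc (sqrt u * sinh r)"])
   fix r :: real
   have e: "exp (- ((sqrt u * cosh r)\<^sup>2)) = exp (- u) * exp (- ((sqrt u * sinh r)\<^sup>2))"
    unfolding exp_add[symmetric] by (rule arg_cong[where f=exp]) (use u in \<open>simp add: power_mult_distrib cosh_square_eq algebra_simps\<close>)
   have s: "sqrt u * sqrt u = u" using u by simp
   have "((%r. - (exp (- u) / (2 * u)) * erfc (sqrt u * sinh r)) has_real_derivative
     - (exp (- u) / (2 * u)) * (- 2 / sqrt pi * exp (- ((sqrt u * sinh r)\<^sup>2)) * (sqrt u * cosh r))) (at r)"
    by (intro DERIV_cmult DERIV_chain2[OF DERIV_erfc]) (auto intro!: derivative_eq_intros)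
   moreover have "- (exp (- u) / (2 * u)) * (- 2 / sqrt pi * exp (- ((sqrt u * sinh r)\<^sup>2)) * (sqrt u * cosh r)) = ?k u r"
   proof -
    have "sqrt u / u = 1 / sqrt u" using u by (simp add: real_div_sqrt field_simps)
    then have "cosh r * (exp (- u) * exp (- ((sqrt u * sinh r)\<^sup>2))) / sqrt pi * (sqrt u / u) = cosh r * (exp (- u) * exp (- ((sqrt u * sinh r)\<^sup>2))) / sqrt pi * (1 / sqrt u)" by simp
    then show ?thesis unfolding e by (simp add: mult_ac)
   qed
   ultimately show "((%r. - (exp (- u) / (2 * u)) * erfc (sqrt u * sinh r)) has_real_derivative ?k u r) (at r)" by simp
   show "0 <= ?k u r" using u by simp
  next
   have "filterlim (%s. sqrt u * sinh s) at_top at_top"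
    using u by (intro filterlim_tendsto_pos_mult_at_top[OF tendsto_const _ sinh_real_at_top]) auto
   from tendsto_mult[OF tendsto_const filterlim_compose[OF erfc_tendsto_0 this], of "- (exp (- u) / (2 * u))"]
   show "((%r. - (exp (- u) / (2 * u)) * erfc (sqrt u * sinh r)) \<longlongrightarrow> 0) at_top" by simp
  qed (use u in \<open>auto intro!: borel_measurable_continuous_onI continuous_intros\<close>)
  then show ?thesis by (simp add: erfc_0)
 qed
 have "(\<integral>\<^sup>+s. ennreal (s * ckern b s) * indicator {0..} s \<partial>lborel) =
   (\<integral>\<^sup>+s. (\<integral>\<^sup>+r. ennreal (ckern b s) * (indicator {0..} r * indicator {r..} s) \<partial>lborel) \<partial>lborel)"
 proof (rule nn_integral_cong)
  fix s :: real
  show "ennreal (s * ckern b s) * indicator {0..} s = (\<integral>\<^sup>+r. ennreal (ckern b s) * (indicator {0..} r * indicator {r..} s) \<partial>lborel)"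
  proof (cases "s >= 0")
   case True
   have "(\<integral>\<^sup>+r. ennreal (ckern b s) * (indicator {0..} r * indicator {r..} s) \<partial>lborel) = (\<integral>\<^sup>+r. ennreal (ckern b s) * indicator {0..s} r \<partial>lborel)"
    by (rule nn_integral_cong) (auto simp: indicator_def)
   also have "... = ennreal (ckern b s) * ennreal s" using True by (simp add: nn_integral_cmult_indicator)
   also have "... = ennreal (s * ckern b s)" using True by (simp add: ennreal_mult' mult.commute)
   finally show ?thesis using True by simp
  next
   case False
   then have "(\<integral>\<^sup>+r. ennreal (ckern b s) * (indicator {0..} r * indicator {r..} s) \<partial>lborel) = (\<integral>\<^sup>+r. 0 \<partial>(lborel :: real measure))"
    by (intro nn_integral_cong) (auto simp: indicator_def)
   then show ?thesis using False by simp
  qed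
 qed
 also have "... = (\<integral>\<^sup>+r. (\<integral>\<^sup>+s. ennreal (ckern b s) * (indicator {0..} r * indicator {r..} s) \<partial>lborel) \<partial>lborel)"
 proof (rule lborel_pair.Fubini')
  have "(%x. ennreal (ckern b (snd x)) * (indicator {0..} (fst x) * indicator {p. fst p <= snd p} x)) \<in> borel_measurable (lborel \<Otimes>\<^sub>M (lborel :: real measure))"
   by measurable
  moreover have "(%x. ennreal (ckern b (snd x)) * (indicator {0..} (fst x) * indicator {p. fst p <= snd p} x)) = (%(r, s). ennreal (ckern b s) * (indicator {0..} r * indicator {r..} s))"
   by (auto simp: indicator_def fun_eq_iff)
  ultimately show "(%(r, s). ennreal (ckern b s) * (indicator {0..} r * indicator {r..} s)) \<in> borel_measurable (lborel \<Otimes>\<^sub>M lborel)" by simp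
 qed
 also have "... = (\<integral>\<^sup>+r. ennreal (erfc (sqrt b * cosh r)) * indicator {0..} r \<partial>lborel)"
  by (rule nn_integral_cong) (simp add: step1[symmetric] indicator_def)
 also have "... = (\<integral>\<^sup>+r. (\<integral>\<^sup>+u. ennreal (?k u r) * (indicator {b..} u * indicator {0..} r) \<partial>lborel) \<partial>lborel)"
  by (rule nn_integral_cong) (simp add: step2 indicator_def)
 also have "... = (\<integral>\<^sup>+u. (\<integral>\<^sup>+r. ennreal (?k u r) * (indicator {b..} u * indicator {0..} r) \<partial>lborel) \<partial>lborel)"
 proof (rule lborel_pair.Fubini')
  have "cosh \<in> borel_measurable (borel :: real measure)" by (intro borel_measurable_continuous_onI continuous_intros)
  then show "(%(u, r). ennreal (?k u r) * (indicator {b..} u * indicator {0..} r)) \<in> borel_measurable (lborel \<Otimes>\<^sub>M lborel)"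
   by measurable
 qed
 also have "... = (\<integral>\<^sup>+u. ennreal (exp (- u) / (2 * u)) * indicator {b..} u \<partial>lborel)"
 proof (rule nn_integral_cong)
  fix u :: real
  show "(\<integral>\<^sup>+r. ennreal (?k u r) * (indicator {b..} u * indicator {0..} r) \<partial>lborel) = ennreal (exp (- u) / (2 * u)) * indicator {b..} u"
   using step3[of u] b by (cases "u >= b") auto
 qed
 also have "... = ennreal (upper_Gamma 0 b / 2)" by (rule upper_Gamma_0_nn_integral(1)[OF b])
 finally show ?thesis .
qed

lemma integral_ckern:
 assumes b: "b > 0"
 shows "(LINT s|lborel. ckern b s) = 0" "(LINT s|lborel. s * ckern b s) = upper_Gamma 0 b"
proof -
 show "(LINT s|lborel. ckern b s) = 0" by (rule integral_odd) (simp add: ckern_def)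
 have ssn: "s * sinh s >= 0" for s :: real by (simp add: zero_le_mult_iff linorder_linear)
 have "0 <= (2 / sqrt pi * sqrt b * exp (- ((sqrt b * cosh s)\<^sup>2))) * (s * sinh s)" for s
  by (rule mult_nonneg_nonneg[OF _ ssn]) (use b in simp)
 then have nn: "s * ckern b s >= 0" for s unfolding ckern_def by (simp add: mult_ac)
 have "(LINT s|lborel. s * ckern b s) = 2 * (upper_Gamma 0 b / 2)"
 proof (rule integral_even_nonneg[OF _ nn _ nn_integral_ckern[OF b]])
  show "- s * ckern b (- s) = s * ckern b s" for s by (simp add: ckern_def)
 qed (use upper_Gamma_0_nn_integral(2)[OF b] in auto)
 then show "(LINT s|lborel. s * ckern b s) = upper_Gamma 0 b" by simp
qed

lemma exp_neg_sinh_square_bound: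
 assumes b: "b > 0"
 obtains C where "C >= 0" "\<And>s. \<bar>skern b s\<bar> <= C * exp (- 2 * abs s)" "\<And>s. \<bar>ckern b s\<bar> <= C * exp (- 2 * abs s)"
proof -
 \<comment> \<open>The Gaussian factor is bounded at rate 3: one unit pays for cosh or sinh, two
   remain. The factor exp(b/2) comes from sinh^2 >= exp(2|s|)/4 - 1/2.\<close>
 define C where "C = 2 / sqrt pi * sqrt b * exp (b / 2) * exp (3\<^sup>2 / (4 * (2 * (b / 4))))"
 have C0: "C >= 0" using b by (simp add: C_def)
 have ch: "\<bar>cosh s\<bar> <= exp \<bar>s\<bar>" "\<bar>sinh s\<bar> <= exp \<bar>s\<bar>" for s :: real
 proof -
  define E where "E = exp \<bar>s\<bar>"
  define a b where "a = exp s" and "b = exp (- s)"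
  have ab: "a <= E" "b <= E" "a > 0" "b > 0" by (auto simp: E_def a_def b_def)
  have "cosh s = (a + b) / 2" "sinh s = (a - b) / 2" unfolding cosh_field_def sinh_field_def a_def b_def by simp_all
  then have "cosh s <= E" "- cosh s <= E" "sinh s <= E" "- sinh s <= E" using ab by simp_all
  then show "\<bar>cosh s\<bar> <= exp \<bar>s\<bar>" "\<bar>sinh s\<bar> <= exp \<bar>s\<bar>" unfolding E_def by linarith+
 qed
 have sh: "(sinh s)\<^sup>2 >= exp (2 * abs s) / 4 - 1 / 2" for s :: real
 proof -
  have "(sinh \<bar>s\<bar>)\<^sup>2 = exp (2 * abs s) / 4 - 1 / 2 + exp (- 2 * abs s) / 4"
   unfolding sinh_def power2_eq_square
   by (simp add: field_simps exp_add[symmetric] flip: exp_add)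
  moreover have "(sinh \<bar>s\<bar>)\<^sup>2 = (sinh s)\<^sup>2" by (simp add: abs_if)
  ultimately show ?thesis by (metis add_increasing2 divide_nonneg_nonneg exp_ge_zero order_refl zero_le_numeral)
 qed
 have e: "exp (- ((sqrt b * sinh s)\<^sup>2)) <= exp (b / 2) * (exp (3\<^sup>2 / (4 * (2 * (b / 4)))) * exp (- 3 * abs s))" for s
 proof -
  have "(sqrt b * sinh s)\<^sup>2 >= b * (exp (2 * abs s) / 4 - 1 / 2)"
   using sh[of s] b by (simp add: power_mult_distrib)
  then have "exp (- ((sqrt b * sinh s)\<^sup>2)) <= exp (b / 2 + - (b / 4) * exp (2 * abs s))" by (simp add: algebra_simps)
  also have "... = exp (b / 2) * exp (- (b / 4) * exp (2 * abs s))" by (rule exp_add)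
  also have "... <= exp (b / 2) * (exp (3\<^sup>2 / (4 * (2 * (b / 4)))) * exp (- 3 * abs s))"
   using exp_abs_superexp_bound[of "b / 4" s 3] b by (intro mult_left_mono) auto
  finally show ?thesis .
 qed
 have cs: "exp (- ((sqrt b * cosh s)\<^sup>2)) <= exp (- ((sqrt b * sinh s)\<^sup>2))" for s
  using b by (simp add: power_mult_distrib cosh_square_eq)
 have gen: "\<bar>2 / sqrt pi * (sqrt b * k) * E\<bar> <= C * exp (- 2 * abs s)"
  if k: "abs k <= exp \<bar>s\<bar>" and E: "0 <= E" "E <= exp (- ((sqrt b * sinh s)\<^sup>2))" for k E s :: real
 proof -
  have "\<bar>2 / sqrt pi * (sqrt b * k) * E\<bar> = 2 / sqrt pi * sqrt b * (abs k * E)"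
   using b E by (simp add: abs_mult)
  also have "... <= 2 / sqrt pi * sqrt b * (exp \<bar>s\<bar> * (exp (b / 2) * (exp (3\<^sup>2 / (4 * (2 * (b / 4)))) * exp (- 3 * abs s))))"
   using b k E order_trans[OF E(2) e] by (intro mult_left_mono mult_mono) auto
  also have "... = C * (exp \<bar>s\<bar> * exp (- 3 * abs s))" unfolding C_def by (simp only: mult_ac)
  also have "exp \<bar>s\<bar> * exp (- 3 * abs s) = exp (- 2 * abs s)" unfolding exp_add[symmetric] by simp
  finally show ?thesis .
 qed
 show thesis
 proof (rule that[OF C0])
  show "\<bar>skern b s\<bar> <= C * exp (- 2 * abs s)" for s unfolding skern_def by (rule gen[OF ch(1)]) auto
  show "\<bar>ckern b s\<bar> <= C * exp (- 2 * abs s)" for s unfolding ckern_def by (rule gen[OF ch(2) _ cs]) auto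
 qed
qed

lemma integrable_kern:
 assumes b: "b > 0"
 shows "integrable lborel (%s. skern b s * (p + q * s))" "integrable lborel (%s. ckern b s * (p + q * s))"
proof -
 obtain C where C: "C >= 0" "\<And>s. \<bar>skern b s\<bar> <= C * exp (- 2 * abs s)" "\<And>s. \<bar>ckern b s\<bar> <= C * exp (- 2 * abs s)"
  by (rule exp_neg_sinh_square_bound[OF b]) blast
 have i: "integrable lborel (%s. C * (abs p + abs q) * exp (- 1 * abs s))"
  by (intro integrable_mult_right integrable_exp_neg_abs) simp
 have l: "\<bar>p + q * s\<bar> <= (abs p + abs q) * exp \<bar>s\<bar>" for s
 proof -
  have "abs s <= exp \<bar>s\<bar>" "1 <= exp \<bar>s\<bar>" using exp_ge_add_one_self[of "abs s"] by linarith+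
  then have "abs p * 1 + abs q * abs s <= abs p * exp \<bar>s\<bar> + abs q * exp \<bar>s\<bar>" by (intro add_mono mult_left_mono) auto
  then show ?thesis using abs_triangle_ineq[of p "q * s"] by (simp add: abs_mult algebra_simps)
 qed
 have bd: "norm (k s * (p + q * s)) <= norm (C * (abs p + abs q) * exp (- 1 * abs s))"
  if "\<And>s. \<bar>k s\<bar> <= C * exp (- 2 * abs s)" for k and s :: real
 proof -
  have "norm (k s * (p + q * s)) <= (C * exp (- 2 * abs s)) * ((abs p + abs q) * exp \<bar>s\<bar>)"
   unfolding real_norm_def abs_mult using that l C by (intro mult_mono) auto
  also have "... = C * (abs p + abs q) * (exp (- 2 * abs s) * exp \<bar>s\<bar>)" by (simp only: mult_ac)
  also have "exp (- 2 * abs s) * exp \<bar>s\<bar> = exp (- 1 * abs s)" unfolding exp_add[symmetric] by simp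
  finally show ?thesis using C(1) by simp
 qed
 show "integrable lborel (%s. skern b s * (p + q * s))"
  by (rule integrable_dominated[OF i _ AE_I2[OF bd[OF C(2)]]]) measurable
 show "integrable lborel (%s. ckern b s * (p + q * s))"
  by (rule integrable_dominated[OF i _ AE_I2[OF bd[OF C(3)]]]) measurable
qed

lemma integral_kern_linear:
 assumes b: "b > 0"
 shows "(LINT w|lborel. skern b (w - c) * (p + q * w)) = 2 * (p + q * c)"
  and "(LINT w|lborel. ckern b (w - c) * (p + q * w)) = q * upper_Gamma 0 b"
proof -
 have sh: "(LINT w|lborel. k (w - c) * (p + q * w)) = (p + q * c) * (LINT s|lborel. k s) + q * (LINT s|lborel. s * k s)"
  if i: "\<And>p q. integrable lborel (%s. k s * (p + q * s))" for k :: "real => real"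
 proof -
  have "(LINT w|lborel. k (w - c) * (p + q * w)) = (LINT s|lborel. k s * (p + q * (c + s)))"
   using lborel_integral_real_affine[of 1 "%w. k (w - c) * (p + q * w)" c] by simp
  also have "... = (LINT s|lborel. (p + q * c) * k s + q * (s * k s))"
   by (rule lebesgue_integral_cong) (auto simp: algebra_simps)
  also have "... = (LINT s|lborel. (p + q * c) * k s) + (LINT s|lborel. q * (s * k s))"
   using i[of 1 0] i[of 0 1] by (intro Bochner_Integration.integral_add) (auto simp: mult.commute)
  finally show ?thesis by simp
 qed
 show "(LINT w|lborel. skern b (w - c) * (p + q * w)) = 2 * (p + q * c)"
  unfolding sh[OF integrable_kern(1)[OF b]] integral_skern[OF b] by simp
 show "(LINT w|lborel. ckern b (w - c) * (p + q * w)) = q * upper_Gamma 0 b"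
  unfolding sh[OF integrable_kern(2)[OF b]] integral_ckern[OF b] by simp
qed

section \<open>Termwise integration over the non-isotropic vectors\<close>

text \<open>A bound that separates the index from w makes the sum of the norms integrable. The
  exchange for ordinary series is transported along an enumeration of the integer pairs, with f
  extended by 0 outside A.\<close>

lemma has_sum_integral_swap:
 fixes f :: "int \<times> int => real => complex"
 assumes m: "\<And>i. i \<in> A ==> f i \<in> borel_measurable borel"
  and b: "\<And>i w. i \<in> A ==> norm (f i w) <= b i * k w"
  and bs: "b summable_on A" and b0: "\<And>i. i \<in> A ==> b i >= 0"
  and k: "integrable lborel k" "\<And>w. k w >= 0"
 shows "((%i. LINT w|lborel. f i w) has_sum (LINT w|lborel. (\<Sum>\<^sub>\<infinity>i\<in>A. f i w))) A"
  and "integrable lborel (%w. \<Sum>\<^sub>\<infinity>i\<in>A. f i w)"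
proof -
 define e where "e = from_nat_into (UNIV :: (int \<times> int) set)"
 have inf: "infinite (UNIV :: (int \<times> int) set)" by (simp add: finite_prod infinite_UNIV_int)
 have e: "bij_betw e UNIV UNIV" unfolding e_def by (rule bij_betw_from_nat_into) (auto simp: inf)
 define g where "g i w = (if i \<in> A then f i w else 0)" for i w
 define c where "c i = (if i \<in> A then b i else 0)" for i
 have gm[measurable]: "g i \<in> borel_measurable borel" for i using m[of i] by (cases "i \<in> A") (auto simp: g_def[abs_def])
 have gc: "norm (g i w) <= c i * k w" for i w using b[of i w] by (auto simp: g_def c_def)
 have c0: "c i >= 0" for i using b0 by (auto simp: c_def)
 have "c summable_on UNIV" using bs by (rule summable_on_cong_neutral[THEN iffD1, rotated -1]) (auto simp: c_def)
 then have "(%n. c (e n)) summable_on UNIV" using summable_on_reindex_bij_betw[OF e, of c] by simp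
 then have cs: "summable (%n. c (e n))" using c0 by (simp add: summable_on_UNIV_nonneg_real_iff)
 have ig: "integrable lborel (g i)" for i
  by (rule integrable_dominated[OF integrable_mult_right[OF k(1), of "c i"] _ AE_I2]) (use gc c0 k(2) in auto)
 have sn: "summable (%n. norm (g (e n) w))" for w
  by (rule summable_comparison_test'[where N=0, OF summable_mult2[OF cs, of "k w"]]) (use gc in auto)
 have nb: "(LINT w|lborel. norm (g i w)) <= c i * (LINT w|lborel. k w)" for i
 proof -
  have "(LINT w|lborel. norm (g i w)) <= (LINT w|lborel. c i * k w)"
   by (rule integral_mono[OF integrable_norm[OF ig] integrable_mult_right[OF k(1)] gc])
  then show ?thesis by simp
 qed
 have sI: "summable (%n. LINT w|lborel. norm (g (e n) w))"
  by (rule summable_comparison_test'[where N=0, OF summable_mult2[OF cs, of "LINT w|lborel. k w"]])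
   (use nb in \<open>auto simp: integral_nonneg_AE\<close>)
 have pw: "(\<Sum>\<^sub>\<infinity>i\<in>A. f i w) = (\<Sum>n. g (e n) w)" for w
 proof -
  have "(\<Sum>\<^sub>\<infinity>i\<in>A. f i w) = (\<Sum>\<^sub>\<infinity>i\<in>UNIV. g i w)" by (rule infsum_cong_neutral) (auto simp: g_def)
  also have "... = (\<Sum>\<^sub>\<infinity>n\<in>UNIV. g (e n) w)" by (rule infsum_reindex_bij_betw[OF e, symmetric])
  also have "... = (\<Sum>n. g (e n) w)"
   by (intro infsumI norm_summable_imp_has_sum sn summable_sums summable_norm_cancel[OF sn])
  finally show ?thesis .
 qed
 show "integrable lborel (%w. \<Sum>\<^sub>\<infinity>i\<in>A. f i w)"
  unfolding pw by (rule integrable_suminf[OF ig AE_I2[OF sn] sI])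
 have su: "(%n. LINT w|lborel. g (e n) w) sums (LINT w|lborel. (\<Sum>n. g (e n) w))"
  by (rule sums_integral[OF ig AE_I2[OF sn] sI])
 have "summable (%n. norm (LINT w|lborel. g (e n) w))"
  by (rule summable_comparison_test'[where N=0, OF sI]) auto
 from norm_summable_imp_has_sum[OF this su]
 have "((%i. LINT w|lborel. g i w) has_sum (LINT w|lborel. (\<Sum>n. g (e n) w))) UNIV"
  using has_sum_reindex_bij_betw[OF e, of "%i. LINT w|lborel. g i w"] by simp
 then show "((%i. LINT w|lborel. f i w) has_sum (LINT w|lborel. (\<Sum>\<^sub>\<infinity>i\<in>A. f i w))) A"
  unfolding pw by (rule has_sum_cong_neutral[THEN iffD1, rotated -1]) (auto simp: g_def)
qed

text \<open>Off the axes both coordinates have absolute value at least 1. Then Y = (x exp(-w))^2 +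
  (y exp w)^2 dominates x + y, by the arithmetic-geometric inequality, and also exp(2|w|), so the
  bound separates the vector from w.\<close>

lemma psi_term_exp_bound:
 assumes N: "N > 0" and v: "Im \<tau> > 0"
 obtains C c where "C >= 0" "c > 0" "\<And>X w. fst X ~= 0 ==> snd X ~= 0 ==>
   norm (psi_term N \<tau> (exp w) X) <= C * (exp (- c * \<bar>x1 X\<bar>) * exp (- c * \<bar>x2 X\<bar>)) * exp (- 3 * abs w)"
proof -
 define \<kappa> where "\<kappa> = pi * Im \<tau> / real N"
 have \<kappa>: "\<kappa> > 0" using N v by (simp add: \<kappa>_def)
 \<comment> \<open>Half of kappa Y is spent on the linear factor; the other half is divided equally
   between decay in the vector and decay in w.\<close>
 define c where "c = \<kappa> / 4"
 have c: "c > 0" using \<kappa> by (simp add: c_def)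
 define D where "D = exp (3\<^sup>2 / (4 * (2 * c)))"
 define C where "C = 2 * sqrt (Im \<tau> / real N) * (1 + 2 / \<kappa>) * D"
 have C: "C >= 0" using v \<kappa> by (simp add: C_def D_def)
 have "norm (psi_term N \<tau> (exp w) X) <= C * (exp (- c * \<bar>x1 X\<bar>) * exp (- c * \<bar>x2 X\<bar>)) * exp (- 3 * abs w)"
  if X: "fst X ~= 0" "snd X ~= 0" for X :: "int \<times> int" and w :: real
 proof -
  define x y where "x = \<bar>real_of_int (fst X)\<bar>" and "y = \<bar>real_of_int (snd X)\<bar>"
  have "\<bar>fst X\<bar> >= 1" "\<bar>snd X\<bar> >= 1" using X by auto
  then have xy: "x >= 1" "y >= 1" unfolding x_def y_def by (simp_all flip: of_int_abs)
  define Y where "Y = (x * exp (- w))\<^sup>2 + (y * exp w)\<^sup>2"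
  have Y: "Y = (x1 X)\<^sup>2 / (exp w)\<^sup>2 + (x2 X)\<^sup>2 * (exp w)\<^sup>2"
   by (simp add: Y_def x_def y_def power_mult_distrib exp_minus field_simps)
  have "\<bar>x2 X * exp w - x1 X / exp w\<bar> <= y * exp w + x * exp (- w)"
   using abs_triangle_ineq4[of "x2 X * exp w" "x1 X / exp w"]
   by (simp add: x_def y_def abs_mult exp_minus field_simps)
  also have "... <= 1 + Y"
  proof -
   have "(x * exp (- w) - 1)\<^sup>2 >= 0" "(y * exp w - 1)\<^sup>2 >= 0" by auto
   then have "2 * (x * exp (- w)) <= (x * exp (- w))\<^sup>2 + 1" "2 * (y * exp w) <= (y * exp w)\<^sup>2 + 1"
    by (simp_all add: power2_diff)
   moreover have "Y >= 0" by (simp add: Y_def)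
   ultimately show ?thesis unfolding Y_def by linarith
  qed
  also have "... <= (1 + 2 / \<kappa>) * exp (\<kappa> / 2 * Y)"
  proof -
   have Y0: "Y >= 0" by (simp add: Y_def)
   have "(1 + 2 / \<kappa>) * (1 + \<kappa> / 2 * Y) = 1 + Y + 2 / \<kappa> + \<kappa> / 2 * Y" using \<kappa> by (simp add: field_simps)
   moreover have "(1 + 2 / \<kappa>) * (1 + \<kappa> / 2 * Y) <= (1 + 2 / \<kappa>) * exp (\<kappa> / 2 * Y)"
    using \<kappa> exp_ge_add_one_self[of "\<kappa> / 2 * Y"] by (intro mult_left_mono) auto
   moreover have "2 / \<kappa> >= 0" "\<kappa> / 2 * Y >= 0" using \<kappa> Y0 by auto
   ultimately show ?thesis by linarith
  qed
  finally have l: "\<bar>x2 X * exp w - x1 X / exp w\<bar> <= (1 + 2 / \<kappa>) * exp (\<kappa> / 2 * Y)" .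
  have Y1: "Y >= x + y"
  proof -
   have "(x * exp (- w) - y * exp w)\<^sup>2 >= 0" by simp
   then have "2 * ((x * exp (- w)) * (y * exp w)) <= Y" unfolding Y_def by (simp add: power2_diff mult.assoc)
   moreover have "(x * exp (- w)) * (y * exp w) = x * y" by (simp add: exp_minus)
   ultimately have "Y >= 2 * (x * y)" by metis
   moreover have "2 * (x * y) >= x + y" using int_prod_abs_ge[OF X] by (simp add: x_def y_def abs_mult)
   ultimately show ?thesis by linarith
  qed
  have Y2: "Y >= exp (2 * abs w)"
  proof -
   have "1 * exp (- w) <= x * exp (- w)" "1 * exp w <= y * exp w" using xy by (intro mult_right_mono; simp)+
   then have "(1 * exp (- w))\<^sup>2 <= (x * exp (- w))\<^sup>2" "(1 * exp w)\<^sup>2 <= (y * exp w)\<^sup>2" by (intro power_mono; simp)+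
   then have "exp (2 * (- w)) + exp (2 * w) <= Y" unfolding Y_def exp_double by simp
   moreover have "exp (2 * abs w) <= exp (2 * (- w)) + exp (2 * w)" by (cases "w >= 0") auto
   ultimately show ?thesis by linarith
  qed
  have "norm (psi_term N \<tau> (exp w) X) = 2 * sqrt (Im \<tau> / real N) * \<bar>x2 X * exp w - x1 X / exp w\<bar> * exp (- \<kappa> * Y)"
   unfolding norm_psi_term[OF v] Y \<kappa>_def by simp
  also have "... <= 2 * sqrt (Im \<tau> / real N) * ((1 + 2 / \<kappa>) * exp (\<kappa> / 2 * Y)) * exp (- \<kappa> * Y)"
   using v by (intro mult_right_mono mult_left_mono l) auto
  also have "... = 2 * sqrt (Im \<tau> / real N) * (1 + 2 / \<kappa>) * (exp (\<kappa> / 2 * Y) * exp (- \<kappa> * Y))" by (simp only: mult_ac)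
  also have "exp (\<kappa> / 2 * Y) * exp (- \<kappa> * Y) = exp (- (\<kappa> / 2 * Y))" unfolding exp_add[symmetric] by simp
  also have "... <= exp ((- c * x + - c * y) + - c * exp (2 * abs w))"
  proof -
   have "c * (x + y) <= c * Y" "c * exp (2 * abs w) <= c * Y" using c Y1 Y2 by (intro mult_left_mono; simp)+
   then show ?thesis by (simp add: c_def algebra_simps)
  qed
  also have "... = (exp (- c * x) * exp (- c * y)) * exp (- c * exp (2 * abs w))" by (simp only: exp_add)
  also have "... <= (exp (- c * x) * exp (- c * y)) * (D * exp (- 3 * abs w))"
   using exp_abs_superexp_bound[OF c, of w 3] unfolding D_def by (intro mult_left_mono) auto
  finally have "norm (psi_term N \<tau> (exp w) X) <= 2 * sqrt (Im \<tau> / real N) * (1 + 2 / \<kappa>) * ((exp (- c * x) * exp (- c * y)) * (D * exp (- 3 * abs w)))"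
   using v \<kappa> by (simp add: mult_left_mono)
  also have "... = C * (exp (- c * x) * exp (- c * y)) * exp (- 3 * abs w)" unfolding C_def by (simp only: mult_ac)
  finally show ?thesis unfolding x_def y_def .
 qed
 with C c show thesis by (rule that)
qed

lemma psi_term_exp_measurable:
 "(%w. psi_term N \<tau> (exp w) X) \<in> borel_measurable borel"
 unfolding psi_term_def by (intro borel_measurable_continuous_onI continuous_intros) auto

lemma psi_term_integral_swap:
 assumes N: "N > 0" and v: "Im \<tau> > 0" and A: "\<And>X. X \<in> A ==> fst X ~= 0 \<and> snd X ~= 0"
 shows "((%X. LINT w|lborel. psi_term N \<tau> (exp w) X * of_real (p + q * w)) has_sum
   (LINT w|lborel. (\<Sum>\<^sub>\<infinity>X\<in>A. psi_term N \<tau> (exp w) X) * of_real (p + q * w))) A"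
  and "integrable lborel (%w. (\<Sum>\<^sub>\<infinity>X\<in>A. psi_term N \<tau> (exp w) X) * of_real (p + q * w))"
  and "(%X. norm (LINT w|lborel. psi_term N \<tau> (exp w) X * of_real (p + q * w))) summable_on A"
proof -
 obtain C c where C: "C >= 0" "c > 0" "\<And>X w. fst X ~= 0 ==> snd X ~= 0 ==>
   norm (psi_term N \<tau> (exp w) X) <= C * (exp (- c * \<bar>x1 X\<bar>) * exp (- c * \<bar>x2 X\<bar>)) * exp (- 3 * abs w)"
  by (rule psi_term_exp_bound[OF N v]) blast
 define b where "b X = C * (exp (- c * \<bar>x1 X\<bar>) * exp (- c * \<bar>x2 X\<bar>))" for X :: "int \<times> int"
 define k where "k w = (abs p + abs q) * exp (- 2 * abs w)" for w :: real
 define f where "f X w = psi_term N \<tau> (exp w) X * of_real (p + q * w)" for X and w :: real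
 have fm: "f X \<in> borel_measurable borel" for X
  unfolding f_def[abs_def] using psi_term_exp_measurable[of N \<tau> X] by measurable
 have ki: "integrable lborel k" unfolding k_def by (intro integrable_mult_right integrable_exp_neg_abs) simp
 have fb: "norm (f X w) <= b X * k w" if "X \<in> A" for X w
 proof -
  have "abs w <= exp \<bar>w\<bar>" "1 <= exp \<bar>w\<bar>" using exp_ge_add_one_self[of "abs w"] by linarith+
  then have "abs p * 1 + abs q * abs w <= abs p * exp \<bar>w\<bar> + abs q * exp \<bar>w\<bar>" by (intro add_mono mult_left_mono) auto
  then have l: "\<bar>p + q * w\<bar> <= (abs p + abs q) * exp \<bar>w\<bar>"
   using abs_triangle_ineq[of p "q * w"] by (simp add: abs_mult algebra_simps)
  have "norm (f X w) <= (b X * exp (- 3 * abs w)) * ((abs p + abs q) * exp \<bar>w\<bar>)"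
   unfolding f_def norm_mult norm_of_real b_def using A[OF that] C(1,2) l by (intro mult_mono C(3)) auto
  also have "... = b X * ((abs p + abs q) * (exp (- 3 * abs w) * exp \<bar>w\<bar>))" by (simp only: mult_ac)
  also have "exp (- 3 * abs w) * exp \<bar>w\<bar> = exp (- 2 * abs w)" unfolding exp_add[symmetric] by simp
  finally show ?thesis unfolding k_def .
 qed
 have bs: "b summable_on A" unfolding b_def by (intro summable_on_cmult_right summable_exp_abs_pair C)
 have b0: "b X >= 0" for X unfolding b_def using C(1) by simp
 have k0: "k w >= 0" for w unfolding k_def by simp
 note S = has_sum_integral_swap[OF fm fb bs b0 ki k0]
 have eq: "(\<Sum>\<^sub>\<infinity>X\<in>A. f X w) = (\<Sum>\<^sub>\<infinity>X\<in>A. psi_term N \<tau> (exp w) X) * of_real (p + q * w)" for w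
  unfolding f_def by (rule infsum_cmult_left')
 show "((%X. LINT w|lborel. psi_term N \<tau> (exp w) X * of_real (p + q * w)) has_sum
   (LINT w|lborel. (\<Sum>\<^sub>\<infinity>X\<in>A. psi_term N \<tau> (exp w) X) * of_real (p + q * w))) A"
  using S(1) unfolding eq unfolding f_def .
 show "integrable lborel (%w. (\<Sum>\<^sub>\<infinity>X\<in>A. psi_term N \<tau> (exp w) X) * of_real (p + q * w))"
  using S(2) unfolding eq .
 have nb: "norm (LINT w|lborel. f X w) <= b X * (LINT w|lborel. k w)" if "X \<in> A" for X
 proof -
  have "norm (LINT w|lborel. f X w) <= (LINT w|lborel. b X * k w)"
   by (rule Bochner_Integration.integral_norm_bound_integral[OF _ _ fb[OF that]])
    (use integrable_dominated[OF integrable_mult_right[OF ki, of "b X"] _ AE_I2, of "f X"] fm fb[OF that] b0 k0 in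
     \<open>auto intro!: integrable_mult_right ki simp: abs_mult\<close>)
  then show ?thesis by simp
 qed
 show "(%X. norm (LINT w|lborel. psi_term N \<tau> (exp w) X * of_real (p + q * w))) summable_on A"
  using summable_on_comparison_test[OF summable_on_cmult_left[OF bs, of "LINT w|lborel. k w"], of "%X. norm (LINT w|lborel. f X w)"] nb
  unfolding f_def by auto
qed

definition logratio :: "int \<times> int => real" where
 "logratio X = ln \<bar>x1 X / x2 X\<bar>"

text \<open>Centring w at half of log|x1/x2| makes the two summands m exp(-s) and m exp(s) up to
  sign, where m is the geometric mean of the absolute values.\<close>

lemma coord_exp_logratio:
 fixes X :: "int \<times> int" and w :: real
 assumes X: "fst X ~= 0" "snd X ~= 0"
 defines "m \<equiv> sqrt \<bar>of_int (fst X * snd X)\<bar>" and "s \<equiv> w - logratio X / 2"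
 shows "x1 X / exp w = sgn (x1 X) * (m * exp (- s))"
  and "x2 X * exp w = sgn (x2 X) * (m * exp s)"
proof -
 define x y where "x = \<bar>real_of_int (fst X)\<bar>" and "y = \<bar>real_of_int (snd X)\<bar>"
 have xy: "x > 0" "y > 0" using X by (auto simp: x_def y_def)
 have l: "logratio X / 2 = ln (sqrt x) - ln (sqrt y)"
  using xy by (simp add: logratio_def x_def y_def ln_sqrt ln_div abs_divide)
 have m: "m = sqrt x * sqrt y" by (simp add: m_def x_def y_def abs_mult real_sqrt_mult)
 have es: "exp s = exp w * (sqrt y / sqrt x)"
  using xy unfolding s_def l by (simp add: exp_diff)
 have ems: "exp (- s) = sqrt x / sqrt y / exp w"
  unfolding exp_minus es using xy by (simp add: field_simps)
 have "m * exp (- s) = (sqrt x * sqrt x) / exp w" unfolding m ems using xy by (simp add: field_simps)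
 then have 1: "m * exp (- s) = x / exp w" using xy by simp
 have "m * exp s = (sqrt y * sqrt y) * exp w" unfolding m es using xy by (simp add: field_simps)
 then have 2: "m * exp s = y * exp w" using xy by simp
 show "x1 X / exp w = sgn (x1 X) * (m * exp (- s))"
  unfolding 1 x_def by (simp add: sgn_mult_abs)
 show "x2 X * exp w = sgn (x2 X) * (m * exp s)"
  unfolding 2 y_def by (simp add: sgn_mult_abs mult.assoc[symmetric])
qed

text \<open>After centring, the sum and the difference of the two summands are hyperbolic sine and
  cosine, with the roles decided by whether the coordinates have equal or opposite signs.\<close>

lemma psi_term_exp_kern:
 assumes N: "N > 0" and v: "Im \<tau> > 0" and X: "fst X ~= 0" "snd X ~= 0"
 shows "fst X * snd X < 0 ==> psi_term N \<tau> (exp w) X = ee (- of_real (qform N X) * \<tau>) *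
   of_real (sgn (x2 X) * skern (4 * pi * Im \<tau> * \<bar>qform N X\<bar>) (w - logratio X / 2))"
  and "fst X * snd X > 0 ==> psi_term N \<tau> (exp w) X = ee (- of_real (qform N X) * \<tau>) *
   of_real (sgn (x1 X) * ckern (4 * pi * Im \<tau> * \<bar>qform N X\<bar>) (w - logratio X / 2))"
proof -
 define m where "m = sqrt \<bar>of_int (fst X * snd X)\<bar>"
 define s where "s = w - logratio X / 2"
 define b where "b = 4 * pi * Im \<tau> * \<bar>qform N X\<bar>"
 define c where "c = sqrt (2 * pi * Im \<tau>)"
 define k where "k = sqrt (pi * Im \<tau> / real N)"
 define \<epsilon> where "\<epsilon> = sgn (real_of_int (snd X))"
 note co = coord_exp_logratio[OF X, of w, folded m_def s_def]
 have k: "c / sqrt (2 * real N) = k"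
  unfolding c_def k_def real_sqrt_divide[symmetric] by simp
 have sb: "sqrt b = 2 * (k * m)"
 proof -
  have "b = 4 * (pi * Im \<tau> / real N * \<bar>of_int (fst X * snd X)\<bar>)"
   using N by (simp add: b_def qform_def abs_divide)
  then show ?thesis unfolding k_def m_def by (simp only: real_sqrt_mult real_sqrt_four)
 qed
 have xi: "c * xi_coord N (exp w) X = k * (x1 X / exp w + x2 X * exp w)"
  and eta: "c * eta_coord N (exp w) X = k * (x2 X * exp w - x1 X / exp w)"
  unfolding k[symmetric] xi_coord_def eta_coord_def by simp_all
 have E: "\<epsilon>\<^sup>2 = 1" using X by (simp add: \<epsilon>_def sgn_if)
 note P = psi_term_eq_deriv[OF N exp_gt_zero v, of w X, folded c_def]
 {
  assume "fst X * snd X < 0"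
  then have sx: "sgn (real_of_int (fst X)) = - \<epsilon>"
   unfolding \<epsilon>_def by (auto simp: mult_less_0_iff)
  have "c * xi_coord N (exp w) X = \<epsilon> * (sqrt b * sinh s)"
   unfolding xi co sx sb sinh_field_def \<epsilon>_def[symmetric] by (simp add: algebra_simps)
  then have 1: "(c * xi_coord N (exp w) X)\<^sup>2 = (sqrt b * sinh s)\<^sup>2" by (simp only: power_mult_distrib E mult_1)
  have 2: "c * eta_coord N (exp w) X = \<epsilon> * (sqrt b * cosh s)"
   unfolding eta co sx sb cosh_field_def \<epsilon>_def[symmetric] by (simp add: algebra_simps)
  show "psi_term N \<tau> (exp w) X = ee (- of_real (qform N X) * \<tau>) *
   of_real (sgn (x2 X) * skern (4 * pi * Im \<tau> * \<bar>qform N X\<bar>) (w - logratio X / 2))"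
   unfolding P 1 2 skern_def \<epsilon>_def[symmetric] b_def[symmetric] s_def[symmetric] by (simp only: mult_ac)
 }
 {
  assume "fst X * snd X > 0"
  then have sx: "sgn (real_of_int (fst X)) = \<epsilon>"
   unfolding \<epsilon>_def by (auto simp: zero_less_mult_iff)
  have "c * xi_coord N (exp w) X = \<epsilon> * (sqrt b * cosh s)"
   unfolding xi co sx sb cosh_field_def \<epsilon>_def[symmetric] by (simp add: algebra_simps)
  then have 1: "(c * xi_coord N (exp w) X)\<^sup>2 = (sqrt b * cosh s)\<^sup>2" by (simp only: power_mult_distrib E mult_1)
  have 2: "c * eta_coord N (exp w) X = \<epsilon> * (sqrt b * sinh s)"
   unfolding eta co sx sb sinh_field_def \<epsilon>_def[symmetric] by (simp add: algebra_simps)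
  show "psi_term N \<tau> (exp w) X = ee (- of_real (qform N X) * \<tau>) *
   of_real (sgn (x1 X) * ckern (4 * pi * Im \<tau> * \<bar>qform N X\<bar>) (w - logratio X / 2))"
   unfolding P 1 2 ckern_def sx b_def[symmetric] s_def[symmetric] by (simp only: mult_ac)
 }
qed

lemma psi_term_integral:
 assumes N: "N > 0" and v: "Im \<tau> > 0" and X: "fst X ~= 0" "snd X ~= 0"
 shows "(LINT w|lborel. psi_term N \<tau> (exp w) X * of_real (p + q * w)) =
   ee (- of_real (qform N X) * \<tau>) *
   of_real (if fst X * snd X < 0 then sgn (x2 X) * (2 * p + q * logratio X)
    else sgn (x1 X) * (q * upper_Gamma 0 (4 * pi * Im \<tau> * qform N X)))"
proof -
 define b where "b = 4 * pi * Im \<tau> * \<bar>qform N X\<bar>"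
 have b: "b > 0" using N v X unfolding b_def qform_def by simp
 have neg: "fst X * snd X < 0 \<or> fst X * snd X > 0" using X by (metis linorder_neqE_linordered_idom mult_eq_0_iff)
 show ?thesis
 proof (cases "fst X * snd X < 0")
  case True
  have "(LINT w|lborel. psi_term N \<tau> (exp w) X * of_real (p + q * w)) =
   (LINT w|lborel. ee (- of_real (qform N X) * \<tau>) * of_real (sgn (x2 X)) * of_real (skern b (w - logratio X / 2) * (p + q * w)))"
   unfolding psi_term_exp_kern(1)[OF N v X True] b_def by (intro lebesgue_integral_cong refl) (simp only: of_real_mult mult_ac)
  also have "... = ee (- of_real (qform N X) * \<tau>) * of_real (sgn (x2 X)) * of_real (2 * (p + q * (logratio X / 2)))"
   by (simp only: integral_mult_right_zero integral_complex_of_real integral_kern_linear(1)[OF b])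
  finally show ?thesis using True by (simp add: algebra_simps)
 next
  case False
  with neg have pos: "fst X * snd X > 0" by simp
  then have "real_of_int (fst X * snd X) > 0" by (simp only: of_int_0_less_iff)
  then have q0: "\<bar>qform N X\<bar> = qform N X" unfolding qform_def by simp
  have "(LINT w|lborel. psi_term N \<tau> (exp w) X * of_real (p + q * w)) =
   (LINT w|lborel. ee (- of_real (qform N X) * \<tau>) * of_real (sgn (x1 X)) * of_real (ckern b (w - logratio X / 2) * (p + q * w)))"
   unfolding psi_term_exp_kern(2)[OF N v X pos] b_def by (intro lebesgue_integral_cong refl) (simp only: of_real_mult mult_ac)
  also have "... = ee (- of_real (qform N X) * \<tau>) * of_real (sgn (x1 X)) * of_real (q * upper_Gamma 0 b)"
   by (simp only: integral_mult_right_zero integral_complex_of_real integral_kern_linear(2)[OF b])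
  finally show ?thesis using False by (simp add: b_def q0 mult.assoc)
 qed
qed

section \<open>The isotropic vectors\<close>

lemma ang_unique:
 assumes "0 < y" "y <= 1" "x - y \<in> \<int>"
 shows "ang x = y"
 unfolding ang_def
proof (rule the_equality)
 fix z assume z: "0 < z \<and> z <= 1 \<and> x - z \<in> \<int>"
 have "(x - y) - (x - z) \<in> \<int>" using Ints_diff[of "x - y" "x - z"] assms z by blast
 then obtain n where n: "z - y = of_int n" by (auto elim: Ints_cases)
 have "of_int n < (1::real)" "of_int n > (-1::real)" using assms z n by linarith+
 then have "n < 1" "n > - 1" by linarith+
 then have "n = 0" by simp
 with n show "z = y" by simp
qed (use assms in auto)

lemma ang_int: "x \<in> \<int> ==> ang x = 1"
 by (rule ang_unique) (auto intro: Ints_diff)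

lemma ang_div:
 assumes N: "N > 0" and h: "\<not> int N dvd h"
 defines "a \<equiv> of_int (h mod int N) / real N"
 shows "ang (of_int h / real N) = a" "ang (- of_int h / real N) = 1 - a" "0 < a" "a < 1"
  "of_int h = real N * (of_int (h div int N) + a)"
proof -
 have "h mod int N ~= 0" using h by (simp add: dvd_eq_mod_eq_0)
 then have m: "0 < h mod int N" "h mod int N < int N"
 proof -
  assume nz: "h mod int N ~= 0"
  have "0 <= h mod int N" "h mod int N < int N" using N by simp_all
  with nz show "0 < h mod int N" "h mod int N < int N" by linarith+
 qed
 have lt: "real_of_int (h mod int N) < real N" using m(2) by (metis of_int_less_iff of_int_of_nat_eq)
 have "real N > 0" using N by simp
 then have "a < 1" unfolding a_def using lt by (rule divide_less_eq_1_pos[THEN iffD2])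
 moreover have "0 < a" unfolding a_def using m N by simp
 ultimately show a: "0 < a" "a < 1" by auto
 have "real_of_int h = of_int (int N * (h div int N) + h mod int N)" by simp
 also have "... = real N * (of_int (h div int N) + a)" using N unfolding of_int_add of_int_mult a_def by (simp add: field_simps)
 finally show h': "of_int h = real N * (of_int (h div int N) + a)" .
 show "ang (of_int h / real N) = a" by (rule ang_unique) (use a N in \<open>auto simp: h'\<close>)
 have "- of_int h / real N - (1 - a) = of_int (- (h div int N) - 1)" using N unfolding h' by (simp add: field_simps)
 then have e: "- of_int h / real N - (1 - a) \<in> \<int>" by (metis Ints_of_int)
 show "ang (- of_int h / real N) = 1 - a" by (rule ang_unique[OF _ _ e]) (use a in auto)
qed

text \<open>The part of \<open>Psi\<close> that \<open>psi_term_exp_bound\<close> does not cover. It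
  is integrable in w only after the summation over the axis.\<close>

definition Psi_iso :: "nat => int \<times> int => complex => real => complex" where
 "Psi_iso N h \<tau> t = (\<Sum>\<^sub>\<infinity>X\<in>{X\<in>lat_coset N h. fst X * snd X = 0}. psi_term N \<tau> t X)"

lemma Psi_iso_swap:
 assumes "t > 0"
 shows "Psi_iso N h \<tau> (1 / t) = - Psi_iso N (prod.swap h) \<tau> t"
proof -
 have eq: "{X\<in>lat_coset N h. fst X * snd X = 0} = prod.swap ` {X\<in>lat_coset N (prod.swap h). fst X * snd X = 0}"
  (is "?A = prod.swap ` ?B")
 proof (intro set_eqI iffI)
  fix X assume "X \<in> ?A"
  then have "prod.swap X \<in> ?B" by (auto simp: in_lat_coset_iff)
  then show "X \<in> prod.swap ` ?B" by (rule image_eqI[where x="prod.swap X", rotated]) simp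
 qed (auto simp: in_lat_coset_iff)
 have "Psi_iso N h \<tau> (1 / t) = (\<Sum>\<^sub>\<infinity>X\<in>?B. psi_term N \<tau> (1 / t) (prod.swap X))"
  unfolding Psi_iso_def eq by (subst infsum_reindex) (auto simp: o_def)
 also have "... = - Psi_iso N (prod.swap h) \<tau> t"
  unfolding psi_term_swap[OF assms] Psi_iso_def by (simp add: infsum_uminus)
 finally show ?thesis .
qed

lemma Psi_iso_empty:
 assumes "\<not> int N dvd fst h" "\<not> int N dvd snd h"
 shows "Psi_iso N h \<tau> t = 0"
proof -
 have e: "{X\<in>lat_coset N h. fst X * snd X = 0} = {}"
  using assms by (auto simp: in_lat_coset_iff)
 show ?thesis unfolding Psi_iso_def e by simp
qed

text \<open>The coset is the lattice itself and stable under negation, while the term is odd in the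
  vector.\<close>

lemma Psi_iso_lattice:
 assumes "int N dvd fst h" "int N dvd snd h"
 shows "Psi_iso N h \<tau> t = 0"
proof -
 let ?A = "{X\<in>lat_coset N h. fst X * snd X = 0}"
 have mem: "X \<in> lat_coset N h \<longleftrightarrow> int N dvd fst X \<and> int N dvd snd X" for X
  using assms dvd_add_left_iff[of "int N" "- fst h" "fst X"] dvd_add_left_iff[of "int N" "- snd h" "snd X"]
  by (simp add: in_lat_coset_iff)
 have eq: "?A = uminus ` ?A"
 proof (intro set_eqI iffI)
  fix X assume "X \<in> ?A"
  then have "- X \<in> ?A" by (simp add: mem)
  then show "X \<in> uminus ` ?A" by (rule image_eqI[where x="- X", rotated]) simp
 qed (auto simp: mem)
 have "psi_term N \<tau> t (- X) = - psi_term N \<tau> t X" for X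
 proof -
  have e: "of_int (snd (- X)) * t - of_int (fst (- X)) / t = - (x2 X * t - x1 X / t)"
   "(real_of_int (fst (- X)))\<^sup>2 = (x1 X)\<^sup>2" "(real_of_int (snd (- X)))\<^sup>2 = (x2 X)\<^sup>2"
   "fst (- X) * snd (- X) = fst X * snd X" by simp_all
  show ?thesis unfolding psi_term_def e by (simp only: mult_minus_right mult_minus_left of_real_minus)
 qed
 then have m: "psi_term N \<tau> t (- X) = - psi_term N \<tau> t X" for X .
 have "Psi_iso N h \<tau> t = (\<Sum>\<^sub>\<infinity>X\<in>uminus ` ?A. psi_term N \<tau> t X)" unfolding Psi_iso_def using eq by simp
 also have "... = (\<Sum>\<^sub>\<infinity>X\<in>?A. psi_term N \<tau> t (- X))" by (subst infsum_reindex) (auto simp: o_def)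
 also have "... = - Psi_iso N h \<tau> t" unfolding m Psi_iso_def by (rule infsum_uminus)
 finally show ?thesis by simp
qed

lemma gkern_minus: "gkern (- x) w = - gkern x w"
 by (simp add: gkern_def)

text \<open>The isotropic vectors are the (N(m + a), 0) with m an integer. In w they are all
  \<open>gkern\<close> reflected and shifted by the same l, since sqrt(pi v / N) N = exp l; folding
  negative m onto positive m by oddness gives the paired series.\<close>

lemma Psi_iso_first_axis:
 fixes \<tau> :: complex
 assumes N: "N > 0" and v: "Im \<tau> > 0" and h: "\<not> int N dvd fst h" "int N dvd snd h"
 defines "a \<equiv> ang (of_int (fst h) / real N)" and "l \<equiv> ln (pi * real N * Im \<tau>) / 2"
 obtains S where "\<And>w. Psi_iso N h \<tau> (exp w) = of_real (- 2 / sqrt pi * S (l - w))"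
  "\<And>w. (%M. \<Sum>m<M. gkern (real m + a) w - gkern (real m + 1 - a) w) \<longlonglongrightarrow> S w"
proof -
 note A = ang_div[OF N h(1)]
 have a: "a = of_int (fst h mod int N) / real N" unfolding a_def by (rule A(1))
 define d where "d = fst h div int N"
 have h': "of_int (fst h) = real N * (of_int d + a)" unfolding a d_def by (rule A(5))
 \<comment> \<open>The quotient d is subtracted so that the offset is the fraction a in (0,
   1).\<close>
 define X where "X m = (fst h + int N * (m - d), 0 :: int)" for m
 have fX: "real_of_int (fst (X m)) = real N * (of_int m + a)" for m
  unfolding X_def by (simp add: h' algebra_simps)
 have inj: "inj X" using N by (auto simp: inj_def X_def)
 have rng: "{X\<in>lat_coset N h. fst X * snd X = 0} = range X"
 proof (intro set_eqI iffI)
  fix Y assume Y: "Y \<in> {X\<in>lat_coset N h. fst X * snd X = 0}"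
  have "fst Y ~= 0" using Y h(1) by (auto simp: in_lat_coset_iff)
  with Y have s: "snd Y = 0" by simp
  from Y obtain k where "fst Y - fst h = int N * k" by (auto simp: in_lat_coset_iff)
  then have "Y = X (k + d)" using s by (simp add: X_def prod_eq_iff)
  then show "Y \<in> range X" by blast
 next
  fix Y assume "Y \<in> range X"
  then show "Y \<in> {X\<in>lat_coset N h. fst X * snd X = 0}" using h(2) by (auto simp: in_lat_coset_iff X_def)
 qed
 have k0: "sqrt (pi * Im \<tau> / real N) > 0" using N v by simp
 have el: "exp l = sqrt (pi * real N * Im \<tau>)"
  unfolding l_def using N v by (simp add: ln_sqrt[symmetric])
 have kN: "sqrt (pi * Im \<tau> / real N) * real N = exp l"
 proof -
  have e: "pi * real N * Im \<tau> = (pi * Im \<tau> / real N) * (real N)\<^sup>2" using N by (simp add: power2_eq_square)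
  show ?thesis unfolding el e by (simp only: real_sqrt_mult[of _ "(real N)\<^sup>2"] real_sqrt_abs abs_of_nat)
 qed
 have term_eq: "psi_term N \<tau> (exp w) (X m) = of_real (- 2 / sqrt pi * gkern (of_int m + a) (l - w))" for m w
 proof -
  define x where "x = real N * (of_int m + a)"
  define k where "k = sqrt (pi * Im \<tau> / real N)"
  have kx: "(of_int m + a) * exp (l - w) = k * x / exp w"
   unfolding exp_diff kN[symmetric] k_def x_def by simp
  have k2: "k\<^sup>2 = pi * Im \<tau> / real N" unfolding k_def using N v by simp
  have s: "2 * sqrt (Im \<tau> / real N) = 2 / sqrt pi * k" unfolding k_def by (simp add: real_sqrt_mult real_sqrt_divide)
  have "psi_term N \<tau> (exp w) (X m) = of_real (2 * sqrt (Im \<tau> / real N) * (- (x / exp w)) * exp (- pi * Im \<tau> / real N * (x^2 / (exp w)\<^sup>2)))"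
   unfolding psi_term_def fX x_def[symmetric] by (simp add: X_def)
  also have "- pi * Im \<tau> / real N * (x^2 / (exp w)\<^sup>2) = - ((k * x / exp w)\<^sup>2)"
   by (simp add: power_divide power_mult_distrib k2)
  also have "2 * sqrt (Im \<tau> / real N) * (- (x / exp w)) * exp (- ((k * x / exp w)\<^sup>2)) = - 2 / sqrt pi * (k * x / exp w * exp (- ((k * x / exp w)\<^sup>2)))"
   unfolding s by simp
  finally show ?thesis unfolding gkern_def kx .
 qed
 define G where "G w m = gkern (of_int m + a) w" for w and m :: int
 have sumG: "G w summable_on UNIV" for w
 proof -
  have "(%Y. psi_term N \<tau> (exp (l - w)) Y) summable_on range X"
   using abs_summable_summable[OF psi_term_abs_summable[OF N v exp_gt_zero]] .
  then have "(%m. psi_term N \<tau> (exp (l - w)) (X m)) summable_on UNIV"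
   by (subst (asm) summable_on_reindex[OF inj]) (simp add: o_def)
  then have "(%m. Re (psi_term N \<tau> (exp (l - w)) (X m))) summable_on UNIV" by (rule summable_on_Re)
  then have "(%m. (- sqrt pi / 2) * Re (psi_term N \<tau> (exp (l - w)) (X m))) summable_on UNIV" by (rule summable_on_cmult_right)
  then show ?thesis unfolding term_eq by (simp add: G_def[abs_def])
 qed
 define S where "S w = (\<Sum>\<^sub>\<infinity>m. G w m)" for w
 have 1: "Psi_iso N h \<tau> (exp w) = of_real (- 2 / sqrt pi * S (l - w))" for w
 proof -
  have "Psi_iso N h \<tau> (exp w) = (\<Sum>\<^sub>\<infinity>m. of_real (- 2 / sqrt pi * G (l - w) m))"
   unfolding Psi_iso_def rng by (subst infsum_reindex[OF inj]) (simp add: o_def term_eq G_def)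
  also have "... = of_real (- 2 / sqrt pi * S (l - w))"
   unfolding S_def by (intro infsumI has_sum_of_real has_sum_cmult_right has_sum_infsum sumG)
  finally show ?thesis .
 qed
 have 2: "(%M. \<Sum>m<M. gkern (real m + a) w - gkern (real m + 1 - a) w) \<longlonglongrightarrow> S w" for w
 proof -
  have "(G w has_sum S w) UNIV" unfolding S_def using sumG by (rule has_sum_infsum)
  then have "((%F. sum (G w) F) \<longlongrightarrow> S w) (finite_subsets_at_top UNIV)" unfolding has_sum_def .
  \<comment> \<open>The half-open window {-M..<M} pairs m with - m - 1, and \<open>gkern\<close> at
    - m - 1 + a is minus \<open>gkern\<close> at m + 1 - a.\<close>
  moreover note filterlim_int_half_open_interval
  ultimately have "(%M. sum (G w) {- int M..<int M}) \<longlonglongrightarrow> S w"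
   by (rule filterlim_compose)
  moreover have "sum (G w) {- int M..<int M} = (\<Sum>m<M. gkern (real m + a) w - gkern (real m + 1 - a) w)" for M
  proof (induction M)
   case (Suc M)
   have "{- int (Suc M)..<int (Suc M)} = insert (int M) (insert (- int M - 1) {- int M..<int M})" by auto
   then have "sum (G w) {- int (Suc M)..<int (Suc M)} = G w (int M) + (G w (- int M - 1) + sum (G w) {- int M..<int M})"
    by simp
   moreover have "G w (- int M - 1) = - gkern (real M + 1 - a) w"
    unfolding G_def gkern_minus[symmetric] by (simp add: algebra_simps)
   ultimately show ?case using Suc by (simp add: G_def)
  qed simp
  ultimately show ?thesis by simp
 qed
 from 1 2 show thesis by (rule that)
qed

text \<open>The substitution w -> l - w turns the weight p + q w into (p + q l) - q w, to which the
  Hurwitz integral applies. The value 2 l = ln(pi N) + ln v is what places log(pi N) in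
  \<open>tc_coeff\<close> and log v beside it.\<close>

lemma Psi_iso_integral_first_axis:
 assumes N: "N > 0" and v: "Im \<tau> > 0" and h: "\<not> int N dvd fst h" "int N dvd snd h"
 shows "integrable lborel (%w. Psi_iso N h \<tau> (exp w) * of_real (p + q * w))"
  and "(LINT w|lborel. Psi_iso N h \<tau> (exp w) * of_real (p + q * w)) =
    of_real (- 2 * c_coeff N h 0 * p - q * (tc_coeff N h 0 + c_coeff N h 0 * ln (Im \<tau>)))"
proof -
 define a where "a = ang (of_int (fst h) / real N)"
 define l where "l = ln (pi * real N * Im \<tau>) / 2"
 obtain S where S: "\<And>w. Psi_iso N h \<tau> (exp w) = of_real (- 2 / sqrt pi * S (l - w))"
  "\<And>w. (%M. \<Sum>m<M. gkern (real m + a) w - gkern (real m + 1 - a) w) \<longlonglongrightarrow> S w"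
  using Psi_iso_first_axis[OF N v h] unfolding a_def l_def by blast
 note A = ang_div[OF N h(1)]
 have a: "0 < a" "a < 1" "ang (- of_int (fst h) / real N) = 1 - a"
  using A unfolding a_def by simp_all
 note H = hurwitz_theta_integral[OF a(1,2) S(2), where p = "p + q * l" and q = "- q"]
 have eq: "Psi_iso N h \<tau> (exp w) * of_real (p + q * w) = of_real ((- 2 / sqrt pi) * (S (l - w) * ((p + q * l) + (- q) * (l - w))))" for w
 proof -
  have "p + q * w = (p + q * l) + (- q) * (l - w)" by (simp add: algebra_simps)
  then show ?thesis unfolding S(1) of_real_mult[symmetric] by (simp only: mult_ac)
 qed
 have i: "integrable lborel (%w. (- 2 / sqrt pi) * (S (l - w) * ((p + q * l) + (- q) * (l - w))))"
  using lborel_integrable_real_affine[OF H(1), of "-1" l] by (intro integrable_mult_right) simp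
 then show "integrable lborel (%w. Psi_iso N h \<tau> (exp w) * of_real (p + q * w))" unfolding eq by (rule integrable_of_real)
 have "(LINT w|lborel. Psi_iso N h \<tau> (exp w) * of_real (p + q * w)) =
   of_real ((- 2 / sqrt pi) * (LINT w|lborel. S (l - w) * ((p + q * l) + (- q) * (l - w))))"
  unfolding eq by (simp only: integral_complex_of_real integral_mult_right_zero)
 also have "(LINT w|lborel. S (l - w) * ((p + q * l) + (- q) * (l - w))) = (LINT w|lborel. S w * ((p + q * l) + (- q) * w))"
  using lborel_integral_real_affine[of "-1" "%w. S w * ((p + q * l) + (- q) * w)" l] by simp
 also have "... = (1 - 2 * a) * (sqrt pi / 2 * (p + q * l) + - q * (deriv Gamma (1/2) / 4))
    + sqrt pi / 2 * (- q) * (ln (Gamma a) - ln (Gamma (1 - a)))" by (rule H(2))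
 also have "(- 2 / sqrt pi) * ... = - 2 * c_coeff N h 0 * p - q * (tc_coeff N h 0 + c_coeff N h 0 * ln (Im \<tau>))"
 proof -
  have c: "c_coeff N h 0 = 1 / 2 - a" using h unfolding a_def c_coeff_def by (cases h) auto
  have t: "tc_coeff N h 0 = (1 / 2 - a) * (ln (pi * real N) - deriv Gamma (1 / 2) / sqrt pi) - ln (Gamma a) + ln (Gamma (1 - a))"
   using h a(3) unfolding c[symmetric] unfolding a_def tc_coeff_def by (cases h) (auto simp: Gamma_one_half_real)
  have ll: "ln (pi * real N) + ln (Im \<tau>) = 2 * l" unfolding l_def using N v by (simp add: ln_mult)
  have sp: "sqrt pi * sqrt pi = pi" "sqrt pi ~= 0" by auto
  define r g G1 G2 where "r = sqrt pi" and "g = deriv Gamma (1 / 2 :: real)" and "G1 = ln (Gamma a)" and "G2 = ln (Gamma (1 - a))"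
  have r: "r ~= 0" by (simp add: r_def)
  have E1: "(- 2 / r) * ((1 - 2 * a) * (r / 2 * (p + q * l) + - q * (g / 4)) + r / 2 * (- q) * (G1 - G2))
   = - (1 - 2 * a) * (p + q * l) + (1 - 2 * a) * q * g / (2 * r) + q * (G1 - G2)"
   using r by (simp add: field_simps)
  have E2: "- 2 * (1 / 2 - a) * p - q * (((1 / 2 - a) * (ln (pi * real N) - g / r) - G1 + G2) + (1 / 2 - a) * ln (Im \<tau>))
   = - (1 - 2 * a) * p - q * ((1 / 2 - a) * (ln (pi * real N) + ln (Im \<tau>))) + (1 - 2 * a) * q * g / (2 * r) + q * (G1 - G2)"
   using r by (simp add: field_simps)
  show ?thesis unfolding c t r_def[symmetric] g_def[symmetric] G1_def[symmetric] G2_def[symmetric] E1 E2 ll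
   by (simp add: field_simps)
 qed
 finally show "(LINT w|lborel. Psi_iso N h \<tau> (exp w) * of_real (p + q * w)) =
    of_real (- 2 * c_coeff N h 0 * p - q * (tc_coeff N h 0 + c_coeff N h 0 * ln (Im \<tau>)))" .
qed

lemma coeff_0_swap:
 "c_coeff N (prod.swap h) 0 = c_coeff N h 0"
 "(int N dvd fst h) ~= (int N dvd snd h) ==> tc_coeff N (prod.swap h) 0 = tc_coeff N h 0"
 by (cases h; auto simp: c_coeff_def tc_coeff_def)+

text \<open>If both congruences hold, both arguments of ln Gamma are 1 and the terms cancel; if
  neither does, the definitions give 0.\<close>

lemma coeff_0_trivial:
 assumes N: "N > 0" and "(int N dvd fst h) = (int N dvd snd h)"
 shows "c_coeff N h 0 = 0" "tc_coeff N h 0 = 0"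
proof -
 have "ang (of_int m / real N) = 1" "ang (- of_int m / real N) = 1" if d: "int N dvd m" for m
 proof -
  from d obtain k where "m = int N * k" by (rule dvdE)
  then have "of_int m / real N = of_int k" "- of_int m / real N = of_int (- k)" using N by simp_all
  then show "ang (of_int m / real N) = 1" "ang (- of_int m / real N) = 1" by (simp_all only: ang_int Ints_of_int)
 qed
 with assms show "c_coeff N h 0 = 0" "tc_coeff N h 0 = 0"
  by (cases h; auto simp: c_coeff_def tc_coeff_def)+
qed

text \<open>The second axis is carried to the first by exchanging the coordinates and reflecting w.
  The kernel changes sign and so does q, hence the result differs only in the sign of the part with
  p.\<close>

lemma Psi_iso_integral:
 assumes N: "N > 0" and v: "Im \<tau> > 0"
 shows "integrable lborel (%w. Psi_iso N h \<tau> (exp w) * of_real (p + q * w))"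
  and "(LINT w|lborel. Psi_iso N h \<tau> (exp w) * of_real (p + q * w)) =
    of_real (2 * (if int N dvd snd h then - 1 else 1) * c_coeff N h 0 * p - q * (tc_coeff N h 0 + c_coeff N h 0 * ln (Im \<tau>)))"
proof -
 have "integrable lborel (%w. Psi_iso N h \<tau> (exp w) * of_real (p + q * w)) \<and>
  (LINT w|lborel. Psi_iso N h \<tau> (exp w) * of_real (p + q * w)) =
    of_real (2 * (if int N dvd snd h then - 1 else 1) * c_coeff N h 0 * p - q * (tc_coeff N h 0 + c_coeff N h 0 * ln (Im \<tau>)))"
 proof (cases "(int N dvd fst h) = (int N dvd snd h)")
  case True
  have "Psi_iso N h \<tau> t = 0" for t
   using True Psi_iso_lattice[of N h \<tau> t] Psi_iso_empty[of N h \<tau> t] by blast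
  then show ?thesis by (simp add: coeff_0_trivial[OF N True])
 next
  case ne: False
  show ?thesis
  proof (cases "int N dvd snd h")
   case True
   with ne have h: "\<not> int N dvd fst h" by simp
   show ?thesis using Psi_iso_integral_first_axis[OF N v h True, of p q] True by simp
  next
   case False
   then have h: "\<not> int N dvd fst (prod.swap h)" "int N dvd snd (prod.swap h)" using ne by simp_all
   note P = Psi_iso_integral_first_axis[OF N v h, of p "- q"]
   have eq: "Psi_iso N h \<tau> (exp w) * of_real (p + q * w) = - (Psi_iso N (prod.swap h) \<tau> (exp (- w)) * of_real (p + - q * (- w)))" for w
    using Psi_iso_swap[of "exp (- w)" N h \<tau>] by (simp add: exp_minus field_simps)
   have "integrable lborel (%w. Psi_iso N h \<tau> (exp w) * of_real (p + q * w))"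
    unfolding eq using lborel_integrable_real_affine[OF P(1), of "-1" 0] by simp
   moreover have "(LINT w|lborel. Psi_iso N h \<tau> (exp w) * of_real (p + q * w)) =
    - (LINT w|lborel. Psi_iso N (prod.swap h) \<tau> (exp w) * of_real (p + - q * w))"
    unfolding eq using lborel_integral_real_affine[of "-1" "%w. Psi_iso N (prod.swap h) \<tau> (exp w) * of_real (p + - q * w)" 0] by simp
   ultimately show ?thesis unfolding P(2) coeff_0_swap(1) coeff_0_swap(2)[OF ne] using False by simp
  qed
 qed
 then show "integrable lborel (%w. Psi_iso N h \<tau> (exp w) * of_real (p + q * w))"
  and "(LINT w|lborel. Psi_iso N h \<tau> (exp w) * of_real (p + q * w)) =
    of_real (2 * (if int N dvd snd h then - 1 else 1) * c_coeff N h 0 * p - q * (tc_coeff N h 0 + c_coeff N h 0 * ln (Im \<tau>)))"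
  by auto
qed

text \<open>Negating a non-integral argument replaces a by 1 - a, which negates 1/2 - a. The sign
  agrees with the one in \<open>Psi_iso_integral\<close>, so the two cancel in the expansion of
  \<open>vartheta\<close>.\<close>

lemma c_coeff_0_reflect:
 assumes N: "N > 0"
 shows "c_coeff N (- fst h, snd h) 0 = (if int N dvd snd h then - 1 else 1) * c_coeff N h 0"
proof (cases "int N dvd fst h")
 case False
 then show ?thesis using ang_div[OF N False] by (cases h) (auto simp: c_coeff_def)
qed (cases h; auto simp: c_coeff_def)

section \<open>Both functions as sums over the vectors of the coset\<close>

definition neg_coset :: "nat => int \<times> int => (int \<times> int) set" where
 "neg_coset N h = {X \<in> lat_coset N h. fst X * snd X < 0}"

definition pos_coset :: "nat => int \<times> int => (int \<times> int) set" where
 "pos_coset N h = {X \<in> lat_coset N h. fst X * snd X > 0}"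

text \<open>The coset splits by the sign of Q. The pair (p, q) = (0, 1) serves
  \<open>tvartheta\<close> and (1, 0) serves \<open>vartheta\<close>. The norm statements supply the
  absolute convergence on which the power series and the Fourier expansion rest.\<close>

lemma Psi_integral:
 fixes \<tau> :: complex
 assumes N: "N > 0" and v: "Im \<tau> > 0"
 defines "f \<equiv> %p q X. ee (- of_real (qform N X) * \<tau>) * of_real (sgn (x2 X) * (2 * p + q * logratio X))"
  and "g \<equiv> %q X. ee (- of_real (qform N X) * \<tau>) * of_real (sgn (x1 X) * (q * upper_Gamma 0 (4 * pi * Im \<tau> * qform N X)))"
 shows "(%X. norm (f p q X)) summable_on neg_coset N h" "(%X. norm (g q X)) summable_on pos_coset N h"
  and "(LINT w|lborel. Psi N h \<tau> (exp w) * of_real (p + q * w)) =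
   of_real (2 * (if int N dvd snd h then - 1 else 1) * c_coeff N h 0 * p - q * (tc_coeff N h 0 + c_coeff N h 0 * ln (Im \<tau>)))
   + (\<Sum>\<^sub>\<infinity>X\<in>neg_coset N h. f p q X) + (\<Sum>\<^sub>\<infinity>X\<in>pos_coset N h. g q X)"
proof -
 have nz: "X \<in> neg_coset N h ==> fst X ~= 0 \<and> snd X ~= 0" "X \<in> pos_coset N h ==> fst X ~= 0 \<and> snd X ~= 0" for X
  by (auto simp: neg_coset_def pos_coset_def)
 have In: "(LINT w|lborel. psi_term N \<tau> (exp w) X * of_real (p + q * w)) = f p q X" if "X \<in> neg_coset N h" for X
  using psi_term_integral[OF N v, of X p q] nz(1)[OF that] that unfolding f_def by (simp add: neg_coset_def)
 have Ip: "(LINT w|lborel. psi_term N \<tau> (exp w) X * of_real (p + q * w)) = g q X" if "X \<in> pos_coset N h" for X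
  using psi_term_integral[OF N v, of X p q] nz(2)[OF that] that unfolding g_def by (simp add: pos_coset_def)
 note Sn = psi_term_integral_swap[OF N v nz(1), where p=p and q=q]
 note Sp = psi_term_integral_swap[OF N v nz(2), where p=p and q=q]
 show "(%X. norm (f p q X)) summable_on neg_coset N h" "(%X. norm (g q X)) summable_on pos_coset N h"
  using Sn(3) Sp(3) In Ip by (simp_all cong: summable_on_cong)
 have dec: "Psi N h \<tau> t = Psi_iso N h \<tau> t + (\<Sum>\<^sub>\<infinity>X\<in>neg_coset N h. psi_term N \<tau> t X) + (\<Sum>\<^sub>\<infinity>X\<in>pos_coset N h. psi_term N \<tau> t X)"
  if t: "t > 0" for t
 proof -
  have s: "psi_term N \<tau> t summable_on A" for A
   using abs_summable_summable[OF psi_term_abs_summable[OF N v t]] .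
  have e1: "lat_coset N h = ({X\<in>lat_coset N h. fst X * snd X = 0} \<union> neg_coset N h) \<union> pos_coset N h"
   by (auto simp: neg_coset_def pos_coset_def)
  have d: "({X\<in>lat_coset N h. fst X * snd X = 0} \<union> neg_coset N h) \<inter> pos_coset N h = {}"
   "{X\<in>lat_coset N h. fst X * snd X = 0} \<inter> neg_coset N h = {}"
   by (auto simp: neg_coset_def pos_coset_def)
  show ?thesis unfolding Psi_def Psi_iso_def
   by (subst e1, subst infsum_Un_disjoint[OF s s d(1)], subst infsum_Un_disjoint[OF s s d(2)]) simp
 qed
 have "(LINT w|lborel. Psi N h \<tau> (exp w) * of_real (p + q * w)) =
  (LINT w|lborel. Psi_iso N h \<tau> (exp w) * of_real (p + q * w) + (\<Sum>\<^sub>\<infinity>X\<in>neg_coset N h. psi_term N \<tau> (exp w) X) * of_real (p + q * w)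
    + (\<Sum>\<^sub>\<infinity>X\<in>pos_coset N h. psi_term N \<tau> (exp w) X) * of_real (p + q * w))"
  unfolding dec[OF exp_gt_zero] by (simp only: distrib_right)
 also have "... = (LINT w|lborel. Psi_iso N h \<tau> (exp w) * of_real (p + q * w)) + (LINT w|lborel. (\<Sum>\<^sub>\<infinity>X\<in>neg_coset N h. psi_term N \<tau> (exp w) X) * of_real (p + q * w))
    + (LINT w|lborel. (\<Sum>\<^sub>\<infinity>X\<in>pos_coset N h. psi_term N \<tau> (exp w) X) * of_real (p + q * w))"
  by (intro Bochner_Integration.integral_add[THEN trans] Bochner_Integration.integrable_add arg_cong2[where f="(+)"] Bochner_Integration.integral_add refl
    Psi_iso_integral(1)[OF N v] Sn(2) Sp(2))
 also have "(LINT w|lborel. (\<Sum>\<^sub>\<infinity>X\<in>neg_coset N h. psi_term N \<tau> (exp w) X) * of_real (p + q * w)) = (\<Sum>\<^sub>\<infinity>X\<in>neg_coset N h. f p q X)"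
  using infsumI[OF Sn(1)] In by (simp cong: infsum_cong)
 also have "(LINT w|lborel. (\<Sum>\<^sub>\<infinity>X\<in>pos_coset N h. psi_term N \<tau> (exp w) X) * of_real (p + q * w)) = (\<Sum>\<^sub>\<infinity>X\<in>pos_coset N h. g q X)"
  using infsumI[OF Sp(1)] Ip by (simp cong: infsum_cong)
 finally show "(LINT w|lborel. Psi N h \<tau> (exp w) * of_real (p + q * w)) =
   of_real (2 * (if int N dvd snd h then - 1 else 1) * c_coeff N h 0 * p - q * (tc_coeff N h 0 + c_coeff N h 0 * ln (Im \<tau>)))
   + (\<Sum>\<^sub>\<infinity>X\<in>neg_coset N h. f p q X) + (\<Sum>\<^sub>\<infinity>X\<in>pos_coset N h. g q X)"
  unfolding Psi_iso_integral(2)[OF N v] .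
qed

text \<open>The minus sign of the integral formula is absorbed for Q < 0, where sgn x2 = - sgn x1,
  and stays visible for Q > 0.\<close>

lemma tvartheta_lattice_sum:
 assumes N: "N > 0" and v: "Im \<tau> > 0"
 shows "tvartheta N h \<tau> = of_real (tc_coeff N h 0 + c_coeff N h 0 * ln (Im \<tau>))
   + (\<Sum>\<^sub>\<infinity>X\<in>neg_coset N h. of_real (sgn (x1 X) * logratio X) * ee (- of_real (qform N X) * \<tau>))
   - (\<Sum>\<^sub>\<infinity>X\<in>pos_coset N h. of_real (sgn (x1 X) * upper_Gamma 0 (4 * pi * Im \<tau> * qform N X)) * ee (- of_real (qform N X) * \<tau>))"
proof -
 have sg: "sgn (real_of_int (snd X)) = - sgn (x1 X)" if "X \<in> neg_coset N h" for X
  using that by (auto simp: neg_coset_def mult_less_0_iff)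
 have n: "(\<Sum>\<^sub>\<infinity>X\<in>neg_coset N h. ee (- of_real (qform N X) * \<tau>) * of_real (sgn (x2 X) * (2 * 0 + 1 * logratio X)))
  = - (\<Sum>\<^sub>\<infinity>X\<in>neg_coset N h. of_real (sgn (x1 X) * logratio X) * ee (- of_real (qform N X) * \<tau>))"
  unfolding infsum_uminus[symmetric] by (rule infsum_cong) (simp add: sg)
 have p: "(\<Sum>\<^sub>\<infinity>X\<in>pos_coset N h. ee (- of_real (qform N X) * \<tau>) * of_real (sgn (x1 X) * (1 * upper_Gamma 0 (4 * pi * Im \<tau> * qform N X))))
  = (\<Sum>\<^sub>\<infinity>X\<in>pos_coset N h. of_real (sgn (x1 X) * upper_Gamma 0 (4 * pi * Im \<tau> * qform N X)) * ee (- of_real (qform N X) * \<tau>))"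
  by (rule infsum_cong) simp
 define A where "A = (\<Sum>\<^sub>\<infinity>X\<in>neg_coset N h. of_real (sgn (x1 X) * logratio X) * ee (- of_real (qform N X) * \<tau>))"
 define B where "B = (\<Sum>\<^sub>\<infinity>X\<in>pos_coset N h. of_real (sgn (x1 X) * upper_Gamma 0 (4 * pi * Im \<tau> * qform N X)) * ee (- of_real (qform N X) * \<tau>))"
 note I = Psi_integral(3)[OF N v, where p=0 and q=1 and h=h, unfolded n p, folded A_def B_def]
 have "tvartheta N h \<tau> = - (LINT w|lborel. Psi N h \<tau> (exp w) * of_real (0 + 1 * w))"
  unfolding add_0 mult_1 by (rule tvartheta_eq_integral[OF N v])
 then show ?thesis unfolding I A_def[symmetric] B_def[symmetric] by simp
qed

text \<open>The reflection of x1 carries the vectors with Q > 0 to those with Q < 0 of the reflected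
  class, where \<open>skern\<close> has total mass 2 and cancels the factor 1/2. The vectors on the
  other side give \<open>ckern\<close>, whose total mass is 0.\<close>

lemma vartheta_lattice_sum:
 assumes N: "N > 0" and v: "Im \<tau> > 0"
 shows "vartheta N h \<tau> = of_real (c_coeff N h 0)
   + (\<Sum>\<^sub>\<infinity>X\<in>pos_coset N h. of_real (sgn (x1 X)) * ee (of_real (qform N X) * \<tau>))"
  and "(%X. norm (of_real (sgn (x1 X)) * ee (of_real (qform N X) * \<tau>))) summable_on pos_coset N h"
proof -
 let ?r = "%X::int \<times> int. (- fst X, snd X)"
 let ?f = "%X. of_real (sgn (x1 X)) * ee (of_real (qform N X) * \<tau>)"
 define g where "g X = ee (- of_real (qform N X) * \<tau>) * of_real (sgn (x2 X) * (2 * 1 + 0 * logratio X))" for X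
 have mem: "?r X \<in> lat_coset N (?r h) \<longleftrightarrow> X \<in> lat_coset N h" for X
  using dvd_minus_iff[of "int N" "fst X - fst h"] by (simp add: in_lat_coset_iff)
 have bij: "bij_betw ?r (pos_coset N h) (neg_coset N (?r h))"
 proof (rule bij_betw_byWitness[where f'="?r"])
  show "?r ` pos_coset N h \<subseteq> neg_coset N (?r h)"
  proof
   fix Y assume "Y \<in> ?r ` pos_coset N h"
   then obtain X where X: "X \<in> pos_coset N h" "Y = ?r X" by blast
   then have "?r X \<in> lat_coset N (?r h)" using mem[of X] by (simp add: pos_coset_def)
   then show "Y \<in> neg_coset N (?r h)" using X by (simp add: pos_coset_def neg_coset_def)
  qed
  show "?r ` neg_coset N (?r h) \<subseteq> pos_coset N h"
  proof
   fix Y assume "Y \<in> ?r ` neg_coset N (?r h)"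
   then obtain X where X: "X \<in> neg_coset N (?r h)" "Y = ?r X" by blast
   then have "?r X \<in> lat_coset N h" using mem[of "?r X"] by (simp add: neg_coset_def)
   then show "Y \<in> pos_coset N h" using X by (simp add: pos_coset_def neg_coset_def)
  qed
 qed auto
 have gr: "g (?r X) = 2 * ?f X" if "X \<in> pos_coset N h" for X
 proof -
  have "sgn (real_of_int (snd X)) = sgn (x1 X)"
   using that by (auto simp: pos_coset_def zero_less_mult_iff)
  then show ?thesis by (simp add: g_def qform_def)
 qed
 note P1 = Psi_integral(1)[OF N v, where p=1 and q=0 and h="?r h"]
  and P3 = Psi_integral(3)[OF N v, where p=1 and q=0 and h="?r h"]
 have "(%X. norm (g X)) summable_on neg_coset N (?r h)" unfolding g_def by (rule P1)
 then have "(%X. norm (g (?r X))) summable_on pos_coset N h"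
  using summable_on_reindex_bij_betw[OF bij, of "%X. norm (g X)"] by simp
 then have "(%X. 1 / 2 * norm (g (?r X))) summable_on pos_coset N h" by (rule summable_on_cmult_right)
 moreover have "1 / 2 * norm (g (?r X)) = norm (?f X)" if "X \<in> pos_coset N h" for X
  unfolding gr[OF that] norm_mult by simp
 ultimately show "(%X. norm (?f X)) summable_on pos_coset N h"
  using summable_on_cong[of "pos_coset N h" "%X. 1 / 2 * norm (g (?r X))" "%X. norm (?f X)"] by blast
 have "(\<Sum>\<^sub>\<infinity>X\<in>neg_coset N (?r h). g X) = (\<Sum>\<^sub>\<infinity>X\<in>pos_coset N h. g (?r X))"
  by (rule infsum_reindex_bij_betw[OF bij, symmetric])
 also have "... = (\<Sum>\<^sub>\<infinity>X\<in>pos_coset N h. 2 * ?f X)" by (rule infsum_cong) (rule gr)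
 also have "... = 2 * (\<Sum>\<^sub>\<infinity>X\<in>pos_coset N h. ?f X)" by (rule infsum_cmult_right')
 finally have n: "(\<Sum>\<^sub>\<infinity>X\<in>neg_coset N (?r h). g X) = 2 * (\<Sum>\<^sub>\<infinity>X\<in>pos_coset N h. ?f X)" .
 define B where "B = (\<Sum>\<^sub>\<infinity>X\<in>pos_coset N h. ?f X)"
 have z: "(\<Sum>\<^sub>\<infinity>X\<in>pos_coset N (?r h). ee (- of_real (qform N X) * \<tau>) * of_real (sgn (x1 X) * (0 * upper_Gamma 0 (4 * pi * Im \<tau> * qform N X)))) = 0"
  by (rule infsum_0) simp
 note I = P3[folded g_def, unfolded n z, folded B_def]
 have V: "vartheta N h \<tau> = 1 / 2 * (LINT w|lborel. Psi N (?r h) \<tau> (exp w) * of_real (1 + 0 * w))"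
  using vartheta_eq_integral[OF N v, of h] by simp
 show "vartheta N h \<tau> = of_real (c_coeff N h 0) + (\<Sum>\<^sub>\<infinity>X\<in>pos_coset N h. ?f X)"
  unfolding V I B_def[symmetric] c_coeff_0_reflect[OF N]
  by (cases "int N dvd snd h") (simp_all add: algebra_simps)
qed

section \<open>Real analyticity and the operators xi and Delta\<close>

lemma DERIV_upper_Gamma_0:
 assumes x: "x > 0"
 shows "(upper_Gamma 0 has_real_derivative - (exp (- x) / x)) (at x)"
proof -
 define a where "a = x / 2"
 have a: "0 < a" "a < x" using x by (auto simp: a_def)
 let ?f = "%t::real. t powr (0 - 1) * exp (- t)"
 have cf: "continuous_on {a..b} ?f" for b using a by (intro continuous_intros) auto
 have i: "set_integrable lborel {a<..} ?f" unfolding set_integrable_def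
 proof (rule integrable_dominated[OF integrable_mult_right[OF integrable_exp_neg_abs[OF zero_less_one], of "1 / a"] _ AE_I2])
  show "norm (indicator {a<..} t *\<^sub>R ?f t) <= norm (1 / a * exp (- 1 * abs t))" for t
   using a by (auto simp: indicator_def powr_minus_divide divide_simps)
 qed simp
 have eq: "upper_Gamma 0 y = upper_Gamma 0 a - integral {a..y} ?f" if y: "a <= y" for y
 proof -
  have sp: "{a<..} = {a<..y} \<union> {y<..}" using y by auto
  have i1: "set_integrable lborel {a<..y} ?f" by (rule set_integrable_subset[OF i]) auto
  have i2: "set_integrable lborel {y<..} ?f" by (rule set_integrable_subset[OF i]) (use y in auto)
  have "upper_Gamma 0 a = (LINT t:{a<..y}|lborel. ?f t) + upper_Gamma 0 y"
   unfolding upper_Gamma_def by (subst sp, rule set_integral_Un[OF _ i1 i2]) auto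
  also have "(LINT t:{a<..y}|lborel. ?f t) = integral {a<..y} ?f" by (rule set_borel_integral_eq_integral(2)[OF i1])
  also have "... = integral {a..y} ?f"
   by (rule integral_spike_set) (auto intro: negligible_subset[OF negligible_sing[of a]])
  finally show ?thesis by simp
 qed
 have fx: "?f x = exp (- x) / x" using x by (simp add: powr_minus_divide)
 have "((%y. integral {a..y} ?f) has_real_derivative ?f x) (at x within {a..x + 1})"
  by (rule integral_has_real_derivative[OF cf]) (use a in auto)
 then have "((%y. upper_Gamma 0 a - integral {a..y} ?f) has_real_derivative 0 - ?f x) (at x within {a..x + 1})"
  by (intro DERIV_diff DERIV_const)
 moreover have "at x within {a..x + 1} = at x" by (rule at_within_interior) (use a in auto)
 ultimately have d: "((%y. upper_Gamma 0 a - integral {a..y} ?f) has_real_derivative - (exp (- x) / x)) (at x)"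
  unfolding fx by simp
 show ?thesis
 proof (rule has_field_derivative_transform_within_open[OF d, of "{a<..}"])
  fix y assume "y \<in> {a<..}"
  then show "upper_Gamma 0 a - integral {a..y} ?f = upper_Gamma 0 y" using eq[of y] by simp
 qed (use a in auto)
qed

lemma ps1_reciprocal:
 assumes "0 <= \<rho>" "\<rho> < v"
 shows "ps1 (%v. of_real (1 / v)) v \<rho> (%k. of_real ((- 1) ^ k / v ^ Suc k)) (1 / (v - \<rho>))"
proof -
 have v: "v > 0" using assms by simp
 have n: "norm (complex_of_real ((- 1) ^ k / v ^ Suc k)) * \<rho> ^ k = 1 / v * (\<rho> / v) ^ k" for k
  unfolding norm_of_real using v by (simp add: abs_divide power_abs power_divide)
 have g: "(%k. 1 / v * (\<rho> / v) ^ k) sums (1 / v * (1 / (1 - \<rho> / v)))"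
  using assms v by (intro sums_mult geometric_sums) auto
 have gv: "1 / v * (1 / (1 - \<rho> / v)) = 1 / (v - \<rho>)" using assms v by (simp add: field_simps)
 have "(%k. of_real ((- 1) ^ k / v ^ Suc k) * of_real y ^ k) sums complex_of_real (1 / (v + y))" if y: "abs y <= \<rho>" for y
 proof -
  have "norm (- y / v) < 1" using y assms v by (simp add: divide_simps)
  then have "(%k. 1 / v * (- y / v) ^ k) sums (1 / v * (1 / (1 - (- y / v))))" by (intro sums_mult geometric_sums)
  moreover have "1 / v * (- y / v) ^ k = (- 1) ^ k / v ^ Suc k * y ^ k" for k
   by (simp add: power_divide power_minus[of "y / v"])
  moreover have "1 / v * (1 / (1 - (- y / v))) = 1 / (v + y)" using v y assms by (simp add: field_simps)
  ultimately have "(%k. (- 1) ^ k / v ^ Suc k * y ^ k) sums (1 / (v + y))" by simp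
  then have "(%k. complex_of_real ((- 1) ^ k / v ^ Suc k * y ^ k)) sums of_real (1 / (v + y))" by (rule sums_of_real)
  then show ?thesis by (simp only: of_real_mult of_real_power)
 qed
 then show ?thesis unfolding ps1_def n using g unfolding gv by (auto simp: sums_iff)
qed

text \<open>Integrating the series of the derivative along the segment from v to v + y divides the
  coefficients by k + 1, so the majorant grows by at most the factor rho. It serves both ln v and
  the incomplete Gamma function, whose derivatives are elementary.\<close>

lemma ps1_antiderivative:
 assumes \<rho>: "\<rho> >= 0" and b: "ps1 B' v \<rho> b M"
  and B: "\<And>y. abs y <= \<rho> ==> (B has_vector_derivative B' (v + y)) (at (v + y))"
 shows "\<exists>c. ps1 B v \<rho> c (norm (B v) + \<rho> * M)"
proof -
 define c where "c k = (case k of 0 => B v | Suc j => b j / of_nat (Suc j))" for k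
 have c: "c 0 = B v" "c (Suc j) = b j / of_nat (Suc j)" for j by (simp_all add: c_def)
 have sb: "summable (%k. norm (b k) * \<rho> ^ k)" and lb: "(\<Sum>k. norm (b k) * \<rho> ^ k) <= M"
  and bs: "\<And>y. abs y <= \<rho> ==> (%k. b k * of_real y ^ k) sums B' (v + y)"
  using b unfolding ps1_def by auto
 have le: "norm (c (Suc k)) * \<rho> ^ Suc k <= \<rho> * (norm (b k) * \<rho> ^ k)" for k
 proof -
  have "norm (b k) / real (Suc k) <= norm (b k)" by (simp add: divide_le_eq mult_left_mono mult_le_cancel_left1)
  then have "norm (c (Suc k)) * \<rho> ^ Suc k <= norm (b k) * \<rho> ^ Suc k"
   unfolding c norm_divide norm_of_nat using \<rho> by (intro mult_right_mono) auto
  then show ?thesis by (simp add: mult_ac)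
 qed
 have s2: "summable (%k. \<rho> * (norm (b k) * \<rho> ^ k))" by (rule summable_mult[OF sb])
 have s1: "summable (%k. norm (c (Suc k)) * \<rho> ^ Suc k)"
  by (rule summable_comparison_test'[where N=0, OF s2]) (use le \<rho> in auto)
 have s0: "summable (%k. norm (c k) * \<rho> ^ k)" using s1 by (subst (asm) summable_Suc_iff)
 have "(\<Sum>k. norm (c k) * \<rho> ^ k) = norm (B v) + (\<Sum>k. norm (c (Suc k)) * \<rho> ^ Suc k)"
  using suminf_split_head[OF s0] c(1) by simp
 also have "(\<Sum>k. norm (c (Suc k)) * \<rho> ^ Suc k) <= (\<Sum>k. \<rho> * (norm (b k) * \<rho> ^ k))"
  by (rule suminf_le[OF le s1 s2])
 also have "... = \<rho> * (\<Sum>k. norm (b k) * \<rho> ^ k)" by (rule suminf_mult[OF sb])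
 also have "... <= \<rho> * M" using \<rho> lb by (rule mult_left_mono[rotated])
 finally have nb: "(\<Sum>k. norm (c k) * \<rho> ^ k) <= norm (B v) + \<rho> * M" by simp
 have "(%k. c k * of_real y ^ k) sums B (v + y)" if y: "abs y <= \<rho>" for y
 proof -
  define f where "f k t = b k * of_real y ^ Suc k * of_real t ^ k" for k and t :: real
  have ty: "\<bar>t * y\<bar> <= \<rho>" if "t \<in> {0..1}" for t
  proof -
   have "abs t * abs y <= 1 * abs y" using that by (intro mult_right_mono) auto
   then show ?thesis using y by (simp add: abs_mult)
  qed
  have fs: "(%k. f k t) sums (of_real y * B' (v + t * y))" if "t \<in> {0..1}" for t
   using sums_mult[OF bs[OF ty[OF that]], of "of_real y"] by (simp add: f_def power_mult_distrib mult_ac)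
  have ul: "uniform_limit (cbox 0 1) (%n t. \<Sum>k<n. f k t) (%t. \<Sum>k. f k t) sequentially"
  proof (rule Weierstrass_m_test[OF _ s2])
   fix k and t :: real assume "t \<in> cbox 0 1"
   then have t: "0 <= t" "t <= 1" by auto
   have "norm (f k t) = norm (b k) * abs y ^ Suc k * abs t ^ k" by (simp only: f_def norm_mult norm_power norm_of_real)
   also have "... <= norm (b k) * \<rho> ^ Suc k * 1"
    using t y by (intro mult_mono mult_left_mono power_mono power_le_one) auto
   finally show "norm (f k t) <= \<rho> * (norm (b k) * \<rho> ^ k)" by (simp add: mult_ac)
  qed
  have hi: "(f k has_integral c (Suc k) * of_real y ^ Suc k) {0..1}" for k
  proof -
   define F where "F t = c (Suc k) * of_real y ^ Suc k * of_real t ^ Suc k" for t :: real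
   have "(F has_vector_derivative f k t) (at t within {0..1})" for t
   proof -
    have "((%t::complex. t ^ Suc k) has_field_derivative of_nat (Suc k) * (1 * of_real t ^ (Suc k - Suc 0))) (at (of_real t))"
     by (rule DERIV_power[OF DERIV_ident])
    then have "((%t::complex. t ^ Suc k) has_field_derivative of_nat (Suc k) * of_real t ^ k) (at (of_real t))"
     by (simp only: mult_1 diff_Suc_Suc minus_nat.diff_0)
    from has_vector_derivative_real_field[OF this]
    have "((%t. complex_of_real t ^ Suc k) has_vector_derivative of_nat (Suc k) * of_real t ^ k) (at t within {0..1})" .
    then have "(F has_vector_derivative c (Suc k) * of_real y ^ Suc k * (of_nat (Suc k) * of_real t ^ k)) (at t within {0..1})"
     unfolding F_def[abs_def] by (rule has_vector_derivative_mult_right)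
    moreover have "c (Suc k) * of_real y ^ Suc k * (of_nat (Suc k) * of_real t ^ k) = f k t"
     unfolding c f_def by (simp del: of_nat_Suc)
    ultimately show ?thesis by simp
   qed
   then have "(f k has_integral F 1 - F 0) {0..1}" by (intro fundamental_theorem_of_calculus) auto
   then show ?thesis by (simp add: F_def)
  qed
  have co: "continuous_on (cbox 0 1) (%t. \<Sum>k<n. f k t)" for n unfolding f_def by (intro continuous_intros)
  obtain I J where IJ: "\<And>n. ((%t. \<Sum>k<n. f k t) has_integral I n) (cbox 0 1)"
   "((%t. \<Sum>k. f k t) has_integral J) (cbox 0 1)" "(I \<longlongrightarrow> J) sequentially"
   by (rule uniform_limit_integral_cbox[OF ul co]) auto
  have I: "I n = (\<Sum>k<n. c (Suc k) * of_real y ^ Suc k)" for n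
  proof -
   have "((%t. \<Sum>k<n. f k t) has_integral (\<Sum>k<n. c (Suc k) * of_real y ^ Suc k)) {0..1}"
    by (intro has_integral_sum finite_lessThan hi)
   then show ?thesis using has_integral_unique[OF IJ(1)[of n]] by simp
  qed
  have "((%t. of_real y * B' (v + t * y)) has_integral B (v + 1 * y) - B (v + 0 * y)) {0..1}"
  proof (rule fundamental_theorem_of_calculus)
   fix t :: real assume t: "t \<in> {0..1}"
   have "((%t. v + t * y) has_vector_derivative y) (at t within {0..1})"
    unfolding has_real_derivative_iff_has_vector_derivative[symmetric] by (auto intro!: derivative_eq_intros)
   from vector_diff_chain_within[OF this has_vector_derivative_at_within[OF B[OF ty[OF t]]]]
   show "((%t. B (v + t * y)) has_vector_derivative of_real y * B' (v + t * y)) (at t within {0..1})"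
    by (simp add: o_def scaleR_conv_of_real)
  qed simp
  then have h: "((%t. of_real y * B' (v + t * y)) has_integral B (v + y) - B v) {0..1}" by simp
  have "of_real y * B' (v + t * y) = (\<Sum>k. f k t)" if "t \<in> {0..1}" for t
   using fs[OF that] by (rule sums_unique)
  from has_integral_eq[OF this h] have "((%t. \<Sum>k. f k t) has_integral B (v + y) - B v) {0..1}" .
  moreover have "((%t. \<Sum>k. f k t) has_integral J) {0..1}" using IJ(2) by simp
  ultimately have J: "J = B (v + y) - B v" using has_integral_unique by blast
  have "I = (%n. \<Sum>k<n. c (Suc k) * of_real y ^ Suc k)" by (rule ext) (rule I)
  with IJ(3) have "(%k. c (Suc k) * of_real y ^ Suc k) sums (B (v + y) - B v)"
   unfolding sums_def J by (simp only:)
  then show ?thesis using sums_Suc_iff[of "%k. c k * of_real y ^ k" "B (v + y) - B v"] c(1) by simp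
 qed
 then have "ps1 B v \<rho> c (norm (B v) + \<rho> * M)" unfolding ps1_def using s0 nb by blast
 then show ?thesis by (intro exI)
qed

lemma ps2_cong:
 "ps2 f z \<rho> a M ==> (\<And>w. \<bar>Im w - Im z\<bar> <= \<rho> ==> f w = g w) ==> ps2 g z \<rho> a M"
 unfolding ps2_def by simp

lemma dbar_add:
 assumes \<rho>: "\<rho> > 0" and f: "ps2 f z \<rho> a M" and g: "ps2 g z \<rho> b K"
 shows "dbar (%\<tau>. f \<tau> + g \<tau>) z = dbar f z + dbar g z"
 unfolding dbar_ps2[OF \<rho> ps2_add[OF \<rho> f g]] dbar_ps2[OF \<rho> f] dbar_ps2[OF \<rho> g]
 by (simp add: field_simps)

lemma dbar_product:
 assumes A: "(A has_vector_derivative A') (at (Re z))" and B: "(B has_vector_derivative B') (at (Im z))"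
 shows "dbar (%\<tau>. A (Re \<tau>) * B (Im \<tau>)) z = (A' * B (Im z) + \<i> * (A (Re z) * B')) / 2"
proof -
 have sh: "((%x. F (p + x)) has_vector_derivative F') (at 0)" if "(F has_vector_derivative F') (at p)" for F :: "real => complex" and F' p
 proof -
  have "((%x. p + x) has_vector_derivative 1) (at 0)"
   unfolding has_real_derivative_iff_has_vector_derivative[symmetric] by (auto intro!: derivative_eq_intros)
  from vector_diff_chain_at[OF this, of F F'] that show ?thesis by (simp add: o_def)
 qed
 have "((%x. A (Re z + x) * B (Im z)) has_vector_derivative A' * B (Im z)) (at 0)"
  by (intro has_vector_derivative_mult_left sh A)
 then have 1: "vector_derivative (%x. A (Re (z + of_real x)) * B (Im (z + of_real x))) (at 0) = A' * B (Im z)"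
  by (simp add: vector_derivative_at)
 have "((%x. A (Re z) * B (Im z + x)) has_vector_derivative A (Re z) * B') (at 0)"
  by (intro has_vector_derivative_mult_right sh B)
 then have 2: "vector_derivative (%x. A (Re (z + \<i> * of_real x)) * B (Im (z + \<i> * of_real x))) (at 0) = A (Re z) * B'"
  by (simp add: vector_derivative_at)
 show ?thesis unfolding dbar_def 1 2 ..
qed

lemma exp_has_vector_derivative:
 "((%x. exp (\<kappa> * of_real x)) has_vector_derivative \<kappa> * exp (\<kappa> * of_real x)) (at x)" for \<kappa> :: complex
 by (rule has_vector_derivative_real_field[where f="%z. exp (\<kappa> * z)"]) (auto intro!: derivative_eq_intros)

lemma ee_of_real_product:
 "ee (of_real c * \<tau>) = exp (of_real (2 * pi * c) * \<i> * of_real (Re \<tau>)) * exp (of_real (- (2 * pi * c)) * of_real (Im \<tau>))"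
 unfolding ee_def exp_add[symmetric]
 by (rule arg_cong[where f=exp]) (simp add: complex_eq_iff algebra_simps)

lemma norm_exp_of_real_times:
 "norm (exp (of_real a * \<i> * of_real x)) = 1"
 "norm (exp (of_real a * complex_of_real x)) = exp (a * x)"
 "norm (of_real a * \<i>) = abs a"
 by (simp_all add: norm_mult)

text \<open>Radius rho costs exp(2 pi c rho) in each of the two real variables, so the majorant is
  the exponential at height Im z - 2 rho, still summable over the coset when that height is
  positive.\<close>

lemma ps2_ee:
 assumes \<rho>: "\<rho> > 0" and c: "c >= 0"
 shows "\<exists>a. ps2 (%\<tau>. s * ee (of_real c * \<tau>)) z \<rho> a (norm s * exp (- (2 * pi * c * (Im z - 2 * \<rho>))))"
  and "dbar (%\<tau>. s * ee (of_real c * \<tau>)) z = 0"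
proof -
 define \<kappa> where "\<kappa> = 2 * pi * c"
 have \<kappa>: "\<kappa> >= 0" using c by (simp add: \<kappa>_def)
 let ?A = "%u::real. exp (of_real \<kappa> * \<i> * of_real u)" and ?B = "%v::real. s * exp (of_real (- \<kappa>) * of_real v)"
 have eq: "(%\<tau>. s * ee (of_real c * \<tau>)) = (%\<tau>. ?A (Re \<tau>) * ?B (Im \<tau>))"
  unfolding ee_of_real_product \<kappa>_def by (simp only: mult_ac)
 have r0: "0 <= \<rho>" using \<rho> by simp
 note P = ps2_product[OF r0 ps1_exp[OF r0, of "of_real \<kappa> * \<i>" "Re z"] ps1_cmult[OF ps1_exp[OF r0, of "of_real (- \<kappa>)" "Im z"], of s]]
 have "exp (\<kappa> * \<rho>) * (exp (- \<kappa> * Im z) * exp (\<kappa> * \<rho>)) = exp (- (\<kappa> * (Im z - 2 * \<rho>)))"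
  unfolding exp_add[symmetric] by (rule arg_cong[where f=exp]) (simp add: algebra_simps)
 then have M: "1 * exp (abs \<kappa> * \<rho>) * (norm s * (exp (- \<kappa> * Im z) * exp (\<bar>- \<kappa>\<bar> * \<rho>))) = norm s * exp (- (\<kappa> * (Im z - 2 * \<rho>)))"
  using \<kappa> by (simp only: abs_minus_cancel abs_of_nonneg mult_ac mult_1)
 show "\<exists>a. ps2 (%\<tau>. s * ee (of_real c * \<tau>)) z \<rho> a (norm s * exp (- (2 * pi * c * (Im z - 2 * \<rho>))))"
  using P unfolding eq norm_exp_of_real_times norm_of_real M unfolding \<kappa>_def by (intro exI)
 have "dbar (%\<tau>. ?A (Re \<tau>) * ?B (Im \<tau>)) z = ((of_real \<kappa> * \<i> * ?A (Re z)) * ?B (Im z) + \<i> * (?A (Re z) * (s * (of_real (- \<kappa>) * exp (of_real (- \<kappa>) * of_real (Im z)))))) / 2"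
  by (intro dbar_product exp_has_vector_derivative has_vector_derivative_mult_right)
 also have "... = 0" by simp
 finally show "dbar (%\<tau>. s * ee (of_real c * \<tau>)) z = 0" unfolding eq .
qed

text \<open>The incomplete Gamma function is an antiderivative of - exp(-2 kappa v)/v with kappa = 2
  pi c. Its decay exp(-2 kappa v) outweighs the growth exp(kappa v) of the other factor, and the
  radius rho is paid for four times: twice for exp(-2 kappa v), once for each variable of the
  exponential. The exponential is holomorphic, so \<open>dbar\<close> only meets the derivative of
  the Gamma factor and leaves an antiholomorphic exponential.\<close>

lemma ps2_Gamma_term:
 assumes \<rho>: "\<rho> > 0" and c: "c > 0" and z: "Im z >= 8 * \<rho>" and s: "norm s <= 1"
 shows "\<exists>a. ps2 (%\<tau>. s * (of_real (upper_Gamma 0 (4 * pi * Im \<tau> * c)) * ee (- of_real c * \<tau>))) z \<rho> a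
   ((1 / (4 * pi * c * Im z) + 1) * exp (- (2 * pi * c * (Im z - 4 * \<rho>))))"
  and "dbar (%\<tau>. s * (of_real (upper_Gamma 0 (4 * pi * Im \<tau> * c)) * ee (- of_real c * \<tau>))) z = - (s * (\<i> / (2 * of_real (Im z)) * cnj (ee (of_real c * z))))"
proof -
 define \<kappa> where "\<kappa> = 2 * pi * c"
 have \<kappa>: "\<kappa> > 0" using c by (simp add: \<kappa>_def)
 have c4: "4 * pi * v * c = 2 * \<kappa> * v" "4 * pi * c * v = 2 * \<kappa> * v" for v by (simp_all add: \<kappa>_def)
 have v: "Im z > 0" using \<rho> z by simp
 let ?A = "%u::real. exp (of_real (- \<kappa>) * \<i> * of_real u)" and ?E = "%v::real. exp (of_real \<kappa> * complex_of_real v)"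
  and ?G = "%v. complex_of_real (upper_Gamma 0 (2 * \<kappa> * v))"
 have eqe: "ee (- of_real c * \<tau>) = ?A (Re \<tau>) * ?E (Im \<tau>)" for \<tau>
  using ee_of_real_product[of "- c" \<tau>] by (simp add: \<kappa>_def)
 have eq: "(%\<tau>. s * (of_real (upper_Gamma 0 (4 * pi * Im \<tau> * c)) * ee (- of_real c * \<tau>))) = (%\<tau>. (s * ?A (Re \<tau>)) * (?G (Im \<tau>) * ?E (Im \<tau>)))"
  unfolding eqe c4 by (simp only: mult_ac)
 define G' where "G' v = - 1 * (exp (of_real (- 2 * \<kappa>) * complex_of_real v) * of_real (1 / v))" for v :: real
 have dG: "(?G has_vector_derivative G' v) (at v)" if v: "v > 0" for v
 proof -
  have "((%v. upper_Gamma 0 (2 * \<kappa> * v)) has_real_derivative - (exp (- (2 * \<kappa> * v)) / (2 * \<kappa> * v)) * (2 * \<kappa>)) (at v)"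
   by (rule DERIV_chain2[OF DERIV_upper_Gamma_0]) (use v \<kappa> in \<open>auto intro!: derivative_eq_intros\<close>)
  then have "(?G has_vector_derivative of_real (- (exp (- (2 * \<kappa> * v)) / (2 * \<kappa> * v)) * (2 * \<kappa>))) (at v)"
   by (rule has_vector_derivative_of_real)
  moreover have "- (exp (- (2 * \<kappa> * v)) / (2 * \<kappa> * v)) * (2 * \<kappa>) = - 1 * (exp (- 2 * \<kappa> * v) * (1 / v))"
   using v \<kappa> by (simp add: field_simps)
  moreover have "complex_of_real (- 1 * (exp (- 2 * \<kappa> * v) * (1 / v))) = G' v"
   unfolding G'_def of_real_mult[symmetric] exp_of_real by (simp only: of_real_mult of_real_minus of_real_1)
  ultimately show ?thesis by (simp only:)
 qed
 have \<rho>v: "0 <= \<rho>" "\<rho> < Im z" using \<rho> z by auto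
 note b = ps1_cmult[OF ps1_mult[OF \<rho>v(1) ps1_exp[OF \<rho>v(1), of "of_real (- 2 * \<kappa>)" "Im z"] ps1_reciprocal[OF \<rho>v]], of "- 1", folded G'_def,
   unfolded norm_exp_of_real_times norm_of_real]
 define M1 where "M1 = norm (- 1 :: complex) * (exp (- 2 * \<kappa> * Im z) * exp (\<bar>- 2 * \<kappa>\<bar> * \<rho>) * (1 / (Im z - \<rho>)))"
 have M1: "M1 = exp (- (2 * \<kappa> * (Im z - \<rho>))) * (1 / (Im z - \<rho>))"
 proof -
  have "exp (- 2 * \<kappa> * Im z) * exp (\<bar>- 2 * \<kappa>\<bar> * \<rho>) = exp (- (2 * \<kappa> * (Im z - \<rho>)))"
   unfolding exp_add[symmetric] using \<kappa> by (intro arg_cong[where f=exp]) (simp add: algebra_simps abs_mult)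
  then show ?thesis unfolding M1_def by simp
 qed
 have "\<exists>g. ps1 ?G (Im z) \<rho> g (norm (?G (Im z)) + \<rho> * M1)"
  unfolding M1_def
 proof (rule ps1_antiderivative[OF \<rho>v(1) b])
  show "(?G has_vector_derivative G' (Im z + y)) (at (Im z + y))" if "abs y <= \<rho>" for y
   by (rule dG) (use that \<rho>v in linarith)
 qed
 then obtain g where g: "ps1 ?G (Im z) \<rho> g (norm (?G (Im z)) + \<rho> * M1)" ..
 note P = ps2_product[OF \<rho>v(1) ps1_cmult[OF ps1_exp[OF \<rho>v(1), of "of_real (- \<kappa>) * \<i>" "Re z"], of s]
   ps1_mult[OF \<rho>v(1) g ps1_exp[OF \<rho>v(1), of "of_real \<kappa>" "Im z"]], unfolded norm_exp_of_real_times norm_of_real]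
 have M: "norm s * (1 * exp (\<bar>- \<kappa>\<bar> * \<rho>)) * ((\<bar>upper_Gamma 0 (2 * \<kappa> * Im z)\<bar> + \<rho> * M1) * (exp (\<kappa> * Im z) * exp (abs \<kappa> * \<rho>)))
   <= (1 / (2 * \<kappa> * Im z) + 1) * exp (- (\<kappa> * (Im z - 4 * \<rho>)))" (is "?K <= _")
 proof -
  have "\<bar>upper_Gamma 0 (2 * \<kappa> * Im z)\<bar> <= exp (- (2 * \<kappa> * Im z)) / (2 * \<kappa> * Im z)"
   using upper_Gamma_0_nn_integral(3)[of "2 * \<kappa> * Im z"] upper_Gamma_0_nn_integral(2)[of "2 * \<kappa> * Im z"] v \<kappa> by simp
  also have "... = 1 / (2 * \<kappa> * Im z) * exp (- (2 * \<kappa> * Im z))" by simp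
  also have "... <= 1 / (2 * \<kappa> * Im z) * exp (- (2 * \<kappa> * (Im z - \<rho>)))"
   using v \<kappa> \<rho> by (intro mult_left_mono) auto
  finally have 1: "\<bar>upper_Gamma 0 (2 * \<kappa> * Im z)\<bar> <= 1 / (2 * \<kappa> * Im z) * exp (- (2 * \<kappa> * (Im z - \<rho>)))" .
  have "\<rho> / (Im z - \<rho>) <= 1" using z \<rho> by (simp add: divide_le_eq)
  then have "exp (- (2 * \<kappa> * (Im z - \<rho>))) * (\<rho> / (Im z - \<rho>)) <= exp (- (2 * \<kappa> * (Im z - \<rho>))) * 1"
   by (intro mult_left_mono) auto
  then have 2: "\<rho> * M1 <= exp (- (2 * \<kappa> * (Im z - \<rho>)))" unfolding M1 by (simp add: mult.commute)
  have 3: "\<bar>upper_Gamma 0 (2 * \<kappa> * Im z)\<bar> + \<rho> * M1 <= (1 / (2 * \<kappa> * Im z) + 1) * exp (- (2 * \<kappa> * (Im z - \<rho>)))"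
   using add_mono[OF 1 2] by (simp only: distrib_right mult_1)
  have M10: "M1 >= 0" unfolding M1 using \<rho>v by simp
  have k: "\<bar>- \<kappa>\<bar> = \<kappa>" "abs \<kappa> = \<kappa>" using \<kappa> by simp_all
  have "?K <= (1 * (1 * exp (\<kappa> * \<rho>))) * (((1 / (2 * \<kappa> * Im z) + 1) * exp (- (2 * \<kappa> * (Im z - \<rho>)))) * (exp (\<kappa> * Im z) * exp (\<kappa> * \<rho>)))"
   unfolding k by (intro mult_mono s order_refl 3) (use v \<kappa> M10 \<rho> in auto)
  also have "... = (1 / (2 * \<kappa> * Im z) + 1) * (exp (\<kappa> * \<rho>) * (exp (- (2 * \<kappa> * (Im z - \<rho>))) * (exp (\<kappa> * Im z) * exp (\<kappa> * \<rho>))))"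
   by (simp only: mult_ac mult_1)
  also have "exp (\<kappa> * \<rho>) * (exp (- (2 * \<kappa> * (Im z - \<rho>))) * (exp (\<kappa> * Im z) * exp (\<kappa> * \<rho>))) = exp (- (\<kappa> * (Im z - 4 * \<rho>)))"
   unfolding exp_add[symmetric] by (rule arg_cong[where f=exp]) (simp add: algebra_simps)
  finally show ?thesis .
 qed
 have mono: "ps2 f z \<rho> a K ==> K <= K' ==> ps2 f z \<rho> a K'" for f a K K' by (auto simp: ps2_def)
 show "\<exists>a. ps2 (%\<tau>. s * (of_real (upper_Gamma 0 (4 * pi * Im \<tau> * c)) * ee (- of_real c * \<tau>))) z \<rho> a
   ((1 / (4 * pi * c * Im z) + 1) * exp (- (2 * pi * c * (Im z - 4 * \<rho>))))"
  unfolding eq unfolding c4 \<kappa>_def[symmetric] using mono[OF P M] by (intro exI)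
 have d: "dbar (%\<tau>. (s * ?A (Re \<tau>)) * (?G (Im \<tau>) * ?E (Im \<tau>))) z =
  ((s * (of_real (- \<kappa>) * \<i> * ?A (Re z))) * (?G (Im z) * ?E (Im z)) + \<i> * ((s * ?A (Re z)) * (?G (Im z) * (of_real \<kappa> * ?E (Im z)) + G' (Im z) * ?E (Im z)))) / 2"
  by (intro dbar_product exp_has_vector_derivative has_vector_derivative_mult_right has_vector_derivative_mult dG v)
 \<comment> \<open>The derivatives of the two exponential factors cancel, which is the
   Cauchy-Riemann equation for their product.\<close>
 have alg1: "((s * (of_real (- \<kappa>) * \<i> * A)) * (G * E) + \<i> * ((s * A) * (G * (of_real \<kappa> * E) + D * E))) / 2 = \<i> * s * A * (D * E) / 2"
  for A G E D :: complex by (simp add: algebra_simps)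
 have g: "G' (Im z) * ?E (Im z) = - (exp (of_real (- \<kappa>) * complex_of_real (Im z)) / of_real (Im z))"
 proof -
  have e: "exp (of_real (- 2 * \<kappa>) * complex_of_real (Im z)) * ?E (Im z) = exp (of_real (- \<kappa>) * complex_of_real (Im z))"
   unfolding exp_add[symmetric] by (rule arg_cong[where f=exp]) (simp add: algebra_simps)
  have n: "- 1 * (F * of_real (1 / Im z)) * E = - ((F * E) / of_real (Im z))" for F E :: complex by simp
  show ?thesis unfolding G'_def n e ..
 qed
 have alg2: "\<i> * s * A * - (F / of_real (Im z)) / 2 = - (s * (\<i> / (2 * of_real (Im z)) * (A * F)))" for A F :: complex by (simp add: mult_ac)
 have "cnj (ee (of_real c * z)) = ?A (Re z) * exp (of_real (- \<kappa>) * complex_of_real (Im z))"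
  unfolding ee_of_real_product complex_cnj_mult exp_cnj \<kappa>_def by simp
 then show "dbar (%\<tau>. s * (of_real (upper_Gamma 0 (4 * pi * Im \<tau> * c)) * ee (- of_real c * \<tau>))) z = - (s * (\<i> / (2 * of_real (Im z)) * cnj (ee (of_real c * z))))"
  unfolding eq d unfolding alg1 unfolding g unfolding alg2 by (simp only:)
qed

lemma ps2_ln_Im:
 assumes \<rho>: "\<rho> > 0" and z: "Im z > \<rho>"
 shows "\<exists>a M. ps2 (%\<tau>. of_real (p + q * ln (Im \<tau>))) z \<rho> a M"
  and "dbar (%\<tau>. of_real (p + q * ln (Im \<tau>))) z = of_real q * (\<i> / (2 * of_real (Im z)))"
proof -
 let ?B = "%v. complex_of_real (p + q * ln v)"
 \<comment> \<open>The constant factor exp 0 gives the function the product form in Re and Im on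
   which \<open>ps2_product\<close> and \<open>dbar_product\<close> operate.\<close>
 have eq: "(%\<tau>. of_real (p + q * ln (Im \<tau>))) = (%\<tau>. exp (0 * of_real (Re \<tau>)) * ?B (Im \<tau>))" by simp
 have dB: "(?B has_vector_derivative of_real q * of_real (1 / v)) (at v)" if "v > 0" for v
 proof -
  have "((%v. p + q * ln v) has_real_derivative q * (1 / v)) (at v)"
   using that by (auto intro!: derivative_eq_intros)
  then have "(?B has_vector_derivative of_real (q * (1 / v))) (at v)" by (rule has_vector_derivative_of_real)
  then show ?thesis by simp
 qed
 have "\<exists>b. ps1 ?B (Im z) \<rho> b (norm (?B (Im z)) + \<rho> * (norm (complex_of_real q) * (1 / (Im z - \<rho>))))"
 proof (rule ps1_antiderivative[OF less_imp_le[OF \<rho>] ps1_cmult[OF ps1_reciprocal]])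
  show "(?B has_vector_derivative of_real q * of_real (1 / (Im z + y))) (at (Im z + y))" if "abs y <= \<rho>" for y
   by (rule dB) (use that z in linarith)
 qed (use \<rho> z in auto)
 then obtain b where b: "ps1 ?B (Im z) \<rho> b (norm (?B (Im z)) + \<rho> * (norm (complex_of_real q) * (1 / (Im z - \<rho>))))" ..
 show "\<exists>a M. ps2 (%\<tau>. of_real (p + q * ln (Im \<tau>))) z \<rho> a M"
  unfolding eq by (rule exI, rule exI, rule ps2_product[OF less_imp_le[OF \<rho>] ps1_exp[OF less_imp_le[OF \<rho>], of 0 "Re z"] b])
 have d: "dbar (%\<tau>. exp (0 * of_real (Re \<tau>)) * ?B (Im \<tau>)) z = ((0 * exp (0 * of_real (Re z))) * ?B (Im z) + \<i> * (exp (0 * of_real (Re z)) * (of_real q * of_real (1 / Im z)))) / 2"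
  by (intro dbar_product exp_has_vector_derivative dB) (use \<rho> z in auto)
 have alg: "((0 * exp (0 * of_real (Re z))) * b + \<i> * (exp (0 * of_real (Re z)) * (of_real q * of_real (1 / Im z)))) / 2 = of_real q * (\<i> / (2 * of_real (Im z)))"
  for b :: complex by (simp add: mult_ac)
 show "dbar (%\<tau>. of_real (p + q * ln (Im \<tau>))) z = of_real q * (\<i> / (2 * of_real (Im z)))"
  unfolding eq d alg ..
qed

lemma dbar_ps2_eq:
 assumes "\<rho> > 0" "ps2 f z \<rho> a M" "ps2 g z \<rho> a M"
 shows "dbar f z = dbar g z"
 unfolding dbar_ps2[OF assms(1,2)] dbar_ps2[OF assms(1,3)] ..

lemma norm_ee_imaginary:
 "norm (ee (of_real c * (\<i> * of_real y))) = exp (- (2 * pi * c * y))"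
 by (simp add: norm_ee)

lemma pos_coset_pos:
 assumes N: "N > 0" and X: "X \<in> pos_coset N h"
 shows "qform N X >= 1 / real N" "qform N X > 0" "norm (complex_of_real (sgn (x1 X))) = 1"
proof -
 have "fst X * snd X >= 1" using X by (auto simp: pos_coset_def)
 then have "real_of_int (fst X * snd X) >= 1" by (metis of_int_1 of_int_le_iff)
 then show q: "qform N X >= 1 / real N" unfolding qform_def by (rule divide_right_mono) simp
 show "qform N X > 0" using q N by (smt (verit) divide_pos_pos of_nat_0_less_iff)
 have "fst X ~= 0" using X by (auto simp: pos_coset_def)
 then show "norm (complex_of_real (sgn (x1 X))) = 1" unfolding norm_of_real by (simp add: sgn_if)
qed

lemma neg_coset_neg:
 assumes N: "N > 0" and X: "X \<in> neg_coset N h"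
 shows "qform N X < 0"
proof -
 have "real_of_int (fst X * snd X) < 0" using X unfolding neg_coset_def of_int_less_0_iff by simp
 then show ?thesis unfolding qform_def using N by (intro divide_neg_pos) auto
qed

text \<open>At the purely imaginary point i y the norms of the absolutely convergent expansion of
  \<open>vartheta\<close> are exactly these exponentials.\<close>

lemma summable_exp_pos_coset:
 assumes N: "N > 0" and y: "y > 0"
 shows "(%X. exp (- (2 * pi * qform N X * y))) summable_on pos_coset N h"
proof -
 have "(%X. norm (of_real (sgn (x1 X)) * ee (of_real (qform N X) * (\<i> * of_real y)))) summable_on pos_coset N h"
  by (rule vartheta_lattice_sum(2)[OF N]) (use y in simp)
 moreover have "norm (of_real (sgn (x1 X)) * ee (of_real (qform N X) * (\<i> * of_real y))) = exp (- (2 * pi * qform N X * y))"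
  if "X \<in> pos_coset N h" for X
  unfolding norm_mult pos_coset_pos(3)[OF N that] norm_ee_imaginary by simp
 ultimately show ?thesis
  using summable_on_cong[of "pos_coset N h" "%X. norm (of_real (sgn (x1 X)) * ee (of_real (qform N X) * (\<i> * of_real y)))" "%X. exp (- (2 * pi * qform N X * y))"]
  by blast
qed

lemma summable_exp_neg_coset:
 assumes N: "N > 0" and y: "y > 0"
 shows "(%X. norm (complex_of_real (sgn (x1 X) * logratio X)) * exp (- (2 * pi * - qform N X * y))) summable_on neg_coset N h"
proof -
 let ?f = "%X. norm (ee (- of_real (qform N X) * (\<i> * of_real y)) * of_real (sgn (x2 X) * (2 * 0 + 1 * logratio X)))"
 have "?f summable_on neg_coset N h"
  by (rule Psi_integral(1)[OF N]) (use y in simp)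
 moreover have "?f X = norm (complex_of_real (sgn (x1 X) * logratio X)) * exp (- (2 * pi * - qform N X * y))"
  if "X \<in> neg_coset N h" for X
 proof -
  have sg: "sgn (real_of_int (snd X)) = - sgn (x1 X)"
   using that by (auto simp: neg_coset_def mult_less_0_iff)
  have "norm (ee (- of_real (qform N X) * (\<i> * of_real y))) = exp (- (2 * pi * - qform N X * y))"
   using norm_ee_imaginary[of "- qform N X" y] by simp
  then show ?thesis unfolding norm_mult sg by (simp add: norm_mult)
 qed
 ultimately show ?thesis
  using summable_on_cong[of "neg_coset N h" ?f "%X. norm (complex_of_real (sgn (x1 X) * logratio X)) * exp (- (2 * pi * - qform N X * y))"]
  by blast
qed

text \<open>Stated for any F that equals \<open>vartheta\<close> on the half-plane, because it is
  applied to \<open>xi 1\<close> of the tilde function, which is known to be \<open>vartheta\<close>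
  only there.\<close>

lemma vartheta_ps2:
 assumes N: "N > 0" and z: "Im z > 0" and F: "\<And>w. Im w > 0 ==> F w = vartheta N h w"
 shows "dbar F z = 0"
proof -
 \<comment> \<open>An eighth of the height keeps the square inside the half-plane and leaves Im z -
   2 rho positive for the summation of the majorants.\<close>
 define \<rho> where "\<rho> = Im z / 8"
 have \<rho>: "\<rho> > 0" using z by (simp add: \<rho>_def)
 define f where "f X \<tau> = of_real (sgn (x1 X)) * ee (of_real (qform N X) * \<tau>)" for X \<tau>
 define M where "M X = norm (complex_of_real (sgn (x1 X))) * exp (- (2 * pi * qform N X * (Im z - 2 * \<rho>)))" for X
 have "\<forall>X\<in>pos_coset N h. \<exists>a. ps2 (f X) z \<rho> a (M X)"
  unfolding f_def[abs_def] M_def by (intro ballI ps2_ee(1) \<rho> less_imp_le pos_coset_pos(2)[OF N])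
 from bchoice[OF this] obtain a where "\<forall>X\<in>pos_coset N h. ps2 (f X) z \<rho> (a X) (M X)" by (elim exE)
 note a = this[rule_format]
 have Ms: "M summable_on pos_coset N h"
 proof -
  have "M X = exp (- (2 * pi * qform N X * (Im z - 2 * \<rho>)))" if "X \<in> pos_coset N h" for X
   unfolding M_def pos_coset_pos(3)[OF N that] by simp
  then show ?thesis
   using summable_on_cong[of "pos_coset N h" M "%X. exp (- (2 * pi * qform N X * (Im z - 2 * \<rho>)))"]
    summable_exp_pos_coset[OF N, of "Im z - 2 * \<rho>" h] z by (simp add: \<rho>_def)
 qed
 have zr: "Im z > \<rho>" using z by (simp add: \<rho>_def)
 \<comment> \<open>The constant is written with 0 * ln so that the expansion of the logarithmic term
   covers it.\<close>
 obtain b K where b: "ps2 (%\<tau>. of_real (c_coeff N h 0 + 0 * ln (Im \<tau>))) z \<rho> b K"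
  using ps2_ln_Im(1)[OF \<rho> zr, of "c_coeff N h 0" 0] by blast
 have P: "ps2 (%\<tau>. \<Sum>\<^sub>\<infinity>X\<in>pos_coset N h. f X \<tau>) z \<rho> (%p. \<Sum>\<^sub>\<infinity>X\<in>pos_coset N h. a X p) (\<Sum>\<^sub>\<infinity>X\<in>pos_coset N h. M X)"
  by (rule ps2_infsum[OF \<rho> a Ms])
 have D: "dbar (%\<tau>. \<Sum>\<^sub>\<infinity>X\<in>pos_coset N h. f X \<tau>) z = (\<Sum>\<^sub>\<infinity>X\<in>pos_coset N h. dbar (f X) z)"
  by (rule dbar_infsum[OF \<rho> a Ms])
 note S = ps2_add[OF \<rho> b P]
 have eq: "of_real (c_coeff N h 0 + 0 * ln (Im w)) + (\<Sum>\<^sub>\<infinity>X\<in>pos_coset N h. f X w) = F w" if "\<bar>Im w - Im z\<bar> <= \<rho>" for w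
 proof -
  have "Im w > 0" using that zr by linarith
  then show ?thesis unfolding F[OF \<open>Im w > 0\<close>] vartheta_lattice_sum(1)[OF N \<open>Im w > 0\<close>] f_def by simp
 qed
 have "dbar F z = dbar (%\<tau>. of_real (c_coeff N h 0 + 0 * ln (Im \<tau>)) + (\<Sum>\<^sub>\<infinity>X\<in>pos_coset N h. f X \<tau>)) z"
  by (rule dbar_ps2_eq[OF \<rho> ps2_cong[OF S eq] S])
 also have "... = dbar (%\<tau>. of_real (c_coeff N h 0 + 0 * ln (Im \<tau>))) z + dbar (%\<tau>. \<Sum>\<^sub>\<infinity>X\<in>pos_coset N h. f X \<tau>) z"
  by (rule dbar_add[OF \<rho> b P])
 also have "dbar (%\<tau>. of_real (c_coeff N h 0 + 0 * ln (Im \<tau>))) z = 0"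
  unfolding ps2_ln_Im(2)[OF \<rho> zr] by simp
 also have "dbar (%\<tau>. \<Sum>\<^sub>\<infinity>X\<in>pos_coset N h. f X \<tau>) z = 0"
  unfolding D
 proof (rule infsum_0)
  fix X assume "X \<in> pos_coset N h"
  then have "qform N X >= 0" using pos_coset_pos(2)[OF N] less_imp_le by blast
  then show "dbar (f X) z = 0" unfolding f_def[abs_def] by (rule ps2_ee(2)[OF \<rho>])
 qed
 finally show ?thesis by simp
qed

text \<open>Of the four parts, the constant and the exponentials with Q < 0 are killed by
  \<open>dbar\<close>. The logarithm contributes c_h(0) and each Gamma term one conjugate
  exponential, all with the common factor i/(2 v), so that together they form the conjugate of the
  expansion of \<open>vartheta\<close>.\<close>

lemma tvartheta_ps2:
 assumes N: "N > 0" and z: "Im z > 0" and F: "\<And>w. Im w > 0 ==> F w = tvartheta N h w"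
 shows "\<exists>\<rho>>0. \<exists>a M. ps2 F z \<rho> a M"
  and "dbar F z = \<i> / (2 * of_real (Im z)) * cnj (vartheta N h z)"
proof -
 \<comment> \<open>8 rho <= Im z is the requirement of \<open>ps2_Gamma_term\<close>; the height Im
   z - 4 rho of its majorant stays positive.\<close>
 define \<rho> where "\<rho> = Im z / 8"
 have \<rho>: "\<rho> > 0" using z by (simp add: \<rho>_def)
 have zr: "Im z > \<rho>" "8 * \<rho> <= Im z" using z by (simp_all add: \<rho>_def)
 define f where "f X \<tau> = of_real (sgn (x1 X) * logratio X) * ee (of_real (- qform N X) * \<tau>)" for X \<tau>
 define M where "M X = norm (complex_of_real (sgn (x1 X) * logratio X)) * exp (- (2 * pi * - qform N X * (Im z - 2 * \<rho>)))" for X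
 have "\<forall>X\<in>neg_coset N h. \<exists>a. ps2 (f X) z \<rho> a (M X)"
 proof
  fix X assume "X \<in> neg_coset N h"
  then have "qform N X < 0" by (rule neg_coset_neg[OF N])
  then have "- qform N X >= 0" by simp
  then show "\<exists>a. ps2 (f X) z \<rho> a (M X)" unfolding f_def[abs_def] M_def by (rule ps2_ee(1)[OF \<rho>])
 qed
 from bchoice[OF this] obtain a where "\<forall>X\<in>neg_coset N h. ps2 (f X) z \<rho> (a X) (M X)" by (elim exE)
 note a = this[rule_format]
 have Ms: "M summable_on neg_coset N h"
  unfolding M_def by (rule summable_exp_neg_coset[OF N]) (use z in \<open>simp add: \<rho>_def\<close>)
 define g where "g X \<tau> = - of_real (sgn (x1 X)) * (of_real (upper_Gamma 0 (4 * pi * Im \<tau> * qform N X)) * ee (- of_real (qform N X) * \<tau>))" for X \<tau>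
 define K where "K X = (1 / (4 * pi * qform N X * Im z) + 1) * exp (- (2 * pi * qform N X * (Im z - 4 * \<rho>)))" for X
 have sn: "norm (- complex_of_real (sgn (x1 X))) <= 1" for X :: "int \<times> int"
  unfolding norm_minus_cancel norm_of_real by (simp add: sgn_if)
 have "\<forall>X\<in>pos_coset N h. \<exists>b. ps2 (g X) z \<rho> b (K X)"
  unfolding g_def[abs_def] K_def by (intro ballI ps2_Gamma_term(1) \<rho> pos_coset_pos(2)[OF N] zr(2) sn)
 from bchoice[OF this] obtain b where "\<forall>X\<in>pos_coset N h. ps2 (g X) z \<rho> (b X) (K X)" by (elim exE)
 note b = this[rule_format]
 have Ks: "K summable_on pos_coset N h"
 proof (rule summable_on_comparison_test)
  show "(%X. (real N / (4 * pi * Im z) + 1) * exp (- (2 * pi * qform N X * (Im z - 4 * \<rho>)))) summable_on pos_coset N h"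
   by (intro summable_on_cmult_right summable_exp_pos_coset[OF N]) (use z in \<open>simp add: \<rho>_def\<close>)
  fix X assume X: "X \<in> pos_coset N h"
  note q = pos_coset_pos(1,2)[OF N X]
  \<comment> \<open>Q takes values in (1/N) Z, so a positive value is at least 1/N and the prefactor
    of the majorant is bounded uniformly over the coset.\<close>
  have "1 / qform N X <= real N" using q N by (simp add: field_simps)
  then have "1 / qform N X * (1 / (4 * pi * Im z)) <= real N * (1 / (4 * pi * Im z))"
   using z by (intro mult_right_mono) auto
  then have "1 / (4 * pi * qform N X * Im z) + 1 <= real N / (4 * pi * Im z) + 1" by (simp add: mult_ac)
  then show "K X <= (real N / (4 * pi * Im z) + 1) * exp (- (2 * pi * qform N X * (Im z - 4 * \<rho>)))"
   unfolding K_def by (intro mult_right_mono) auto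
  show "0 <= K X" unfolding K_def using q z by simp
 qed
 let ?f0 = "%\<tau>. complex_of_real (tc_coeff N h 0 + c_coeff N h 0 * ln (Im \<tau>))"
 obtain a0 M0 where a0: "ps2 ?f0 z \<rho> a0 M0"
  using ps2_ln_Im(1)[OF \<rho> zr(1), of "tc_coeff N h 0" "c_coeff N h 0"] by blast
 have P1: "ps2 (%\<tau>. \<Sum>\<^sub>\<infinity>X\<in>neg_coset N h. f X \<tau>) z \<rho> (%p. \<Sum>\<^sub>\<infinity>X\<in>neg_coset N h. a X p) (\<Sum>\<^sub>\<infinity>X\<in>neg_coset N h. M X)"
  by (rule ps2_infsum[OF \<rho> a Ms])
 have P2: "ps2 (%\<tau>. \<Sum>\<^sub>\<infinity>X\<in>pos_coset N h. g X \<tau>) z \<rho> (%p. \<Sum>\<^sub>\<infinity>X\<in>pos_coset N h. b X p) (\<Sum>\<^sub>\<infinity>X\<in>pos_coset N h. K X)"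
  by (rule ps2_infsum[OF \<rho> b Ks])
 have D1: "dbar (%\<tau>. \<Sum>\<^sub>\<infinity>X\<in>neg_coset N h. f X \<tau>) z = (\<Sum>\<^sub>\<infinity>X\<in>neg_coset N h. dbar (f X) z)"
  by (rule dbar_infsum[OF \<rho> a Ms])
 note S1 = ps2_add[OF \<rho> a0 P1]
 note S = ps2_add[OF \<rho> S1 P2]
 have eq: "?f0 w + (\<Sum>\<^sub>\<infinity>X\<in>neg_coset N h. f X w) + (\<Sum>\<^sub>\<infinity>X\<in>pos_coset N h. g X w) = F w" if "\<bar>Im w - Im z\<bar> <= \<rho>" for w
 proof -
  have w: "Im w > 0" using that zr by linarith
  have 1: "(\<Sum>\<^sub>\<infinity>X\<in>neg_coset N h. f X w) = (\<Sum>\<^sub>\<infinity>X\<in>neg_coset N h. of_real (sgn (x1 X) * logratio X) * ee (- of_real (qform N X) * w))"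
   unfolding f_def by (simp only: of_real_minus)
  have 2: "(\<Sum>\<^sub>\<infinity>X\<in>pos_coset N h. g X w) = - (\<Sum>\<^sub>\<infinity>X\<in>pos_coset N h. of_real (sgn (x1 X) * upper_Gamma 0 (4 * pi * Im w * qform N X)) * ee (- of_real (qform N X) * w))"
   unfolding g_def infsum_uminus[symmetric] by (rule infsum_cong) simp
  show ?thesis unfolding F[OF w] tvartheta_lattice_sum[OF N w] 1 2 by (simp only: diff_conv_add_uminus)
 qed
 have PF: "ps2 F z \<rho> (%p. (a0 p + (\<Sum>\<^sub>\<infinity>X\<in>neg_coset N h. a X p)) + (\<Sum>\<^sub>\<infinity>X\<in>pos_coset N h. b X p)) ((M0 + (\<Sum>\<^sub>\<infinity>X\<in>neg_coset N h. M X)) + (\<Sum>\<^sub>\<infinity>X\<in>pos_coset N h. K X))"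
  by (rule ps2_cong[OF S eq])
 then show "\<exists>\<rho>>0. \<exists>a M. ps2 F z \<rho> a M" using \<rho> by blast
 define \<mu> where "\<mu> = \<i> / (2 * complex_of_real (Im z))"
 have "dbar F z = dbar (%\<tau>. ?f0 \<tau> + (\<Sum>\<^sub>\<infinity>X\<in>neg_coset N h. f X \<tau>) + (\<Sum>\<^sub>\<infinity>X\<in>pos_coset N h. g X \<tau>)) z"
  by (rule dbar_ps2_eq[OF \<rho> PF S])
 also have "... = dbar ?f0 z + dbar (%\<tau>. \<Sum>\<^sub>\<infinity>X\<in>neg_coset N h. f X \<tau>) z + dbar (%\<tau>. \<Sum>\<^sub>\<infinity>X\<in>pos_coset N h. g X \<tau>) z"
  unfolding dbar_add[OF \<rho> S1 P2] dbar_add[OF \<rho> a0 P1] ..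
 also have "dbar ?f0 z = of_real (c_coeff N h 0) * \<mu>"
  unfolding \<mu>_def by (rule ps2_ln_Im(2)[OF \<rho> zr(1)])
 also have "dbar (%\<tau>. \<Sum>\<^sub>\<infinity>X\<in>neg_coset N h. f X \<tau>) z = 0"
  unfolding D1
 proof (rule infsum_0)
  fix X assume "X \<in> neg_coset N h"
  then have "qform N X < 0" by (rule neg_coset_neg[OF N])
  then have "- qform N X >= 0" by simp
  then show "dbar (f X) z = 0" unfolding f_def[abs_def] by (rule ps2_ee(2)[OF \<rho>])
 qed
 also have "dbar (%\<tau>. \<Sum>\<^sub>\<infinity>X\<in>pos_coset N h. g X \<tau>) z = \<mu> * cnj (\<Sum>\<^sub>\<infinity>X\<in>pos_coset N h. of_real (sgn (x1 X)) * ee (of_real (qform N X) * z))"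
 proof -
  have "dbar (%\<tau>. \<Sum>\<^sub>\<infinity>X\<in>pos_coset N h. g X \<tau>) z = (\<Sum>\<^sub>\<infinity>X\<in>pos_coset N h. dbar (g X) z)"
   by (rule dbar_infsum[OF \<rho> b Ks])
  also have "... = (\<Sum>\<^sub>\<infinity>X\<in>pos_coset N h. \<mu> * cnj (of_real (sgn (x1 X)) * ee (of_real (qform N X) * z)))"
  proof (rule infsum_cong)
   fix X assume X: "X \<in> pos_coset N h"
   have "dbar (g X) z = - (- of_real (sgn (x1 X)) * (\<mu> * cnj (ee (of_real (qform N X) * z))))"
    unfolding g_def[abs_def] \<mu>_def by (rule ps2_Gamma_term(2)[OF \<rho> pos_coset_pos(2)[OF N X] zr(2) sn])
   then show "dbar (g X) z = \<mu> * cnj (of_real (sgn (x1 X)) * ee (of_real (qform N X) * z))"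
    by simp
  qed
  also have "... = \<mu> * (\<Sum>\<^sub>\<infinity>X\<in>pos_coset N h. cnj (of_real (sgn (x1 X)) * ee (of_real (qform N X) * z)))"
   by (rule infsum_cmult_right')
  also have "(\<Sum>\<^sub>\<infinity>X\<in>pos_coset N h. cnj (of_real (sgn (x1 X)) * ee (of_real (qform N X) * z))) = cnj (\<Sum>\<^sub>\<infinity>X\<in>pos_coset N h. of_real (sgn (x1 X)) * ee (of_real (qform N X) * z))"
   by (rule infsum_cnj)
  finally show ?thesis .
 qed
 finally show "dbar F z = \<i> / (2 * of_real (Im z)) * cnj (vartheta N h z)"
  unfolding \<mu>_def[symmetric] vartheta_lattice_sum(1)[OF N z] by (simp add: algebra_simps)
qed

lemma xi_tvartheta:
 assumes N: "N > 0" and z: "Im z > 0" and F: "\<And>w. Im w > 0 ==> F w = tvartheta N h w"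
 shows "xi 1 F z = vartheta N h z"
proof -
 have "complex_of_real (Im z) ~= 0" using z by simp
 moreover have d: "dbar F z = \<i> / (2 * of_real (Im z)) * cnj (vartheta N h z)"
  by (rule tvartheta_ps2(2)[OF N z F])
 ultimately show ?thesis unfolding xi_def d by simp
qed

text \<open>The first application of xi gives \<open>vartheta\<close>, which is holomorphic, so the
  second gives 0.\<close>

lemma Delta_tvartheta:
 assumes N: "N > 0" and z: "Im z > 0" and F: "\<And>w. Im w > 0 ==> F w = tvartheta N h w"
 shows "Delta 1 F z = 0"
proof -
 have "dbar (xi 1 F) z = 0"
  by (rule vartheta_ps2[OF N z, where h=h]) (rule xi_tvartheta[OF N _ F])
 then show ?thesis unfolding Delta_def by (simp add: xi_def[of 1 "xi 1 F"])
qed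

section \<open>The Fourier expansion\<close>

text \<open>Absolute summability permits grouping the vectors by the value of g; values of T that
  are not attained contribute empty sums.\<close>

lemma infsum_over_fibers:
 fixes F :: "'a => complex" and g :: "'a => real"
 assumes F: "(%x. norm (F x)) summable_on S" and g: "\<And>x. x \<in> S ==> g x \<in> T"
 shows "(%n. \<Sum>\<^sub>\<infinity>x\<in>{x\<in>S. g x = n}. F x) summable_on T"
  and "(\<Sum>\<^sub>\<infinity>n\<in>T. \<Sum>\<^sub>\<infinity>x\<in>{x\<in>S. g x = n}. F x) = (\<Sum>\<^sub>\<infinity>x\<in>S. F x)"
proof -
 let ?Z = "Sigma T (%n. {x\<in>S. g x = n})"
 have im: "?Z = (%x. (g x, x)) ` S" using g by auto
 have inj: "inj_on (%x. (g x, x)) S" by (auto simp: inj_on_def)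
 have s: "F summable_on S" using F by (rule abs_summable_summable)
 have sZ: "(%(n, x). F x) summable_on ?Z"
  unfolding im by (subst summable_on_reindex[OF inj]) (simp add: o_def s)
 show "(%n. \<Sum>\<^sub>\<infinity>x\<in>{x\<in>S. g x = n}. F x) summable_on T"
  by (rule summable_on_Sigma_banach[OF sZ])
 have "(\<Sum>\<^sub>\<infinity>n\<in>T. \<Sum>\<^sub>\<infinity>x\<in>{x\<in>S. g x = n}. F x) = infsum (%(n, x). F x) ?Z"
  by (rule infsum_Sigma'_banach[OF sZ])
 also have "... = (\<Sum>\<^sub>\<infinity>x\<in>S. F x)"
  unfolding im by (subst infsum_reindex[OF inj]) (simp add: o_def)
 finally show "(\<Sum>\<^sub>\<infinity>n\<in>T. \<Sum>\<^sub>\<infinity>x\<in>{x\<in>S. g x = n}. F x) = (\<Sum>\<^sub>\<infinity>x\<in>S. F x)" .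
qed

lemma QF_rvec_qform: "QF N (rvec X) = qform N X"
 by (simp add: QF_def rvec_def qform_def)

text \<open>If n is nonzero, both coordinates are nonzero integers with product n N, so each is at
  most |n N| in absolute value. Finiteness makes the unordered sum over a fibre agree with the
  finite sum in the coefficients.\<close>

lemma finite_qform_fiber:
 assumes N: "N > 0" and n: "n ~= 0"
 shows "finite {X \<in> lat_coset N h. qform N X = n}"
proof (rule finite_subset)
 define B where "B = \<lceil>\<bar>n * real N\<bar>\<rceil>"
 show "finite ({- B..B} \<times> {- B..B})" by simp
 show "{X \<in> lat_coset N h. qform N X = n} \<subseteq> {- B..B} \<times> {- B..B}"
 proof
  fix X assume "X \<in> {X \<in> lat_coset N h. qform N X = n}"
  then have "qform N X = n" by simp
  then have e: "real_of_int (fst X * snd X) = n * real N" using N by (simp add: qform_def field_simps)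
  then have nz: "fst X ~= 0" "snd X ~= 0" using n N by auto
  have "real_of_int \<bar>fst X * snd X\<bar> = \<bar>n * real N\<bar>" using e by (simp only: of_int_abs)
  also have "... <= real_of_int B" unfolding B_def by (rule le_of_int_ceiling)
  finally have b: "\<bar>fst X\<bar> * \<bar>snd X\<bar> <= B" by (simp only: of_int_le_iff abs_mult)
  have "\<bar>fst X\<bar> * 1 <= \<bar>fst X\<bar> * \<bar>snd X\<bar>" "1 * \<bar>snd X\<bar> <= \<bar>fst X\<bar> * \<bar>snd X\<bar>"
   using nz by (intro mult_left_mono mult_right_mono; simp)+
  then have "\<bar>fst X\<bar> <= B" "\<bar>snd X\<bar> <= B" using b by linarith+
  then have "fst X \<in> {- B..B}" "snd X \<in> {- B..B}" by (simp_all add: abs_le_iff)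
  then show "X \<in> {- B..B} \<times> {- B..B}" by (cases X) simp
 qed
qed

lemma qform_Rats: "qform N X \<in> \<rat>"
 unfolding qform_def by (intro Rats_divide Rats_of_int Rats_of_nat)

lemma pos_coset_fiber:
 assumes N: "N > 0" and n: "n > 0"
 shows "{X \<in> pos_coset N h. qform N X = n} = {X \<in> lat_coset N h. qform N X = n}"
proof -
 have "fst X * snd X > 0" if "qform N X = n" for X
 proof -
  have "real_of_int (fst X * snd X) > 0" using that n N unfolding qform_def by (auto simp: zero_less_divide_iff simp del: of_int_mult)
  then show ?thesis by (simp only: of_int_0_less_iff)
 qed
 then show ?thesis by (auto simp: pos_coset_def)
qed

lemma neg_coset_fiber:
 assumes N: "N > 0" and n: "n > 0"
 shows "{X \<in> neg_coset N h. - qform N X = n} = {X \<in> lat_coset N h. - qform N X = n}"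
proof -
 have "fst X * snd X < 0" if "- qform N X = n" for X
 proof -
  have "qform N X < 0" using that n by simp
  then have "real_of_int (fst X * snd X) < 0" using N unfolding qform_def by (auto simp: divide_less_0_iff simp del: of_int_mult)
  then show ?thesis by (simp only: of_int_less_0_iff)
 qed
 then show ?thesis by (auto simp: neg_coset_def)
qed

text \<open>The lattice sums are grouped by the exponent, which is -Q for the holomorphic part and Q
  for the Gamma part. The exponent 0 of the holomorphic part comes from the isotropic vectors and is
  inserted separately.\<close>

lemma tvartheta_fourier:
 assumes N: "N > 0" and v: "Im \<tau> > 0"
 shows "(%n. of_real (tc_coeff N h n) * qpow \<tau> n) summable_on {n\<in>\<rat>. n >= 0}"
  and "(%n. of_real (c_coeff N h n * upper_Gamma 0 (4 * pi * Im \<tau> * n)) * qpow \<tau> (- n)) summable_on {n\<in>\<rat>. n > 0}"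
  and "tvartheta N h \<tau> = (\<Sum>\<^sub>\<infinity>n\<in>{n\<in>\<rat>. n >= 0}. of_real (tc_coeff N h n) * qpow \<tau> n)
      + of_real (c_coeff N h 0 * ln (Im \<tau>))
      - (\<Sum>\<^sub>\<infinity>n\<in>{n\<in>\<rat>. n > 0}. of_real (c_coeff N h n * upper_Gamma 0 (4 * pi * Im \<tau> * n)) * qpow \<tau> (- n))"
proof -
 define f where "f X = of_real (sgn (x1 X) * logratio X) * ee (- of_real (qform N X) * \<tau>)" for X
 define g where "g X = of_real (sgn (x1 X) * upper_Gamma 0 (4 * pi * Im \<tau> * qform N X)) * ee (- of_real (qform N X) * \<tau>)" for X
 define a where "a n = of_real (tc_coeff N h n) * qpow \<tau> n" for n
 define b where "b n = of_real (c_coeff N h n * upper_Gamma 0 (4 * pi * Im \<tau> * n)) * qpow \<tau> (- n)" for n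
 let ?T = "{n\<in>\<rat>. n > (0::real)}"
 have fs: "(%X. norm (f X)) summable_on neg_coset N h"
 proof -
  let ?f = "%X. norm (ee (- of_real (qform N X) * \<tau>) * of_real (sgn (x2 X) * (2 * 0 + 1 * logratio X)))"
  have "?f summable_on neg_coset N h" by (rule Psi_integral(1)[OF N v])
  moreover have "?f X = norm (f X)" if "X \<in> neg_coset N h" for X
  proof -
   have sg: "sgn (real_of_int (snd X)) = - sgn (x1 X)"
    using that by (auto simp: neg_coset_def mult_less_0_iff)
   show ?thesis unfolding f_def sg by (simp add: norm_mult)
  qed
  ultimately show ?thesis using summable_on_cong[of "neg_coset N h" ?f "%X. norm (f X)"] by blast
 qed
 have gs: "(%X. norm (g X)) summable_on pos_coset N h"
  using Psi_integral(2)[OF N v, of 1 h] unfolding g_def by (simp add: norm_mult mult_ac)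
 have fT: "- qform N X \<in> ?T" if "X \<in> neg_coset N h" for X
 proof -
  have "real_of_int (fst X * snd X) < 0" using that unfolding neg_coset_def of_int_less_0_iff by simp
  then have "qform N X < 0" unfolding qform_def using N by (intro divide_neg_pos) auto
  then show ?thesis using qform_Rats[of N X] by simp
 qed
 have gT: "qform N X \<in> ?T" if "X \<in> pos_coset N h" for X
 proof -
  have "real_of_int (fst X * snd X) > 0" using that unfolding pos_coset_def of_int_0_less_iff by simp
  then have "qform N X > 0" unfolding qform_def using N by (intro divide_pos_pos) auto
  then show ?thesis using qform_Rats[of N X] by simp
 qed
 note Ff = infsum_over_fibers(1)[OF fs fT] and Fg = infsum_over_fibers(1)[OF gs gT]
 have Ff2: "(\<Sum>\<^sub>\<infinity>n\<in>?T. \<Sum>\<^sub>\<infinity>X\<in>{X\<in>neg_coset N h. - qform N X = n}. f X) = (\<Sum>\<^sub>\<infinity>X\<in>neg_coset N h. f X)"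
  by (rule infsum_over_fibers(2)[OF fs fT])
 have Fg2: "(\<Sum>\<^sub>\<infinity>n\<in>?T. \<Sum>\<^sub>\<infinity>X\<in>{X\<in>pos_coset N h. qform N X = n}. g X) = (\<Sum>\<^sub>\<infinity>X\<in>pos_coset N h. g X)"
  by (rule infsum_over_fibers(2)[OF gs gT])
 have fa: "(\<Sum>\<^sub>\<infinity>X\<in>{X\<in>neg_coset N h. - qform N X = n}. f X) = a n" if n: "n \<in> ?T" for n
 proof -
  have n0: "n > 0" using n by simp
  let ?S = "{X \<in> lat_coset N h. - qform N X = n}"
  have S: "?S = {X \<in> lat_coset N h. qform N X = - n}" by auto
  have fin: "finite ?S" unfolding S by (rule finite_qform_fiber[OF N]) (use n0 in simp)
  have "(\<Sum>\<^sub>\<infinity>X\<in>{X\<in>neg_coset N h. - qform N X = n}. f X) = (\<Sum>X\<in>?S. f X)"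
   unfolding neg_coset_fiber[OF N n0] using fin by simp
  also have "... = (\<Sum>X\<in>?S. of_real (sgn (x1 X) * ln \<bar>x1 X / x2 X\<bar>) * qpow \<tau> n)"
  proof (rule sum.cong[OF refl])
   fix X assume "X \<in> ?S"
   then have q: "- qform N X = n" by simp
   have "- complex_of_real (qform N X) = of_real n" unfolding q[symmetric] by simp
   then show "f X = of_real (sgn (x1 X) * ln \<bar>x1 X / x2 X\<bar>) * qpow \<tau> n"
    unfolding f_def logratio_def qpow_def by (simp only:)
  qed
  also have "... = of_real (\<Sum>X\<in>?S. sgn (x1 X) * ln \<bar>x1 X / x2 X\<bar>) * qpow \<tau> n"
   unfolding of_real_sum by (rule sum_distrib_right[symmetric])
  also have "(\<Sum>X\<in>?S. sgn (x1 X) * ln \<bar>x1 X / x2 X\<bar>) = tc_coeff N h n"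
   using n0 by (cases h) (simp add: tc_coeff_def QF_rvec_qform)
  finally show ?thesis unfolding a_def .
 qed
 have gb: "(\<Sum>\<^sub>\<infinity>X\<in>{X\<in>pos_coset N h. qform N X = n}. g X) = b n" if n: "n \<in> ?T" for n
 proof -
  have n0: "n > 0" using n by simp
  let ?S = "{X \<in> lat_coset N h. qform N X = n}"
  have fin: "finite ?S" by (rule finite_qform_fiber[OF N]) (use n0 in simp)
  have "(\<Sum>\<^sub>\<infinity>X\<in>{X\<in>pos_coset N h. qform N X = n}. g X) = (\<Sum>X\<in>?S. g X)"
   unfolding pos_coset_fiber[OF N n0] using fin by simp
  also have "... = (\<Sum>X\<in>?S. of_real (sgn (x1 X) * upper_Gamma 0 (4 * pi * Im \<tau> * n)) * qpow \<tau> (- n))"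
   by (rule sum.cong[OF refl]) (simp add: g_def qpow_def)
  also have "... = of_real (\<Sum>X\<in>?S. sgn (x1 X) * upper_Gamma 0 (4 * pi * Im \<tau> * n)) * qpow \<tau> (- n)"
   unfolding of_real_sum by (rule sum_distrib_right[symmetric])
  also have "(\<Sum>X\<in>?S. sgn (x1 X) * upper_Gamma 0 (4 * pi * Im \<tau> * n)) = c_coeff N h n * upper_Gamma 0 (4 * pi * Im \<tau> * n)"
   unfolding sum_distrib_right[symmetric] using n0 by (cases h) (simp add: c_coeff_def QF_rvec_qform)
  finally show ?thesis unfolding b_def .
 qed
 have as: "a summable_on ?T" by (rule summable_on_cong[THEN iffD1, OF fa Ff])
 have ai: "(\<Sum>\<^sub>\<infinity>n\<in>?T. a n) = (\<Sum>\<^sub>\<infinity>X\<in>neg_coset N h. f X)"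
  unfolding Ff2[symmetric] by (rule infsum_cong) (rule fa[symmetric])
 have bs: "b summable_on ?T" by (rule summable_on_cong[THEN iffD1, OF gb Fg])
 have bi: "(\<Sum>\<^sub>\<infinity>n\<in>?T. b n) = (\<Sum>\<^sub>\<infinity>X\<in>pos_coset N h. g X)"
  unfolding Fg2[symmetric] by (rule infsum_cong) (rule gb[symmetric])
 have U: "{n\<in>\<rat>. n >= (0::real)} = insert 0 ?T" by auto
 have a0: "a 0 = of_real (tc_coeff N h 0)" by (simp add: a_def qpow_def)
 show "(%n. of_real (tc_coeff N h n) * qpow \<tau> n) summable_on {n\<in>\<rat>. n >= 0}"
  unfolding U a_def[symmetric] summable_on_insert_iff using as .
 show "(%n. of_real (c_coeff N h n * upper_Gamma 0 (4 * pi * Im \<tau> * n)) * qpow \<tau> (- n)) summable_on ?T"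
  using bs unfolding b_def .
 have "(\<Sum>\<^sub>\<infinity>n\<in>insert 0 ?T. a n) = a 0 + (\<Sum>\<^sub>\<infinity>n\<in>?T. a n)"
  by (rule infsum_insert[OF as]) simp
 then show "tvartheta N h \<tau> = (\<Sum>\<^sub>\<infinity>n\<in>{n\<in>\<rat>. n >= 0}. of_real (tc_coeff N h n) * qpow \<tau> n)
      + of_real (c_coeff N h 0 * ln (Im \<tau>))
      - (\<Sum>\<^sub>\<infinity>n\<in>?T. of_real (c_coeff N h n * upper_Gamma 0 (4 * pi * Im \<tau> * n)) * qpow \<tau> (- n))"
  unfolding U a_def[symmetric] b_def[symmetric] bi ai a0 tvartheta_lattice_sum[OF N v] f_def g_def
  by (simp only: of_real_add of_real_mult add_ac)
qed

lemma c_coeff_Rats: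
 assumes N: "N > 0"
 shows "c_coeff N h n \<in> \<rat>"
proof -
 have A: "ang (of_int m / of_nat N) \<in> \<rat>" if "\<not> int N dvd m" for m
  unfolding ang_div(1)[OF N that] by (intro Rats_divide Rats_of_int Rats_of_nat)
 have sg: "sgn (real_of_int k) = of_int (sgn k)" for k by (simp add: sgn_if)
 have "(\<Sum>X\<in>S. sgn (real_of_int (fst X))) = of_int (\<Sum>X\<in>S. sgn (fst X))" for S :: "(int \<times> int) set"
  unfolding sg of_int_sum ..
 then have S: "(\<Sum>X\<in>S. sgn (real_of_int (fst X))) \<in> \<rat>" for S :: "(int \<times> int) set"
  by (simp only: Rats_of_int)
 show ?thesis using A S by (cases h) (auto simp: c_coeff_def intro!: Rats_diff Rats_divide)
qed

section \<open>Periodicity in the class, transformation under T and S, and the assembly\<close>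

lemma lat_coset_add:
 assumes "X \<in> lat N"
 shows "lat_coset N (h + X) = lat_coset N h"
proof -
 obtain a b where X: "X = (int N * a, int N * b)" using assms by (auto simp: lat_def)
 have d: "int N dvd m - (k + int N * c) \<longleftrightarrow> int N dvd m - k" for m k c
 proof -
  have e: "m - (k + int N * c) = (m - k) + int N * (- c)" by simp
  show ?thesis unfolding e by (rule dvd_add_left_iff) simp
 qed
 show ?thesis by (rule set_eqI) (simp add: in_lat_coset_iff X d)
qed

lemma vartheta_in_group_algebra: "(%h. vartheta N h \<tau>) \<in> group_algebra N"
 by (simp add: group_algebra_def vartheta_def Theta_def[abs_def] lat_coset_add)

lemma tvartheta_in_group_algebra:
 assumes N: "N > 0" and v: "Im \<tau> > 0"
 shows "(%h. tvartheta N h \<tau>) \<in> group_algebra N"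
 by (simp add: group_algebra_def tvartheta_eq_integral[OF N v] Psi_def lat_coset_add)

lemma vartheta_vec_eq: "N > 0 ==> vartheta_vec N \<tau> = (%h. vartheta N h \<tau>)"
 unfolding vartheta_vec_def by (rule ext) (rule sum_e_vec[OF _ vartheta_in_group_algebra])

lemma tvartheta_vec_eq: "N > 0 ==> Im \<tau> > 0 ==> tvartheta_vec N \<tau> = (%h. tvartheta N h \<tau>)"
 unfolding tvartheta_vec_def by (rule ext) (rule sum_e_vec[OF _ tvartheta_in_group_algebra])

lemma tvartheta_T:
 assumes N: "N > 0" and v: "Im \<tau> > 0"
 shows "tvartheta N h (\<tau> + 1) = ee (- of_int (fst h * snd h) / of_nat N) * tvartheta N h \<tau>"
proof -
 have v1: "Im (\<tau> + 1) > 0" using v by simp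
 show ?thesis
  unfolding tvartheta_eq_integral[OF N v1] tvartheta_eq_integral[OF N v] Psi_T[OF N]
  by (simp only: mult.assoc integral_mult_right_zero mult_minus_right)
qed

text \<open>The weight w in the integral does not involve tau, so the transformation law of
  \<open>Psi\<close> at each t integrates to one for \<open>tvartheta\<close>.\<close>

lemma tvartheta_S:
 assumes N: "N > 0" and v: "Im \<tau> > 0"
 shows "tvartheta N h (- 1 / \<tau>) = \<tau> * (1 / of_nat N * (\<Sum>\<delta>\<in>disc_reps N. tvartheta N \<delta> \<tau> * ee (of_int (fst h * snd \<delta> + snd h * fst \<delta>) / of_nat N)))"
proof -
 have vS: "Im (- 1 / \<tau>) > 0" using uminus_inverse_in_uhp[of \<tau>] v by (simp add: uhp_def)
 define e where "e \<delta> = ee (of_int (fst h * snd \<delta> + snd h * fst \<delta>) / of_nat N)" for \<delta>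
 have i: "integrable lborel (%w. Psi N \<delta> \<tau> (exp w) * of_real w)" for \<delta>
  using Psi_exp_integrable_poly[OF N v, of \<delta> 0 1] by simp
 have "(LINT w|lborel. Psi N h (- 1 / \<tau>) (exp w) * of_real w) =
   (LINT w|lborel. \<tau> * (1 / of_nat N * (\<Sum>\<delta>\<in>disc_reps N. e \<delta> * (Psi N \<delta> \<tau> (exp w) * of_real w))))"
  unfolding Psi_S[OF N v exp_gt_zero] e_def[symmetric]
  by (rule lebesgue_integral_cong) (simp_all add: sum_distrib_left sum_distrib_right mult_ac)
 also have "... = \<tau> * (1 / of_nat N * (LINT w|lborel. (\<Sum>\<delta>\<in>disc_reps N. e \<delta> * (Psi N \<delta> \<tau> (exp w) * of_real w))))"
  by (simp only: integral_mult_right_zero)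
 also have "(LINT w|lborel. (\<Sum>\<delta>\<in>disc_reps N. e \<delta> * (Psi N \<delta> \<tau> (exp w) * of_real w))) = (\<Sum>\<delta>\<in>disc_reps N. e \<delta> * (LINT w|lborel. Psi N \<delta> \<tau> (exp w) * of_real w))"
  by (subst Bochner_Integration.integral_sum) (simp_all add: i)
 also have "... = - (\<Sum>\<delta>\<in>disc_reps N. tvartheta N \<delta> \<tau> * e \<delta>)"
  unfolding tvartheta_eq_integral[OF N v] sum_negf[symmetric] by (simp add: mult.commute)
 finally show ?thesis unfolding tvartheta_eq_integral[OF N vS] e_def by (simp only: mult_minus_right minus_minus)
qed

theorem theorem4p3:
  fixes N :: nat
  assumes "N \<ge> 1"
  shows "harmonic_maass_form 1 (group_algebra N) (weil_rep N) (tvartheta_vec N)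
    \<and> (\<forall>\<tau>\<in>uhp. xi_vec 1 (tvartheta_vec N) \<tau> = vartheta_vec N \<tau>)
    \<and> (\<forall>h. \<forall>n::real. n \<in> \<rat> \<and> n \<ge> 0 \<longrightarrow> c_coeff N h n \<in> \<rat>)
    \<and> (\<forall>h. \<forall>\<tau>\<in>uhp.
          (\<lambda>n. of_real (tc_coeff N h n) * qpow \<tau> n) summable_on {n\<in>\<rat>. n \<ge> 0}
        \<and> (\<lambda>n. of_real (c_coeff N h n * upper_Gamma 0 (4 * pi * Im \<tau> * n)) * qpow \<tau> (- n))
            summable_on {n\<in>\<rat>. n > 0}
        \<and> tvartheta N h \<tau> =
            (\<Sum>\<^sub>\<infinity>n\<in>{n\<in>\<rat>. n \<ge> 0}. of_real (tc_coeff N h n) * qpow \<tau> n)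
            + of_real (c_coeff N h 0 * ln (Im \<tau>))
            - (\<Sum>\<^sub>\<infinity>n\<in>{n\<in>\<rat>. n > 0}.
                 of_real (c_coeff N h n * upper_Gamma 0 (4 * pi * Im \<tau> * n)) * qpow \<tau> (- n)))"
proof (intro conjI ballI allI impI)
 have N: "N > 0" using assms by simp
 let ?F = "tvartheta_vec N"
 \<comment> \<open>The vector and its components are identified on the half-plane only, which is why
   the analytic lemmas take a function F with this agreement as hypothesis.\<close>
 have FE: "?F w h = tvartheta N h w" if "Im w > 0" for w h
  using tvartheta_vec_eq[OF N that] by simp
 have im: "Im \<tau> > 0" if "\<tau> \<in> uhp" for \<tau> using that by (simp add: uhp_def)
 note W = is_weil_rep_weil_rep[OF N]
 then have rep: "sl2z_rep (group_algebra N) (weil_rep N)" unfolding is_weil_rep_def by blast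
 have GA: "?F \<tau> \<in> group_algebra N" if "\<tau> \<in> uhp" for \<tau>
  unfolding tvartheta_vec_eq[OF N im[OF that]] by (rule tvartheta_in_group_algebra[OF N im[OF that]])
 have T: "?F (\<tau> + 1) = weil_rep N T_mat (?F \<tau>)" if t: "\<tau> \<in> uhp" for \<tau>
 proof
  fix h :: "int \<times> int"
  have v1: "Im (\<tau> + 1) > 0" using im[OF t] by simp
  have "?F (\<tau> + 1) (fst h, snd h) = weil_rep N T_mat (?F \<tau>) (fst h, snd h)"
   unfolding weil_rep_T[OF N W GA[OF t]] FE[OF v1] FE[OF im[OF t]] tvartheta_T[OF N im[OF t]] fst_conv snd_conv ..
  then show "?F (\<tau> + 1) h = weil_rep N T_mat (?F \<tau>) h" by simp
 qed
 have S: "?F (- 1 / \<tau>) = (%h. \<tau> * weil_rep N S_mat (?F \<tau>) h)" if t: "\<tau> \<in> uhp" for \<tau>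
 proof
  fix h :: "int \<times> int"
  have vS: "Im (- 1 / \<tau>) > 0" by (rule im[OF uminus_inverse_in_uhp[OF t]])
  have "?F (- 1 / \<tau>) (fst h, snd h) = \<tau> * weil_rep N S_mat (?F \<tau>) (fst h, snd h)"
   unfolding weil_rep_S[OF N W GA[OF t]] FE[OF vS] FE[OF im[OF t]] tvartheta_S[OF N im[OF t]] fst_conv snd_conv ..
  then show "?F (- 1 / \<tau>) h = \<tau> * weil_rep N S_mat (?F \<tau>) h" by simp
 qed
 have ana: "real_analytic_on (%\<tau>. ?F \<tau> h) uhp" for h
 proof (rule real_analytic_onI)
  fix z assume "z \<in> uhp"
  show "\<exists>\<rho>>0. \<exists>a M. ps2 (%\<tau>. ?F \<tau> h) z \<rho> a M"
   by (rule tvartheta_ps2(1)[OF N im[OF \<open>z \<in> uhp\<close>], where h=h]) (rule FE)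
 qed
 have D: "Delta 1 (%\<tau>'. ?F \<tau>' h) \<tau> = 0" if "\<tau> \<in> uhp" for h \<tau>
  by (rule Delta_tvartheta[OF N im[OF that], where h=h]) (rule FE)
 have X: "xi 1 (%\<tau>'. ?F \<tau>' h) \<tau> = vartheta N h \<tau>" if "\<tau> \<in> uhp" for h \<tau>
  by (rule xi_tvartheta[OF N im[OF that], where h=h]) (rule FE)
 show "harmonic_maass_form 1 (group_algebra N) (weil_rep N) ?F"
  unfolding harmonic_maass_form_def power_int_1_right
  using rep GA ana D modular_from_generators[OF N rep GA T S] by blast
 show "xi_vec 1 ?F \<tau> = vartheta_vec N \<tau>" if "\<tau> \<in> uhp" for \<tau>
  unfolding xi_vec_def vartheta_vec_eq[OF N] X[OF that] ..
 show "c_coeff N h n \<in> \<rat>" for h n by (rule c_coeff_Rats[OF N])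
 fix h \<tau> assume "\<tau> \<in> uhp"
 then have v: "Im \<tau> > 0" by (rule im)
 show "(%n. of_real (tc_coeff N h n) * qpow \<tau> n) summable_on {n\<in>\<rat>. n >= 0}"
  by (rule tvartheta_fourier(1)[OF N v])
 show "(%n. of_real (c_coeff N h n * upper_Gamma 0 (4 * pi * Im \<tau> * n)) * qpow \<tau> (- n)) summable_on {n\<in>\<rat>. n > 0}"
  by (rule tvartheta_fourier(2)[OF N v])
 show "tvartheta N h \<tau> = (\<Sum>\<^sub>\<infinity>n\<in>{n\<in>\<rat>. n >= 0}. of_real (tc_coeff N h n) * qpow \<tau> n)
      + of_real (c_coeff N h 0 * ln (Im \<tau>))
      - (\<Sum>\<^sub>\<infinity>n\<in>{n\<in>\<rat>. n > 0}. of_real (c_coeff N h n * upper_Gamma 0 (4 * pi * Im \<tau> * n)) * qpow \<tau> (- n))"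
  by (rule tvartheta_fourier(3)[OF N v])
qed

end
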